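(* Let $\boldsymbol\mu=(\mu_1,\mu_2)$ be an Eve composition of $n$, and write $\mu_1=a_1p^{(i_1)}-1\ge\mu_2=a_2p^{(i_2)}-1$, where $a_j$ is the unique nonzero digit of $\mu_j+1$. (i) The algebra $\mathrm{TL}_{\boldsymbol\mu}$ has $k$-dimension equal to $\min\{\mu_1,\mu_2\}$. (ii) The set $\Lambda_{\boldsymbol\mu}=E_{\mu_1,\mu_2}\subseteq\Lambda_{\mathbf n}$, where $E_{\mu_1,\mu_2}=\{|\mu_1-\mu_2|,|\mu_1-\mu_2|+2,\dots,\mu_1+\mu_2\}$ and $\Lambda_{\mathbf n}=\{0\le m\le n: m\equiv n \bmod 2\}$, and each cell module $\Delta_{\boldsymbol\mu}(m)$, $m\in\Lambda_{\boldsymbol\mu}$, is one dimensional. (iii) Further, $(\Lambda_{\boldsymbol\mu})_0=\{m\in E_{\mu_1,\mu_2}: (n+m)/2+1\triangleright(n-m)/2\}$. This can also be written as $$(\Lambda_{\boldsymbol\mu})_0=\Big\{n-2\sum_{i=0}^{i_2}k_ip^{(i)}: k_{i_2}\in X\text{ and }k_i\le\Big\lfloor\frac{\ell\wedge p-1}{2}\Big\rfloor\text{ for }0\le i<i_2\Big\},$$ where the $k_i$ are non-negative integers, and: if $i_1>i_2$ the set $X=\{0,\dots,a_2-1\}$; and if $i_1=i_2$ with $(a_1+a_2-1)p^{(i_1)}=cp^{(i_1)}+dp^{(i_1+1)}$ (digit expansion), $$X=\{0,\dots,\lfloor c/2\rfloor\}\cup\{c+1,\dots,\min\{a_2,\lfloor(p\wedge\ell+c)/2\rfloor\}\}.$$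 Here $\ell\wedge p=p\wedge\ell$ denotes the base at the digit position in question: $\ell$ at position $0$ and $p$ at positions $\ge1$ (position $i$ for the bound on $k_i$, position $i_1=i_2$ in the formula for $X$).
   Context: Base ring. $k$ is an integral domain with a distinguished element $\delta$. Quantum numbers are $[0]=0$, $[1]=1$, $[n+1]=\delta[n]-[n-1]$. $\ell\ge 2$ is the least positive integer with $[\ell]=0$ in $k$ ($\ell=\infty$ if there is none), and $p$ is the characteristic of $k$ ($p=\infty$ in characteristic zero). Dimensions of $k$-modules mean ranks. Digits. $p^{(0)}=1$, $p^{(i)}=\ell p^{i-1}$ for $i\ge1$. Each integer $N\ge 0$ is uniquely $N=\sum_{i}N_ip^{(i)}$ with $0\le N_0<\ell$, $0\le N_i<p$ for $i>0$; the $N_i$ are its digits. If $\ell=\infty$ only $N_0$ occurs (so $d=0$); half of $\infty$ is read as $\infty$. $N\triangleright R$ means $N_i\ge R_i$ for all $i$. $n\ge 0$ is Eve if $n+1$ has exactly one nonzero digit. A composition (tuple of non-negative integers) is Eve if all its parts are. Temperley-Lieb category. Objects $\underline n$, $n\ge0$; morphisms $\underline n\to\underline m$ are linear combinations of planar (crossingless) pairings ("diagrams") of $n$ source and $m$ target points. $xy$ denotes concatenation with $x$ on the left, closed loops being replaced by $\delta$; $\otimes$ is juxtaposition; $\iota$ is reflection exchanging source and target. $\mathrm{TL}_n=\mathrm{End}(\underline n)$. The through degree of a diagram is its number of source-to-target strands; a diagram $\underline n\to\underline m$ is monic if it has through degree $m$. Idempotents. Over $\mathbb Q(X)$ (loop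 value an indeterminate $X$), $\mathrm{JW}_n\in\mathrm{TL}_n$ is the Jones-Wenzl idempotent: the unique nonzero idempotent killed by all simple cups and caps. If $n$ is Eve its coefficients can be specialised at $X=\delta$, giving $e^n\in\mathrm{TL}_n$ (assumed to have coefficients in $k$; automatic if $k$ is a field). For an Eve composition $\boldsymbol\mu=(\mu_1,\mu_2)$ of $n=\mu_1+\mu_2$: $e^{\boldsymbol\mu}=e^{\mu_1}\otimes e^{\mu_2}$ and $\mathrm{TL}_{\boldsymbol\mu}=e^{\boldsymbol\mu}\mathrm{TL}_ne^{\boldsymbol\mu}$. Cell modules. $\Delta_n(m)$ is the left $\mathrm{TL}_n$-module with basis the monic diagrams $\underline n\to\underline m$, acted on by concatenation modulo morphisms of through degree $<m$; it has the bilinear form $\langle x,y\rangle=$ coefficient of $\mathrm{id}_m$ in $\iota(x)y$. $\Delta_{\boldsymbol\mu}(m)=e^{\boldsymbol\mu}\Delta_n(m)$ with the restricted form, $\Lambda_{\boldsymbol\mu}=\{m:\Delta_{\boldsymbol\mu}(m)\neq0\}$, and $(\Lambda_{\boldsymbol\mu})_0$ is the set of $m$ for which the form on $\Delta_{\boldsymbol\mu}(m)$ is not identically zero.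
   Formalization: In (i) the dimension is min{μ1,μ2}+1. In (iii) X is {0,…,⌊(a2−1)/2⌋} if i1>i2, and {0,…,min(a2−1,⌊c/2⌋)}∪{c+1,…,min(a2−1,⌊(p∧ℓ+c)/2⌋)} if i1=i2. The printed formulas fail for μ=(0,0), for μ=(2,1) with ℓ=3, and for μ=(1,0) with ℓ≥3. *)

theory Defs
  imports
    "HOL-Computational_Algebra.Computational_Algebra"
    "HOL-Library.Poly_Mapping"
    "HOL-Library.Disjoint_Sets"
    "HOL-Library.Extended_Nat"
begin

section \<open>Quantum numbers and digits\<close>

fun qnum :: "'k::comm_ring_1 \<Rightarrow> nat \<Rightarrow> 'k" where
  "qnum \<delta> 0 = 0"
| "qnum \<delta> (Suc 0) = 1"
| "qnum \<delta> (Suc (Suc n)) = \<delta> * qnum \<delta> (Suc n) - qnum \<delta> n"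

definition ell :: "'k::comm_ring_1 \<Rightarrow> enat" where
  "ell \<delta> = (if \<exists>m>0. qnum \<delta> m = 0 then enat (LEAST m. m > 0 \<and> qnum \<delta> m = 0) else \<infinity>)"

definition char_enat :: "'k::comm_ring_1 itself \<Rightarrow> enat" where
  "char_enat _ = (if CHAR('k) = 0 then \<infinity> else enat CHAR('k))"

text \<open>The place values \<open>p\<^sup>(\<^sup>i\<^sup>)\<close> and the base at position \<open>i\<close>, written
  \<open>\<ell> \<and> p\<close> in the literature.\<close>

definition ppow :: "'k::comm_ring_1 \<Rightarrow> nat \<Rightarrow> enat" where
  "ppow \<delta> i = (if i = 0 then 1 else ell \<delta> * char_enat TYPE('k) ^ (i - 1))"

definition pbase :: "'k::comm_ring_1 \<Rightarrow> nat \<Rightarrow> enat" where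
  "pbase \<delta> i = (if i = 0 then ell \<delta> else char_enat TYPE('k))"

text \<open>The sum is taken in \<^typ>\<open>enat\<close>: since \<open>N\<close> is finite, a position whose place value is
  infinite has digit 0.\<close>

definition is_expansion :: "'k::comm_ring_1 \<Rightarrow> nat \<Rightarrow> (nat \<Rightarrow> nat) \<Rightarrow> bool" where
  "is_expansion \<delta> N d \<longleftrightarrow> finite {i. d i \<noteq> 0} \<and> (\<forall>i. enat (d i) < pbase \<delta> i)
     \<and> enat N = (\<Sum>i | d i \<noteq> 0. enat (d i) * ppow \<delta> i)"

definition digit :: "'k::comm_ring_1 \<Rightarrow> nat \<Rightarrow> nat \<Rightarrow> nat" where
  "digit \<delta> N = (THE d. is_expansion \<delta> N d)"

definition dominates :: "'k::comm_ring_1 \<Rightarrow> nat \<Rightarrow> nat \<Rightarrow> bool" where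
  "dominates \<delta> N R \<longleftrightarrow> (\<forall>i. digit \<delta> R i \<le> digit \<delta> N i)"

definition eve :: "'k::comm_ring_1 \<Rightarrow> nat \<Rightarrow> bool" where
  "eve \<delta> n \<longleftrightarrow> (\<exists>!i. digit \<delta> (n + 1) i \<noteq> 0)"

section \<open>Diagrams\<close>

text \<open>The point \<open>(0, i)\<close> is the \<open>i\<close>-th source and \<open>(1, j)\<close> the \<open>j\<close>-th target, both counted from
  0. A diagram is the partition of the points into its strands. Walking around the boundary one
  meets the sources in increasing and then the targets in decreasing order.\<close>

type_synonym point = "nat \<times> nat"
type_synonym diagram = "point set set"

definition points :: "nat \<Rightarrow> nat \<Rightarrow> point set" where
  "points n m = {0} \<times> {..<n} \<union> {1} \<times> {..<m}"

definition bpos :: "nat \<Rightarrow> nat \<Rightarrow> point \<Rightarrow> nat" where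
  "bpos n m = (\<lambda>(l, i). if l = 0 then i else n + m - 1 - i)"

definition planar :: "nat \<Rightarrow> nat \<Rightarrow> diagram \<Rightarrow> bool" where
  "planar n m D \<longleftrightarrow> \<not> (\<exists>a b c d. {a, c} \<in> D \<and> {b, d} \<in> D \<and>
     bpos n m a < bpos n m b \<and> bpos n m b < bpos n m c \<and> bpos n m c < bpos n m d)"

definition diagrams :: "nat \<Rightarrow> nat \<Rightarrow> diagram set" where
  "diagrams n m = {D. partition_on (points n m) D \<and> (\<forall>B\<in>D. card B = 2) \<and> planar n m D}"

definition id_diag :: "nat \<Rightarrow> diagram" where
  "id_diag n = {{(0, i), (1, i)} | i. i < n}"

text \<open>Concatenation, with \<open>D\<close> on the left: \<open>E\<close> is moved one layer to the right, so that the
  targets of \<open>D\<close> and the sources of \<open>E\<close> are both the points of layer 1. A connected component of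
  the resulting figure is a closed loop if it stays in layer 1, and otherwise becomes a strand by
  forgetting the points of layer 1.\<close>

definition glue :: "diagram \<Rightarrow> diagram \<Rightarrow> diagram" where
  "glue D E = D \<union> (\<lambda>B. map_prod Suc id ` B) ` E"

definition components :: "point set set \<Rightarrow> point set set" where
  "components G = \<Union>G // (\<Union>B\<in>G. B \<times> B)\<^sup>+"

definition outer :: "point set \<Rightarrow> point set" where
  "outer C = {(l, i) \<in> C. l \<noteq> 1}"

definition cat_diag :: "diagram \<Rightarrow> diagram \<Rightarrow> diagram" where
  "cat_diag D E = {map_prod (\<lambda>l. if l = 2 then 1 else l) id ` outer C | C.
     C \<in> components (glue D E) \<and> outer C \<noteq> {}}"

definition loops :: "diagram \<Rightarrow> diagram \<Rightarrow> nat" where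
  "loops D E = card {C \<in> components (glue D E). outer C = {}}"

text \<open>Juxtaposition of \<open>D : n \<rightarrow> m\<close> with \<open>E\<close>.\<close>

definition tensor_diag :: "nat \<Rightarrow> nat \<Rightarrow> diagram \<Rightarrow> diagram \<Rightarrow> diagram" where
  "tensor_diag n m D E = D \<union> (\<lambda>B. (\<lambda>(l, i). (l, (if l = 0 then n else m) + i)) ` B) ` E"

definition refl_diag :: "diagram \<Rightarrow> diagram" where
  "refl_diag D = (\<lambda>B. map_prod (\<lambda>l. 1 - l) id ` B) ` D"

definition through :: "diagram \<Rightarrow> nat" where
  "through D = card {B \<in> D. \<exists>i j. (0, i) \<in> B \<and> (1, j) \<in> B}"

definition monic :: "nat \<Rightarrow> nat \<Rightarrow> diagram set" where
  "monic n m = {D \<in> diagrams n m. through D = m}"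

text \<open>The simple cap \<open>n \<rightarrow> n - 2\<close> joining the sources \<open>i\<close> and \<open>i + 1\<close>; the simple cups are the
  reflections of these.\<close>

definition cap_diag :: "nat \<Rightarrow> nat \<Rightarrow> diagram" where
  "cap_diag n i = {{(0, i), (0, i + 1)}} \<union> {{(0, j), (1, j)} | j. j < i}
     \<union> {{(0, j + 2), (1, j)} | j. i \<le> j \<and> j + 2 < n}"

section \<open>The Temperley--Lieb category\<close>

type_synonym 'k mor = "diagram \<Rightarrow>\<^sub>0 'k"

definition Hom :: "nat \<Rightarrow> nat \<Rightarrow> 'k::comm_ring_1 mor set" where
  "Hom n m = {x. Poly_Mapping.keys x \<subseteq> diagrams n m}"

definition tl_scale :: "'k::comm_ring_1 \<Rightarrow> 'k mor \<Rightarrow> 'k mor" where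
  "tl_scale c x = Poly_Mapping.map ((*) c) x"

definition tl_comp :: "'k::comm_ring_1 \<Rightarrow> 'k mor \<Rightarrow> 'k mor \<Rightarrow> 'k mor" where
  "tl_comp \<delta> x y = (\<Sum>D\<in>Poly_Mapping.keys x. \<Sum>E\<in>Poly_Mapping.keys y.
     Poly_Mapping.single (cat_diag D E)
       (Poly_Mapping.lookup x D * Poly_Mapping.lookup y E * \<delta> ^ loops D E))"

definition tensor :: "nat \<Rightarrow> nat \<Rightarrow> 'k::comm_ring_1 mor \<Rightarrow> 'k mor \<Rightarrow> 'k mor" where
  "tensor n m x y = (\<Sum>D\<in>Poly_Mapping.keys x. \<Sum>E\<in>Poly_Mapping.keys y.
     Poly_Mapping.single (tensor_diag n m D E)
       (Poly_Mapping.lookup x D * Poly_Mapping.lookup y E))"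

definition refl_mor :: "'k::comm_ring_1 mor \<Rightarrow> 'k mor" where
  "refl_mor x = (\<Sum>D\<in>Poly_Mapping.keys x.
     Poly_Mapping.single (refl_diag D) (Poly_Mapping.lookup x D))"

lemma lookup_tl_scale [simp]:
  "Poly_Mapping.lookup (tl_scale c x) D = c * Poly_Mapping.lookup x D"
  by (simp add: tl_scale_def Poly_Mapping.map.rep_eq when_def)

interpretation TL: module "tl_scale :: 'k::comm_ring_1 \<Rightarrow> 'k mor \<Rightarrow> 'k mor"
  by unfold_locales
    (auto intro!: poly_mapping_eqI simp: lookup_add algebra_simps)

text \<open>\<open>S\<close> is a free module of rank \<open>r\<close>.\<close>

definition has_rank :: "'k::comm_ring_1 mor set \<Rightarrow> nat \<Rightarrow> bool" where
  "has_rank S r \<longleftrightarrow> (\<exists>B. finite B \<and> card B = r \<and> TL.independent B \<and> TL.span B = S)"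

section \<open>Jones--Wenzl idempotents\<close>

text \<open>The field \<open>\<rat>(X)\<close> is taken to be the field of fractions of \<open>\<int>[X]\<close>.\<close>

definition generic_loop :: "int poly fract" where
  "generic_loop = to_fract [:0, 1:]"

definition JW :: "nat \<Rightarrow> int poly fract mor" where
  "JW n = (THE f. f \<in> Hom n n \<and> f \<noteq> 0 \<and> tl_comp generic_loop f f = f
     \<and> (\<forall>i. i + 1 < n \<longrightarrow>
          tl_comp generic_loop f (Poly_Mapping.single (cap_diag n i) 1) = 0
        \<and> tl_comp generic_loop (Poly_Mapping.single (refl_diag (cap_diag n i)) 1) f = 0))"

definition eval_at :: "'k::comm_ring_1 \<Rightarrow> int poly \<Rightarrow> 'k" where
  "eval_at \<delta> P = poly (map_poly of_int P) \<delta>"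

definition specialise :: "'k::idom \<Rightarrow> int poly fract \<Rightarrow> 'k" where
  "specialise \<delta> f = (THE c. \<exists>P Q. f = to_fract P / to_fract Q \<and> eval_at \<delta> Q \<noteq> 0
     \<and> c * eval_at \<delta> Q = eval_at \<delta> P)"

text \<open>The value \<open>P(\<delta>) / Q(\<delta>)\<close> of a coefficient a priori lies in the field of fractions of \<open>k\<close>;
  the following says that it lies in \<open>k\<close>. It always holds if \<open>k\<close> is a field, and it does not
  include the existence of a representation \<open>P / Q\<close> with \<open>Q(\<delta>) \<noteq> 0\<close>, which for Eve \<open>n\<close> is a
  theorem.\<close>

definition JW_values_in_base :: "'k::idom \<Rightarrow> nat \<Rightarrow> bool" where
  "JW_values_in_base \<delta> n \<longleftrightarrow> (\<forall>D P Q. Poly_Mapping.lookup (JW n) D = to_fract P / to_fract Q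
     \<and> eval_at \<delta> Q \<noteq> 0 \<longrightarrow> eval_at \<delta> Q dvd eval_at \<delta> P)"

definition eve_idem :: "'k::idom \<Rightarrow> nat \<Rightarrow> 'k mor" where
  "eve_idem \<delta> n = Poly_Mapping.map (specialise \<delta>) (JW n)"

definition eve_idem2 :: "'k::idom \<Rightarrow> nat \<Rightarrow> nat \<Rightarrow> 'k mor" where
  "eve_idem2 \<delta> \<mu>1 \<mu>2 = tensor \<mu>1 \<mu>1 (eve_idem \<delta> \<mu>1) (eve_idem \<delta> \<mu>2)"

text \<open>The rank of this algebra is \<open>min \<mu>1 \<mu>2 + 1\<close>, not \<open>min \<mu>1 \<mu>2\<close> as in the source: there is one
  basis element for each through degree, and \<open>\<mu> = (0, 0)\<close> gives the ground ring.\<close>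

definition TL_mu :: "'k::idom \<Rightarrow> nat \<Rightarrow> nat \<Rightarrow> 'k mor set" where
  "TL_mu \<delta> \<mu>1 \<mu>2 = (\<lambda>x. tl_comp \<delta> (tl_comp \<delta> (eve_idem2 \<delta> \<mu>1 \<mu>2) x) (eve_idem2 \<delta> \<mu>1 \<mu>2))
     ` Hom (\<mu>1 + \<mu>2) (\<mu>1 + \<mu>2)"

section \<open>Cell modules\<close>

definition cell :: "nat \<Rightarrow> nat \<Rightarrow> 'k::comm_ring_1 mor set" where
  "cell n m = {x. Poly_Mapping.keys x \<subseteq> monic n m}"

text \<open>The normal form modulo morphisms of through degree less than \<open>m\<close>.\<close>

definition trunc :: "nat \<Rightarrow> 'k::comm_ring_1 mor \<Rightarrow> 'k mor" where
  "trunc m x = (\<Sum>D | D \<in> Poly_Mapping.keys x \<and> m \<le> through D.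
     Poly_Mapping.single D (Poly_Mapping.lookup x D))"

definition cell_act :: "'k::comm_ring_1 \<Rightarrow> nat \<Rightarrow> 'k mor \<Rightarrow> 'k mor \<Rightarrow> 'k mor" where
  "cell_act \<delta> m a x = trunc m (tl_comp \<delta> a x)"

definition cell_form :: "'k::comm_ring_1 \<Rightarrow> nat \<Rightarrow> 'k mor \<Rightarrow> 'k mor \<Rightarrow> 'k" where
  "cell_form \<delta> m x y = Poly_Mapping.lookup (tl_comp \<delta> (refl_mor x) y) (id_diag m)"

definition cell_mu :: "'k::idom \<Rightarrow> nat \<Rightarrow> nat \<Rightarrow> nat \<Rightarrow> 'k mor set" where
  "cell_mu \<delta> \<mu>1 \<mu>2 m = cell_act \<delta> m (eve_idem2 \<delta> \<mu>1 \<mu>2) ` cell (\<mu>1 + \<mu>2) m"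

definition Lambda_mu :: "'k::idom \<Rightarrow> nat \<Rightarrow> nat \<Rightarrow> nat set" where
  "Lambda_mu \<delta> \<mu>1 \<mu>2 = {m. cell_mu \<delta> \<mu>1 \<mu>2 m \<noteq> {0}}"

definition Lambda_mu_0 :: "'k::idom \<Rightarrow> nat \<Rightarrow> nat \<Rightarrow> nat set" where
  "Lambda_mu_0 \<delta> \<mu>1 \<mu>2 =
     {m. \<exists>x\<in>cell_mu \<delta> \<mu>1 \<mu>2 m. \<exists>y\<in>cell_mu \<delta> \<mu>1 \<mu>2 m. cell_form \<delta> m x y \<noteq> 0}"

definition Lambda_n :: "nat \<Rightarrow> nat set" where
  "Lambda_n n = {m. m \<le> n \<and> m mod 2 = n mod 2}"

section \<open>The index sets of the theorem\<close>

definition E_set :: "nat \<Rightarrow> nat \<Rightarrow> nat set" where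
  "E_set \<mu>1 \<mu>2 = {m. \<exists>j. m = nat \<bar>int \<mu>1 - int \<mu>2\<bar> + 2 * j \<and> m \<le> \<mu>1 + \<mu>2}"

definition half :: "enat \<Rightarrow> enat" where
  "half x = (case x of enat n \<Rightarrow> enat (n div 2) | \<infinity> \<Rightarrow> \<infinity>)"

text \<open>The values allowed for the digit \<open>k\<close> at position \<open>i2\<close> of \<open>(n - m) / 2\<close>, namely the
  \<open>k < a2\<close> not exceeding the corresponding digit of \<open>(n + m) / 2 + 1\<close>. If \<open>i1 > i2\<close> that digit
  is \<open>a2 - 1 - k\<close>; if \<open>i1 = i2\<close> it is \<open>c - k\<close> for \<open>k \<le> c\<close>, and the base plus \<open>c - k\<close> (after a
  borrow) for \<open>k > c\<close>. These bounds correct the ones in the source, which are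
  \<open>{0, \<dots>, a2 - 1}\<close> if \<open>i1 > i2\<close>, and
  \<open>{0, \<dots>, \<lfloor>c/2\<rfloor>} \<union> {c + 1, \<dots>, min a2 \<lfloor>(base + c)/2\<rfloor>}\<close> if \<open>i1 = i2\<close>.
  Counterexamples to those: for \<open>\<ell> = 3\<close> and \<open>\<mu> = (2, 1)\<close> the form on the cell module of
  \<open>m = 1\<close> has value \<open>[3]/[2] = 0\<close>, so \<open>k = 1 = a2 - 1\<close> is not allowed; for \<open>\<ell> \<ge> 3\<close> and
  \<open>\<mu> = (1, 0)\<close> the first interval contains \<open>k = 1\<close>, that is \<open>m = -1\<close>; for \<open>\<ell> = 5\<close> and
  \<open>\<mu> = (3, 2)\<close> the second one contains \<open>k = 3 = a2\<close>, again \<open>m = -1\<close>.\<close>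

definition top_digits :: "'k::comm_ring_1 \<Rightarrow> nat \<Rightarrow> nat \<Rightarrow> nat \<Rightarrow> nat \<Rightarrow> nat set" where
  "top_digits \<delta> i1 a1 i2 a2 =
     (if i1 > i2 then {0..(a2 - 1) div 2}
      else let c = digit \<delta> ((a1 + a2 - 1) * the_enat (ppow \<delta> i1)) i1
           in {0..min (a2 - 1) (c div 2)}
              \<union> {k. c + 1 \<le> k \<and> enat k \<le> min (enat (a2 - 1)) (half (pbase \<delta> i1 + enat c))})"

text \<open>Only used when position \<open>i2\<close> carries a nonzero digit, so that all place values
  \<open>ppow \<delta> i\<close> with \<open>i \<le> i2\<close> are finite.\<close>

definition digit_set :: "'k::comm_ring_1 \<Rightarrow> nat \<Rightarrow> nat \<Rightarrow> nat set \<Rightarrow> int set" where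
  "digit_set \<delta> n i2 X = {int n - 2 * (\<Sum>i\<le>i2. int (k i * the_enat (ppow \<delta> i))) | k :: nat \<Rightarrow> nat.
     k i2 \<in> X \<and> (\<forall>i<i2. enat (k i) \<le> half (pbase \<delta> i - 1))}"

end

theory Submission
  imports Defs
begin

text \<open>The element \<open>e\<^sup>\<mu>\<close> kills every simple cap except the middle one, which joins the two blocks.
  Hence of all monic diagrams \<open>n \<rightarrow> m\<close> only the one made of \<open>r\<close> nested middle caps survives, with
  \<open>m = n - 2 r\<close> and \<open>r \<le> \<mu>2\<close>; this gives the ranks, and the form on the cell module of \<open>m\<close> is given by
  a single value \<open>c\<close>. Generically the Jones--Wenzl idempotents are the projections onto the
  \<open>q\<close>-symmetric tensors over quantum \<open>sl\<^sub>2\<close>. Contracting the middle points of the symmetrised nested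
  caps pair by pair shows that \<open>c\<close> times the quantum binomial coefficients of \<open>\<mu>1\<close> over \<open>r\<close> and of \<open>\<mu>2\<close>
  over \<open>r\<close> is the one of \<open>n - r + 1\<close> over \<open>r\<close>. The first two coefficients do not vanish at \<open>\<delta>\<close> because
  \<open>\<mu>1\<close> and \<open>\<mu>2\<close> are Eve; by the quantum Lucas theorem the last one is nonzero if and only if no digit
  of \<open>r\<close> exceeds that of \<open>n - r + 1 = (n + m) / 2 + 1\<close>.\<close>

subsection \<open>States and saturation\<close>

text \<open>Concatenation is defined by connected components, which resist direct computation. A
  diagram is therefore replaced by its admissible two-colourings: a pair of sets of sources and
  targets is admissible if every strand has a single colour. These relations determine the diagram,
  concatenation is composition of relations, and closed loops are counted by the free choices of a
  middle colouring, so that associativity becomes a double count. The ring k need not contain q, and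
  coefficients of Jones-Wenzl idempotents have denominators that may vanish at \<delta>. The spin
  computations take place in a quadratic extension of Q(X) that contains q, with identities
  multiplied through by factorials. The result is freed of q, rewritten with binomial coefficients,
  lifted to Z[X] by clearing a common denominator, and only there evaluated at \<delta>. The common
  denominator is the product over k of the quantum binomial coefficients of n over k: pairing with
  the q-symmetric vector with k ups costs such a coefficient, up to a power of q. For Eve n none of
  them vanishes, since all digits of n below the leading one are maximal.\<close>

definition saturated :: "'a set set \<Rightarrow> 'a set \<Rightarrow> bool" where
  "saturated D X \<longleftrightarrow> (\<forall>B\<in>D. B \<subseteq> X \<or> B \<inter> X = {})"

definition state :: "nat set \<Rightarrow> nat set \<Rightarrow> point set" where
  "state S T = {0} \<times> S \<union> {1} \<times> T"

text \<open>The diagram as a relation between a colouring S of the sources and a colouring T of the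
  targets. Arbitrary sets of numbers are allowed; \<open>sem_restrict\<close> cuts them down to the
  actual points.\<close>

definition sem :: "diagram \<Rightarrow> nat set \<Rightarrow> nat set \<Rightarrow> bool" where
  "sem D S T \<longleftrightarrow> saturated D (state S T)"

text \<open>The blocks of a partition are its minimal nonempty saturated sets, so the family of
  saturated sets recovers the partition.\<close>

lemma partition_on_eqI_saturated:
  assumes "partition_on A P" "partition_on A Q"
    and "\<And>X. X \<subseteq> A \<Longrightarrow> saturated P X \<longleftrightarrow> saturated Q X"
  shows "P = Q"
proof -
  have sub: "P \<subseteq> Q" if P: "partition_on A P" and Q: "partition_on A Q"
    and eq: "\<And>X. X \<subseteq> A \<Longrightarrow> saturated P X \<longleftrightarrow> saturated Q X" for P Q
  proof
    fix B assume B: "B \<in> P"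
    have dP: "\<And>B B'. B \<in> P \<Longrightarrow> B' \<in> P \<Longrightarrow> B \<noteq> B' \<Longrightarrow> B \<inter> B' = {}"
      and dQ: "\<And>B B'. B \<in> Q \<Longrightarrow> B' \<in> Q \<Longrightarrow> B \<noteq> B' \<Longrightarrow> B \<inter> B' = {}"
      using P Q unfolding partition_on_def disjoint_def by auto
    have "saturated P B" using dP B unfolding saturated_def by blast
    moreover have BA: "B \<subseteq> A" using B P partition_onD1 by blast
    ultimately have sQ: "saturated Q B" using eq by auto
    have "B \<noteq> {}" using B P unfolding partition_on_def by auto
    then obtain x where x: "x \<in> B" by blast
    then obtain C where C: "C \<in> Q" "x \<in> C" using BA Q partition_onD1 by blast
    have CB: "C \<subseteq> B" using sQ C x unfolding saturated_def by blast
    have "saturated Q C" using dQ C unfolding saturated_def by blast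
    moreover have "C \<subseteq> A" using C Q partition_onD1 by blast
    ultimately have "saturated P C" using eq by auto
    then have "B \<subseteq> C" using B x C unfolding saturated_def by blast
    then show "B \<in> Q" using CB C by auto
  qed
  show ?thesis using sub[of P Q] sub[of Q P] assms by blast
qed

lemma diagrams_partition: "D \<in> diagrams n m \<Longrightarrow> partition_on (points n m) D"
  by (simp add: diagrams_def)

lemma diag_eqI:
  assumes "partition_on (points n m) D" "partition_on (points n m) E"
    and "\<And>S T. S \<subseteq> {..<n} \<Longrightarrow> T \<subseteq> {..<m} \<Longrightarrow> sem D S T \<longleftrightarrow> sem E S T"
  shows "D = E"
proof (rule partition_on_eqI_saturated[OF assms(1,2)])
  fix X assume X: "X \<subseteq> points n m"
  then have "X = state {i. (0, i) \<in> X} {i. (1, i) \<in> X}"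
    by (auto simp: state_def points_def)
  moreover have "{i. (0, i) \<in> X} \<subseteq> {..<n}" "{i. (1, i) \<in> X} \<subseteq> {..<m}"
    using X by (auto simp: points_def)
  ultimately show "saturated D X \<longleftrightarrow> saturated E X"
    using assms(3) unfolding sem_def by metis
qed

lemma sem_restrict:
  assumes "\<Union>D \<subseteq> points n m"
  shows "sem D S T \<longleftrightarrow> sem D (S \<inter> {..<n}) (T \<inter> {..<m})"
proof -
  have "B \<subseteq> state S T \<longleftrightarrow> B \<subseteq> state (S \<inter> {..<n}) (T \<inter> {..<m})"
    "B \<inter> state S T = B \<inter> state (S \<inter> {..<n}) (T \<inter> {..<m})" if "B \<in> D" for B
    using that assms by (auto simp: state_def points_def)
  then show ?thesis unfolding sem_def saturated_def by (metis (no_types, lifting))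
qed

lemma diag_Union: "D \<in> diagrams n m \<Longrightarrow> \<Union>D = points n m"
  using diagrams_partition partition_onD1 by metis

lemma finite_points [simp]: "finite (points n m)"
  by (simp add: points_def)

lemma finite_diagrams [simp]: "finite (diagrams n m)"
  by (rule finite_subset[OF _ finitely_many_partition_on[OF finite_points[of n m]]])
    (auto simp: diagrams_def)

lemma diag_finite: "D \<in> diagrams n m \<Longrightarrow> finite D"
  by (metis diagrams_partition finite_elements finite_points)

lemma diag_block_eq: "D \<in> diagrams n m \<Longrightarrow> B \<in> D \<Longrightarrow> C \<in> D \<Longrightarrow> x \<in> B \<Longrightarrow> x \<in> C \<Longrightarrow> B = C"
  using diagrams_partition unfolding partition_on_def disjoint_def by blast

lemma diag_card2: "D \<in> diagrams n m \<Longrightarrow> B \<in> D \<Longrightarrow> card B = 2"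
  by (simp add: diagrams_def)

lemma diag_blockE:
  assumes "D \<in> diagrams n m" "x \<in> points n m"
  obtains y where "{x, y} \<in> D" "y \<in> points n m" "x \<noteq> y"
proof -
  obtain B where B: "B \<in> D" "x \<in> B" using assms diag_Union by blast
  then have "card B = 2" using assms diag_card2 by blast
  then obtain y where "B = {x, y}" "x \<noteq> y"
    using B by (metis card_2_iff doubleton_eq_iff insertE singletonD)
  then show ?thesis using that B diag_Union[OF assms(1)] by blast
qed

subsection \<open>Components of a glued figure\<close>

abbreviation comp_rel :: "'a set set \<Rightarrow> ('a \<times> 'a) set" where
  "comp_rel G \<equiv> (\<Union>B\<in>G. B \<times> B)\<^sup>+"

lemma comp_rel_equiv: "equiv (\<Union>G) (comp_rel G)"
proof (rule equivI)
  show "comp_rel G \<subseteq> \<Union>G \<times> \<Union>G"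
    by (rule trancl_subset_Sigma) auto
  show "refl_on (\<Union>G) (comp_rel G)"
    by (rule refl_onI) auto
  show "sym (comp_rel G)" by (rule sym_trancl) (auto simp: sym_def)
  show "trans (comp_rel G)" by simp
qed

lemma components_partition: "partition_on (\<Union>G) (components G :: point set set)"
proof (rule partition_onI)
  show "\<Union>(components G) = \<Union>G"
    unfolding components_def by (rule Union_quotient[OF comp_rel_equiv])
  show "{} \<notin> components G"
    unfolding components_def using in_quotient_imp_non_empty[OF comp_rel_equiv] by blast
  fix p q assume "p \<in> components G" "q \<in> components G" "p \<noteq> q"
  then show "disjnt p q"
    unfolding components_def disjnt_def using quotient_disj[OF comp_rel_equiv] by blast
qed

text \<open>Saturation is a condition on single edges, hence it is inherited along chains of edges.
  This removes the transitive closure from the later arguments about components.\<close>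

lemma saturated_components:
  "saturated (components G) X \<longleftrightarrow> saturated G (X :: point set)"
proof
  assume s: "saturated G X"
  have *: "x \<in> X \<longleftrightarrow> y \<in> X" if "(x, y) \<in> comp_rel G" for x y
    using that
  proof (induction rule: trancl_induct)
    case (base y) then show ?case using s unfolding saturated_def by blast
  next
    case (step y z) then show ?case using s unfolding saturated_def by blast
  qed
  show "saturated (components G) X"
    unfolding saturated_def
  proof
    fix C assume "C \<in> components G"
    then obtain a where C: "C = comp_rel G `` {a}" unfolding components_def by (elim quotientE)
    show "C \<subseteq> X \<or> C \<inter> X = {}"
    proof (cases "a \<in> X")
      case True then have "C \<subseteq> X" using C * by auto
      then show ?thesis ..
    next
      case False then have "C \<inter> X = {}" using C * by auto
      then show ?thesis ..
    qed
  qed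
next
  assume s: "saturated (components G) X"
  show "saturated G X" unfolding saturated_def
  proof
    fix B assume B: "B \<in> G"
    show "B \<subseteq> X \<or> B \<inter> X = {}"
    proof (cases "B = {}")
      case False
      then obtain a where a: "a \<in> B" by blast
      have "B \<subseteq> comp_rel G `` {a}" using a B by auto
      moreover have "comp_rel G `` {a} \<in> components G"
        unfolding components_def using a B by (auto intro: quotientI)
      ultimately show ?thesis using s unfolding saturated_def by blast
    qed auto
  qed
qed

lemma component_block:
  assumes "C \<in> components G" "B \<in> G" "x \<in> B" "x \<in> C" shows "B \<subseteq> C"
proof -
  have "saturated (components G) C"
    using assms(1) components_partition[of G]
    unfolding saturated_def partition_on_def disjoint_def by blast
  then have "saturated G C" by (simp add: saturated_components)
  then show ?thesis using assms unfolding saturated_def by blast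
qed

abbreviation next_layer :: "point \<Rightarrow> point" where
  "next_layer \<equiv> map_prod Suc id"

abbreviation forget_layer :: "point \<Rightarrow> point" where
  "forget_layer \<equiv> map_prod (\<lambda>l. if l = 2 then 1 else l) id"

lemma image_preserved:
  assumes "\<And>x. x \<in> B \<Longrightarrow> f x \<in> X \<longleftrightarrow> x \<in> Y"
  shows "f ` B \<subseteq> X \<longleftrightarrow> B \<subseteq> Y" "f ` B \<inter> X = {} \<longleftrightarrow> B \<inter> Y = {}"
  using assms by auto

lemma next_layer_times: "next_layer ` ({l} \<times> A) = {Suc l} \<times> A"
  by force

definition state3 :: "nat set \<Rightarrow> nat set \<Rightarrow> nat set \<Rightarrow> point set" where
  "state3 S U T = {0} \<times> S \<union> {1} \<times> U \<union> {2} \<times> T"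

lemma saturated_glue:
  assumes "\<Union>D \<subseteq> {0, 1} \<times> UNIV" "\<Union>E \<subseteq> {0, 1} \<times> UNIV"
  shows "saturated (glue D E) (state3 S U T) \<longleftrightarrow> sem D S U \<and> sem E U T"
proof -
  have D: "B \<subseteq> state3 S U T \<longleftrightarrow> B \<subseteq> state S U" "B \<inter> state3 S U T = B \<inter> state S U"
    if "B \<in> D" for B
  proof -
    have *: "\<And>x. x \<in> B \<Longrightarrow> x \<in> state3 S U T \<longleftrightarrow> x \<in> state S U"
      using that assms(1) by (fastforce simp: state3_def state_def)
    show "B \<subseteq> state3 S U T \<longleftrightarrow> B \<subseteq> state S U" "B \<inter> state3 S U T = B \<inter> state S U"
      using * by blast+
  qed
  have st: "x \<in> {0, 1} \<times> UNIV \<Longrightarrow> next_layer x \<in> state3 S U T \<longleftrightarrow> x \<in> state U T" for x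
    by (auto simp: state3_def state_def)
  have "next_layer ` B \<subseteq> state3 S U T \<longleftrightarrow> B \<subseteq> state U T"
      "next_layer ` B \<inter> state3 S U T = {} \<longleftrightarrow> B \<inter> state U T = {}"
    if "B \<in> E" for B
  proof -
    have B: "\<And>x. x \<in> B \<Longrightarrow> x \<in> {0, 1} \<times> UNIV" using that assms(2) by blast
    show "next_layer ` B \<subseteq> state3 S U T \<longleftrightarrow> B \<subseteq> state U T"
      "next_layer ` B \<inter> state3 S U T = {} \<longleftrightarrow> B \<inter> state U T = {}"
      using image_preserved[where B = B and f = next_layer, OF st[OF B]] by blast+
  qed
  then show ?thesis
    using D unfolding glue_def saturated_def sem_def ball_Un by simp
qed

lemma glue_layers:
  assumes "\<Union>D \<subseteq> {0, 1} \<times> UNIV" "\<Union>E \<subseteq> {0, 1} \<times> UNIV"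
  shows "\<Union>(glue D E) \<subseteq> {0, 1, 2} \<times> UNIV"
proof -
  have "next_layer ` B \<subseteq> {0, 1, 2} \<times> UNIV" if "B \<in> E" for B
    using that assms(2) by auto
  then show ?thesis using assms(1) unfolding glue_def by blast
qed

text \<open>Every component with an outer point forces the colours of its middle points, while
  closed loops may be coloured at will. So an outer colouring extends over the middle layer as soon
  as it is constant on the outer points of each component.\<close>

lemma sem_cat:
  assumes "\<Union>D \<subseteq> {0, 1} \<times> UNIV" "\<Union>E \<subseteq> {0, 1} \<times> UNIV"
  shows "sem (cat_diag D E) S T \<longleftrightarrow> (\<exists>U. sem D S U \<and> sem E U T)"
proof -
  let ?G = "glue D E"
  have lay: "C \<subseteq> {0, 1, 2} \<times> UNIV" if "C \<in> components ?G" for C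
    using that glue_layers[OF assms] partition_onD1[OF components_partition] by blast
  have disj: "C = C'" if "C \<in> components ?G" "C' \<in> components ?G" "x \<in> C" "x \<in> C'" for C C' x
    using that components_partition unfolding partition_on_def disjoint_def by blast
  have fo: "forget_layer ` outer C \<subseteq> state S T \<longleftrightarrow> outer C \<subseteq> state3 S U T"
    "forget_layer ` outer C \<inter> state S T = {} \<longleftrightarrow> outer C \<inter> state3 S U T = {}"
    if C: "C \<in> components ?G" for C U
  proof -
    have "forget_layer x \<in> state S T \<longleftrightarrow> x \<in> state3 S U T" if "x \<in> outer C" for x
      using that lay[OF C] by (auto simp: outer_def state_def state3_def)
    note * = this
    show "forget_layer ` outer C \<subseteq> state S T \<longleftrightarrow> outer C \<subseteq> state3 S U T"
      "forget_layer ` outer C \<inter> state S T = {} \<longleftrightarrow> outer C \<inter> state3 S U T = {}"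
      using image_preserved[where B = "outer C" and f = forget_layer, OF *] by blast+
  qed
  have "sem (cat_diag D E) S T \<longleftrightarrow> (\<exists>U. saturated (components ?G) (state3 S U T))"
  proof
    assume "\<exists>U. saturated (components ?G) (state3 S U T)"
    then obtain U where U: "saturated (components ?G) (state3 S U T)" ..
    show "sem (cat_diag D E) S T"
      unfolding sem_def saturated_def
    proof
      fix B assume "B \<in> cat_diag D E"
      then obtain C where C: "C \<in> components ?G" and B: "B = forget_layer ` outer C"
        unfolding cat_diag_def by blast
      have "outer C \<subseteq> C" by (auto simp: outer_def)
      then have "outer C \<subseteq> state3 S U T \<or> outer C \<inter> state3 S U T = {}"
        using U C unfolding saturated_def by blast
      then show "B \<subseteq> state S T \<or> B \<inter> state S T = {}"
        using fo[OF C] unfolding B by blast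
    qed
  next
    assume s: "sem (cat_diag D E) S T"
    \<comment> \<open>Middle points take the colour of the outer points of their component; closed
      loops stay outside \<open>U\<close>.\<close>
    define U where "U = {i. \<exists>C\<in>components ?G. (1, i) \<in> C \<and> outer C \<noteq> {} \<and> outer C \<subseteq> state3 S {} T}"
    have "saturated (components ?G) (state3 S U T)"
      unfolding saturated_def
    proof
      fix C assume C: "C \<in> components ?G"
      have U: "(1, i) \<in> C \<Longrightarrow> i \<in> U \<longleftrightarrow> outer C \<noteq> {} \<and> outer C \<subseteq> state3 S {} T" for i
        unfolding U_def using C disj by blast
      have split: "x \<in> C \<Longrightarrow> x \<in> outer C \<or> (\<exists>i. x = (1, i))" for x
        by (cases x) (auto simp: outer_def)
      have s1: "x \<in> outer C \<Longrightarrow> x \<in> state3 S {} T \<longleftrightarrow> x \<in> state3 S U T" for x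
        by (auto simp: outer_def state3_def)
      have U1: "(1, i) \<in> state3 S U T \<longleftrightarrow> i \<in> U" for i by (auto simp: state3_def)
      show "C \<subseteq> state3 S U T \<or> C \<inter> state3 S U T = {}"
      proof (cases "outer C = {}")
        case True
        then have "C \<inter> state3 S U T = {}" using split U U1 by auto
        then show ?thesis ..
      next
        case False
        then have "forget_layer ` outer C \<in> cat_diag D E" using C by (auto simp: cat_diag_def)
        with s have "forget_layer ` outer C \<subseteq> state S T \<or> forget_layer ` outer C \<inter> state S T = {}"
          unfolding sem_def saturated_def by (rule bspec)
        then have "outer C \<subseteq> state3 S {} T \<or> outer C \<inter> state3 S {} T = {}"
          by (simp only: fo[OF C, of "{}"])
        then have out: "x \<in> state3 S {} T \<longleftrightarrow> outer C \<subseteq> state3 S {} T" if "x \<in> outer C" for x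
          using that by blast
        have "x \<in> state3 S U T \<longleftrightarrow> outer C \<subseteq> state3 S {} T" if x: "x \<in> C" for x
        proof (cases "x \<in> outer C")
          case True then show ?thesis using s1 out by simp
        next
          case nout: False
          then obtain i where "x = (1, i)" using split x by blast
          then show ?thesis using U[of i] U1[of i] x False by simp
        qed
        then show ?thesis by (cases "outer C \<subseteq> state3 S {} T") auto
      qed
    qed
    then show "\<exists>U. saturated (components ?G) (state3 S U T)" ..
  qed
  then show ?thesis by (simp add: saturated_components saturated_glue[OF assms])
qed

lemma diag_layers: "D \<in> diagrams n m \<Longrightarrow> \<Union>D \<subseteq> {0, 1} \<times> UNIV"
  using diag_Union by (auto simp: points_def)

lemma sem_empty [simp]: "sem D {} {}"
  by (simp add: sem_def state_def saturated_def)

text \<open>The sources of the loops are the degrees of freedom of the state on the middle layer.\<close>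

lemma card_middle_states:
  assumes D: "D \<in> diagrams n m" and E: "E \<in> diagrams m p"
  shows "card {U \<in> Pow {..<m}. sem D S U \<and> sem E U T} =
    (if sem (cat_diag D E) S T then 2 ^ loops D E else 0)"
proof (cases "sem (cat_diag D E) S T")
  case False
  then have e: "{U \<in> Pow {..<m}. sem D S U \<and> sem E U T} = {}"
    using sem_cat[OF diag_layers[OF D] diag_layers[OF E]] by blast
  show ?thesis using False unfolding e by simp
next
  case True
  let ?G = "glue D E"
  let ?M = "{U \<in> Pow {..<m}. sem D S U \<and> sem E U T}"
  define L where "L = {C \<in> components ?G. outer C = {}}"
  have sg: "\<And>S U T. sem D S U \<and> sem E U T \<longleftrightarrow> saturated (components ?G) (state3 S U T)"
    using saturated_glue[OF diag_layers[OF D] diag_layers[OF E]] by (simp add: saturated_components)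
  have disj: "C = C'" if "C \<in> components ?G" "C' \<in> components ?G" "x \<in> C" "x \<in> C'" for C C' x
    using that components_partition unfolding partition_on_def disjoint_def by blast
  have ne: "C \<noteq> {}" if "C \<in> components ?G" for C
    using that components_partition[of ?G] unfolding partition_on_def by blast
  have "\<Union>(components ?G) = \<Union>?G" using components_partition[of ?G] partition_onD1 by blast
  also have "\<Union>?G = points n m \<union> next_layer ` points m p"
    unfolding glue_def using diag_Union[OF D] diag_Union[OF E] by (simp add: image_Union[symmetric])
  also have "\<dots> = {0} \<times> {..<n} \<union> {1} \<times> {..<m} \<union> {2} \<times> {..<p}"
    unfolding points_def by (simp add: image_Un next_layer_times numeral_2_eq_2 Un_assoc)
  finally have UC: "\<Union>(components ?G) = {0} \<times> {..<n} \<union> {1} \<times> {..<m} \<union> {2} \<times> {..<p}" .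
  have finL: "finite L"
    by (rule finite_subset[of _ "components ?G"])
      (auto simp: L_def intro!: finite_UnionD simp: UC)
  have Lsub: "x \<in> C \<Longrightarrow> \<exists>i<m. x = (1, i)" if "C \<in> L" for C x
  proof -
    assume x: "x \<in> C"
    have "x \<in> {0} \<times> {..<n} \<union> {1} \<times> {..<m} \<union> {2} \<times> {..<p}" using UC x that L_def by blast
    moreover have "x \<notin> outer C" using that by (simp add: L_def)
    ultimately show ?thesis using x by (auto simp: outer_def)
  qed
  obtain U0' where U0': "sem D S U0'" "sem E U0' T"
    using True sem_cat[OF diag_layers[OF D] diag_layers[OF E]] by blast
  define U0 where "U0 = U0' \<inter> {..<m}"
  have U0: "U0 \<in> ?M"
    using U0' sem_restrict[of D n m S U0'] sem_restrict[of D n m S U0]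
      sem_restrict[of E m p U0' T] sem_restrict[of E m p U0 T] diag_Union[OF D] diag_Union[OF E]
    by (simp add: U0_def Int_assoc)
  \<comment> \<open>Recolours the loops in \<open>K\<close>: the symmetric difference of
    \<open>U0\<close> with the set of their middle points.\<close>
  define fl where "fl K = (let V = {i. (1, i) \<in> \<Union>K} in (U0 - V) \<union> (V - U0))" for K :: "point set set"
  have fl_in: "(1, i) \<in> C \<Longrightarrow> i \<in> fl K \<longleftrightarrow> (if C \<in> K then i \<notin> U0 else i \<in> U0)"
    if "C \<in> components ?G" "K \<subseteq> L" for C K i
  proof -
    assume i: "(1, i) \<in> C"
    have "(1, i) \<in> \<Union>K \<longleftrightarrow> C \<in> K" using that disj[of C] i unfolding L_def by blast
    then show ?thesis unfolding fl_def Let_def by auto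
  qed
  \<comment> \<open>Two admissible middle states with the same outer state agree on all components
    that have an outer point, so they differ exactly by a set of loops.\<close>
  have "bij_betw fl (Pow L) ?M"
  proof (rule bij_betwI')
    fix K K' assume K: "K \<in> Pow L" "K' \<in> Pow L"
    show "fl K = fl K' \<longleftrightarrow> K = K'"
    proof
      assume eq: "fl K = fl K'"
      have "C \<in> K \<longleftrightarrow> C \<in> K'" if CL: "C \<in> L" for C
      proof -
        have C: "C \<in> components ?G" using CL by (simp add: L_def)
        obtain i where "(1, i) \<in> C" using ne[OF C] Lsub[OF CL] by blast
        then show ?thesis using fl_in[OF C] K eq by (metis PowD)
      qed
      then show "K = K'" using K by blast
    qed simp
  next
    fix K assume K: "K \<in> Pow L"
    have "fl K \<subseteq> {..<m}" using U0 K Lsub unfolding fl_def Let_def by fastforce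
    moreover have "saturated (components ?G) (state3 S (fl K) T)"
      unfolding saturated_def
    proof
      fix C assume C: "C \<in> components ?G"
      have U0s: "C \<subseteq> state3 S U0 T \<or> C \<inter> state3 S U0 T = {}"
        using U0 sg C unfolding saturated_def by blast
      show "C \<subseteq> state3 S (fl K) T \<or> C \<inter> state3 S (fl K) T = {}"
      proof (cases "C \<in> K")
        case True
        then have "\<forall>x\<in>C. \<exists>i. x = (1, i)" using Lsub K by blast
        then have "\<forall>x\<in>C. x \<in> state3 S (fl K) T \<longleftrightarrow> x \<notin> state3 S U0 T"
          using fl_in[OF C, of K] K True by (fastforce simp: state3_def)
        then show ?thesis using U0s by blast
      next
        case False
        then have "x \<in> state3 S (fl K) T \<longleftrightarrow> x \<in> state3 S U0 T" if "x \<in> C" for x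
          using fl_in[OF C, of K] K False that by (cases x) (auto simp: state3_def)
        then show ?thesis using U0s by blast
      qed
    qed
    ultimately show "fl K \<in> ?M" using sg by blast
  next
    fix U assume U: "U \<in> ?M"
    define K where "K = {C \<in> L. \<exists>i. (1, i) \<in> C \<and> (i \<in> U) \<noteq> (i \<in> U0)}"
    have K: "K \<subseteq> L" by (auto simp: K_def)
    have "i \<in> U \<longleftrightarrow> i \<in> fl K" for i
    proof (cases "i < m")
      case True
      then obtain C where C: "C \<in> components ?G" "(1, i) \<in> C" using UC by blast
      have sU: "C \<subseteq> state3 S U T \<or> C \<inter> state3 S U T = {}"
        "C \<subseteq> state3 S U0 T \<or> C \<inter> state3 S U0 T = {}"
        using U U0 sg C unfolding saturated_def by blast+
      have i1: "(1, j) \<in> state3 S V T \<longleftrightarrow> j \<in> V" for j V by (auto simp: state3_def)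
      show ?thesis
      proof (cases "C \<in> L")
        case True
        have "C \<in> K \<longleftrightarrow> (i \<in> U) \<noteq> (i \<in> U0)"
          unfolding K_def using sU i1 C True by blast
        then show ?thesis using fl_in[OF C(1) K C(2)] by auto
      next
        case False
        then obtain x where x: "x \<in> outer C" using C by (auto simp: L_def)
        then have "x \<in> C" "x \<in> state3 S U T \<longleftrightarrow> x \<in> state3 S U0 T"
          by (auto simp: outer_def state3_def)
        then have "i \<in> U \<longleftrightarrow> i \<in> U0" using sU i1 C by blast
        moreover have "C \<notin> K" using False K by blast
        ultimately show ?thesis using fl_in[OF C(1) K C(2)] by auto
      qed
    next
      case False
      then have "(1, i) \<notin> \<Union>K" using Lsub K by (metis UnionE subsetD prod.inject)
      then show ?thesis using False U U0 unfolding fl_def Let_def by auto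
    qed
    then show "\<exists>K\<in>Pow L. U = fl K" using K by blast
  qed
  then have "card ?M = card (Pow L)" by (rule bij_betw_same_card[symmetric])
  also have "\<dots> = 2 ^ loops D E" using finL by (simp add: card_Pow L_def loops_def)
  finally show ?thesis using True by simp
qed

subsection \<open>Concatenation of diagrams is a diagram\<close>

text \<open>A connected graph with e edges has at most e + 1 vertices. A largest vertex set
  \<open>T\<close> around \<open>a\<close> that obeys this bound is saturated: an edge leaving
  \<open>T\<close> could be added together with its other end, at the price of one vertex for at
  least one edge.\<close>

lemma card_component_le:
  fixes G :: "point set set"
  assumes G: "finite G" "\<And>B. B \<in> G \<Longrightarrow> card B = 2" and C: "C \<in> components G"
  shows "card C \<le> card {B \<in> G. B \<subseteq> C} + 1"
proof -
  have finU: "finite (\<Union>G)" using G by (metis card.infinite finite_Union zero_neq_numeral)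
  have sub: "C \<subseteq> \<Union>G" "C \<noteq> {}"
    using C components_partition[of G] unfolding partition_on_def by blast+
  then have finC: "finite C" using finU finite_subset by blast
  obtain a where a: "a \<in> C" using sub by blast
  define P where "P T \<longleftrightarrow> a \<in> T \<and> T \<subseteq> C \<and> card T \<le> card {B \<in> G. B \<subseteq> T} + 1" for T
  have "P {a}" using a by (simp add: P_def)
  moreover have "card T \<le> card C" if "P T" for T
    using that finC card_mono unfolding P_def by blast
  ultimately obtain T where T: "P T" "\<And>T'. P T' \<Longrightarrow> card T' \<le> card T"
    using ex_has_greatest_nat[of P "{a}" card "card C + 1"] by (metis add.commute le_imp_less_Suc plus_1_eq_Suc)
  have finT: "finite T" using T finC finite_subset unfolding P_def by blast
  have "saturated G T"
  proof (rule ccontr)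
    assume "\<not> saturated G T"
    then obtain B where B: "B \<in> G" "\<not> B \<subseteq> T" "B \<inter> T \<noteq> {}" unfolding saturated_def by blast
    then obtain x y where xy: "x \<in> B" "x \<in> T" "y \<in> B" "y \<notin> T" by blast
    have "card B = 2" using G B by blast
    moreover have "x \<noteq> y" using xy by blast
    then have "card {x, y} = 2" by simp
    ultimately have Bxy: "B = {x, y}"
      using xy by (metis (no_types, lifting) card_2_iff card_subset_eq empty_subsetI finite.emptyI finite.insertI insert_subset)
    have "B \<subseteq> C" using component_block[OF C B(1) xy(1)] xy T unfolding P_def by blast
    have "card (insert B {B \<in> G. B \<subseteq> T}) \<le> card {B \<in> G. B \<subseteq> insert y T}"
      by (rule card_mono) (use G B Bxy xy in auto)
    moreover have "card (insert B {B \<in> G. B \<subseteq> T}) = card {B \<in> G. B \<subseteq> T} + 1"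
      using G B by simp
    ultimately have "P (insert y T)"
      using T(1) xy \<open>B \<subseteq> C\<close> finT unfolding P_def by auto
    then show False using T(2) xy finT by fastforce
  qed
  then have "saturated (components G) T" by (simp add: saturated_components)
  then have "C \<subseteq> T" using C a T(1) unfolding saturated_def P_def by blast
  then show ?thesis using T(1) unfolding P_def by (metis subset_antisym)
qed

lemma Union_glue:
  assumes "D \<in> diagrams n m" "E \<in> diagrams m p"
  shows "\<Union>(glue D E) = {0} \<times> {..<n} \<union> {1} \<times> {..<m} \<union> {2} \<times> {..<p}"
proof -
  have "\<Union>(glue D E) = points n m \<union> next_layer ` points m p"
    unfolding glue_def using assms[THEN diag_Union] by (simp add: image_Union[symmetric])
  then show ?thesis
    unfolding points_def by (simp add: image_Un next_layer_times numeral_2_eq_2 Un_assoc)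
qed

lemma cat_partition:
  assumes D: "D \<in> diagrams n m" and E: "E \<in> diagrams m p"
  shows "partition_on (points n p) (cat_diag D E)"
proof -
  let ?G = "glue D E"
  have 1: "partition_on (outer (\<Union>?G)) (outer ` components ?G - {{}})"
    by (rule partition_on_transform[OF components_partition]) (auto simp: outer_def disjnt_def)
  have "inj_on forget_layer (outer (\<Union>?G))"
    unfolding Union_glue[OF D E] by (auto simp: inj_on_def outer_def)
  from partition_on_inj_image[OF 1 this]
  have "partition_on (forget_layer ` outer (\<Union>?G)) ((`) forget_layer ` (outer ` components ?G - {{}}) - {{}})" .
  moreover have "(`) forget_layer ` (outer ` components ?G - {{}}) - {{}} = cat_diag D E"
    unfolding cat_diag_def by auto
  moreover have "forget_layer ` outer (\<Union>?G) = points n p"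
  proof -
    have "outer (\<Union>?G) = {0} \<times> {..<n} \<union> {2} \<times> {..<p}"
      unfolding Union_glue[OF D E] by (auto simp: outer_def)
    moreover have "forget_layer ` ({0} \<times> {..<n}) = {0} \<times> {..<n}"
      "forget_layer ` ({2} \<times> {..<p}) = {1} \<times> {..<p}" by force+
    ultimately show ?thesis by (simp add: image_Un points_def)
  qed
  ultimately show ?thesis by simp
qed

lemma sem_Union_blocks:
  assumes D: "D \<in> diagrams n m" and "sem D S T" "S \<subseteq> {..<n}" "T \<subseteq> {..<m}"
  shows "\<Union>{B \<in> D. B \<subseteq> state S T} = state S T"
proof -
  have "x \<in> \<Union>{B \<in> D. B \<subseteq> state S T}" if x: "x \<in> state S T" for x
  proof -
    have "x \<in> \<Union>D" using x assms(3,4) diag_Union[OF D] by (auto simp: state_def points_def)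
    then show ?thesis using x assms(2) unfolding sem_def saturated_def by blast
  qed
  then show ?thesis by blast
qed

lemma card_state: "finite S \<Longrightarrow> finite T \<Longrightarrow> card (state S T) = card S + card T"
  unfolding state_def by (subst card_Un_disjoint) auto

text \<open>An admissible state is a disjoint union of strands, and each strand has two
  points.\<close>

lemma card_sem_blocks:
  assumes D: "D \<in> diagrams n m" and "sem D S T" "S \<subseteq> {..<n}" "T \<subseteq> {..<m}"
  shows "2 * card {B \<in> D. B \<subseteq> state S T} = card S + card T"
proof -
  have fin: "finite S" "finite T" using assms finite_subset by blast+
  have "card (\<Union>{B \<in> D. B \<subseteq> state S T}) = (\<Sum>B\<in>{B \<in> D. B \<subseteq> state S T}. card B)"
  proof (rule card_Union_disjoint)
    show "pairwise disjnt {B \<in> D. B \<subseteq> state S T}"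
      using diag_block_eq[OF D] unfolding pairwise_def disjnt_def by blast
    show "finite B" if "B \<in> {B \<in> D. B \<subseteq> state S T}" for B
      using that diag_card2[OF D] by (metis (mono_tags, lifting) card.infinite mem_Collect_eq zero_neq_numeral)
  qed
  also have "\<dots> = (\<Sum>B\<in>{B \<in> D. B \<subseteq> state S T}. 2)"
    using diag_card2[OF D] by (intro sum.cong) auto
  finally show ?thesis
    unfolding sem_Union_blocks[OF assms] using fin by (simp add: card_state)
qed

text \<open>A component is saturated, hence an admissible state of both diagrams. This makes the
  strand counts for states available for components.\<close>

lemma component_state3:
  assumes D: "D \<in> diagrams n m" and E: "E \<in> diagrams m p" and C: "C \<in> components (glue D E)"
  obtains S U T where "C = state3 S U T" "sem D S U" "sem E U T"
    "S \<subseteq> {..<n}" "U \<subseteq> {..<m}" "T \<subseteq> {..<p}"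
proof -
  let ?S = "{i. (0, i) \<in> C}" and ?U = "{i. (1, i) \<in> C}" and ?T = "{i. (2, i) \<in> C}"
  have "C \<subseteq> \<Union>(glue D E)"
    using C components_partition[of "glue D E"] unfolding partition_on_def by blast
  then have C': "C = state3 ?S ?U ?T" "?S \<subseteq> {..<n}" "?U \<subseteq> {..<m}" "?T \<subseteq> {..<p}"
    unfolding Union_glue[OF D E] by (auto simp: state3_def)
  have "saturated (glue D E) C" using component_block[OF C] unfolding saturated_def by blast
  then show ?thesis
    using that[of ?S ?U ?T] C' saturated_glue[OF diag_layers[OF D] diag_layers[OF E]] by metis
qed

lemma forget_outer_state3: "forget_layer ` outer (state3 S U T) = state S T"
proof -
  have "outer (state3 S U T) = {0} \<times> S \<union> {2} \<times> T" by (auto simp: outer_def state3_def)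
  moreover have "forget_layer ` ({0} \<times> S) = {0} \<times> S" "forget_layer ` ({2} \<times> T) = {1} \<times> T" by force+
  ultimately show ?thesis by (simp add: image_Un state_def)
qed

text \<open>A component of the glued figure is a connected graph of degree at most 2; comparing the
  numbers of its edges and vertices shows that it has at most 2 ends.\<close>

lemma cat_card2:
  assumes D: "D \<in> diagrams n m" and E: "E \<in> diagrams m p" and B: "B \<in> cat_diag D E"
  shows "card B = 2"
proof -
  obtain C where C: "C \<in> components (glue D E)" and B': "B = forget_layer ` outer C" and ne: "outer C \<noteq> {}"
    using B unfolding cat_diag_def by blast
  obtain S U T where CST: "C = state3 S U T" and sem: "sem D S U" "sem E U T"
    and sub: "S \<subseteq> {..<n}" "U \<subseteq> {..<m}" "T \<subseteq> {..<p}"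
    using component_state3[OF D E C] .
  have fin: "finite S" "finite U" "finite T" using sub finite_subset by blast+
  let ?GD = "{B \<in> D. B \<subseteq> state S U}" and ?GE = "{B \<in> E. B \<subseteq> state U T}"
  have inj: "inj next_layer" by (auto simp: inj_def)
  have "card C \<le> card {B \<in> glue D E. B \<subseteq> C} + 1"
  proof (rule card_component_le[OF _ _ C])
    show "finite (glue D E)" using diag_finite[OF D] diag_finite[OF E] by (simp add: glue_def)
    show "card B = 2" if "B \<in> glue D E" for B
      using that diag_card2[OF D] diag_card2[OF E] card_image[OF inj_on_subset[OF inj subset_UNIV]]
      by (auto simp: glue_def)
  qed
  also have "card {B \<in> glue D E. B \<subseteq> C} \<le> card (?GD \<union> (\<lambda>B. next_layer ` B) ` ?GE)"
  proof (rule card_mono)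
    show "finite (?GD \<union> (\<lambda>B. next_layer ` B) ` ?GE)"
      using diag_finite[OF D] diag_finite[OF E] by simp
    have "B \<subseteq> state S U" if "B \<in> D" "B \<subseteq> C" for B
    proof
      fix x assume x: "x \<in> B"
      then have "x \<in> {0, 1} \<times> UNIV" using diag_layers[OF D] that by blast
      moreover have "x \<in> state3 S U T" using x that CST by blast
      ultimately show "x \<in> state S U" by (auto simp: state3_def state_def)
    qed
    moreover have "B \<subseteq> state U T" if "B \<in> E" "next_layer ` B \<subseteq> C" for B
    proof
      fix x assume x: "x \<in> B"
      then have "x \<in> {0, 1} \<times> UNIV" using diag_layers[OF E] that by blast
      moreover have "next_layer x \<in> state3 S U T" using x that CST by blast
      ultimately show "x \<in> state U T" by (auto simp: state3_def state_def)
    qed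
    ultimately show "{B \<in> glue D E. B \<subseteq> C} \<subseteq> ?GD \<union> (\<lambda>B. next_layer ` B) ` ?GE"
      unfolding glue_def by blast
  qed
  also have "\<dots> \<le> card ?GD + card ?GE"
    by (rule order_trans[OF card_Un_le]) (simp add: card_image_le diag_finite[OF E])
  finally have le: "card C \<le> card ?GD + card ?GE + 1" by simp
  have cC: "card C = card S + card U + card T"
    unfolding CST state3_def using fin
    by (simp add: card_Un_disjoint Int_Un_distrib2 Times_Int_Times)
  have cB: "card B = card S + card T"
    unfolding B' CST forget_outer_state3 using fin by (simp add: card_state)
  note half = card_sem_blocks[OF D sem(1) sub(1,2)] card_sem_blocks[OF E sem(2) sub(2,3)]
  \<comment> \<open>With s, u, t points in the three layers there are (s + u)/2 + (u + t)/2 edges,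
    and s + u + t exceeds this by at most 1, so s + t is at most 2. It is even because s + u and u +
    t are.\<close>
  have "card B \<le> 2" using le half cC cB by linarith
  moreover have "even (card B)" using half cB by presburger
  moreover have "B \<noteq> {}" "finite B"
    unfolding B' CST forget_outer_state3 using ne fin CST
    by (auto simp: outer_def state3_def state_def)
  then have "card B > 0" by (simp add: card_gt_0_iff)
  ultimately show ?thesis by presburger
qed

text \<open>Planarity of a concatenation is proved by a parity count: two disjoint chords cross if and
  only if the number of pairs \<open>x < y\<close> with \<open>x\<close> an end of the first and \<open>y\<close> an end of the
  second chord is odd, and this number is additive.\<close>

definition cross :: "('a \<Rightarrow> nat) \<Rightarrow> 'a set \<Rightarrow> 'a set \<Rightarrow> nat" where
  "cross f X Y = (\<Sum>x\<in>X. \<Sum>y\<in>Y. of_bool (f x < f y))"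

lemma bpos_inj: "inj_on (bpos n m) (points n m)"
  by (auto simp: inj_on_def points_def bpos_def)

lemma bpos_less: "x \<in> points n m \<Longrightarrow> bpos n m x < n + m"
  by (auto simp: points_def bpos_def)

text \<open>Two intervals that do not cross are either disjoint, with 4 or 0 pairs in the right
  order, or nested, with 2 such pairs.\<close>

lemma even_pairs_of_noncrossing:
  fixes a b c d :: nat
  assumes "a < c" "b < d" "a \<noteq> b" "a \<noteq> d" "c \<noteq> b" "c \<noteq> d"
    and nc: "\<not> (a < b \<and> b < c \<and> c < d)" "\<not> (b < a \<and> a < d \<and> d < c)"
  shows "even (of_bool (a < b) + of_bool (a < d) + (of_bool (c < b) + of_bool (c < d)) :: nat)"
proof -
  consider "c < b" | "d < a" | "a < b" "b < c" "d < c" | "b < a" "a < d" "c < d"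
    using assms by linarith
  then show ?thesis using assms(1,2) by cases simp_all
qed

lemma even_cross_blocks:
  assumes D: "D \<in> diagrams n m" and B: "B \<in> D" "B' \<in> D" "B \<noteq> B'"
  shows "even (cross (bpos n m) B B')"
proof -
  let ?f = "bpos n m"
  have *: "\<exists>a c. X = {a, c} \<and> ?f a < ?f c \<and> a \<in> points n m \<and> c \<in> points n m" if X: "X \<in> D" for X
  proof -
    obtain a c where ac: "X = {a, c}" "a \<noteq> c" using diag_card2[OF D X] by (meson card_2_iff)
    then have "a \<in> points n m" "c \<in> points n m" using diag_Union[OF D] X by auto
    then have "?f a < ?f c \<or> ?f c < ?f a" using bpos_inj ac by (metis inj_on_def linorder_neqE_nat)
    then show ?thesis using ac \<open>a \<in> points n m\<close> \<open>c \<in> points n m\<close> by blast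
  qed
  obtain a c where ac: "B = {a, c}" "?f a < ?f c" "a \<in> points n m" "c \<in> points n m" using *[OF B(1)] by blast
  obtain b d where bd: "B' = {b, d}" "?f b < ?f d" "b \<in> points n m" "d \<in> points n m" using *[OF B(2)] by blast
  have "B \<inter> B' = {}" using diag_block_eq[OF D] B by blast
  then have "a \<noteq> b" "a \<noteq> d" "c \<noteq> b" "c \<noteq> d" using ac bd by auto
  then have ne: "?f a \<noteq> ?f b" "?f a \<noteq> ?f d" "?f c \<noteq> ?f b" "?f c \<noteq> ?f d"
    using bpos_inj ac bd by (metis inj_on_def)+
  have pl: "planar n m D" using D by (simp add: diagrams_def)
  have "\<not> (?f a < ?f b \<and> ?f b < ?f c \<and> ?f c < ?f d)" "\<not> (?f b < ?f a \<and> ?f a < ?f d \<and> ?f d < ?f c)"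
    using pl B ac bd unfolding planar_def by blast+
  then have "even (of_bool (?f a < ?f b) + of_bool (?f a < ?f d) +
      (of_bool (?f c < ?f b) + of_bool (?f c < ?f d)) :: nat)"
    by (intro even_pairs_of_noncrossing ac(2) bd(2) ne)
  moreover have "a \<noteq> c" "b \<noteq> d" using ac bd by auto
  ultimately show ?thesis unfolding cross_def ac(1) bd(1) by (simp del: sum_of_bool_eq)
qed

lemma cross_Union:
  assumes "finite P" "finite Q" "\<And>B. B \<in> P \<union> Q \<Longrightarrow> finite B"
    and "\<And>B B'. B \<in> P \<Longrightarrow> B' \<in> P \<Longrightarrow> B \<noteq> B' \<Longrightarrow> B \<inter> B' = {}"
    and "\<And>B B'. B \<in> Q \<Longrightarrow> B' \<in> Q \<Longrightarrow> B \<noteq> B' \<Longrightarrow> B \<inter> B' = {}"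
  shows "cross f (\<Union>P) (\<Union>Q) = (\<Sum>B\<in>P. \<Sum>B'\<in>Q. cross f B B')"
proof -
  have "cross f (\<Union>P) (\<Union>Q) = (\<Sum>B\<in>P. \<Sum>x\<in>B. \<Sum>y\<in>\<Union>Q. of_bool (f x < f y))"
    unfolding cross_def using assms by (subst sum.Union_disjoint) auto
  also have "\<dots> = (\<Sum>B\<in>P. \<Sum>x\<in>B. \<Sum>B'\<in>Q. \<Sum>y\<in>B'. of_bool (f x < f y))"
    using assms by (subst sum.Union_disjoint) auto
  also have "\<dots> = (\<Sum>B\<in>P. \<Sum>B'\<in>Q. cross f B B')"
    unfolding cross_def by (rule sum.cong[OF refl], rule sum.swap)
  finally show ?thesis .
qed

text \<open>By additivity of \<open>cross\<close> over disjoint unions this reduces to pairs of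
  distinct strands.\<close>

lemma even_cross_state:
  assumes D: "D \<in> diagrams n m" and X: "sem D S T" "S \<subseteq> {..<n}" "T \<subseteq> {..<m}"
    and Y: "sem D S' T'" "S' \<subseteq> {..<n}" "T' \<subseteq> {..<m}" and "S \<inter> S' = {}" "T \<inter> T' = {}"
  shows "even (cross (bpos n m) (state S T) (state S' T'))"
proof -
  have disj: "B \<inter> B' = {}" if "B \<in> D" "B' \<in> D" "B \<noteq> B'" for B B'
    using that diag_block_eq[OF D] by blast
  have fin: "finite B" if "B \<in> D" for B
    using diag_card2[OF D that] by (metis card.infinite zero_neq_numeral)
  have "cross (bpos n m) (\<Union>{B \<in> D. B \<subseteq> state S T}) (\<Union>{B \<in> D. B \<subseteq> state S' T'})
    = (\<Sum>B\<in>{B \<in> D. B \<subseteq> state S T}. \<Sum>B'\<in>{B \<in> D. B \<subseteq> state S' T'}. cross (bpos n m) B B')"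
    using diag_finite[OF D] fin disj by (intro cross_Union) auto
  also have "even \<dots>"
  proof (intro dvd_sum)
    fix B B' assume "B \<in> {B \<in> D. B \<subseteq> state S T}" "B' \<in> {B \<in> D. B \<subseteq> state S' T'}"
    moreover have "state S T \<inter> state S' T' = {}" using assms by (auto simp: state_def)
    moreover have "B \<noteq> {}" using calculation diag_card2[OF D, of B] by force
    ultimately show "even (cross (bpos n m) B B')"
      by (intro even_cross_blocks[OF D]) auto
  qed
  finally show ?thesis unfolding sem_Union_blocks[OF D X] sem_Union_blocks[OF D Y] .
qed

lemma cross_Un:
  "finite X \<Longrightarrow> finite X' \<Longrightarrow> X \<inter> X' = {} \<Longrightarrow> cross f (X \<union> X') Y = cross f X Y + cross f X' Y"
  "finite Y \<Longrightarrow> finite Y' \<Longrightarrow> Y \<inter> Y' = {} \<Longrightarrow> cross f X (Y \<union> Y') = cross f X Y + cross f X Y'"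
  unfolding cross_def by (simp_all add: sum.union_disjoint sum.distrib del: sum_of_bool_eq)

text \<open>All sources precede all targets on the boundary, which accounts for the product in the
  middle and for the absence of the opposite mixed term. Targets are met in decreasing order, so the
  roles of \<open>T\<close> and \<open>T'\<close> are exchanged in the last term.\<close>

lemma cross_state:
  assumes "S \<subseteq> {..<n}" "T \<subseteq> {..<m}" "S' \<subseteq> {..<n}" "T' \<subseteq> {..<m}"
  shows "cross (bpos n m) (state S T) (state S' T') =
    cross id S S' + card S * card T' + cross id T' T"
proof -
  have fin: "finite S" "finite T" "finite S'" "finite T'" using assms finite_subset by blast+
  let ?c = "cross (bpos n m)"
  have pr: "(\<Sum>x\<in>{l} \<times> A. g x) = (\<Sum>i\<in>A. g (l, i))" for l :: nat and A and g :: "point \<Rightarrow> nat"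
    by (subst sum.cartesian_product') simp
  have "?c (state S T) (state S' T') = ?c ({0} \<times> S) ({0} \<times> S') + ?c ({0} \<times> S) ({1} \<times> T')
      + (?c ({1} \<times> T) ({0} \<times> S') + ?c ({1} \<times> T) ({1} \<times> T'))"
    unfolding state_def using fin by (simp add: cross_Un Times_Int_Times)
  also have "?c ({0} \<times> S) ({0} \<times> S') = cross id S S'"
    unfolding cross_def pr by (simp add: bpos_def)
  also have "?c ({0} \<times> S) ({1} \<times> T') = (\<Sum>x\<in>S. \<Sum>y\<in>T'. 1)"
    unfolding cross_def pr using assms by (intro sum.cong) (fastforce simp: bpos_def)+
  also have "?c ({1} \<times> T) ({0} \<times> S') = (\<Sum>x\<in>T. \<Sum>y\<in>S'. 0)"
    unfolding cross_def pr using assms by (intro sum.cong) (fastforce simp: bpos_def)+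
  also have "?c ({1} \<times> T) ({1} \<times> T') = (\<Sum>x\<in>T. \<Sum>y\<in>T'. of_bool (y < x))"
    unfolding cross_def pr using assms by (intro sum.cong) (fastforce simp: bpos_def)+
  also have "\<dots> = cross id T' T" unfolding cross_def by (subst sum.swap) simp
  finally show ?thesis by (simp add: id_def)
qed

lemma cross_swap:
  "S \<inter> S' = {} \<Longrightarrow> finite S \<Longrightarrow> finite S' \<Longrightarrow> cross id S S' + cross id S' S = card S * card (S' :: nat set)"
proof -
  assume a: "S \<inter> S' = {}" "finite S" "finite S'"
  have "cross id S' S = (\<Sum>x\<in>S. \<Sum>y\<in>S'. of_bool (y < x))"
    unfolding cross_def by (subst sum.swap) simp
  then have "cross id S S' + cross id S' S = (\<Sum>x\<in>S. \<Sum>y\<in>S'. of_bool (x < y) + of_bool (y < x))"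
    unfolding cross_def by (simp add: sum.distrib)
  also have "\<dots> = (\<Sum>x\<in>S. \<Sum>y\<in>S'. 1)"
    using a by (intro sum.cong refl) (auto simp: of_bool_def)
  finally show ?thesis by simp
qed

lemma state3_Int:
  "state3 S U T \<inter> state3 S' U' T' = {} \<longleftrightarrow> S \<inter> S' = {} \<and> U \<inter> U' = {} \<and> T \<inter> T' = {}"
  by (simp add: state3_def Int_Un_distrib Int_Un_distrib2 Times_Int_Times)

text \<open>The parities for \<open>D\<close> and \<open>E\<close> are added. The two middle terms
  \<open>cross id U' U\<close> and \<open>cross id U U'\<close> sum to the product of the sizes of
  \<open>U\<close> and \<open>U'\<close>. Since the three layers of a component have sizes of equal
  parity, all products that involve the middle layer combine to the product of the sizes of
  \<open>S\<close> and \<open>T'\<close>, which is the mixed term of the concatenation.\<close>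

lemma cat_planar:
  assumes D: "D \<in> diagrams n m" and E: "E \<in> diagrams m p"
  shows "planar n p (cat_diag D E)"
  unfolding planar_def
proof (intro notI, elim exE conjE)
  fix a b c d
  assume B: "{a, c} \<in> cat_diag D E" "{b, d} \<in> cat_diag D E"
    and lt: "bpos n p a < bpos n p b" "bpos n p b < bpos n p c" "bpos n p c < bpos n p d"
  obtain C where C: "C \<in> components (glue D E)" and B1: "{a, c} = forget_layer ` outer C"
    using B unfolding cat_diag_def by blast
  obtain C' where C': "C' \<in> components (glue D E)" and B2: "{b, d} = forget_layer ` outer C'"
    using B unfolding cat_diag_def by blast
  have "C \<noteq> C'"
  proof
    assume "C = C'"
    then have "{a, c} = {b, d}" using B1 B2 by simp
    then show False using lt by (metis doubleton_eq_iff less_irrefl order.strict_trans)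
  qed
  then have disj: "C \<inter> C' = {}"
    using C C' components_partition[of "glue D E"] unfolding partition_on_def disjoint_def by blast
  obtain S U T where CST: "C = state3 S U T" and sem: "sem D S U" "sem E U T"
    and sub: "S \<subseteq> {..<n}" "U \<subseteq> {..<m}" "T \<subseteq> {..<p}"
    using component_state3[OF D E C] .
  obtain S' U' T' where CST': "C' = state3 S' U' T'" and sem': "sem D S' U'" "sem E U' T'"
    and sub': "S' \<subseteq> {..<n}" "U' \<subseteq> {..<m}" "T' \<subseteq> {..<p}"
    using component_state3[OF D E C'] .
  have dis: "S \<inter> S' = {}" "U \<inter> U' = {}" "T \<inter> T' = {}"
    using disj unfolding CST CST' by (simp_all add: state3_Int)
  have fin: "finite U" "finite U'" using sub sub' finite_subset by blast+
  have "even (cross id S S' + card S * card U' + cross id U' U)"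
    using even_cross_state[OF D sem(1) sub(1,2) sem'(1) sub'(1,2) dis(1,2)]
      cross_state[OF sub(1,2) sub'(1,2)] by simp
  moreover have "even (cross id U U' + card U * card T' + cross id T' T)"
    using even_cross_state[OF E sem(2) sub(2,3) sem'(2) sub'(2,3) dis(2,3)]
      cross_state[OF sub(2,3) sub'(2,3)] by simp
  moreover have "cross id U U' + cross id U' U = card U * card U'"
    using cross_swap[OF dis(2) fin] .
  then have "even (cross id U U') = (even (cross id U' U) = even (card U * card U'))"
    by (metis even_add)
  moreover have "even (card S + card U)" "even (card U + card T)"
    "even (card S' + card U')" "even (card U' + card T')"
    using card_sem_blocks[OF D sem(1) sub(1,2)] card_sem_blocks[OF E sem(2) sub(2,3)]
      card_sem_blocks[OF D sem'(1) sub'(1,2)] card_sem_blocks[OF E sem'(2) sub'(2,3)] by presburger+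
  ultimately have "even (cross id S S' + card S * card T' + cross id T' T)"
    by (auto simp: even_add even_mult_iff)
  then have "even (cross (bpos n p) (state S T) (state S' T'))"
    using cross_state[OF sub(1,3) sub'(1,3)] by simp
  then have "even (cross (bpos n p) {a, c} {b, d})"
    unfolding B1 B2 CST CST' forget_outer_state3 .
  moreover have "a \<noteq> c" "b \<noteq> d" using lt by auto
  ultimately show False using lt by (simp add: cross_def)
qed

lemma cat_diagrams:
  "D \<in> diagrams n m \<Longrightarrow> E \<in> diagrams m p \<Longrightarrow> cat_diag D E \<in> diagrams n p"
  unfolding diagrams_def[of n p] using cat_partition cat_card2 cat_planar by blast

lemma sem_cat_diag:
  "D \<in> diagrams n m \<Longrightarrow> E \<in> diagrams m p \<Longrightarrow>
    sem (cat_diag D E) S T \<longleftrightarrow> (\<exists>U\<subseteq>{..<m}. sem D S U \<and> sem E U T)"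
proof -
  assume D: "D \<in> diagrams n m" and E: "E \<in> diagrams m p"
  have "sem D S (U \<inter> {..<m}) \<longleftrightarrow> sem D S U" "sem E (U \<inter> {..<m}) T \<longleftrightarrow> sem E U T" for U
    using sem_restrict[of D n m S U] sem_restrict[of D n m S "U \<inter> {..<m}"]
      sem_restrict[of E m p U T] sem_restrict[of E m p "U \<inter> {..<m}" T] diag_Union[OF D] diag_Union[OF E]
    by (simp_all add: Int_assoc)
  then show ?thesis unfolding sem_cat[OF diag_layers[OF D] diag_layers[OF E]] by (metis inf_le2)
qed

lemma diag_eqI_sem:
  assumes "D \<in> diagrams n m" "E \<in> diagrams n m"
    and "\<And>S T. S \<subseteq> {..<n} \<Longrightarrow> T \<subseteq> {..<m} \<Longrightarrow> sem D S T \<longleftrightarrow> sem E S T"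
  shows "D = E"
  using diag_eqI assms diagrams_partition by blast

text \<open>Both sides are composites of the same three relations.\<close>

lemma cat_assoc:
  assumes "D \<in> diagrams n m" "E \<in> diagrams m p" "F \<in> diagrams p r"
  shows "cat_diag (cat_diag D E) F = cat_diag D (cat_diag E F)"
proof (rule diag_eqI_sem)
  note DE = cat_diagrams[OF assms(1,2)] and EF = cat_diagrams[OF assms(2,3)]
  show "cat_diag (cat_diag D E) F \<in> diagrams n r" "cat_diag D (cat_diag E F) \<in> diagrams n r"
    by (rule cat_diagrams[OF DE assms(3)], rule cat_diagrams[OF assms(1) EF])
  show "sem (cat_diag (cat_diag D E) F) S T \<longleftrightarrow> sem (cat_diag D (cat_diag E F)) S T" for S T
    unfolding sem_cat_diag[OF DE assms(3)] sem_cat_diag[OF assms(1) EF]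
      sem_cat_diag[OF assms(1,2)] sem_cat_diag[OF assms(2,3)] by blast
qed

lemma loops_eqI:
  assumes "D \<in> diagrams n m" "E \<in> diagrams m p" "card {U \<in> Pow {..<m}. sem D {} U \<and> sem E U {}} = 2 ^ l"
  shows "loops D E = l"
  using card_middle_states[OF assms(1,2), of "{}" "{}"] assms(3) by simp

text \<open>Double counting of the pairs of states on the two middle layers that are compatible with
  empty outer states. Summing over either layer last gives 2 to the power of one side of the
  equation.\<close>

lemma loops_assoc:
  assumes D: "D \<in> diagrams n m" and E: "E \<in> diagrams m p" and F: "F \<in> diagrams p r"
  shows "loops D E + loops (cat_diag D E) F = loops E F + loops D (cat_diag E F)"
proof -
  have eq1: "(\<Sum>V\<in>{V \<in> Pow {..<p}. sem F V {}}. card {U \<in> Pow {..<m}. sem D {} U \<and> sem E U V})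
      = 2 ^ (loops D E + loops (cat_diag D E) F)"
  proof -
    have "(\<Sum>V\<in>{V \<in> Pow {..<p}. sem F V {}}. card {U \<in> Pow {..<m}. sem D {} U \<and> sem E U V})
      = (\<Sum>V\<in>{V \<in> Pow {..<p}. sem F V {}}. if sem (cat_diag D E) {} V then 2 ^ loops D E else 0)"
      using card_middle_states[OF D E] by simp
    also have "\<dots> = (\<Sum>V\<in>{V \<in> {V \<in> Pow {..<p}. sem F V {}}. sem (cat_diag D E) {} V}. 2 ^ loops D E)"
      by (rule sum.inter_filter[symmetric]) simp
    also have "\<dots> = card {V \<in> Pow {..<p}. sem (cat_diag D E) {} V \<and> sem F V {}} * 2 ^ loops D E"
      by (simp add: conj_commute conj_left_commute)
    finally show ?thesis using card_middle_states[OF cat_diagrams[OF D E] F, of "{}" "{}"]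
      by (simp add: power_add)
  qed
  have eq2: "(\<Sum>U\<in>{U \<in> Pow {..<m}. sem D {} U}. card {V \<in> Pow {..<p}. sem E U V \<and> sem F V {}})
      = 2 ^ (loops E F + loops D (cat_diag E F))"
  proof -
    have "(\<Sum>U\<in>{U \<in> Pow {..<m}. sem D {} U}. card {V \<in> Pow {..<p}. sem E U V \<and> sem F V {}})
      = (\<Sum>U\<in>{U \<in> Pow {..<m}. sem D {} U}. if sem (cat_diag E F) U {} then 2 ^ loops E F else 0)"
      using card_middle_states[OF E F] by simp
    also have "\<dots> = (\<Sum>U\<in>{U \<in> {U \<in> Pow {..<m}. sem D {} U}. sem (cat_diag E F) U {}}. 2 ^ loops E F)"
      by (rule sum.inter_filter[symmetric]) simp
    also have "\<dots> = card {U \<in> Pow {..<m}. sem D {} U \<and> sem (cat_diag E F) U {}} * 2 ^ loops E F"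
      by simp
    finally show ?thesis using card_middle_states[OF D cat_diagrams[OF E F], of "{}" "{}"]
      by (simp add: power_add)
  qed
  have "(\<Sum>V\<in>{V \<in> Pow {..<p}. sem F V {}}. card {U \<in> Pow {..<m}. sem D {} U \<and> sem E U V})
    = (\<Sum>V\<in>Pow {..<p}. \<Sum>U\<in>Pow {..<m}. if sem D {} U \<and> sem E U V \<and> sem F V {} then 1 else 0)"
    by (subst sum.inter_filter, simp, intro sum.cong refl, simp add: sum.inter_filter[symmetric])
  also have "\<dots> = (\<Sum>U\<in>Pow {..<m}. \<Sum>V\<in>Pow {..<p}. if sem D {} U \<and> sem E U V \<and> sem F V {} then 1 else 0)"
    by (rule sum.swap)
  also have "\<dots> = (\<Sum>U\<in>{U \<in> Pow {..<m}. sem D {} U}. card {V \<in> Pow {..<p}. sem E U V \<and> sem F V {}})"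
    by (subst sum.inter_filter, simp, intro sum.cong refl, simp add: sum.inter_filter[symmetric])
  finally show ?thesis unfolding eq1 eq2 by simp
qed

subsection \<open>Elementary diagrams\<close>

lemma partition_on_image:
  assumes "partition_on A P" "inj_on f A"
  shows "partition_on (f ` A) ((`) f ` P)"
proof -
  have "(`) f ` P - {{}} = (`) f ` P" using assms(1) unfolding partition_on_def by auto
  then show ?thesis using partition_on_inj_image[OF assms] by simp
qed

lemma partition_on_Un:
  assumes "partition_on A P" "partition_on B Q" "A \<inter> B = {}"
  shows "partition_on (A \<union> B) (P \<union> Q)"
proof (rule partition_onI)
  show "\<Union>(P \<union> Q) = A \<union> B" "{} \<notin> P \<union> Q" using assms unfolding partition_on_def by auto
  fix p q assume "p \<in> P \<union> Q" "q \<in> P \<union> Q" "p \<noteq> q"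
  moreover have "p \<in> P \<Longrightarrow> p \<subseteq> A" "p \<in> Q \<Longrightarrow> p \<subseteq> B" for p
    using assms unfolding partition_on_def by auto
  moreover have "p \<in> P \<Longrightarrow> q \<in> P \<Longrightarrow> p \<noteq> q \<Longrightarrow> p \<inter> q = {}" "p \<in> Q \<Longrightarrow> q \<in> Q \<Longrightarrow> p \<noteq> q \<Longrightarrow> p \<inter> q = {}"
    for p q using assms unfolding partition_on_def disjoint_def by auto
  ultimately show "disjnt p q" unfolding disjnt_def using assms(3) by blast
qed

definition cross4 :: "('a \<Rightarrow> nat) \<Rightarrow> 'a set \<Rightarrow> 'a set \<Rightarrow> bool" where
  "cross4 f X Y \<longleftrightarrow> (\<exists>a b c d. X = {a, c} \<and> Y = {b, d} \<and> f a < f b \<and> f b < f c \<and> f c < f d)"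

lemma planar_cross4: "planar n m D \<longleftrightarrow> (\<forall>X\<in>D. \<forall>Y\<in>D. \<not> cross4 (bpos n m) X Y)"
  unfolding planar_def cross4_def by blast

lemma cross4_image:
  assumes "cross4 g (h ` X) (h ` Y)" "card X = 2" "card Y = 2"
    and mono: "\<And>x y. x \<in> X \<union> Y \<Longrightarrow> y \<in> X \<union> Y \<Longrightarrow> g (h x) < g (h y) \<Longrightarrow> f x < f y"
  shows "cross4 f X Y"
proof -
  obtain a b c d where *: "h ` X = {a, c}" "h ` Y = {b, d}" "g a < g b" "g b < g c" "g c < g d"
    using assms(1) unfolding cross4_def by blast
  obtain a' c' where X: "X = {a', c'}" "a = h a'" "c = h c'"
  proof -
    obtain u v where "X = {u, v}" using assms(2) by (meson card_2_iff)
    then show ?thesis using that[of u v] that[of v u] *(1) by (auto simp: doubleton_eq_iff insert_commute)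
  qed
  obtain b' d' where Y: "Y = {b', d'}" "b = h b'" "d = h d'"
  proof -
    obtain u v where "Y = {u, v}" using assms(3) by (meson card_2_iff)
    then show ?thesis using that[of u v] that[of v u] *(2) by (auto simp: doubleton_eq_iff insert_commute)
  qed
  have "f a' < f b'" "f b' < f c'" "f c' < f d'" using * X Y mono by auto
  then show ?thesis unfolding cross4_def using X Y by blast
qed

text \<open>For reflections, which reverse the order of the boundary positions: a crossing is
  carried to a crossing with the two chords in exchanged roles.\<close>

lemma cross4_image_anti:
  assumes "cross4 g (h ` X) (h ` Y)" "card X = 2" "card Y = 2"
    and mono: "\<And>x y. x \<in> X \<union> Y \<Longrightarrow> y \<in> X \<union> Y \<Longrightarrow> g (h x) < g (h y) \<Longrightarrow> f y < f x"
  shows "cross4 f Y X"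
proof -
  obtain a b c d where *: "h ` X = {a, c}" "h ` Y = {b, d}" "g a < g b" "g b < g c" "g c < g d"
    using assms(1) unfolding cross4_def by blast
  obtain a' c' where X: "X = {a', c'}" "a = h a'" "c = h c'"
  proof -
    obtain u v where "X = {u, v}" using assms(2) by (meson card_2_iff)
    then show ?thesis using that[of u v] that[of v u] *(1) by (auto simp: doubleton_eq_iff insert_commute)
  qed
  obtain b' d' where Y: "Y = {b', d'}" "b = h b'" "d = h d'"
  proof -
    obtain u v where "Y = {u, v}" using assms(3) by (meson card_2_iff)
    then show ?thesis using that[of u v] that[of v u] *(2) by (auto simp: doubleton_eq_iff insert_commute)
  qed
  have "f b' < f a'" "f c' < f b'" "f d' < f c'" using * X Y mono by auto
  then have "Y = {d', b'} \<and> X = {c', a'} \<and> f d' < f c' \<and> f c' < f b' \<and> f b' < f a'"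
    using X Y by auto
  then show ?thesis unfolding cross4_def by blast
qed

lemma id_diag_in [simp]: "id_diag n \<in> diagrams n n"
proof -
  have "partition_on (points n n) (id_diag n)"
    by (rule partition_onI) (auto simp: id_diag_def points_def disjnt_def)
  moreover have "planar n n (id_diag n)"
    unfolding planar_def id_diag_def bpos_def by (auto simp: doubleton_eq_iff)
  moreover have "\<forall>B\<in>id_diag n. card B = 2" by (auto simp: id_diag_def)
  ultimately show ?thesis by (simp add: diagrams_def)
qed

lemma sem_id_diag: "sem (id_diag n) S T \<longleftrightarrow> S \<inter> {..<n} = T \<inter> {..<n}"
  unfolding sem_def saturated_def id_diag_def state_def by auto

section \<open>Reflection of diagrams\<close>

abbreviation flip :: "point \<Rightarrow> point" where
  "flip \<equiv> map_prod (\<lambda>l. 1 - l) id"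

lemma flip_points: "flip ` points n m = points m n"
proof -
  have "flip ` ({0} \<times> A) = {1} \<times> A" "flip ` ({1} \<times> A) = {0} \<times> A" for A by force+
  then show ?thesis unfolding points_def by (auto simp: image_Un)
qed

lemma refl_diag_in [simp]:
  assumes D: "D \<in> diagrams n m" shows "refl_diag D \<in> diagrams m n"
proof -
  have inj: "inj_on flip (points n m)" by (auto simp: inj_on_def points_def)
  have "partition_on (points m n) (refl_diag D)"
    using partition_on_image[OF diagrams_partition[OF D] inj] unfolding flip_points refl_diag_def .
  moreover have "card B = 2" if B: "B \<in> refl_diag D" for B
  proof -
    obtain B' where B': "B' \<in> D" "B = flip ` B'" using B unfolding refl_diag_def by blast
    then have "B' \<subseteq> points n m" using diag_Union[OF D] by blast
    then have "inj_on flip B'" by (rule inj_on_subset[OF inj])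
    then show ?thesis using B' diag_card2[OF D] by (simp add: card_image)
  qed
  moreover have "planar m n (refl_diag D)"
    unfolding planar_cross4
  proof (intro ballI notI)
    fix X Y assume "X \<in> refl_diag D" "Y \<in> refl_diag D" and c: "cross4 (bpos m n) X Y"
    then obtain X' Y' where X: "X' \<in> D" "X = flip ` X'" "Y' \<in> D" "Y = flip ` Y'"
      unfolding refl_diag_def by blast
    have "cross4 (bpos n m) Y' X'"
    proof (rule cross4_image_anti[OF c[unfolded X]])
      fix x y assume "x \<in> X' \<union> Y'" "y \<in> X' \<union> Y'" and lt: "bpos m n (flip x) < bpos m n (flip y)"
      then have "x \<in> points n m" "y \<in> points n m" using X diag_Union[OF D] by auto
      then show "bpos n m y < bpos n m x" using lt by (auto simp: points_def bpos_def)
    qed (use X diag_card2[OF D] in auto)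
    then show False using D X unfolding diagrams_def planar_cross4 by blast
  qed
  ultimately show ?thesis by (simp add: diagrams_def)
qed

lemma sem_refl_diag:
  assumes D: "D \<in> diagrams n m" shows "sem (refl_diag D) S T \<longleftrightarrow> sem D T S"
proof -
  have "flip ` B \<subseteq> state S T \<longleftrightarrow> B \<subseteq> state T S" "flip ` B \<inter> state S T = {} \<longleftrightarrow> B \<inter> state T S = {}"
    if "B \<in> D" for B
  proof -
    have "flip x \<in> state S T \<longleftrightarrow> x \<in> state T S" if x: "x \<in> B" for x
    proof -
      have "x \<in> {0, 1} \<times> UNIV" using diag_layers[OF D] x \<open>B \<in> D\<close> by blast
      then show ?thesis by (auto simp: state_def)
    qed
    note * = this
    show "flip ` B \<subseteq> state S T \<longleftrightarrow> B \<subseteq> state T S" "flip ` B \<inter> state S T = {} \<longleftrightarrow> B \<inter> state T S = {}"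
      using image_preserved[where B = B and f = flip, OF *] by blast+
  qed
  then show ?thesis unfolding sem_def saturated_def refl_diag_def by simp
qed

lemma refl_refl [simp]: "D \<in> diagrams n m \<Longrightarrow> refl_diag (refl_diag D) = D"
  by (rule diag_eqI_sem[of _ n m]) (auto simp: sem_refl_diag[of _ n m] sem_refl_diag[of _ m n])

lemma refl_id [simp]: "refl_diag (id_diag n) = id_diag n"
  by (rule diag_eqI_sem[of _ n n]) (auto simp: sem_refl_diag[of _ n n] sem_id_diag)

lemma refl_cat:
  assumes D: "D \<in> diagrams n m" and E: "E \<in> diagrams m p"
  shows "refl_diag (cat_diag D E) = cat_diag (refl_diag E) (refl_diag D)"
    and "loops (refl_diag E) (refl_diag D) = loops D E"
proof -
  show "refl_diag (cat_diag D E) = cat_diag (refl_diag E) (refl_diag D)"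
  proof (rule diag_eqI_sem[of _ p n])
    note R = refl_diag_in[OF E] refl_diag_in[OF D]
    show "refl_diag (cat_diag D E) \<in> diagrams p n" "cat_diag (refl_diag E) (refl_diag D) \<in> diagrams p n"
      by (rule refl_diag_in[OF cat_diagrams[OF D E]], rule cat_diagrams[OF R])
    show "sem (refl_diag (cat_diag D E)) S T \<longleftrightarrow> sem (cat_diag (refl_diag E) (refl_diag D)) S T" for S T
      unfolding sem_refl_diag[OF cat_diagrams[OF D E]] sem_cat_diag[OF D E] sem_cat_diag[OF R]
        sem_refl_diag[OF D] sem_refl_diag[OF E] by blast
  qed
  show "loops (refl_diag E) (refl_diag D) = loops D E"
    by (rule loops_eqI[of _ p m _ n])
      (use D E card_middle_states[OF D E, of "{}" "{}"] in
        \<open>simp_all add: sem_refl_diag[OF D] sem_refl_diag[OF E] conj_commute\<close>)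
qed

lemma cat_id_left [simp]: "D \<in> diagrams n m \<Longrightarrow> cat_diag (id_diag n) D = D"
proof (rule diag_eqI_sem)
  assume D: "D \<in> diagrams n m"
  show "cat_diag (id_diag n) D \<in> diagrams n m" by (rule cat_diagrams[OF id_diag_in D])
  show "sem (cat_diag (id_diag n) D) S T \<longleftrightarrow> sem D S T" if "S \<subseteq> {..<n}" "T \<subseteq> {..<m}" for S T
    using that by (auto simp: sem_cat_diag[OF id_diag_in D] sem_id_diag Int_absorb2)
qed

lemma cat_id_right [simp]: "D \<in> diagrams n m \<Longrightarrow> cat_diag D (id_diag m) = D"
proof (rule diag_eqI_sem)
  assume D: "D \<in> diagrams n m"
  show "cat_diag D (id_diag m) \<in> diagrams n m" by (rule cat_diagrams[OF D id_diag_in])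
  show "sem (cat_diag D (id_diag m)) S T \<longleftrightarrow> sem D S T" if "S \<subseteq> {..<n}" "T \<subseteq> {..<m}" for S T
    using that by (auto simp: sem_cat_diag[OF D id_diag_in] sem_id_diag Int_absorb2)
qed

lemma loops_id [simp]:
  assumes D: "D \<in> diagrams n m" shows "loops (id_diag n) D = 0" "loops D (id_diag m) = 0"
proof -
  have 1: "{U \<in> Pow {..<n}. sem (id_diag n) {} U \<and> sem D U {}} = {{}}"
    and 2: "{U \<in> Pow {..<m}. sem D {} U \<and> sem (id_diag m) U {}} = {{}}"
    by (auto simp: sem_id_diag)
  show "loops (id_diag n) D = 0"
    by (rule loops_eqI[OF id_diag_in D]) (unfold 1, simp)
  show "loops D (id_diag m) = 0"
    by (rule loops_eqI[OF D id_diag_in]) (unfold 2, simp)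
qed

section \<open>Juxtaposition of diagrams\<close>

abbreviation shift_by :: "nat \<Rightarrow> nat \<Rightarrow> point \<Rightarrow> point" where
  "shift_by n m \<equiv> (\<lambda>(l, i). (l, (if l = 0 then n else m) + i))"

lemma tensor_diag_in [simp]:
  assumes D: "D \<in> diagrams n m" and E: "E \<in> diagrams n' m'"
  shows "tensor_diag n m D E \<in> diagrams (n + n') (m + m')"
proof -
  let ?h = "shift_by n m"
  have inj: "inj ?h" by (auto simp: inj_def split: if_splits)
  have h: "?h ` points n' m' = {0} \<times> {n..<n + n'} \<union> {1} \<times> {m..<m + m'}"
  proof -
    have "?h ` ({0} \<times> A) = {0} \<times> ((+) n ` A)" "?h ` ({1} \<times> A) = {1} \<times> ((+) m ` A)" for A by force+
    then show ?thesis
      by (simp add: points_def image_Un lessThan_atLeast0 image_add_atLeastLessThan add.commute)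
  qed
  have "partition_on (points n m \<union> ?h ` points n' m') (tensor_diag n m D E)"
    unfolding tensor_diag_def
    by (rule partition_on_Un[OF diagrams_partition[OF D] partition_on_image[OF diagrams_partition[OF E]
          inj_on_subset[OF inj subset_UNIV]]]) (unfold h, auto simp: points_def)
  moreover have "points n m \<union> ?h ` points n' m' = points (n + n') (m + m')"
    unfolding h by (auto simp: points_def)
  ultimately have "partition_on (points (n + n') (m + m')) (tensor_diag n m D E)" by simp
  moreover have "card B = 2" if "B \<in> tensor_diag n m D E" for B
    using that diag_card2[OF D] diag_card2[OF E] card_image[OF inj_on_subset[OF inj subset_UNIV]]
    by (auto simp: tensor_diag_def)
  moreover have "planar (n + n') (m + m') (tensor_diag n m D E)"
    unfolding planar_cross4
  proof (intro ballI notI)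
    let ?b = "bpos (n + n') (m + m')"
    fix X Y assume XY: "X \<in> tensor_diag n m D E" "Y \<in> tensor_diag n m D E" and c: "cross4 ?b X Y"
    have eD: "x \<in> points n m" if "X \<in> D" "x \<in> X" for X x using that diag_Union[OF D] by blast
    have eE: "x \<in> points n' m'" if "X \<in> E" "x \<in> X" for X x using that diag_Union[OF E] by blast
    \<comment> \<open>The points of \<open>E\<close> occupy an interval of boundary positions and
      those of \<open>D\<close> lie outside it, so a strand of one cannot cross a strand of the
      other.\<close>
    have inE: "n \<le> ?b (?h x) \<and> ?b (?h x) < n + n' + m'" if "X \<in> E" "x \<in> X" for X x
      using eE[OF that] by (auto simp: points_def bpos_def)
    have outE: "?b x < n \<or> n + n' + m' \<le> ?b x" if "X \<in> D" "x \<in> X" for X x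
      using eD[OF that] by (auto simp: points_def bpos_def)
    consider "X \<in> D" "Y \<in> D" | X' Y' where "X' \<in> E" "Y' \<in> E" "X = ?h ` X'" "Y = ?h ` Y'"
      | Y' where "X \<in> D" "Y' \<in> E" "Y = ?h ` Y'" | X' where "X' \<in> E" "Y \<in> D" "X = ?h ` X'"
      using XY unfolding tensor_diag_def by blast
    then show False
    proof cases
      case 1
      have "cross4 (bpos n m) X Y"
      proof (rule cross4_image[where h = id and g = ?b])
        fix x y assume "x \<in> X \<union> Y" "y \<in> X \<union> Y" and lt: "?b (id x) < ?b (id y)"
        then have "x \<in> points n m" "y \<in> points n m" using 1 eD by blast+
        then show "bpos n m x < bpos n m y" using lt by (auto simp: points_def bpos_def)
      qed (use 1 c diag_card2[OF D] in auto)
      then show False using D 1 unfolding diagrams_def planar_cross4 by blast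
    next
      case 2
      have "cross4 (bpos n' m') X' Y'"
      proof (rule cross4_image[where h = ?h and g = ?b])
        fix x y assume "x \<in> X' \<union> Y'" "y \<in> X' \<union> Y'" and lt: "?b (?h x) < ?b (?h y)"
        then have "x \<in> points n' m'" "y \<in> points n' m'" using 2 eE by blast+
        then show "bpos n' m' x < bpos n' m' y" using lt by (auto simp: points_def bpos_def)
      qed (use 2 c diag_card2[OF E] in auto)
      then show False using E 2 unfolding diagrams_def planar_cross4 by blast
    next
      case 3
      then obtain a b c' d where *: "X = {a, c'}" "Y = {b, d}" "?b a < ?b b" "?b b < ?b c'" "?b c' < ?b d"
        using c unfolding cross4_def by blast
      have "n \<le> ?b b" "?b b < n + n' + m'" "n \<le> ?b d" "?b d < n + n' + m'"
        using 3 * inE by (metis (no_types, lifting) imageE insertCI)+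
      moreover have "?b c' < n \<or> n + n' + m' \<le> ?b c'" using outE 3 * by blast
      ultimately show False using * by linarith
    next
      case 4
      then obtain a b c' d where *: "X = {a, c'}" "Y = {b, d}" "?b a < ?b b" "?b b < ?b c'" "?b c' < ?b d"
        using c unfolding cross4_def by blast
      have "n \<le> ?b a" "?b a < n + n' + m'" "n \<le> ?b c'" "?b c' < n + n' + m'"
        using 4 * inE by (metis (no_types, lifting) imageE insertCI)+
      moreover have "?b b < n \<or> n + n' + m' \<le> ?b b" using outE 4 * by blast
      ultimately show False using * by linarith
    qed
  qed
  ultimately show ?thesis by (simp add: diagrams_def)
qed

lemma sem_tensor_diag:
  assumes D: "D \<in> diagrams n m" and E: "E \<in> diagrams n' m'"
  shows "sem (tensor_diag n m D E) S T \<longleftrightarrow> sem D S T \<and> sem E {i. n + i \<in> S} {i. m + i \<in> T}"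
proof -
  let ?h = "shift_by n m" and ?S = "{i. n + i \<in> S}" and ?T = "{i. m + i \<in> T}"
  have "?h ` B \<subseteq> state S T \<longleftrightarrow> B \<subseteq> state ?S ?T" "?h ` B \<inter> state S T = {} \<longleftrightarrow> B \<inter> state ?S ?T = {}"
    if B: "B \<in> E" for B
  proof -
    have "?h x \<in> state S T \<longleftrightarrow> x \<in> state ?S ?T" if x: "x \<in> B" for x
    proof -
      have "x \<in> {0, 1} \<times> UNIV" using diag_layers[OF E] x B by blast
      then show ?thesis by (auto simp: state_def)
    qed
    note * = this
    show "?h ` B \<subseteq> state S T \<longleftrightarrow> B \<subseteq> state ?S ?T" "?h ` B \<inter> state S T = {} \<longleftrightarrow> B \<inter> state ?S ?T = {}"
      using image_preserved[where B = B and f = ?h, OF *] by blast+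
  qed
  then show ?thesis unfolding sem_def saturated_def tensor_diag_def ball_Un by simp
qed

lemma all_less_add: "(\<forall>i<n + m. P i) \<longleftrightarrow> (\<forall>i<n. P i) \<and> (\<forall>i<m. P (n + i :: nat))"
proof safe
  fix i assume "\<forall>i<n. P i" "\<forall>i<m. P (n + i)" "i < n + m"
  then show "P i" by (cases "i < n") (auto dest!: spec[of _ "i - n"])
qed auto

lemma tensor_id [simp]: "tensor_diag n n (id_diag n) (id_diag m) = id_diag (n + m)"
proof (rule diag_eqI_sem[of _ "n + m" "n + m"])
  fix S T
  have e: "S \<inter> {..<k} = T \<inter> {..<k} \<longleftrightarrow> (\<forall>i<k. i \<in> S \<longleftrightarrow> i \<in> T)" for S T :: "nat set" and k
    by (auto simp: set_eq_iff)
  have "S \<inter> {..<n + m} = T \<inter> {..<n + m} \<longleftrightarrow>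
      (\<forall>i<n. i \<in> S \<longleftrightarrow> i \<in> T) \<and> (\<forall>i<m. n + i \<in> S \<longleftrightarrow> n + i \<in> T)"
    unfolding e by (rule all_less_add)
  then show "sem (tensor_diag n n (id_diag n) (id_diag m)) S T \<longleftrightarrow> sem (id_diag (n + m)) S T"
    unfolding sem_tensor_diag[OF id_diag_in id_diag_in] sem_id_diag e by simp
qed simp_all

lemma refl_tensor:
  assumes "D \<in> diagrams n m" "E \<in> diagrams n' m'"
  shows "refl_diag (tensor_diag n m D E) = tensor_diag m n (refl_diag D) (refl_diag E)"
  using assms by (intro diag_eqI_sem[of _ "m + m'" "n + n'"])
    (auto simp: sem_refl_diag[of _ n m] sem_refl_diag[of _ n' m'] sem_refl_diag[of _ "n + n'" "m + m'"]
      sem_tensor_diag[of _ n m _ n' m'] sem_tensor_diag[of _ m n _ m' n'])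

lemma middle_states_tensor:
  assumes D: "D \<in> diagrams n m" "E \<in> diagrams n' m'" and D': "D' \<in> diagrams m p" "E' \<in> diagrams m' p'"
  shows "bij_betw (\<lambda>U. (U \<inter> {..<m}, {i. m + i \<in> U}))
    {U \<in> Pow {..<m + m'}. sem (tensor_diag n m D E) S U \<and> sem (tensor_diag m p D' E') U T}
    ({U \<in> Pow {..<m}. sem D S U \<and> sem D' U T} \<times>
     {U \<in> Pow {..<m'}. sem E {i. n + i \<in> S} U \<and> sem E' U {i. p + i \<in> T}})"
proof (rule bij_betw_byWitness[where f' = "\<lambda>(U, V). U \<union> (+) m ` V"])
  have r: "sem D S U \<longleftrightarrow> sem D S (U \<inter> {..<m})" "sem D' U T \<longleftrightarrow> sem D' (U \<inter> {..<m}) T" for U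
    using sem_restrict[of D n m S U] sem_restrict[of D n m S "U \<inter> {..<m}"]
      sem_restrict[of D' m p U T] sem_restrict[of D' m p "U \<inter> {..<m}" T] diag_Union[OF D(1)] diag_Union[OF D'(1)]
    by (simp_all add: Int_assoc)
  show "\<forall>U\<in>{U \<in> Pow {..<m + m'}. sem (tensor_diag n m D E) S U \<and> sem (tensor_diag m p D' E') U T}.
    (case (U \<inter> {..<m}, {i. m + i \<in> U}) of (U, V) \<Rightarrow> U \<union> (+) m ` V) = U"
  proof
    fix U
    have "x \<in> U \<inter> {..<m} \<or> x \<in> (+) m ` {i. m + i \<in> U}" if "x \<in> U" for x
      using that by (cases "x < m") (auto simp: image_iff intro!: exI[of _ "x - m"])
    then show "(case (U \<inter> {..<m}, {i. m + i \<in> U}) of (U, V) \<Rightarrow> U \<union> (+) m ` V) = U" by auto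
  qed
  show "(\<lambda>U. (U \<inter> {..<m}, {i. m + i \<in> U})) `
    {U \<in> Pow {..<m + m'}. sem (tensor_diag n m D E) S U \<and> sem (tensor_diag m p D' E') U T}
    \<subseteq> {U \<in> Pow {..<m}. sem D S U \<and> sem D' U T} \<times>
      {U \<in> Pow {..<m'}. sem E {i. n + i \<in> S} U \<and> sem E' U {i. p + i \<in> T}}"
    using r by (auto simp: sem_tensor_diag[OF D] sem_tensor_diag[OF D'])
  have e: "(U \<union> (+) m ` V) \<inter> {..<m} = U" "{i. m + i \<in> U \<union> (+) m ` V} = V" if "U \<subseteq> {..<m}" for U V
    using that by auto
  then show "\<forall>x\<in>{U \<in> Pow {..<m}. sem D S U \<and> sem D' U T} \<times>
      {U \<in> Pow {..<m'}. sem E {i. n + i \<in> S} U \<and> sem E' U {i. p + i \<in> T}}.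
    (\<lambda>U. (U \<inter> {..<m}, {i. m + i \<in> U})) (case x of (U, V) \<Rightarrow> U \<union> (+) m ` V) = x" by auto
  show "(\<lambda>(U, V). U \<union> (+) m ` V) ` ({U \<in> Pow {..<m}. sem D S U \<and> sem D' U T} \<times>
      {U \<in> Pow {..<m'}. sem E {i. n + i \<in> S} U \<and> sem E' U {i. p + i \<in> T}})
    \<subseteq> {U \<in> Pow {..<m + m'}. sem (tensor_diag n m D E) S U \<and> sem (tensor_diag m p D' E') U T}"
  proof safe
    fix U V x assume U: "U \<subseteq> {..<m}" "V \<subseteq> {..<m'}"
      and s: "sem D S U" "sem D' U T" "sem E {i. n + i \<in> S} V" "sem E' V {i. p + i \<in> T}"
    show "sem (tensor_diag n m D E) S (U \<union> (+) m ` V)"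
      unfolding sem_tensor_diag[OF D] e(2)[OF U(1)] using s r(1)[of "U \<union> (+) m ` V"] e(1)[OF U(1)] by simp
    show "sem (tensor_diag m p D' E') (U \<union> (+) m ` V) T"
      unfolding sem_tensor_diag[OF D'] e(2)[OF U(1)] using s r(2)[of "U \<union> (+) m ` V"] e(1)[OF U(1)] by simp
  qed auto
qed

lemma cat_tensor:
  assumes D: "D \<in> diagrams n m" "E \<in> diagrams n' m'" and D': "D' \<in> diagrams m p" "E' \<in> diagrams m' p'"
  shows "cat_diag (tensor_diag n m D E) (tensor_diag m p D' E') = tensor_diag n p (cat_diag D D') (cat_diag E E')"
    and "loops (tensor_diag n m D E) (tensor_diag m p D' E') = loops D D' + loops E E'"
proof -
  note bij = middle_states_tensor[OF D D']
  show "cat_diag (tensor_diag n m D E) (tensor_diag m p D' E') = tensor_diag n p (cat_diag D D') (cat_diag E E')"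
  proof (rule diag_eqI_sem[of _ "n + n'" "p + p'"])
    fix S T
    let ?L = "{U \<in> Pow {..<m + m'}. sem (tensor_diag n m D E) S U \<and> sem (tensor_diag m p D' E') U T}"
    have "?L = {} \<longleftrightarrow>
      {U \<in> Pow {..<m}. sem D S U \<and> sem D' U T} \<times>
        {U \<in> Pow {..<m'}. sem E {i. n + i \<in> S} U \<and> sem E' U {i. p + i \<in> T}} = {}"
      unfolding bij[THEN bij_betw_imp_surj_on, of S T, symmetric] by (simp only: image_is_empty)
    then show "sem (cat_diag (tensor_diag n m D E) (tensor_diag m p D' E')) S T
      \<longleftrightarrow> sem (tensor_diag n p (cat_diag D D') (cat_diag E E')) S T"
      unfolding sem_cat_diag[OF tensor_diag_in[OF D] tensor_diag_in[OF D']]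
        sem_tensor_diag[OF cat_diagrams[OF D(1) D'(1)] cat_diagrams[OF D(2) D'(2)]]
        sem_cat_diag[OF D(1) D'(1)] sem_cat_diag[OF D(2) D'(2)] by auto
  qed (use cat_diagrams[OF tensor_diag_in[OF D] tensor_diag_in[OF D']]
      cat_diagrams[OF D(1) D'(1)] cat_diagrams[OF D(2) D'(2)] in simp_all)
  show "loops (tensor_diag n m D E) (tensor_diag m p D' E') = loops D D' + loops E E'"
  proof (rule loops_eqI[of _ "n + n'" "m + m'" _ "p + p'"])
    show "card {U \<in> Pow {..<m + m'}. sem (tensor_diag n m D E) {} U \<and> sem (tensor_diag m p D' E') U {}}
      = 2 ^ (loops D D' + loops E E')"
      using bij_betw_same_card[OF bij[of "{}" "{}"]] card_middle_states[OF D(1) D'(1), of "{}" "{}"]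
        card_middle_states[OF D(2) D'(2), of "{}" "{}"]
      by (simp add: card_cartesian_product power_add)
  qed (use D D' in simp_all)
qed

subsection \<open>Inserting and contracting simple caps\<close>

abbreviation skip2 :: "nat \<Rightarrow> nat \<Rightarrow> nat" where
  "skip2 i j \<equiv> (if j < i then j else j + 2)"

definition skip2_pt :: "nat \<Rightarrow> point \<Rightarrow> point" where
  "skip2_pt i = (\<lambda>(l, j). (l, if l = 0 then skip2 i j else j))"

text \<open>The explicit form of a concatenation with a simple cap on the left, see
  \<open>cat_cap_diag\<close>. Induction over diagrams removes such caps one at a time.\<close>

definition ins_cap :: "nat \<Rightarrow> diagram \<Rightarrow> diagram" where
  "ins_cap i D = insert {(0, i), (0, i + 1)} ((`) (skip2_pt i) ` D)"

lemma inj_skip2_pt: "inj (skip2_pt i)"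
  by (auto simp: inj_def skip2_pt_def split: if_splits)

lemma skip2_pt_points:
  assumes "i \<le> n"
  shows "skip2_pt i ` points n m = points (n + 2) m - {(0, i), (0, i + 1)}"
proof
  show "skip2_pt i ` points n m \<subseteq> points (n + 2) m - {(0, i), (0, i + 1)}"
    using assms by (auto simp: skip2_pt_def points_def split: if_splits)
  show "points (n + 2) m - {(0, i), (0, i + 1)} \<subseteq> skip2_pt i ` points n m"
  proof
    fix x assume x: "x \<in> points (n + 2) m - {(0, i), (0, i + 1)}"
    then consider j where "x = (0, j)" "j < i" | j where "x = (0, j)" "j \<ge> i + 2" "j < n + 2"
      | j where "x = (1, j)" "j < m"
      unfolding points_def by (cases x) (fastforce simp: not_less)
    then show "x \<in> skip2_pt i ` points n m"
    proof cases
      case (1 j) then show ?thesis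
        using assms by (intro image_eqI[of _ _ "(0, j)"]) (auto simp: skip2_pt_def points_def)
    next
      case (2 j) then show ?thesis
        using assms by (intro image_eqI[of _ _ "(0, j - 2)"]) (auto simp: skip2_pt_def points_def)
    next
      case (3 j) then show ?thesis
        using assms by (intro image_eqI[of _ _ "(1, j)"]) (auto simp: skip2_pt_def points_def)
    qed
  qed
qed

lemma bpos_skip2_pt:
  assumes "x \<in> points n m" "i \<le> n"
  shows "bpos (n + 2) m (skip2_pt i x) = skip2 i (bpos n m x)"
  using assms by (auto simp: points_def bpos_def skip2_pt_def)

lemma skip2_less: "skip2 i j < skip2 i k \<longleftrightarrow> j < k" by auto

lemma ins_cap_partition_iff:
  assumes i: "i \<le> n"
  shows "partition_on (points (n + 2) m) (ins_cap i D) \<longleftrightarrow> partition_on (points n m) D"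
proof -
  let ?B = "{(0, i), (0, i + 1)} :: point set"
  have inj: "inj_on (skip2_pt i) A" for A using inj_skip2_pt inj_on_subset by blast
  have nB: "disjnt ?B (skip2_pt i ` X)" if "X \<in> D" for X
    unfolding disjnt_def skip2_pt_def by (auto split: if_splits)
  then have nB': "disjnt ?B (\<Union>((`) (skip2_pt i) ` D))" by (auto simp: disjnt_def)
  have "partition_on (points (n + 2) m) (ins_cap i D) \<longleftrightarrow>
      partition_on (points (n + 2) m - ?B) ((`) (skip2_pt i) ` D)"
    unfolding ins_cap_def using nB' i by (subst partition_on_insert) (auto simp: points_def)
  also have "\<dots> \<longleftrightarrow> partition_on (skip2_pt i ` points n m) ((`) (skip2_pt i) ` D)"
    by (simp add: skip2_pt_points[OF i])
  also have "\<dots> \<longleftrightarrow> partition_on (points n m) D"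
  proof
    assume "partition_on (points n m) D"
    then show "partition_on (skip2_pt i ` points n m) ((`) (skip2_pt i) ` D)"
      using partition_on_image inj by blast
  next
    assume p: "partition_on (skip2_pt i ` points n m) ((`) (skip2_pt i) ` D)"
    let ?g = "inv (skip2_pt i)"
    have g: "?g ` skip2_pt i ` X = X" for X
      by (simp add: image_image inv_f_f[OF inj_skip2_pt])
    have "inj_on ?g (skip2_pt i ` points n m)"
      by (rule inj_on_inverseI[where g = "skip2_pt i"]) (auto simp: inv_f_f[OF inj_skip2_pt])
    from partition_on_image[OF p this] show "partition_on (points n m) D"
      by (simp add: image_image inv_f_f[OF inj_skip2_pt])
  qed
  finally show ?thesis .
qed

lemma ins_cap_in_iff:
  assumes i: "i \<le> n" and D: "\<Union>D \<subseteq> points n m"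
  shows "ins_cap i D \<in> diagrams (n + 2) m \<longleftrightarrow> D \<in> diagrams n m"
proof -
  let ?B = "{(0, i), (0, i + 1)} :: point set"
  have inj: "inj_on (skip2_pt i) A" for A using inj_skip2_pt inj_on_subset by blast
  have card: "(\<forall>B\<in>ins_cap i D. card B = 2) \<longleftrightarrow> (\<forall>B\<in>D. card B = 2)"
    unfolding ins_cap_def by (auto simp: card_image[OF inj])
  have "planar (n + 2) m (ins_cap i D) \<longleftrightarrow> planar n m D" if c2: "\<forall>B\<in>D. card B = 2"
  proof -
    let ?b = "bpos (n + 2) m"
    have b: "?b (skip2_pt i x) = skip2 i (bpos n m x)" if "X \<in> D" "x \<in> X" for X x
      using that D i bpos_skip2_pt by blast
    have img: "cross4 ?b (skip2_pt i ` X) (skip2_pt i ` Y) \<longleftrightarrow> cross4 (bpos n m) X Y"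
      if XY: "X \<in> D" "Y \<in> D" for X Y
    proof
      assume c: "cross4 ?b (skip2_pt i ` X) (skip2_pt i ` Y)"
      show "cross4 (bpos n m) X Y"
      proof (rule cross4_image[OF c])
        fix x y assume xy: "x \<in> X \<union> Y" "y \<in> X \<union> Y" and lt: "?b (skip2_pt i x) < ?b (skip2_pt i y)"
        have "?b (skip2_pt i x) = skip2 i (bpos n m x)" "?b (skip2_pt i y) = skip2 i (bpos n m y)"
          using xy b[OF XY(1)] b[OF XY(2)] by blast+
        with lt show "bpos n m x < bpos n m y" by (simp only: skip2_less)
      qed (use c2 XY in auto)
    next
      assume "cross4 (bpos n m) X Y"
      then obtain a b' c d where *: "X = {a, c}" "Y = {b', d}" "bpos n m a < bpos n m b'"
        "bpos n m b' < bpos n m c" "bpos n m c < bpos n m d" unfolding cross4_def by blast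
      have "?b (skip2_pt i a) < ?b (skip2_pt i b')" "?b (skip2_pt i b') < ?b (skip2_pt i c)"
        "?b (skip2_pt i c) < ?b (skip2_pt i d)"
        using * b[OF XY(1), of a] b[OF XY(1), of c] b[OF XY(2), of b'] b[OF XY(2), of d]
        by (simp_all add: skip2_less del: if_split)
      then show "cross4 ?b (skip2_pt i ` X) (skip2_pt i ` Y)"
        unfolding cross4_def * by (intro exI[of _ "skip2_pt i a"] exI[of _ "skip2_pt i b'"]
          exI[of _ "skip2_pt i c"] exI[of _ "skip2_pt i d"]) simp
    qed
    \<comment> \<open>A crossing would put a point strictly between the positions i and i +
      1.\<close>
    have "\<not> cross4 ?b ?B Y \<and> \<not> cross4 ?b Y ?B" for Y
      unfolding cross4_def by (auto simp: doubleton_eq_iff bpos_def split: if_splits prod.splits)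
    then show ?thesis unfolding planar_cross4 ins_cap_def using img by auto
  qed
  then show ?thesis using ins_cap_partition_iff[OF i, of m D] card unfolding diagrams_def by auto
qed

lemma ins_cap_in: "D \<in> diagrams n m \<Longrightarrow> i \<le> n \<Longrightarrow> ins_cap i D \<in> diagrams (n + 2) m"
  using ins_cap_in_iff[of i n D m] diag_Union by fastforce

lemma ins_cap_block: "{(0, i), (0, i + 1)} \<in> ins_cap i D" by (simp add: ins_cap_def)

lemma ins_cap_exists:
  assumes E: "E \<in> diagrams (n + 2) m" and B: "{(0, i), (0, i + 1)} \<in> E"
  obtains D where "D \<in> diagrams n m" "E = ins_cap i D" "i \<le> n"
proof -
  let ?B = "{(0, i), (0, i + 1)} :: point set"
  have "?B \<subseteq> points (n + 2) m" using B diag_Union[OF E] by blast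
  then have i: "i \<le> n" by (auto simp: points_def)
  define D where "D = (\<lambda>X. skip2_pt i -` X) ` (E - {?B})"
  have vi: "skip2_pt i ` (skip2_pt i -` X) = X" "skip2_pt i -` X \<subseteq> points n m" if X: "X \<in> E - {?B}" for X
  proof -
    have "X \<inter> ?B = {}" using diag_block_eq[OF E _ B] X by blast
    then have sub: "X \<subseteq> skip2_pt i ` points n m"
      unfolding skip2_pt_points[OF i] using X diag_Union[OF E] by blast
    then show "skip2_pt i ` (skip2_pt i -` X) = X" by blast
    show "skip2_pt i -` X \<subseteq> points n m"
      using sub inj_skip2_pt by (auto simp: inj_def) (metis (no_types, opaque_lifting) imageE inj_def inj_skip2_pt subsetD)
  qed
  have "(`) (skip2_pt i) ` D = E - {?B}" unfolding D_def image_image using vi(1) by simp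
  then have e: "E = ins_cap i D" unfolding ins_cap_def using B by blast
  moreover have "\<Union>D \<subseteq> points n m" unfolding D_def using vi(2) by blast
  ultimately have "D \<in> diagrams n m" using E ins_cap_in_iff[OF i] by blast
  then show ?thesis using that e i by blast
qed

lemma sem_ins_cap:
  assumes D: "D \<in> diagrams n m"
  shows "sem (ins_cap i D) S T \<longleftrightarrow> (i \<in> S \<longleftrightarrow> i + 1 \<in> S) \<and> sem D {j. skip2 i j \<in> S} T"
proof -
  let ?h = "skip2_pt i" and ?S = "{j. skip2 i j \<in> S}"
  have "?h ` B \<subseteq> state S T \<longleftrightarrow> B \<subseteq> state ?S T" "?h ` B \<inter> state S T = {} \<longleftrightarrow> B \<inter> state ?S T = {}"
    if B: "B \<in> D" for B
  proof -
    have "?h x \<in> state S T \<longleftrightarrow> x \<in> state ?S T" if x: "x \<in> B" for x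
    proof -
      have "x \<in> {0, 1} \<times> UNIV" using diag_layers[OF D] x B by blast
      then show ?thesis by (auto simp: state_def skip2_pt_def)
    qed
    note * = this
    show "?h ` B \<subseteq> state S T \<longleftrightarrow> B \<subseteq> state ?S T" "?h ` B \<inter> state S T = {} \<longleftrightarrow> B \<inter> state ?S T = {}"
      using image_preserved[where B = B and f = ?h, OF *] by blast+
  qed
  moreover have "{(0, i), (0, i + 1)} \<subseteq> state S T \<or> {(0, i), (0, i + 1)} \<inter> state S T = {}
      \<longleftrightarrow> (i \<in> S \<longleftrightarrow> i + 1 \<in> S)" by (auto simp: state_def)
  ultimately show ?thesis unfolding sem_def saturated_def ins_cap_def by simp
qed

lemma cap_diag_eq: "i \<le> n \<Longrightarrow> cap_diag (n + 2) i = ins_cap i (id_diag n)"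
proof -
  assume i: "i \<le> n"
  have "id_diag n = (\<lambda>j. {(0, j), (1, j)}) ` ({..<i} \<union> {i..<n})"
    using i by (auto simp: id_diag_def)
  then have "(`) (skip2_pt i) ` id_diag n =
      (\<lambda>j. skip2_pt i ` {(0, j), (1, j)}) ` {..<i} \<union> (\<lambda>j. skip2_pt i ` {(0, j), (1, j)}) ` {i..<n}"
    by (simp only: image_Un image_image)
  also have "(\<lambda>j. skip2_pt i ` {(0, j), (1, j)}) ` {..<i} = (\<lambda>j. {(0, j), (1, j)}) ` {..<i}"
    by (rule image_cong) (auto simp: skip2_pt_def)
  also have "(\<lambda>j. skip2_pt i ` {(0, j), (1, j)}) ` {i..<n} = (\<lambda>j. {(0, j + 2), (1, j)}) ` {i..<n}"
    by (rule image_cong) (auto simp: skip2_pt_def)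
  also have "(\<lambda>j. {(0, j), (1, j)}) ` {..<i} = {{(0, j), (1, j)} | j. j < i}" by blast
  also have "(\<lambda>j. {(0, j + 2), (1, j)}) ` {i..<n} = {{(0, j + 2), (1, j)} | j. i \<le> j \<and> j + 2 < n + 2}"
    unfolding setcompr_eq_image by (rule image_cong) auto
  finally show ?thesis unfolding cap_diag_def ins_cap_def by (simp only: insert_is_Un[symmetric] Un_insert_left Un_empty_left)
qed

lemma cap_diag_in: "i \<le> n \<Longrightarrow> cap_diag (n + 2) i \<in> diagrams (n + 2) n"
  unfolding cap_diag_eq by (rule ins_cap_in[OF id_diag_in])

lemma Int_lessThan_eq_iff: "A \<inter> {..<n} = B \<inter> {..<n} \<longleftrightarrow> (\<forall>j<n. j \<in> A \<longleftrightarrow> (j :: nat) \<in> B)"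
  by blast

lemma sem_cong:
  assumes "D \<in> diagrams n m" "S \<inter> {..<n} = S' \<inter> {..<n}" "T \<inter> {..<m} = T' \<inter> {..<m}"
  shows "sem D S T \<longleftrightarrow> sem D S' T'"
  using sem_restrict[of D n m S T] sem_restrict[of D n m S' T'] diag_Union[OF assms(1)] assms(2,3) by simp

lemma sem_cap_diag:
  "i \<le> n \<Longrightarrow> sem (cap_diag (n + 2) i) S T \<longleftrightarrow>
    (i \<in> S \<longleftrightarrow> i + 1 \<in> S) \<and> {j. skip2 i j \<in> S} \<inter> {..<n} = T \<inter> {..<n}"
  unfolding cap_diag_eq sem_ins_cap[OF id_diag_in] sem_id_diag ..

abbreviation cup_diag :: "nat \<Rightarrow> nat \<Rightarrow> diagram" where
  "cup_diag n i \<equiv> refl_diag (cap_diag n i)"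

lemma cup_diag_in: "i \<le> n \<Longrightarrow> cup_diag (n + 2) i \<in> diagrams n (n + 2)"
  by (rule refl_diag_in[OF cap_diag_in])

lemma sem_cup_diag:
  "i \<le> n \<Longrightarrow> sem (cup_diag (n + 2) i) S T \<longleftrightarrow>
    (i \<in> T \<longleftrightarrow> i + 1 \<in> T) \<and> {j. skip2 i j \<in> T} \<inter> {..<n} = S \<inter> {..<n}"
  unfolding sem_refl_diag[OF cap_diag_in] sem_cap_diag ..

lemma cat_cap_diag:
  assumes i: "i \<le> n" and D: "D \<in> diagrams n m"
  shows "cat_diag (cap_diag (n + 2) i) D = ins_cap i D" and "loops (cap_diag (n + 2) i) D = 0"
proof -
  note C = cap_diag_in[OF i]
  show "cat_diag (cap_diag (n + 2) i) D = ins_cap i D"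
  proof (rule diag_eqI_sem[OF cat_diagrams[OF C D] ins_cap_in[OF D i]])
    fix S T
    let ?V = "{j. skip2 i j \<in> S}"
    have "sem (cat_diag (cap_diag (n + 2) i) D) S T \<longleftrightarrow>
        (\<exists>U\<subseteq>{..<n}. ((i \<in> S \<longleftrightarrow> i + 1 \<in> S) \<and> ?V \<inter> {..<n} = U \<inter> {..<n}) \<and> sem D U T)"
      unfolding sem_cat_diag[OF C D] sem_cap_diag[OF i] ..
    also have "\<dots> \<longleftrightarrow> (i \<in> S \<longleftrightarrow> i + 1 \<in> S) \<and> sem D ?V T"
    proof
      assume "\<exists>U\<subseteq>{..<n}. ((i \<in> S \<longleftrightarrow> i + 1 \<in> S) \<and> ?V \<inter> {..<n} = U \<inter> {..<n}) \<and> sem D U T"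
      then show "(i \<in> S \<longleftrightarrow> i + 1 \<in> S) \<and> sem D ?V T" using sem_cong[OF D] by blast
    next
      assume a: "(i \<in> S \<longleftrightarrow> i + 1 \<in> S) \<and> sem D ?V T"
      have "sem D (?V \<inter> {..<n}) T" using a sem_cong[OF D, of "?V \<inter> {..<n}" ?V T T] by simp
      then show "\<exists>U\<subseteq>{..<n}. ((i \<in> S \<longleftrightarrow> i + 1 \<in> S) \<and> ?V \<inter> {..<n} = U \<inter> {..<n}) \<and> sem D U T"
        using a by (intro exI[of _ "?V \<inter> {..<n}"]) simp
    qed
    finally show "sem (cat_diag (cap_diag (n + 2) i) D) S T \<longleftrightarrow> sem (ins_cap i D) S T"
      unfolding sem_ins_cap[OF D] .
  qed
  have "{U \<in> Pow {..<n}. sem (cap_diag (n + 2) i) {} U \<and> sem D U {}} = {{}}"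
    unfolding sem_cap_diag[OF i] by auto
  then show "loops (cap_diag (n + 2) i) D = 0"
    by (intro loops_eqI[OF C D]) simp
qed

text \<open>The cup closes the inserted cap to a single loop. Its two colourings are the only middle
  states over empty outer states, namely \<open>{}\<close> and \<open>{i, i + 1}\<close>.\<close>

lemma cat_cup_ins_cap:
  assumes i: "i \<le> n" and D: "D \<in> diagrams n m"
  shows "cat_diag (cup_diag (n + 2) i) (ins_cap i D) = D" and "loops (cup_diag (n + 2) i) (ins_cap i D) = 1"
proof -
  note C = cup_diag_in[OF i] and I = ins_cap_in[OF D i]
  show "cat_diag (cup_diag (n + 2) i) (ins_cap i D) = D"
  proof (rule diag_eqI_sem[OF cat_diagrams[OF C I] D])
    fix S T :: "nat set" assume S: "S \<subseteq> {..<n}"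
    show "sem (cat_diag (cup_diag (n + 2) i) (ins_cap i D)) S T \<longleftrightarrow> sem D S T"
      unfolding sem_cat_diag[OF C I] sem_cup_diag[OF i] sem_ins_cap[OF D]
    proof
      assume "\<exists>U\<subseteq>{..<n + 2}. ((i \<in> U \<longleftrightarrow> i + 1 \<in> U) \<and> {j. skip2 i j \<in> U} \<inter> {..<n} = S \<inter> {..<n}) \<and>
          (i \<in> U \<longleftrightarrow> i + 1 \<in> U) \<and> sem D {j. skip2 i j \<in> U} T"
      then show "sem D S T" using sem_cong[OF D] by blast
    next
      assume s: "sem D S T"
      let ?U = "skip2 i ` S"
      have e: "{j. skip2 i j \<in> ?U} = S" by (auto simp: image_iff split: if_splits)
      have "?U \<subseteq> {..<n + 2}" "i \<notin> ?U" "i + 1 \<notin> ?U" using S by (auto simp: image_iff split: if_splits)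
      then show "\<exists>U\<subseteq>{..<n + 2}. ((i \<in> U \<longleftrightarrow> i + 1 \<in> U) \<and> {j. skip2 i j \<in> U} \<inter> {..<n} = S \<inter> {..<n}) \<and>
          (i \<in> U \<longleftrightarrow> i + 1 \<in> U) \<and> sem D {j. skip2 i j \<in> U} T"
        using s e by (intro exI[of _ ?U]) simp
    qed
  qed
  have "{U \<in> Pow {..<n + 2}. sem (cup_diag (n + 2) i) {} U \<and> sem (ins_cap i D) U {}} = {{}, {i, i + 1}}"
    (is "?L = _")
  proof
    show "?L \<subseteq> {{}, {i, i + 1}}"
    proof
      fix U assume U: "U \<in> ?L"
      then have *: "i \<in> U \<longleftrightarrow> i + 1 \<in> U" "\<And>j. j < n \<Longrightarrow> skip2 i j \<notin> U" "U \<subseteq> {..<n + 2}"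
        unfolding sem_cup_diag[OF i] by auto
      have "k = i \<or> k = i + 1" if "k \<in> U" for k
      proof (rule ccontr)
        assume "\<not> (k = i \<or> k = i + 1)"
        then have "skip2 i (if k < i then k else k - 2) = k" "(if k < i then k else k - 2) < n"
          using that *(3) i by auto
        then show False using *(2) that by metis
      qed
      then show "U \<in> {{}, {i, i + 1}}" using *(1) by auto
    qed
    have "{j. skip2 i j \<in> {i, i + 1}} = {}" by auto
    then show "{{}, {i, i + 1}} \<subseteq> ?L"
      using i unfolding sem_cup_diag[OF i] sem_ins_cap[OF D] by auto
  qed
  then have "card {U \<in> Pow {..<n + 2}. sem (cup_diag (n + 2) i) {} U \<and> sem (ins_cap i D) U {}} = 2 ^ 1"
    by simp
  then show "loops (cup_diag (n + 2) i) (ins_cap i D) = 1" by (rule loops_eqI[OF C I])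
qed

text \<open>What joining does to two strands: the ends u and v are paired off, and so are the
  remaining ends x and y. With u and v the sources i and i + 1, the new partition has the shape
  \<open>ins_cap\<close> of the joined diagram.\<close>

lemma partition_on_exchange:
  assumes P: "partition_on A P" and X: "{x, u} \<in> P" and Y: "{y, v} \<in> P" and ne: "{x, u} \<noteq> {y, v}" "x \<noteq> u" "y \<noteq> v"
  shows "partition_on A (insert {u, v} (insert {x, y} (P - {{x, u}, {y, v}})))"
proof -
  have disj: "B \<inter> C = {}" if "B \<in> P" "C \<in> P" "B \<noteq> C" for B C
    using that P unfolding partition_on_def disjoint_def by blast
  have d: "{x, u} \<inter> {y, v} = {}" using disj[OF X Y ne(1)] .
  obtain R where R: "R = P - {{x, u}, {y, v}}" by blast
  have "x \<notin> B \<and> y \<notin> B \<and> u \<notin> B \<and> v \<notin> B" if "B \<in> R" for B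
    using disj[OF X, of B] disj[OF Y, of B] that R by auto
  then have other: "disjnt B {x, y}" "disjnt B {u, v}" "disjnt {x, y} B" "disjnt {u, v} B" if "B \<in> R" for B
    unfolding disjnt_def using that by blast+
  have RR: "disjnt p q" if "p \<in> R" "q \<in> R" "p \<noteq> q" for p q
    unfolding disjnt_def using disj that R by blast
  have uv: "disjnt {u, v} {x, y}" "disjnt {x, y} {u, v}" unfolding disjnt_def using d ne by auto
  have "partition_on A (insert {u, v} (insert {x, y} R))"
  proof (rule partition_onI)
    have "\<Union>P = {x, u} \<union> {y, v} \<union> \<Union>R" using X Y R by blast
    then show "\<Union>(insert {u, v} (insert {x, y} R)) = A" using P unfolding partition_on_def by auto
    show "{} \<notin> insert {u, v} (insert {x, y} R)" using P R unfolding partition_on_def by auto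
    fix p q assume "p \<in> insert {u, v} (insert {x, y} R)" "q \<in> insert {u, v} (insert {x, y} R)" "p \<noteq> q"
    then show "disjnt p q" by (elim insertE; simp only: uv other RR simp_thms; metis uv other RR)
  qed
  then show ?thesis unfolding R .
qed

text \<open>The cup meets two different strands, whose other ends are \<open>x\<close> and \<open>y\<close>.\<close>

lemma cat_cup_join:
  assumes i: "i \<le> n" and D: "D \<in> diagrams (n + 2) m"
    and D0: "D = insert {skip2_pt i x, (0, i)} (insert {skip2_pt i y, (0, i + 1)} ((`) (skip2_pt i) ` D0))"
    and xy: "{skip2_pt i x, (0, i)} \<notin> (`) (skip2_pt i) ` D0" "{skip2_pt i y, (0, i + 1)} \<notin> (`) (skip2_pt i) ` D0"
  shows "cat_diag (cup_diag (n + 2) i) D = insert {x, y} D0" and "loops (cup_diag (n + 2) i) D = 0"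
proof -
  note C = cup_diag_in[OF i]
  let ?h = "skip2_pt i"
  have hi: "?h z \<noteq> (0, i)" "?h z \<noteq> (0, i + 1)" for z
    by (auto simp: skip2_pt_def split: prod.splits if_splits)
  have part: "partition_on (points n m) (insert {x, y} D0)"
  proof -
    have "partition_on (points (n + 2) m) (insert {(0, i), (0, i + 1)} (insert {?h x, ?h y}
        (D - {{?h x, (0, i)}, {?h y, (0, i + 1)}})))"
      by (rule partition_on_exchange[OF diagrams_partition[OF D]])
        (use D0 hi in \<open>auto simp: doubleton_eq_iff\<close>)
    also have "D - {{?h x, (0, i)}, {?h y, (0, i + 1)}} = (`) ?h ` D0"
      unfolding D0 using xy by blast
    finally have "partition_on (points (n + 2) m) (ins_cap i (insert {x, y} D0))"
      unfolding ins_cap_def by simp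
    then show ?thesis using ins_cap_partition_iff[OF i] by blast
  qed
  have lay: "z \<in> {0, 1} \<times> UNIV" if "z \<in> \<Union>(insert {x, y} D0)" for z
  proof -
    have "z \<in> points n m" using that unfolding partition_onD1[OF part] .
    then show ?thesis by (auto simp: points_def)
  qed
  have hs: "?h z \<in> state U T \<longleftrightarrow> z \<in> state {j. skip2 i j \<in> U} T" if "z \<in> \<Union>(insert {x, y} D0)" for z U T
    using lay[OF that] by (auto simp: state_def skip2_pt_def)
  have sD: "sem D U T \<longleftrightarrow> (i \<in> U \<longleftrightarrow> x \<in> state {j. skip2 i j \<in> U} T) \<and>
      (i + 1 \<in> U \<longleftrightarrow> y \<in> state {j. skip2 i j \<in> U} T) \<and> sem D0 {j. skip2 i j \<in> U} T" for U T
  proof -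
    let ?V = "{j. skip2 i j \<in> U}"
    have "?h ` B \<subseteq> state U T \<longleftrightarrow> B \<subseteq> state ?V T" "?h ` B \<inter> state U T = {} \<longleftrightarrow> B \<inter> state ?V T = {}"
      if B: "B \<in> D0" for B
    proof -
      have "?h z \<in> state U T \<longleftrightarrow> z \<in> state ?V T" if "z \<in> B" for z using hs that B by blast
      note * = this
      show "?h ` B \<subseteq> state U T \<longleftrightarrow> B \<subseteq> state ?V T" "?h ` B \<inter> state U T = {} \<longleftrightarrow> B \<inter> state ?V T = {}"
        using image_preserved[where B = B and f = ?h, OF *] by blast+
    qed
    then have "sem D U T \<longleftrightarrow> ({?h x, (0, i)} \<subseteq> state U T \<or> {?h x, (0, i)} \<inter> state U T = {}) \<and>
        ({?h y, (0, i + 1)} \<subseteq> state U T \<or> {?h y, (0, i + 1)} \<inter> state U T = {}) \<and> sem D0 ?V T"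
      unfolding D0 sem_def saturated_def by simp
    moreover have "?h x \<in> state U T \<longleftrightarrow> x \<in> state ?V T" "?h y \<in> state U T \<longleftrightarrow> y \<in> state ?V T"
      using hs by blast+
    moreover have "(0, k) \<in> state U T \<longleftrightarrow> k \<in> U" for k by (simp add: state_def)
    ultimately show ?thesis by auto
  qed
  have sC: "sem (insert {x, y} D0) S T \<longleftrightarrow> (x \<in> state S T \<longleftrightarrow> y \<in> state S T) \<and> sem D0 S T" for S T
    unfolding sem_def saturated_def by auto
  have res: "sem (insert {x, y} D0) (S \<inter> {..<n}) T \<longleftrightarrow> sem (insert {x, y} D0) S T" for S T
    using sem_restrict[of "insert {x, y} D0" n m "S \<inter> {..<n}" T] sem_restrict[of "insert {x, y} D0" n m S T]
      partition_onD1[OF part] by simp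
  show "cat_diag (cup_diag (n + 2) i) D = insert {x, y} D0"
  proof (rule diag_eqI[OF diagrams_partition[OF cat_diagrams[OF C D]] part])
    fix S T :: "nat set" assume S: "S \<subseteq> {..<n}"
    show "sem (cat_diag (cup_diag (n + 2) i) D) S T \<longleftrightarrow> sem (insert {x, y} D0) S T"
      unfolding sem_cat_diag[OF C D] sem_cup_diag[OF i]
    proof
      assume "\<exists>U\<subseteq>{..<n + 2}. ((i \<in> U \<longleftrightarrow> i + 1 \<in> U) \<and> {j. skip2 i j \<in> U} \<inter> {..<n} = S \<inter> {..<n}) \<and> sem D U T"
      then obtain U where U: "i \<in> U \<longleftrightarrow> i + 1 \<in> U" "{j. skip2 i j \<in> U} \<inter> {..<n} = S \<inter> {..<n}" "sem D U T"
        by blast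
      have "sem (insert {x, y} D0) {j. skip2 i j \<in> U} T" using U sD sC by blast
      then show "sem (insert {x, y} D0) S T"
        using res[of "{j. skip2 i j \<in> U}" T] res[of S T] unfolding U(2) by simp
    next
      assume s: "sem (insert {x, y} D0) S T"
      \<comment> \<open>The two points of the cup take the common colour of x and y.\<close>
      let ?U = "skip2 i ` S \<union> (if x \<in> state S T then {i, i + 1} else {})"
      have e: "{j. skip2 i j \<in> ?U} = S" by (auto simp: image_iff split: if_splits)
      have "?U \<subseteq> {..<n + 2}" "i \<in> ?U \<longleftrightarrow> x \<in> state S T" "i + 1 \<in> ?U \<longleftrightarrow> x \<in> state S T"
        using S i by (auto simp: image_iff split: if_splits)
      then show "\<exists>U\<subseteq>{..<n + 2}. ((i \<in> U \<longleftrightarrow> i + 1 \<in> U) \<and> {j. skip2 i j \<in> U} \<inter> {..<n} = S \<inter> {..<n}) \<and> sem D U T"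
        using s e sD[of ?U T] unfolding sC by (intro exI[of _ ?U]) simp
    qed
  qed
  have "{U \<in> Pow {..<n + 2}. sem (cup_diag (n + 2) i) {} U \<and> sem D U {}} = {{}}"
  proof -
    have "U = {}" if "U \<in> Pow {..<n + 2}" "sem (cup_diag (n + 2) i) {} U" "sem D U {}" for U
    proof -
      have *: "i \<in> U \<longleftrightarrow> i + 1 \<in> U" "\<And>j. j < n \<Longrightarrow> skip2 i j \<notin> U" "U \<subseteq> {..<n + 2}"
        using that unfolding sem_cup_diag[OF i] by auto
      have k: "k = i \<or> k = i + 1" if "k \<in> U" for k
      proof (rule ccontr)
        assume "\<not> (k = i \<or> k = i + 1)"
        then have "skip2 i (if k < i then k else k - 2) = k" "(if k < i then k else k - 2) < n"
          using that *(3) i by auto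
        then show False using *(2) that by metis
      qed
      then have "{j. skip2 i j \<in> U} = {}" by (auto dest!: k split: if_splits)
      then have "i \<notin> U" using that(3) unfolding sD by (simp add: state_def)
      then show ?thesis using k *(1) by blast
    qed
    then show ?thesis by auto
  qed
  then show "loops (cup_diag (n + 2) i) D = 0"
    by (intro loops_eqI[OF C D]) simp
qed

text \<open>The straightening relations. There is no loop because empty outer states force every
  middle point out of the state; the second pair follows from the first by reflection.\<close>

lemma zigzag:
  assumes i: "i < n"
  shows "cat_diag (cup_diag (n + 2) i) (cap_diag (n + 2) (Suc i)) = id_diag n"
    and "loops (cup_diag (n + 2) i) (cap_diag (n + 2) (Suc i)) = 0"
    and "cat_diag (cup_diag (n + 2) (Suc i)) (cap_diag (n + 2) i) = id_diag n"
    and "loops (cup_diag (n + 2) (Suc i)) (cap_diag (n + 2) i) = 0"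
proof -
  have i1: "i \<le> n" "Suc i \<le> n" using i by auto
  note C = cap_diag_in[OF i1(1)] cap_diag_in[OF i1(2)]
  note R = cup_diag_in[OF i1(1)] cup_diag_in[OF i1(2)]
  have semi: "{j. skip2 k j \<in> U} \<inter> {..<n} = S \<inter> {..<n} \<longleftrightarrow> (\<forall>j<n. skip2 k j \<in> U \<longleftrightarrow> j \<in> S)" for k U S
    unfolding Int_lessThan_eq_iff mem_Collect_eq ..
  show 1: "cat_diag (cup_diag (n + 2) i) (cap_diag (n + 2) (Suc i)) = id_diag n"
  proof (rule diag_eqI_sem[OF cat_diagrams[OF R(1) C(2)] id_diag_in])
    fix S T :: "nat set" assume S: "S \<subseteq> {..<n}" "T \<subseteq> {..<n}"
    show "sem (cat_diag (cup_diag (n + 2) i) (cap_diag (n + 2) (Suc i))) S T \<longleftrightarrow> sem (id_diag n) S T"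
      unfolding sem_cat_diag[OF R(1) C(2)] sem_cup_diag[OF i1(1)] sem_cap_diag[OF i1(2)] semi sem_id_diag
    proof
      assume "\<exists>U\<subseteq>{..<n + 2}. ((i \<in> U \<longleftrightarrow> i + 1 \<in> U) \<and> (\<forall>j<n. skip2 i j \<in> U \<longleftrightarrow> j \<in> S)) \<and>
        (Suc i \<in> U \<longleftrightarrow> Suc i + 1 \<in> U) \<and> (\<forall>j<n. skip2 (Suc i) j \<in> U \<longleftrightarrow> j \<in> T)"
      then obtain U where U: "i \<in> U \<longleftrightarrow> i + 1 \<in> U" "\<And>j. j < n \<Longrightarrow> skip2 i j \<in> U \<longleftrightarrow> j \<in> S"
        "Suc i \<in> U \<longleftrightarrow> Suc i + 1 \<in> U" "\<And>j. j < n \<Longrightarrow> skip2 (Suc i) j \<in> U \<longleftrightarrow> j \<in> T" by blast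
      have "j \<in> S \<longleftrightarrow> j \<in> T" if "j < n" for j
        using U(2)[OF that] U(4)[OF that] U(1,3)
        by (cases "j < i"; cases "j = i") auto
      then show "S \<inter> {..<n} = T \<inter> {..<n}" by blast
    next
      assume "S \<inter> {..<n} = T \<inter> {..<n}"
      then have "S = T" using S by blast
      \<comment> \<open>The strand of i runs through the middle points i, i + 1 and i + 2, which all
        get its colour; later strands are shifted by two.\<close>
      let ?U = "{k. k < n + 2 \<and> (if k \<le> i then k else if k \<le> i + 2 then i else k - 2) \<in> S}"
      have u: "?U \<subseteq> {..<n + 2}" "(i \<in> ?U \<longleftrightarrow> i + 1 \<in> ?U)" "(\<forall>j<n. skip2 i j \<in> ?U \<longleftrightarrow> j \<in> S)"
        "(Suc i \<in> ?U \<longleftrightarrow> Suc i + 1 \<in> ?U)" "(\<forall>j<n. skip2 (Suc i) j \<in> ?U \<longleftrightarrow> j \<in> S)"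
        using i by (auto simp: le_Suc_eq not_less_eq)
      show "\<exists>U\<subseteq>{..<n + 2}. ((i \<in> U \<longleftrightarrow> i + 1 \<in> U) \<and> (\<forall>j<n. skip2 i j \<in> U \<longleftrightarrow> j \<in> S)) \<and>
        (Suc i \<in> U \<longleftrightarrow> Suc i + 1 \<in> U) \<and> (\<forall>j<n. skip2 (Suc i) j \<in> U \<longleftrightarrow> j \<in> T)"
        unfolding \<open>S = T\<close>[symmetric] by (intro exI[of _ ?U] conjI u)
    qed
  qed
  show 2: "loops (cup_diag (n + 2) i) (cap_diag (n + 2) (Suc i)) = 0"
  proof (rule loops_eqI[OF R(1) C(2)])
    have "U = {}" if "U \<subseteq> {..<n + 2}" "i \<in> U \<longleftrightarrow> i + 1 \<in> U" "\<forall>j<n. skip2 i j \<notin> U"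
      "Suc i \<in> U \<longleftrightarrow> Suc i + 1 \<in> U" "\<forall>j<n. skip2 (Suc i) j \<notin> U" for U
    proof -
      have "k \<notin> U" for k
      proof (cases "k < n + 2")
        case True
        consider "k \<le> i" | "k = i + 1" | "k \<ge> i + 2" by linarith
        then show ?thesis
        proof cases
          case 1 then show ?thesis using that(5)[rule_format, of k] i by simp
        next
          case 2
          have "i \<notin> U" using that(5)[rule_format, of i] i by simp
          then show ?thesis using 2 that(2) by simp
        next
          case 3
          then have e: "skip2 i (k - 2) = k" and "k - 2 < n" using True by auto
          then have "skip2 i (k - 2) \<notin> U" using that(3) by blast
          then show ?thesis unfolding e .
        qed
      qed (use that in auto)
      then show ?thesis by blast
    qed
    note emp = this
    have "U = {}" if "U \<in> Pow {..<n + 2}" "sem (cup_diag (n + 2) i) {} U" "sem (cap_diag (n + 2) (Suc i)) U {}" for U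
      using that unfolding sem_cup_diag[OF i1(1)] sem_cap_diag[OF i1(2)] semi
      by (intro emp[of U]) simp_all
    then have "{U \<in> Pow {..<n + 2}. sem (cup_diag (n + 2) i) {} U \<and> sem (cap_diag (n + 2) (Suc i)) U {}} = {{}}"
      by auto
    then show "card {U \<in> Pow {..<n + 2}. sem (cup_diag (n + 2) i) {} U \<and> sem (cap_diag (n + 2) (Suc i)) U {}} = 2 ^ 0"
      by simp
  qed
  have "cat_diag (cup_diag (n + 2) (Suc i)) (cap_diag (n + 2) i) =
      refl_diag (cat_diag (cup_diag (n + 2) i) (cap_diag (n + 2) (Suc i)))"
    unfolding refl_cat(1)[OF R(1) C(2)] refl_refl[OF C(1)] ..
  then show "cat_diag (cup_diag (n + 2) (Suc i)) (cap_diag (n + 2) i) = id_diag n" unfolding 1 by simp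
  show "loops (cup_diag (n + 2) (Suc i)) (cap_diag (n + 2) i) = 0"
    using refl_cat(2)[OF R(1) C(2)] unfolding refl_refl[OF C(1)] 2 .
qed

lemma cap_diag_tensor_left:
  assumes i: "i \<le> a"
  shows "cap_diag (a + 2 + b) i = tensor_diag (a + 2) a (cap_diag (a + 2) i) (id_diag b)"
proof -
  have i': "i \<le> a + b" using i by simp
  have e: "a + 2 + b = a + b + 2" by simp
  show ?thesis
  proof (rule diag_eqI_sem[of _ "a + b + 2" "a + b"])
    show "cap_diag (a + 2 + b) i \<in> diagrams (a + b + 2) (a + b)" unfolding e by (rule cap_diag_in[OF i'])
    show "tensor_diag (a + 2) a (cap_diag (a + 2) i) (id_diag b) \<in> diagrams (a + b + 2) (a + b)"
      using tensor_diag_in[OF cap_diag_in[OF i] id_diag_in[of b]] unfolding e .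
    show "sem (cap_diag (a + 2 + b) i) S T \<longleftrightarrow> sem (tensor_diag (a + 2) a (cap_diag (a + 2) i) (id_diag b)) S T"
      for S T
      unfolding e sem_tensor_diag[OF cap_diag_in[OF i] id_diag_in] sem_cap_diag[OF i] sem_cap_diag[OF i'] sem_id_diag
        Int_lessThan_eq_iff mem_Collect_eq all_less_add[of a b] using i by (auto simp: add.commute add.left_commute)
  qed
qed

lemma cap_diag_tensor_right:
  assumes i: "i \<le> b"
  shows "cap_diag (a + (b + 2)) (a + i) = tensor_diag a a (id_diag a) (cap_diag (b + 2) i)"
proof -
  have i': "a + i \<le> a + b" using i by simp
  have e: "a + (b + 2) = a + b + 2" by simp
  show ?thesis
  proof (rule diag_eqI_sem[of _ "a + b + 2" "a + b"])
    show "cap_diag (a + (b + 2)) (a + i) \<in> diagrams (a + b + 2) (a + b)" unfolding e by (rule cap_diag_in[OF i'])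
    show "tensor_diag a a (id_diag a) (cap_diag (b + 2) i) \<in> diagrams (a + b + 2) (a + b)"
      using tensor_diag_in[OF id_diag_in[of a] cap_diag_in[OF i]] unfolding e .
    show "sem (cap_diag (a + (b + 2)) (a + i)) S T \<longleftrightarrow> sem (tensor_diag a a (id_diag a) (cap_diag (b + 2) i)) S T"
      for S T
      unfolding e sem_tensor_diag[OF id_diag_in cap_diag_in[OF i]] sem_cap_diag[OF i] sem_cap_diag[OF i'] sem_id_diag
        Int_lessThan_eq_iff mem_Collect_eq all_less_add[of a b] by (auto simp: add.assoc)
  qed
qed

subsection \<open>The structure of diagrams\<close>

text \<open>A strand between two sources does not reach the middle layer, so it is a component of
  the glued figure by itself. This is how caps off the middle are seen to persist in
  products.\<close>

lemma cat_source_block: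
  assumes D: "D \<in> diagrams n m" and E: "E \<in> diagrams m p" and B: "{(0, i), (0, j)} \<in> D"
  shows "{(0, i), (0, j)} \<in> cat_diag D E"
proof -
  let ?B = "{(0, i), (0, j)} :: point set"
  have BG: "?B \<in> glue D E" using B by (simp add: glue_def)
  have "saturated (glue D E) ?B"
    unfolding saturated_def glue_def
  proof
    fix X assume "X \<in> D \<union> (`) next_layer ` E"
    then show "X \<subseteq> ?B \<or> X \<inter> ?B = {}"
    proof
      assume "X \<in> D" then show ?thesis using diag_block_eq[OF D B] by blast
    next
      assume "X \<in> (`) next_layer ` E"
      then have "X \<inter> ?B = {}" by auto
      then show ?thesis ..
    qed
  qed
  then have sat: "saturated (components (glue D E)) ?B" by (simp add: saturated_components)
  have "(0, i) \<in> \<Union>(components (glue D E))"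
    using BG components_partition[of "glue D E"] unfolding partition_on_def by blast
  then obtain C where C: "C \<in> components (glue D E)" "(0, i) \<in> C" by blast
  have "C \<subseteq> ?B" using sat C unfolding saturated_def by blast
  moreover have "?B \<subseteq> C" by (rule component_block[OF C(1) BG _ C(2)]) simp
  ultimately have "C = ?B" by blast
  moreover have e: "outer ?B = ?B" by (auto simp: outer_def)
  ultimately have "forget_layer ` ?B \<in> cat_diag D E" unfolding cat_diag_def using C
    by (intro CollectI exI[of _ ?B] conjI) (simp_all only: e, simp)
  then show ?thesis by simp
qed

lemma flip_block_iff:
  assumes D: "D \<in> diagrams n m"
  shows "{(1, i), (1, j)} \<in> refl_diag D \<longleftrightarrow> {(0, i), (0, j)} \<in> D"
    and "{(0, i), (0, j)} \<in> refl_diag D \<longleftrightarrow> {(1, i), (1, j)} \<in> D"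
proof -
  have 1: "{(1, i), (1, j)} \<in> refl_diag D" if "{(0, i), (0, j)} \<in> D" for D
    unfolding refl_diag_def using that by (intro image_eqI[where x = "{(0, i), (0, j)}"]) auto
  have 2: "{(0, i), (0, j)} \<in> refl_diag D" if "{(1, i), (1, j)} \<in> D" for D
    unfolding refl_diag_def using that by (intro image_eqI[where x = "{(1, i), (1, j)}"]) auto
  show "{(1, i), (1, j)} \<in> refl_diag D \<longleftrightarrow> {(0, i), (0, j)} \<in> D"
    using 1 2[of "refl_diag D"] refl_refl[OF D] by auto
  show "{(0, i), (0, j)} \<in> refl_diag D \<longleftrightarrow> {(1, i), (1, j)} \<in> D"
    using 2 1[of "refl_diag D"] refl_refl[OF D] by auto
qed

lemma cat_target_block:
  assumes D: "D \<in> diagrams n m" and E: "E \<in> diagrams m p" and B: "{(1, i), (1, j)} \<in> E"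
  shows "{(1, i), (1, j)} \<in> cat_diag D E"
proof -
  have "{(0, i), (0, j)} \<in> cat_diag (refl_diag E) (refl_diag D)"
    using cat_source_block[OF refl_diag_in[OF E] refl_diag_in[OF D]] B flip_block_iff(2)[OF E] by blast
  then show ?thesis
    unfolding refl_cat(1)[OF D E, symmetric] flip_block_iff(2)[OF cat_diagrams[OF D E]] .
qed

lemma bpos_source [simp]: "bpos n m (0, i) = i"
  by (simp add: bpos_def)

lemma bpos_source_iff: "x \<in> points n m \<Longrightarrow> bpos n m x < n \<longleftrightarrow> (\<exists>i<n. x = (0, i))"
  by (auto simp: points_def bpos_def)

text \<open>An innermost cap is simple. If j is not i + 1, planarity confines the strand of the
  source i + 1 to the positions between i and j, which gives a shorter cap.\<close>

lemma simple_cap_exists: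
  assumes D: "D \<in> diagrams n m"
  shows "{(0, i), (0, j)} \<in> D \<Longrightarrow> i < j \<Longrightarrow> \<exists>k. i \<le> k \<and> k < j \<and> {(0, k), (0, k + 1)} \<in> D"
proof (induction "j - i" arbitrary: i j rule: less_induct)
  case less
  show ?case
  proof (cases "j = i + 1")
    case True then show ?thesis using less by auto
  next
    case False
    have in_pts: "(0, i) \<in> points n m" "(0, j) \<in> points n m" using less.prems diag_Union[OF D] by blast+
    then have j: "j < n" by (auto simp: points_def)
    then have "(0, i + 1) \<in> points n m" using less.prems by (auto simp: points_def)
    then obtain y where y: "{(0, i + 1), y} \<in> D" "y \<in> points n m" "(0, i + 1) \<noteq> y" by (rule diag_blockE[OF D])
    have ne: "y \<noteq> (0, i)" "y \<noteq> (0, j)"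
    proof -
      have "{(0, i + 1), y} \<noteq> {(0, i), (0, j)}" using False by (auto simp: doubleton_eq_iff)
      then show "y \<noteq> (0, i)" "y \<noteq> (0, j)"
        using diag_block_eq[OF D y(1) less.prems(1), of y] by auto
    qed
    have pl: "\<not> (bpos n m a < bpos n m b \<and> bpos n m b < bpos n m c \<and> bpos n m c < bpos n m d)"
      if "{a, c} \<in> D" "{b, d} \<in> D" for a b c d using that D unfolding diagrams_def planar_def by blast
    have "\<not> bpos n m y < i"
      using pl[of y "(0, i + 1)" "(0, i)" "(0, j)"] y(1) less.prems False by (auto simp: insert_commute)
    moreover have "\<not> j < bpos n m y"
      using pl[OF less.prems(1) y(1)] less.prems False by auto
    moreover have "bpos n m y \<noteq> i" "bpos n m y \<noteq> j"
      using ne bpos_inj[of n m] y(2) in_pts by (metis bpos_source inj_on_def)+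
    ultimately have b: "i < bpos n m y" "bpos n m y < j" by auto
    then obtain l where l: "y = (0, l)" using bpos_source_iff[OF y(2)] j by auto
    then have "i + 1 < l" "l < j" using b y(3) by auto
    then have "\<exists>k\<ge>i + 1. k < l \<and> {(0, k), (0, k + 1)} \<in> D"
      using less.hyps[of l "i + 1"] y(1) l by auto
    then show ?thesis using \<open>l < j\<close> by (meson add_leD1 order.strict_trans)
  qed
qed

text \<open>Without caps every source is joined to a target, and this assignment is injective; for n
  = m it is therefore onto.\<close>

lemma no_cap_through:
  assumes D: "D \<in> diagrams n m" and nc: "\<And>i j. {(0, i), (0, j)} \<notin> D"
  shows "n \<le> m" and "\<And>i. i < n \<Longrightarrow> \<exists>j<m. {(0, i), (1, j)} \<in> D"
    and "n = m \<Longrightarrow> j < m \<Longrightarrow> \<exists>i<n. {(0, i), (1, j)} \<in> D"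
proof -
  show *: "\<exists>j<m. {(0, i), (1, j)} \<in> D" if "i < n" for i
  proof -
    have "(0, i) \<in> points n m" using that by (simp add: points_def)
    then obtain y where y: "{(0, i), y} \<in> D" "y \<in> points n m" by (rule diag_blockE[OF D])
    then show ?thesis using nc by (auto simp: points_def)
  qed
  then obtain f where f: "\<And>i. i < n \<Longrightarrow> f i < m \<and> {(0, i), (1, f i)} \<in> D" by metis
  have inj: "inj_on f {..<n}"
  proof (rule inj_onI)
    fix i j assume ij: "i \<in> {..<n}" "j \<in> {..<n}" "f i = f j"
    have "{(0, i), (1 :: nat, f i)} = {(0, j), (1, f j)}"
      by (rule diag_block_eq[OF D, of _ _ "(1, f i)"]) (use f[of i] f[of j] ij in auto)
    then show "i = j" by (auto simp: doubleton_eq_iff)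
  qed
  have sub: "f ` {..<n} \<subseteq> {..<m}" using f by auto
  show "n \<le> m" using card_inj_on_le[OF inj sub] by simp
  show "\<exists>i<n. {(0, i), (1, j)} \<in> D" if "n = m" "j < m"
  proof -
    have "f ` {..<n} = {..<m}" by (rule card_subset_eq[OF _ sub]) (use card_image[OF inj] that in simp_all)
    then show ?thesis using f that by (metis imageE lessThan_iff)
  qed
qed

section \<open>Planar diagrams as bracket words, with the openers as opening brackets\<close>

definition openers :: "nat \<Rightarrow> nat \<Rightarrow> diagram \<Rightarrow> nat set" where
  "openers n m D = {bpos n m x | x y. {x, y} \<in> D \<and> bpos n m x < bpos n m y}"

lemma opener_iff:
  assumes D: "D \<in> diagrams n m" and xy: "{x, y} \<in> D" "x \<noteq> y"
  shows "bpos n m x \<in> openers n m D \<longleftrightarrow> bpos n m x < bpos n m y"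
proof
  assume "bpos n m x \<in> openers n m D"
  then obtain x' y' where *: "bpos n m x = bpos n m x'" "{x', y'} \<in> D" "bpos n m x' < bpos n m y'"
    unfolding openers_def by blast
  have "x \<in> points n m" "x' \<in> points n m" using xy * diag_Union[OF D] by blast+
  then have "x = x'" using * bpos_inj[of n m] unfolding inj_on_def by blast
  then have "{x, y} = {x', y'}" using diag_block_eq[OF D xy(1) *(2)] by blast
  then have "y = y'" using \<open>x = x'\<close> xy(2) by (auto simp: doubleton_eq_iff)
  then show "bpos n m x < bpos n m y" using * by simp
next
  show "bpos n m x < bpos n m y \<Longrightarrow> bpos n m x \<in> openers n m D"
    unfolding openers_def using xy by blast
qed

text \<open>Matching of brackets is unique; induction on the position of the closing end y. Its
  partner x' in E also precedes y. If x' were different from x, the later one of the two would open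
  strands in both diagrams; planarity closes one of these before y, and the induction hypothesis
  carries that strand from D to E, where it clashes with the strand of y or of x.\<close>

lemma openers_determine_subset:
  assumes D: "D \<in> diagrams n m" and E: "E \<in> diagrams n m" and eq: "openers n m D = openers n m E"
  shows "{x, y} \<in> D \<Longrightarrow> bpos n m x < bpos n m y \<Longrightarrow> {x, y} \<in> E"
proof (induction "bpos n m y" arbitrary: x y rule: less_induct)
  case less
  let ?b = "bpos n m"
  have pl: "\<not> (?b a < ?b b \<and> ?b b < ?b c \<and> ?b c < ?b d)" if "{a, c} \<in> X" "{b, d} \<in> X" "X \<in> diagrams n m"
    for a b c d X using that unfolding diagrams_def planar_def by blast
  have inj: "u = v" if "?b u = ?b v" "u \<in> points n m" "v \<in> points n m" for u v
    using that bpos_inj[of n m] unfolding inj_on_def by blast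
  have part: "u = v" if "{w, u} \<in> X" "{w, v} \<in> X" "X \<in> diagrams n m" for u v w X
  proof -
    have "{w, u} = {w, v}" by (rule diag_block_eq[OF that(3,1,2)]) auto
    then show ?thesis by (auto simp: doubleton_eq_iff)
  qed
  have pts: "x \<in> points n m" "y \<in> points n m" using less.prems diag_Union[OF D] by blast+
  have yx: "{y, x} \<in> D" using less.prems by (simp add: insert_commute)
  obtain x' where x': "{y, x'} \<in> E" "x' \<in> points n m" "y \<noteq> x'" using pts by (metis diag_blockE[OF E])
  have "?b y \<notin> openers n m D" using opener_iff[OF D yx] less.prems by auto
  then have "\<not> ?b y < ?b x'" using eq opener_iff[OF E x'(1,3)] by simp
  then have lt: "?b x' < ?b y" using inj x' pts by (metis linorder_neqE_nat)
  consider "x = x'" | "?b x < ?b x'" | "?b x' < ?b x" using inj x' pts by (metis linorder_neqE_nat)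
  then show ?case
  proof cases
    case 1 then show ?thesis using x' by (simp add: insert_commute)
  next
    case 2
    have "{x', y} \<in> E" using x'(1) insert_commute[of x' y "{}"] by simp
    then have "?b x' \<in> openers n m E" unfolding openers_def using lt
      by (intro CollectI exI[of _ x'] exI[of _ y]) simp
    then obtain u z where z: "{u, z} \<in> D" "?b u < ?b z" "?b u = ?b x'" 
      unfolding eq[symmetric] unfolding openers_def by (elim CollectE exE conjE) (rule that, auto)
    have "u = x'" using inj z x' diag_Union[OF D] by blast
    then have z: "{x', z} \<in> D" "?b x' < ?b z" using z by auto
    have zp: "z \<in> points n m" using z diag_Union[OF D] by blast
    have "\<not> ?b y < ?b z" using pl[OF less.prems(1) z(1) D] 2 lt by blast
    moreover have "z \<noteq> y"
    proof
      assume "z = y"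
      then have "{y, x'} \<in> D" using z(1) by (simp add: insert_commute)
      then have "x = x'" using part[OF yx _ D] by blast
      then show False using 2 by simp
    qed
    ultimately have zy: "?b z < ?b y" using inj zp pts by (metis linorder_neqE_nat)
    then have "{x', z} \<in> E" using less.hyps z by blast
    then have "z = y" using part[of x' z E y] x' E by (simp add: insert_commute)
    then show ?thesis using zy by simp
  next
    case 3
    have "?b x \<in> openers n m D" unfolding openers_def using less.prems by blast
    then obtain u z where z: "{u, z} \<in> E" "?b u < ?b z" "?b u = ?b x" 
      unfolding eq unfolding openers_def by (elim CollectE exE conjE) (rule that, auto)
    have "u = x" using inj z pts diag_Union[OF E] by blast
    then have z: "{x, z} \<in> E" "?b x < ?b z" using z by auto
    have zp: "z \<in> points n m" using z diag_Union[OF E] by blast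
    have xy': "{x', y} \<in> E" using x' by (simp add: insert_commute)
    have "\<not> ?b y < ?b z" using pl[OF xy' z(1) E] 3 less.prems(2) by blast
    moreover have "z \<noteq> y"
    proof
      assume "z = y"
      then have "{y, x} \<in> E" using z(1) by (simp add: insert_commute)
      then have "x = x'" using part[OF _ x'(1) E] by blast
      then show False using 3 by simp
    qed
    ultimately have zy: "?b z < ?b y" using inj zp pts by (metis linorder_neqE_nat)
    obtain w where w: "{z, w} \<in> D" "w \<in> points n m" "z \<noteq> w" using zp by (metis diag_blockE[OF D])
    have zx: "{z, x} \<in> E" using z by (simp add: insert_commute)
    have "?b z \<notin> openers n m E" using opener_iff[OF E zx] z by auto
    then have "\<not> ?b z < ?b w" using eq opener_iff[OF D w(1,3)] by simp
    then have "?b w < ?b z" using inj w zp by (metis linorder_neqE_nat)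
    then have "{w, z} \<in> E" using less.hyps[OF zy, of w] w by (simp add: insert_commute)
    then have "w = x" using part[of z w E x] zx E by (simp add: insert_commute)
    then have "{x, z} \<in> D" using w by (simp add: insert_commute)
    then have "z = y" using part less.prems D by blast
    then show ?thesis using zy by simp
  qed
qed

lemma openers_determine:
  assumes D: "D \<in> diagrams n m" and E: "E \<in> diagrams n m" and eq: "openers n m D = openers n m E"
  shows "D = E"
proof -
  have sub: "D \<subseteq> E" if D: "D \<in> diagrams n m" and E: "E \<in> diagrams n m" and eq: "openers n m D = openers n m E"
    for D E
  proof
    fix B assume B: "B \<in> D"
    then obtain x y where xy: "B = {x, y}" "x \<noteq> y" using diag_card2[OF D] by (meson card_2_iff)
    then have "x \<in> points n m" "y \<in> points n m" using B diag_Union[OF D] by blast+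
    then have "bpos n m x \<noteq> bpos n m y" using xy bpos_inj[of n m] unfolding inj_on_def by blast
    then consider "bpos n m x < bpos n m y" | "bpos n m y < bpos n m x" by linarith
    then show "B \<in> E"
    proof cases
      case 1 then show ?thesis using openers_determine_subset[OF D E eq] B xy by blast
    next
      case 2
      then show ?thesis using openers_determine_subset[OF D E eq, of y x] B xy by (simp add: insert_commute)
    qed
  qed
  show ?thesis using sub[OF D E eq] sub[OF E D eq[symmetric]] by blast
qed

lemma openers_no_cap:
  assumes D: "D \<in> diagrams n n" and nc: "\<And>i j. {(0, i), (0, j)} \<notin> D"
  shows "openers n n D = {..<n}"
proof
  show "openers n n D \<subseteq> {..<n}"
  proof
    fix k assume "k \<in> openers n n D"
    then obtain x y where xy: "{x, y} \<in> D" "bpos n n x < bpos n n y" "k = bpos n n x" unfolding openers_def by blast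
    show "k \<in> {..<n}"
    proof (rule ccontr)
      assume "k \<notin> {..<n}"
      moreover have "x \<in> points n n" using xy diag_Union[OF D] by blast
      ultimately obtain j where j: "x = (1, j)" "j < n" using xy by (auto simp: points_def)
      then obtain i where i: "i < n" "{(0, i), (1, j)} \<in> D" using no_cap_through(3)[OF D nc] by blast
      then have "{(0, i), (1, j)} = {x, y}" using diag_block_eq[OF D] xy j by blast
      then have "y = (0, i)" using j by (auto simp: doubleton_eq_iff)
      then show False using xy \<open>k \<notin> {..<n}\<close> i by auto
    qed
  qed
  show "{..<n} \<subseteq> openers n n D"
  proof
    fix i assume "i \<in> {..<n}"
    then obtain j where "j < n" "{(0, i), (1, j)} \<in> D" using no_cap_through(2)[OF D nc] by blast
    then show "i \<in> openers n n D" using \<open>i \<in> {..<n}\<close> unfolding openers_def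
      by (intro CollectI exI[of _ "(0, i)"] exI[of _ "(1, j)"]) (auto simp: bpos_def)
  qed
qed

lemma no_cap_eq_id:
  assumes D: "D \<in> diagrams n n" and nc: "\<And>i j. {(0, i), (0, j)} \<notin> D"
  shows "D = id_diag n"
proof (rule openers_determine[OF D id_diag_in])
  have "{(0, i), (0, j)} \<notin> id_diag n" for i j by (auto simp: id_diag_def doubleton_eq_iff)
  then show "openers n n D = openers n n (id_diag n)"
    using openers_no_cap[OF D nc] openers_no_cap[OF id_diag_in] by simp
qed

lemma source_block_ins_cap:
  assumes D: "D \<in> diagrams n m" and B: "{(0, i), (0, j)} \<in> D"
  obtains k n' D' where "n = n' + 2" "k \<le> n'" "D' \<in> diagrams n' m" "D = ins_cap k D'"
proof -
  have "card {(0 :: nat, i), (0, j)} = 2" using diag_card2[OF D B] .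
  then have "i \<noteq> j" by auto
  then obtain k where k: "{(0, k), (0, k + 1)} \<in> D"
    using simple_cap_exists[OF D, of i j] simple_cap_exists[OF D, of j i] B
    by (metis insert_commute linorder_neqE_nat)
  then have "(0, k + 1) \<in> points n m" using diag_Union[OF D] by blast
  then have "n = (n - 2) + 2" by (auto simp: points_def)
  then obtain n' where n': "n = n' + 2" by blast
  show ?thesis using ins_cap_exists[of D n' m k] D k that n' by metis
qed

text \<open>The source of all absorption arguments: whatever is killed by the simple caps is killed
  by every diagram other than the identity.\<close>

lemma diag_not_id_ins_cap:
  assumes D: "D \<in> diagrams n n" "D \<noteq> id_diag n"
  obtains k n' D' where "n = n' + 2" "k \<le> n'" "D' \<in> diagrams n' n" "D = ins_cap k D'"
proof -
  obtain i j where "{(0, i), (0, j)} \<in> D" using no_cap_eq_id[OF D(1)] D(2) by blast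
  then show ?thesis using that by (rule source_block_ins_cap[OF D(1)])
qed

text \<open>Sending a through strand to its target is injective, and it is onto exactly if no strand
  joins two targets.\<close>

lemma through_eq_iff:
  assumes D: "D \<in> diagrams n m"
  shows "through D \<le> m" and "through D = m \<longleftrightarrow> (\<forall>k l. {(1, k), (1, l)} \<notin> D)"
proof -
  let ?T = "{B \<in> D. \<exists>i j. (0, i) \<in> B \<and> (1, j) \<in> B}"
  have "\<exists>i j. j < m \<and> B = {(0, i), (1, j)}" if "B \<in> ?T" for B
  proof -
    obtain i j where ij: "(0, i) \<in> B" "(1, j) \<in> B" "B \<in> D" using \<open>B \<in> ?T\<close> by blast
    then have "card B = 2" using diag_card2[OF D] by blast
    then have "B = {(0, i), (1, j)}" using ij
      by (metis (no_types, lifting) card_2_iff doubleton_eq_iff insertE prod.inject singletonD zero_neq_one)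
    moreover have "(1, j) \<in> points n m" using ij diag_Union[OF D] by blast
    ultimately show ?thesis by (auto simp: points_def)
  qed
  note two = this
  have "\<exists>p. B \<in> ?T \<longrightarrow> snd p < m \<and> B = {(0, fst p), (1, snd p)}" for B
  proof (cases "B \<in> ?T")
    case True
    then obtain i j where "j < m" "B = {(0, i), (1, j)}" using two[of B] by blast
    then show ?thesis by (intro exI[of _ "(i, j)"]) simp
  qed blast
  then have "\<forall>B. \<exists>p. B \<in> ?T \<longrightarrow> snd p < m \<and> B = {(0, fst p), (1, snd p)}" ..
  from choice[OF this] obtain h
    where h: "\<forall>B. B \<in> ?T \<longrightarrow> snd (h B) < m \<and> B = {(0, fst (h B)), (1, snd (h B))}" ..
  obtain f g where "f = fst \<circ> h" "g = snd \<circ> h" by blast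
  then have fg: "\<And>B. B \<in> ?T \<Longrightarrow> g B < m \<and> B = {(0, f B), (1, g B)}" using h by simp
  have inj: "inj_on g ?T"
  proof (rule inj_onI)
    fix A B assume "A \<in> ?T" "B \<in> ?T" "g A = g B"
    then show "A = B" using diag_block_eq[OF D, of A B "(1, g A)"] fg by (metis (no_types, lifting) insertCI mem_Collect_eq)
  qed
  have sub: "g ` ?T \<subseteq> {..<m}" using fg by blast
  have thr: "through D = card (g ` ?T)" unfolding through_def by (rule card_image[OF inj, symmetric])
  show "through D \<le> m" unfolding thr using card_mono[OF _ sub] by simp
  show "through D = m \<longleftrightarrow> (\<forall>k l. {(1, k), (1, l)} \<notin> D)"
  proof
    assume t: "through D = m"
    show "\<forall>k l. {(1, k), (1, l)} \<notin> D"
    proof (intro allI notI)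
      fix k l assume B: "{(1, k), (1, l)} \<in> D"
      have "g ` ?T = {..<m}" by (rule card_subset_eq[OF _ sub]) (use t thr in simp_all)
      moreover have "(1, k) \<in> points n m" using B diag_Union[OF D] by blast
      then have "k < m" by (auto simp: points_def)
      ultimately have "k \<in> g ` ?T" by simp
      then obtain A where A: "A \<in> ?T" "g A = k" by (elim imageE) simp
      have 1: "(1, k) \<in> A" "(0, f A) \<in> A" "A \<in> D" using fg[OF A(1)] A by auto
      have "A = {(1, k), (1, l)}"
        by (rule diag_block_eq[OF D 1(3) B 1(1)]) simp
      then have "(0 :: nat, f A) \<in> {(1, k), (1, l)}" using 1(2) by simp
      then show False by simp
    qed
  next
    assume nc: "\<forall>k l. {(1, k), (1, l)} \<notin> D"
    have "{..<m} \<subseteq> g ` ?T"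
    proof
      fix j assume "j \<in> {..<m}"
      then have "(1, j) \<in> points n m" by (simp add: points_def)
      then obtain y where y: "{(1, j), y} \<in> D" "y \<in> points n m" by (rule diag_blockE[OF D])
      then obtain i where i: "y = (0, i)" using nc by (auto simp: points_def)
      then have T: "{(1, j), y} \<in> ?T" using y by blast
      have "g {(1, j), y} = j" using fg[OF T] i by (auto simp: doubleton_eq_iff)
      then show "j \<in> g ` ?T" using T by force
    qed
    then have "g ` ?T = {..<m}" using sub by blast
    then show "through D = m" unfolding thr by simp
  qed
qed

text \<open>The recursion inserts the innermost cap, which joins the last source of the block of
  size a to the first source of the block of size b. When a block is exhausted the value defaults to
  an identity, so r nested caps are meant only for r \<le> a and r \<le> b.\<close>

fun nested :: "nat \<Rightarrow> nat \<Rightarrow> nat \<Rightarrow> diagram" where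
  "nested (Suc a) (Suc b) (Suc r) = ins_cap a (nested a b r)"
| "nested a b r = id_diag (a + b)"

lemma nested_in: "r \<le> a \<Longrightarrow> r \<le> b \<Longrightarrow> nested a b r \<in> diagrams (a + b) (a + b - 2 * r)"
proof (induction a b r rule: nested.induct)
  case (1 a b r)
  then have "nested a b r \<in> diagrams (a + b) (a + b - 2 * r)" by simp
  from ins_cap_in[OF this, of a] show ?case by simp
qed auto

lemma nested_no_cup: "{(1, k), (1, l)} \<notin> nested a b r"
proof (induction a b r rule: nested.induct)
  case (1 a b r)
  show ?case
  proof
    assume "{(1, k), (1, l)} \<in> nested (Suc a) (Suc b) (Suc r)"
    then obtain X where X: "X \<in> nested a b r" "{(1, k), (1, l)} = skip2_pt a ` X"
      by (auto simp: ins_cap_def doubleton_eq_iff)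
    have "X = {(1, k), (1, l)}"
    proof -
      have "skip2_pt a ` {(1, k), (1, l)} = {(1, k), (1, l)}" by (simp add: skip2_pt_def)
      then show ?thesis using X(2) inj_image_eq_iff[OF inj_skip2_pt] by metis
    qed
    then show False using 1 X by simp
  qed
qed (auto simp: id_diag_def doubleton_eq_iff)

lemma nested_through: "r \<le> a \<Longrightarrow> r \<le> b \<Longrightarrow> through (nested a b r) = a + b - 2 * r"
  using through_eq_iff(2)[OF nested_in] nested_no_cup by blast

text \<open>If the only simple cap of D sits in the middle, its removal leaves a diagram with the
  same property for blocks shortened by one. The process ends with a diagram E without caps.\<close>

lemma middle_caps_factor:
  assumes "D \<in> diagrams (a + b) m" and "\<And>k. {(0, k), (0, k + 1)} \<in> D \<Longrightarrow> k + 1 = a"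
  shows "\<exists>r E. r \<le> a \<and> r \<le> b \<and> E \<in> diagrams (a + b - 2 * r) m \<and> D = cat_diag (nested a b r) E \<and>
    (\<forall>i j. {(0, i), (0, j)} \<notin> E)"
  using assms
proof (induction a arbitrary: b D)
  case 0
  have "{(0, i), (0, j)} \<notin> D" for i j
  proof
    assume "{(0, i), (0, j)} \<in> D"
    then obtain k D' where "D = ins_cap k D'" using source_block_ins_cap[OF 0(1)] by metis
    then show False using 0(2) ins_cap_block[of k D'] by auto
  qed
  then show ?case using 0(1) by (intro exI[of _ 0] exI[of _ D]) simp
next
  case (Suc a)
  show ?case
  proof (cases "\<exists>i j. {(0, i), (0, j)} \<in> D")
    case False
    then show ?thesis using Suc.prems(1) by (intro exI[of _ 0] exI[of _ D]) simp
  next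
    case True
    then obtain i j where "{(0, i), (0, j)} \<in> D" by blast
    then obtain k n' D' where k: "Suc a + b = n' + 2" "k \<le> n'" "D' \<in> diagrams n' m" "D = ins_cap k D'"
      using source_block_ins_cap[OF Suc.prems(1)] by metis
    have ka: "k = a" using Suc.prems(2) ins_cap_block[of k D'] k by auto
    then obtain b' where b: "b = Suc b'" using k by (cases b) auto
    then have n': "n' = a + b'" using k by simp
    \<comment> \<open>A simple cap of \<open>D'\<close> elsewhere is not split by the reinserted
      cap, so it would be a simple cap of \<open>D\<close> off the middle.\<close>
    have "k' + 1 = a" if k': "{(0, k'), (0, k' + 1)} \<in> D'" for k'
    proof (rule ccontr)
      assume ne: "k' + 1 \<noteq> a"
      have "skip2_pt a ` {(0, k'), (0, k' + 1)} \<in> D" unfolding k(4) ka ins_cap_def using k' by blast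
      also have "skip2_pt a ` {(0, k'), (0, k' + 1)} = {(0, skip2 a k'), (0, skip2 a (k' + 1))}"
        by (simp add: skip2_pt_def)
      finally have "{(0, skip2 a k'), (0, skip2 a (k' + 1))} \<in> D" .
      moreover have "skip2 a (k' + 1) = skip2 a k' + 1" using ne by auto
      ultimately have "{(0, skip2 a k'), (0, skip2 a k' + 1)} \<in> D" by (simp only:)
      then have "skip2 a k' + 1 = Suc a" by (rule Suc.prems(2))
      then show False by (auto split: if_splits)
    qed
    then obtain r E where rE: "r \<le> a" "r \<le> b'" "E \<in> diagrams (a + b' - 2 * r) m"
      "D' = cat_diag (nested a b' r) E" "\<forall>i j. {(0, i), (0, j)} \<notin> E"
      using Suc.IH[of D' b'] k(3) n' by metis
    note N = nested_in[OF rE(1,2)]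
    have a: "a \<le> a + b'" by simp
    have "D = cat_diag (cap_diag (a + b' + 2) a) (cat_diag (nested a b' r) E)"
      unfolding k(4) ka rE(4) cat_cap_diag[OF a cat_diagrams[OF N rE(3)]] ..
    also have "\<dots> = cat_diag (nested (Suc a) (Suc b') (Suc r)) E"
      unfolding cat_assoc[OF cap_diag_in[OF a] N rE(3), symmetric] cat_cap_diag[OF a N] by simp
    finally show ?thesis using rE b by (intro exI[of _ "Suc r"] exI[of _ E]) simp
  qed
qed

text \<open>The remaining factor E has neither caps nor cups, so it is an identity.\<close>

lemma middle_caps_monic:
  assumes D: "D \<in> diagrams (a + b) m" and mid: "\<And>k. {(0, k), (0, k + 1)} \<in> D \<Longrightarrow> k + 1 = a"
    and nc: "\<And>k l. {(1, k), (1, l)} \<notin> D"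
  obtains r where "r \<le> a" "r \<le> b" "m = a + b - 2 * r" "D = nested a b r"
proof -
  obtain r E where rE: "r \<le> a" "r \<le> b" "E \<in> diagrams (a + b - 2 * r) m"
      "D = cat_diag (nested a b r) E" "\<And>i j. {(0, i), (0, j)} \<notin> E"
    using middle_caps_factor[OF D mid] by blast
  have nc': "{(1, k), (1, l)} \<notin> E" for k l
    using cat_target_block[OF nested_in[OF rE(1,2)] rE(3)] nc rE(4) by blast
  have "a + b - 2 * r \<le> m" by (rule no_cap_through(1)[OF rE(3,5)])
  moreover have "m \<le> a + b - 2 * r"
    by (rule no_cap_through(1)[OF refl_diag_in[OF rE(3)]]) (unfold flip_block_iff(2)[OF rE(3)], rule nc')
  ultimately have m: "m = a + b - 2 * r" by simp
  then have "E = id_diag m" using no_cap_eq_id rE by metis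
  then show ?thesis using that[OF rE(1,2) m] rE(4) nested_in[OF rE(1,2)] m by simp
qed

text \<open>After the caps are split off, the reflected remainder is again of this kind. It carries
  the same number r of caps because it has a + b - 2 r targets.\<close>

lemma middle_caps_both:
  assumes D: "D \<in> diagrams (a + b) (a + b)" and mid: "\<And>k. {(0, k), (0, k + 1)} \<in> D \<Longrightarrow> k + 1 = a"
    and mid': "\<And>k. {(1, k), (1, k + 1)} \<in> D \<Longrightarrow> k + 1 = a"
  obtains r where "r \<le> a" "r \<le> b" "D = cat_diag (nested a b r) (refl_diag (nested a b r))"
proof -
  obtain r E where rE: "r \<le> a" "r \<le> b" "E \<in> diagrams (a + b - 2 * r) (a + b)"
      "D = cat_diag (nested a b r) E" "\<And>i j. {(0, i), (0, j)} \<notin> E"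
    using middle_caps_factor[OF D mid] by blast
  have "k + 1 = a" if "{(0, k), (0, k + 1)} \<in> refl_diag E" for k
    using that mid' cat_target_block[OF nested_in[OF rE(1,2)] rE(3)] rE(4) flip_block_iff(2)[OF rE(3)] by blast
  moreover have "{(1, k), (1, l)} \<notin> refl_diag E" for k l using rE(5) flip_block_iff(1)[OF rE(3)] by blast
  ultimately obtain r' where r': "r' \<le> a" "r' \<le> b" "a + b - 2 * r = a + b - 2 * r'" "refl_diag E = nested a b r'"
    using middle_caps_monic[OF refl_diag_in[OF rE(3)]] by metis
  then have "r' = r" using rE by linarith
  then have "E = refl_diag (nested a b r)" using r'(4) refl_refl[OF rE(3)] by simp
  then show ?thesis using that rE by blast
qed

subsection \<open>The category of morphisms\<close>

abbreviation lk :: "'k::comm_ring_1 mor \<Rightarrow> diagram \<Rightarrow> 'k" where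
  "lk \<equiv> Poly_Mapping.lookup"

abbreviation dg :: "diagram \<Rightarrow> 'k::comm_ring_1 mor" where
  "dg D \<equiv> Poly_Mapping.single D 1"

lemma mor_expand:
  assumes "finite S" "Poly_Mapping.keys x \<subseteq> S"
  shows "x = (\<Sum>D\<in>S. Poly_Mapping.single D (Poly_Mapping.lookup x D))"
proof (rule poly_mapping_eqI)
  fix D
  have "Poly_Mapping.lookup (\<Sum>D\<in>S. Poly_Mapping.single D (Poly_Mapping.lookup x D)) D
      = (\<Sum>E\<in>S. if E = D then Poly_Mapping.lookup x D else 0)"
    unfolding lookup_sum by (rule sum.cong) (auto simp: lookup_single when_def)
  also have "\<dots> = Poly_Mapping.lookup x D"
    using assms by (auto simp: in_keys_iff)
  finally show "Poly_Mapping.lookup x D = Poly_Mapping.lookup (\<Sum>D\<in>S. Poly_Mapping.single D (Poly_Mapping.lookup x D)) D" ..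
qed

lemma Hom_iff: "x \<in> Hom n m \<longleftrightarrow> (\<forall>D. lk x D \<noteq> 0 \<longrightarrow> D \<in> diagrams n m)"
  by (auto simp: Hom_def in_keys_iff)

lemma Hom_zero [simp]: "0 \<in> Hom n m" by (simp add: Hom_iff)

lemma Hom_add: "x \<in> Hom n m \<Longrightarrow> y \<in> Hom n m \<Longrightarrow> x + y \<in> Hom n m"
  using keys_add[of x y] by (auto simp: Hom_def)

lemma Hom_diff: "x \<in> Hom n m \<Longrightarrow> y \<in> Hom n m \<Longrightarrow> x - y \<in> Hom n m"
proof -
  assume *: "x \<in> Hom n m" "y \<in> Hom n m"
  have "D \<in> diagrams n m" if "lk x D - lk y D \<noteq> 0" for D
  proof -
    have "lk x D \<noteq> 0 \<or> lk y D \<noteq> 0" using that by auto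
    then show ?thesis using * unfolding Hom_iff by blast
  qed
  then show ?thesis unfolding Hom_iff lookup_minus by blast
qed

lemma Hom_scale: "x \<in> Hom n m \<Longrightarrow> tl_scale c x \<in> Hom n m"
  unfolding Hom_iff lookup_tl_scale by (metis mult_zero_right)

lemma Hom_single: "D \<in> diagrams n m \<Longrightarrow> Poly_Mapping.single D c \<in> Hom n m"
  unfolding Hom_iff by (auto simp: lookup_single when_def)

lemma Hom_sum: "(\<And>i. i \<in> I \<Longrightarrow> f i \<in> Hom n m) \<Longrightarrow> sum f I \<in> Hom n m"
  by (induction I rule: infinite_finite_induct) (auto intro: Hom_add)

lemma Hom_expand: "x \<in> Hom n m \<Longrightarrow> x = (\<Sum>D\<in>diagrams n m. Poly_Mapping.single D (lk x D))"
  by (rule mor_expand) (auto simp: Hom_def)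

lemma Hom_induct [consumes 1, case_names zero add single]:
  assumes x: "x \<in> Hom n m" and "P 0"
    and add: "\<And>x y. x \<in> Hom n m \<Longrightarrow> y \<in> Hom n m \<Longrightarrow> P x \<Longrightarrow> P y \<Longrightarrow> P (x + y)"
    and single: "\<And>D c. D \<in> diagrams n m \<Longrightarrow> P (Poly_Mapping.single D c)"
  shows "P x"
proof -
  have "A \<subseteq> diagrams n m \<Longrightarrow> P (\<Sum>D\<in>A. Poly_Mapping.single D (lk x D))" for A
  proof (induction A rule: infinite_finite_induct)
    case (insert D A)
    then show ?case by (auto intro!: add single Hom_sum Hom_single)
  qed (use assms in auto)
  from this[of "diagrams n m"] show ?thesis unfolding Hom_expand[OF x, symmetric] by simp
qed

lemma tl_comp_superset:
  assumes "finite S" "finite T" "Poly_Mapping.keys x \<subseteq> S" "Poly_Mapping.keys y \<subseteq> T"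
  shows "tl_comp \<delta> x y =
    (\<Sum>D\<in>S. \<Sum>E\<in>T. Poly_Mapping.single (cat_diag D E) (lk x D * lk y E * \<delta> ^ loops D E))"
proof -
  have "tl_comp \<delta> x y =
      (\<Sum>D\<in>Poly_Mapping.keys x. \<Sum>E\<in>T. Poly_Mapping.single (cat_diag D E) (lk x D * lk y E * \<delta> ^ loops D E))"
    unfolding tl_comp_def using assms
    by (intro sum.cong refl sum.mono_neutral_left) (auto simp: in_keys_iff)
  also have "\<dots> = (\<Sum>D\<in>S. \<Sum>E\<in>T. Poly_Mapping.single (cat_diag D E) (lk x D * lk y E * \<delta> ^ loops D E))"
    using assms by (intro sum.mono_neutral_left) (auto simp: in_keys_iff)
  finally show ?thesis .
qed

lemma tl_comp_add_left: "tl_comp \<delta> (x + y) z = tl_comp \<delta> x z + tl_comp \<delta> y z"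
proof -
  let ?S = "Poly_Mapping.keys x \<union> Poly_Mapping.keys y" and ?T = "Poly_Mapping.keys z"
  note e = tl_comp_superset[of ?S ?T _ z]
  show ?thesis using keys_add[of x y]
    by (simp add: e lookup_add distrib_right single_add sum.distrib)
qed

lemma tl_comp_add_right: "tl_comp \<delta> z (x + y) = tl_comp \<delta> z x + tl_comp \<delta> z y"
proof -
  let ?S = "Poly_Mapping.keys x \<union> Poly_Mapping.keys y" and ?T = "Poly_Mapping.keys z"
  note e = tl_comp_superset[of ?T ?S z]
  show ?thesis using keys_add[of x y]
    by (simp add: e lookup_add distrib_right distrib_left single_add sum.distrib)
qed

lemma tl_comp_zero [simp]: "tl_comp \<delta> 0 x = 0" "tl_comp \<delta> x 0 = 0"
  by (simp_all add: tl_comp_def)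

lemma tl_scale_single [simp]: "tl_scale c (Poly_Mapping.single D a) = Poly_Mapping.single D (c * a)"
  by (rule poly_mapping_eqI) (simp add: lookup_single when_def)

lemma tl_comp_scale_left: "tl_comp \<delta> (tl_scale c x) y = tl_scale c (tl_comp \<delta> x y)"
proof -
  have "Poly_Mapping.keys (tl_scale c x) \<subseteq> Poly_Mapping.keys x" by (auto simp: in_keys_iff)
  then show ?thesis
    using tl_comp_superset[of "Poly_Mapping.keys x" "Poly_Mapping.keys y" "tl_scale c x" y \<delta>]
      tl_comp_superset[of "Poly_Mapping.keys x" "Poly_Mapping.keys y" x y \<delta>]
    by (simp add: TL.scale_sum_right mult.assoc)
qed

lemma tl_comp_scale_right: "tl_comp \<delta> x (tl_scale c y) = tl_scale c (tl_comp \<delta> x y)"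
proof -
  have "Poly_Mapping.keys (tl_scale c y) \<subseteq> Poly_Mapping.keys y" by (auto simp: in_keys_iff)
  then show ?thesis
    using tl_comp_superset[of "Poly_Mapping.keys x" "Poly_Mapping.keys y" x "tl_scale c y" \<delta>]
      tl_comp_superset[of "Poly_Mapping.keys x" "Poly_Mapping.keys y" x y \<delta>]
    by (simp add: TL.scale_sum_right mult.assoc mult.left_commute)
qed

lemma tl_comp_diff_left: "tl_comp \<delta> (x - y) z = tl_comp \<delta> x z - tl_comp \<delta> y z"
  using tl_comp_add_left[of \<delta> "x - y" y z] by simp

lemma tl_comp_diff_right: "tl_comp \<delta> z (x - y) = tl_comp \<delta> z x - tl_comp \<delta> z y"
  using tl_comp_add_right[of \<delta> z "x - y" y] by simp

lemma tl_comp_sum_left: "tl_comp \<delta> (sum f I) z = (\<Sum>i\<in>I. tl_comp \<delta> (f i) z)"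
  by (induction I rule: infinite_finite_induct) (simp_all add: tl_comp_add_left)

lemma tl_comp_sum_right: "tl_comp \<delta> z (sum f I) = (\<Sum>i\<in>I. tl_comp \<delta> z (f i))"
  by (induction I rule: infinite_finite_induct) (simp_all add: tl_comp_add_right)

lemma tl_comp_single:
  "tl_comp \<delta> (Poly_Mapping.single D a) (Poly_Mapping.single E b) =
    Poly_Mapping.single (cat_diag D E) (a * b * \<delta> ^ loops D E)"
  using tl_comp_superset[of "{D}" "{E}" "Poly_Mapping.single D a" "Poly_Mapping.single E b" \<delta>] by simp

lemma tl_comp_in: "x \<in> Hom n m \<Longrightarrow> y \<in> Hom m p \<Longrightarrow> tl_comp \<delta> x y \<in> Hom n p"
  unfolding tl_comp_def by (intro Hom_sum Hom_single cat_diagrams[of _ n m]) (auto simp: Hom_def)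

lemma tl_comp_assoc:
  assumes "x \<in> Hom n m" "y \<in> Hom m p" "z \<in> Hom p r"
  shows "tl_comp \<delta> (tl_comp \<delta> x y) z = tl_comp \<delta> x (tl_comp \<delta> y z)"
  using assms(1)
proof (induction x rule: Hom_induct)
  case (single D a)
  note D = single
  show ?case using assms(2)
  proof (induction y rule: Hom_induct)
    case (single E b)
    note E = single
    show ?case using assms(3)
    proof (induction z rule: Hom_induct)
      case (single F c)
      show ?case
        using loops_assoc[OF D E single] 
        by (simp add: tl_comp_single cat_assoc[OF D E single] power_add[symmetric] mult.assoc
          mult.left_commute[of "\<delta> ^ _" c] add.commute)
    qed (simp_all add: tl_comp_add_right)
  qed (simp_all add: tl_comp_add_right tl_comp_add_left)
qed (simp_all add: tl_comp_add_left)

lemma tl_comp_id_left: "x \<in> Hom n m \<Longrightarrow> tl_comp \<delta> (dg (id_diag n)) x = x"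
  by (induction x rule: Hom_induct) (simp_all add: tl_comp_add_right tl_comp_single)

lemma tl_comp_id_right: "x \<in> Hom n m \<Longrightarrow> tl_comp \<delta> x (dg (id_diag m)) = x"
  by (induction x rule: Hom_induct) (simp_all add: tl_comp_add_left tl_comp_single)

lemma refl_mor_superset:
  assumes "finite S" "Poly_Mapping.keys x \<subseteq> S"
  shows "refl_mor x = (\<Sum>D\<in>S. Poly_Mapping.single (refl_diag D) (lk x D))"
  unfolding refl_mor_def using assms by (intro sum.mono_neutral_left) (auto simp: in_keys_iff)

lemma refl_mor_add: "refl_mor (x + y) = refl_mor x + refl_mor y"
proof -
  let ?S = "Poly_Mapping.keys x \<union> Poly_Mapping.keys y"
  show ?thesis using keys_add[of x y]
    by (simp add: refl_mor_superset[of ?S] lookup_add single_add sum.distrib)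
qed

lemma refl_mor_zero [simp]: "refl_mor 0 = 0" by (simp add: refl_mor_def)

lemma refl_mor_single [simp]: "refl_mor (Poly_Mapping.single D c) = Poly_Mapping.single (refl_diag D) c"
  using refl_mor_superset[of "{D}" "Poly_Mapping.single D c"] by simp

lemma refl_mor_in: "x \<in> Hom n m \<Longrightarrow> refl_mor x \<in> Hom m n"
  by (induction x rule: Hom_induct) (auto simp: refl_mor_add intro: Hom_add Hom_single)

lemma refl_mor_refl: "x \<in> Hom n m \<Longrightarrow> refl_mor (refl_mor x) = x"
  by (induction x rule: Hom_induct) (simp_all add: refl_mor_add)

lemma refl_mor_scale: "refl_mor (tl_scale c x) = tl_scale c (refl_mor x)"
proof -
  have "Poly_Mapping.keys (tl_scale c x) \<subseteq> Poly_Mapping.keys x" by (auto simp: in_keys_iff)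
  then show ?thesis
    by (simp add: refl_mor_superset[of "Poly_Mapping.keys x"] TL.scale_sum_right)
qed

lemma refl_mor_comp:
  assumes "x \<in> Hom n m" "y \<in> Hom m p"
  shows "refl_mor (tl_comp \<delta> x y) = tl_comp \<delta> (refl_mor y) (refl_mor x)"
  using assms(1)
proof (induction x rule: Hom_induct)
  case (single D a)
  note D = single
  show ?case using assms(2)
  proof (induction y rule: Hom_induct)
    case (single E b)
    then show ?case using D
      by (simp add: tl_comp_single refl_cat mult.commute[of a])
  qed (simp_all add: tl_comp_add_right tl_comp_add_left refl_mor_add)
qed (simp_all add: tl_comp_add_right tl_comp_add_left refl_mor_add)

lemma tensor_superset:
  assumes "finite S" "finite T" "Poly_Mapping.keys x \<subseteq> S" "Poly_Mapping.keys y \<subseteq> T"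
  shows "tensor n m x y =
    (\<Sum>D\<in>S. \<Sum>E\<in>T. Poly_Mapping.single (tensor_diag n m D E) (lk x D * lk y E))"
proof -
  have "tensor n m x y =
      (\<Sum>D\<in>Poly_Mapping.keys x. \<Sum>E\<in>T. Poly_Mapping.single (tensor_diag n m D E) (lk x D * lk y E))"
    unfolding tensor_def using assms
    by (intro sum.cong refl sum.mono_neutral_left) (auto simp: in_keys_iff)
  also have "\<dots> = (\<Sum>D\<in>S. \<Sum>E\<in>T. Poly_Mapping.single (tensor_diag n m D E) (lk x D * lk y E))"
    using assms by (intro sum.mono_neutral_left) (auto simp: in_keys_iff)
  finally show ?thesis .
qed

lemma tensor_add_left: "tensor n m (x + y) z = tensor n m x z + tensor n m y z"
proof -
  let ?S = "Poly_Mapping.keys x \<union> Poly_Mapping.keys y" and ?T = "Poly_Mapping.keys z"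
  note e = tensor_superset[of ?S ?T _ z]
  show ?thesis using keys_add[of x y]
    by (simp add: e lookup_add distrib_right single_add sum.distrib)
qed

lemma tensor_add_right: "tensor n m z (x + y) = tensor n m z x + tensor n m z y"
proof -
  let ?S = "Poly_Mapping.keys x \<union> Poly_Mapping.keys y" and ?T = "Poly_Mapping.keys z"
  note e = tensor_superset[of ?T ?S z]
  show ?thesis using keys_add[of x y]
    by (simp add: e lookup_add distrib_left single_add sum.distrib)
qed

lemma tensor_zero [simp]: "tensor n m 0 x = 0" "tensor n m x 0 = 0"
  by (simp_all add: tensor_def)

lemma tensor_single:
  "tensor n m (Poly_Mapping.single D a) (Poly_Mapping.single E b) =
    Poly_Mapping.single (tensor_diag n m D E) (a * b)"
  using tensor_superset[of "{D}" "{E}" "Poly_Mapping.single D a" "Poly_Mapping.single E b"] by simp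

lemma tensor_in: "x \<in> Hom n m \<Longrightarrow> y \<in> Hom n' m' \<Longrightarrow> tensor n m x y \<in> Hom (n + n') (m + m')"
  unfolding tensor_def by (intro Hom_sum Hom_single tensor_diag_in) (auto simp: Hom_def)

lemma tensor_comp:
  assumes "x \<in> Hom n m" "y \<in> Hom n' m'" "x' \<in> Hom m p" "y' \<in> Hom m' p'"
  shows "tl_comp \<delta> (tensor n m x y) (tensor m p x' y') = tensor n p (tl_comp \<delta> x x') (tl_comp \<delta> y y')"
  using assms(1)
proof (induction x rule: Hom_induct)
  case (single D a)
  note D = single
  show ?case using assms(2)
  proof (induction y rule: Hom_induct)
    case (single E b)
    note E = single
    show ?case using assms(3)
    proof (induction x' rule: Hom_induct)
      case (single D' a')
      note D' = single
      show ?case using assms(4)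
      proof (induction y' rule: Hom_induct)
        case (single E' b')
        then show ?case
          using cat_tensor[OF D E D' single]
          by (simp add: tensor_single tl_comp_single power_add mult.assoc mult.left_commute)
      qed (simp_all add: tensor_add_right tl_comp_add_right)
    qed (simp_all add: tensor_add_left tl_comp_add_right)
  qed (simp_all add: tensor_add_right tl_comp_add_left)
qed (simp_all add: tensor_add_left tl_comp_add_left)

section \<open>Change of the coefficient ring\<close>

definition is_hom :: "('a::comm_ring_1 \<Rightarrow> 'b::comm_ring_1) \<Rightarrow> bool" where
  "is_hom \<phi> \<longleftrightarrow> \<phi> 0 = 0 \<and> \<phi> 1 = 1 \<and> (\<forall>x y. \<phi> (x + y) = \<phi> x + \<phi> y) \<and> (\<forall>x y. \<phi> (x * y) = \<phi> x * \<phi> y)"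

abbreviation mmap :: "('a::comm_ring_1 \<Rightarrow> 'b::comm_ring_1) \<Rightarrow> 'a mor \<Rightarrow> 'b mor" where
  "mmap \<equiv> Poly_Mapping.map"

lemma is_hom_power: "is_hom \<phi> \<Longrightarrow> \<phi> (x ^ n) = \<phi> x ^ n"
  by (induction n) (auto simp: is_hom_def)

lemma is_hom_diff: "is_hom \<phi> \<Longrightarrow> \<phi> (x - y) = \<phi> x - \<phi> y"
  unfolding is_hom_def by (metis add_diff_cancel_right' diff_add_cancel)

lemma lookup_mmap: "\<phi> 0 = 0 \<Longrightarrow> lk (mmap \<phi> x) D = \<phi> (lk x D)"
  by (simp add: Poly_Mapping.map.rep_eq when_def)

lemma mmap_sum:
  assumes "is_hom \<phi>" shows "mmap \<phi> (sum f I) = (\<Sum>i\<in>I. mmap \<phi> (f i))"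
proof -
  have 0: "\<phi> 0 = 0" and add: "mmap \<phi> (x + y) = mmap \<phi> x + mmap \<phi> y" for x y
    using assms by (auto intro!: poly_mapping_eqI simp: lookup_mmap is_hom_def lookup_add)
  show ?thesis
    by (induction I rule: infinite_finite_induct) (auto simp: add intro!: poly_mapping_eqI simp: lookup_mmap[of \<phi>, OF 0] 0)
qed

lemma mmap_single: "\<phi> 0 = 0 \<Longrightarrow> mmap \<phi> (Poly_Mapping.single D c) = Poly_Mapping.single D (\<phi> c)"
  by (intro poly_mapping_eqI) (simp add: lookup_mmap lookup_single when_def)

lemma keys_mmap: "\<phi> 0 = 0 \<Longrightarrow> Poly_Mapping.keys (mmap \<phi> x) \<subseteq> Poly_Mapping.keys x"
  by (auto simp: in_keys_iff lookup_mmap)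

lemma mmap_in: "\<phi> 0 = 0 \<Longrightarrow> x \<in> Hom n m \<Longrightarrow> mmap \<phi> x \<in> Hom n m"
  using keys_mmap by (fastforce simp: Hom_def)

lemma mmap_comp:
  assumes h: "is_hom \<phi>"
  shows "mmap \<phi> (tl_comp \<delta> x y) = tl_comp (\<phi> \<delta>) (mmap \<phi> x) (mmap \<phi> y)"
proof -
  have 0: "\<phi> 0 = 0" using h by (simp add: is_hom_def)
  have "tl_comp (\<phi> \<delta>) (mmap \<phi> x) (mmap \<phi> y) = (\<Sum>D\<in>Poly_Mapping.keys x. \<Sum>E\<in>Poly_Mapping.keys y.
      Poly_Mapping.single (cat_diag D E) (lk (mmap \<phi> x) D * lk (mmap \<phi> y) E * \<phi> \<delta> ^ loops D E))"
    using keys_mmap[of \<phi>, OF 0] by (intro tl_comp_superset) auto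
  also have "\<dots> = mmap \<phi> (tl_comp \<delta> x y)"
    unfolding tl_comp_def mmap_sum[OF h] mmap_single[of \<phi>, OF 0] lookup_mmap[of \<phi>, OF 0]
    using h by (simp add: is_hom_def is_hom_power[OF h, symmetric])
  finally show ?thesis ..
qed

lemma mmap_tensor:
  assumes h: "is_hom \<phi>"
  shows "mmap \<phi> (tensor n m x y) = tensor n m (mmap \<phi> x) (mmap \<phi> y)"
proof -
  have 0: "\<phi> 0 = 0" using h by (simp add: is_hom_def)
  have "tensor n m (mmap \<phi> x) (mmap \<phi> y) = (\<Sum>D\<in>Poly_Mapping.keys x. \<Sum>E\<in>Poly_Mapping.keys y.
      Poly_Mapping.single (tensor_diag n m D E) (lk (mmap \<phi> x) D * lk (mmap \<phi> y) E))"
    using keys_mmap[of \<phi>, OF 0] by (intro tensor_superset) auto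
  also have "\<dots> = mmap \<phi> (tensor n m x y)"
    unfolding tensor_def mmap_sum[OF h] mmap_single[of \<phi>, OF 0] lookup_mmap[of \<phi>, OF 0]
    using h by (simp add: is_hom_def)
  finally show ?thesis ..
qed

text \<open>A morphism to fewer points has a cap at its source, this cap persists in the product,
  and the identity has none.\<close>

lemma lookup_comp_id_eq_0:
  assumes "x \<in> Hom n m" "y \<in> Hom m n" "m < n"
  shows "lk (tl_comp \<delta> x y) (id_diag n) = 0"
proof -
  have "cat_diag D E \<noteq> id_diag n" if D: "D \<in> diagrams n m" and E: "E \<in> diagrams m n" for D E
  proof
    assume e: "cat_diag D E = id_diag n"
    obtain i j where "{(0, i), (0, j)} \<in> D" using no_cap_through(1)[OF D] assms(3) by fastforce
    then have "{(0, i), (0, j)} \<in> id_diag n" using cat_source_block[OF D E] e by simp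
    then show False by (auto simp: id_diag_def doubleton_eq_iff)
  qed
  then show ?thesis
    unfolding tl_comp_def lookup_sum using assms
    by (intro sum.neutral ballI) (auto simp: Hom_def lookup_single when_def)
qed

subsection \<open>Jones--Wenzl elements\<close>

text \<open>Normalised by the coefficient of the identity instead of idempotency. This makes sense
  over every ring and passes through ring homomorphisms; idempotency follows by
  \<open>jw_absorb\<close>.\<close>

definition jw :: "'k::comm_ring_1 \<Rightarrow> nat \<Rightarrow> 'k mor \<Rightarrow> bool" where
  "jw \<delta> n f \<longleftrightarrow> f \<in> Hom n n \<and> lk f (id_diag n) = 1 \<and> (\<forall>i. i + 1 < n \<longrightarrow>
    tl_comp \<delta> f (dg (cap_diag n i)) = 0 \<and> tl_comp \<delta> (dg (cup_diag n i)) f = 0)"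

lemma dg_cap_in: "i \<le> n \<Longrightarrow> dg (cap_diag (n + 2) i) \<in> Hom (n + 2) n"
  by (rule Hom_single[OF cap_diag_in])

lemma dg_cup_in: "i \<le> n \<Longrightarrow> dg (cup_diag (n + 2) i) \<in> Hom n (n + 2)"
  by (rule Hom_single[OF cup_diag_in])

lemma dg_ins_cap: "i \<le> n \<Longrightarrow> D \<in> diagrams n m \<Longrightarrow>
    (Poly_Mapping.single (ins_cap i D) c :: 'k::comm_ring_1 mor) =
      tl_comp \<delta> (dg (cap_diag (n + 2) i)) (Poly_Mapping.single D c)"
  by (simp only: tl_comp_single cat_cap_diag) simp

lemma cap_kill:
  assumes f: "f \<in> Hom k (n + 2)" and i: "i \<le> n" and D: "D \<in> diagrams n m"
    and z: "tl_comp \<delta> f (dg (cap_diag (n + 2) i)) = 0"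
  shows "tl_comp \<delta> f (Poly_Mapping.single (ins_cap i D) c) = 0"
  unfolding dg_ins_cap[OF i D, of c \<delta>] tl_comp_assoc[OF f dg_cap_in[OF i] Hom_single[OF D], symmetric] z by simp

lemma tl_comp_expand_right:
  assumes "x \<in> Hom n m"
  shows "tl_comp \<delta> f x = (\<Sum>D\<in>diagrams n m. tl_comp \<delta> f (Poly_Mapping.single D (lk x D)))"
  by (subst Hom_expand[OF assms]) (rule tl_comp_sum_right)

text \<open>Every diagram other than the identity begins with a simple cap, so only the identity
  term of x survives. Only killing from one side is assumed, which serves to compare the
  characterisation in \<open>JW\<close> with \<open>jw\<close>.\<close>

lemma cap_killer_absorb:
  assumes fH: "f \<in> Hom n n" and kill: "\<And>i. i + 1 < n \<Longrightarrow> tl_comp \<delta> f (dg (cap_diag n i)) = 0"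
    and x: "x \<in> Hom n n"
  shows "tl_comp \<delta> f x = tl_scale (lk x (id_diag n)) f"
proof -
  have "tl_comp \<delta> f (Poly_Mapping.single D c) = 0" if D: "D \<in> diagrams n n" "D \<noteq> id_diag n" for D c
  proof -
    obtain k n' D' where k: "n = n' + 2" "k \<le> n'" "D' \<in> diagrams n' n" "D = ins_cap k D'"
      using diag_not_id_ins_cap[OF D] .
    have "k + 1 < n" using k by simp
    then have "tl_comp \<delta> f (dg (cap_diag (n' + 2) k)) = 0" using kill k(1) by blast
    then show ?thesis unfolding k(4) using cap_kill[OF _ k(2,3)] fH k(1) by blast
  qed
  then have "tl_comp \<delta> f x =
      (\<Sum>D\<in>diagrams n n. if D = id_diag n then tl_comp \<delta> f (Poly_Mapping.single D (lk x D)) else 0)"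
    unfolding tl_comp_expand_right[OF x] by (intro sum.cong) auto
  also have "\<dots> = tl_comp \<delta> f (Poly_Mapping.single (id_diag n) (lk x (id_diag n)))" by simp
  also have "Poly_Mapping.single (id_diag n) (lk x (id_diag n)) = tl_scale (lk x (id_diag n)) (dg (id_diag n))"
    by simp
  finally show ?thesis unfolding tl_comp_scale_right tl_comp_id_right[OF fH] .
qed

lemma jw_absorb:
  assumes f: "jw \<delta> n f" and x: "x \<in> Hom n n"
  shows "tl_comp \<delta> f x = tl_scale (lk x (id_diag n)) f"
  using f x by (intro cap_killer_absorb) (auto simp: jw_def)

lemma jw_refl:
  assumes "jw \<delta> n f" shows "jw \<delta> n (refl_mor f)"
proof -
  have fH: "f \<in> Hom n n" using assms by (simp add: jw_def)
  have coeff: "lk (refl_mor f) (id_diag n) = lk f (id_diag n)"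
  proof -
    have "lk (refl_mor f) (id_diag n) = (\<Sum>D\<in>diagrams n n. if refl_diag D = id_diag n then lk f D else 0)"
      using fH by (subst refl_mor_superset[of "diagrams n n"])
        (auto simp: Hom_def lookup_sum lookup_single when_def intro: sum.cong)
    also have "\<dots> = (\<Sum>D\<in>diagrams n n. if D = id_diag n then lk f D else 0)"
      by (intro sum.cong refl if_cong) (metis refl_id refl_refl)
    finally show ?thesis by simp
  qed
  have "tl_comp \<delta> (refl_mor f) (dg (cap_diag n i)) = 0 \<and> tl_comp \<delta> (dg (cup_diag n i)) (refl_mor f) = 0"
    if i: "i + 1 < n" for i
  proof -
    obtain n' where n': "n' = n - 2" by blast
    then have n': "n = n' + 2" "i \<le> n'" using i by auto
    have C: "cap_diag n i \<in> diagrams n n'" using cap_diag_in[OF n'(2)] n'(1) by simp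
    have z: "tl_comp \<delta> f (dg (cap_diag n i)) = 0" "tl_comp \<delta> (dg (cup_diag n i)) f = 0"
      using assms i by (auto simp: jw_def)
    have "refl_mor (tl_comp \<delta> (dg (cup_diag n i)) f) = tl_comp \<delta> (refl_mor f) (dg (cap_diag n i))"
      using refl_mor_comp[OF Hom_single[OF refl_diag_in[OF C]] fH] refl_refl[OF C] by simp
    moreover have "refl_mor (tl_comp \<delta> f (dg (cap_diag n i))) = tl_comp \<delta> (dg (cup_diag n i)) (refl_mor f)"
      using refl_mor_comp[OF fH Hom_single[OF C]] by simp
    ultimately show ?thesis unfolding z by simp
  qed
  then show ?thesis using assms coeff refl_mor_in[OF fH] by (simp add: jw_def)
qed

lemma jw_absorb_left:
  assumes f: "jw \<delta> n f" and x: "x \<in> Hom n n"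
  shows "tl_comp \<delta> x f = tl_scale (lk x (id_diag n)) f"
proof -
  have fH: "f \<in> Hom n n" using f by (simp add: jw_def)
  have "lk (refl_mor x) (id_diag n) = lk x (id_diag n)"
  proof -
    have "lk (refl_mor x) (id_diag n) = (\<Sum>D\<in>diagrams n n. if refl_diag D = id_diag n then lk x D else 0)"
      using x by (subst refl_mor_superset[of "diagrams n n"])
        (auto simp: Hom_def lookup_sum lookup_single when_def intro: sum.cong)
    also have "\<dots> = (\<Sum>D\<in>diagrams n n. if D = id_diag n then lk x D else 0)"
      by (intro sum.cong refl if_cong) (metis refl_id refl_refl)
    finally show ?thesis by simp
  qed
  then have "refl_mor (tl_comp \<delta> x f) = tl_scale (lk x (id_diag n)) (refl_mor f)"
    unfolding refl_mor_comp[OF x fH] jw_absorb[OF jw_refl[OF f] refl_mor_in[OF x]] by simp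
  then have "refl_mor (refl_mor (tl_comp \<delta> x f)) = refl_mor (refl_mor (tl_scale (lk x (id_diag n)) f))"
    by (simp add: refl_mor_scale)
  then show ?thesis
    using refl_mor_refl[OF tl_comp_in[OF x fH]] refl_mor_refl[OF Hom_scale[OF fH]] by simp
qed

text \<open>The product of f and g equals f by absorption on one side and g by absorption on the
  other.\<close>

lemma jw_unique: "jw \<delta> n f \<Longrightarrow> jw \<delta> n g \<Longrightarrow> f = g"
  using jw_absorb[of \<delta> n f g] jw_absorb_left[of \<delta> n g f] by (simp add: jw_def)

section \<open>Temperley-Lieb generators and the Wenzl recursion\<close>

lemma tl_gen_eq:
  assumes i: "i \<le> N"
  shows "cat_diag (cap_diag (N + 2) i) (cup_diag (N + 2) i) \<in> diagrams (N + 2) (N + 2)"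
    and "dg (cat_diag (cap_diag (N + 2) i) (cup_diag (N + 2) i)) =
      tl_comp \<delta> (dg (cap_diag (N + 2) i)) (dg (cup_diag (N + 2) i))"
proof -
  show "cat_diag (cap_diag (N + 2) i) (cup_diag (N + 2) i) \<in> diagrams (N + 2) (N + 2)"
    by (rule cat_diagrams[OF cap_diag_in[OF i] cup_diag_in[OF i]])
  show "dg (cat_diag (cap_diag (N + 2) i) (cup_diag (N + 2) i)) =
      tl_comp \<delta> (dg (cap_diag (N + 2) i)) (dg (cup_diag (N + 2) i))"
    unfolding tl_comp_single cat_cap_diag(2)[OF i cup_diag_in[OF i]] by simp
qed

text \<open>The usual generator \<open>U_i\<close> on N + 2 strands, so that i runs from 0 to
  N.\<close>

definition tl_gen :: "nat \<Rightarrow> nat \<Rightarrow> 'k::comm_ring_1 mor" where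
  "tl_gen N i = dg (cat_diag (cap_diag (N + 2) i) (cup_diag (N + 2) i))"

lemma tl_gen_in: "i \<le> N \<Longrightarrow> tl_gen N i \<in> Hom (N + 2) (N + 2)"
  unfolding tl_gen_def by (rule Hom_single[OF tl_gen_eq(1)])

lemma cup_cap:
  assumes i: "i \<le> N"
  shows "tl_comp \<delta> (dg (cup_diag (N + 2) i)) (dg (cap_diag (N + 2) i)) = tl_scale \<delta> (dg (id_diag N))"
  using cat_cup_ins_cap[OF i id_diag_in] unfolding tl_comp_single cap_diag_eq[OF i] by simp

lemma tl_gen_sq:
  assumes i: "i \<le> N"
  shows "tl_comp \<delta> (tl_gen N i) (tl_gen N i) = tl_scale \<delta> (tl_gen N i)"
proof -
  let ?c = "dg (cap_diag (N + 2) i)" and ?d = "dg (cup_diag (N + 2) i)"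
  note c = dg_cap_in[OF i] and d = dg_cup_in[OF i]
  have "tl_comp \<delta> (tl_comp \<delta> ?c ?d) (tl_comp \<delta> ?c ?d) = tl_comp \<delta> ?c (tl_comp \<delta> (tl_comp \<delta> ?d ?c) ?d)"
    unfolding tl_comp_assoc[OF c d tl_comp_in[OF c d]] tl_comp_assoc[OF d c d] ..
  then show ?thesis
    unfolding tl_gen_def tl_gen_eq(2)[OF i, of \<delta>] cup_cap[OF i] tl_comp_scale_left tl_comp_scale_right
      tl_comp_id_left[OF d] .
qed

text \<open>Written out in caps and cups, the two inner cup-cap pairs straighten to identities by
  \<open>zigzag\<close>.\<close>

lemma tl_gen_braid:
  assumes i: "i < N"
  shows "tl_comp \<delta> (tl_gen N (Suc i)) (tl_comp \<delta> (tl_gen N i) (tl_gen N (Suc i))) = tl_gen N (Suc i)"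
proof -
  have i': "i \<le> N" "Suc i \<le> N" using i by auto
  let ?c = "dg (cap_diag (N + 2) i)" and ?d = "dg (cup_diag (N + 2) i)"
  let ?c' = "dg (cap_diag (N + 2) (Suc i))" and ?d' = "dg (cup_diag (N + 2) (Suc i))"
  note c = dg_cap_in[OF i'(1)] and d = dg_cup_in[OF i'(1)] and c' = dg_cap_in[OF i'(2)] and d' = dg_cup_in[OF i'(2)]
  have "tl_comp \<delta> (tl_comp \<delta> ?c' ?d') (tl_comp \<delta> (tl_comp \<delta> ?c ?d) (tl_comp \<delta> ?c' ?d'))
      = tl_comp \<delta> ?c' (tl_comp \<delta> (tl_comp \<delta> ?d' ?c) (tl_comp \<delta> (tl_comp \<delta> ?d ?c') ?d'))"
    unfolding tl_comp_assoc[OF c' d' tl_comp_in[OF c tl_comp_in[OF d tl_comp_in[OF c' d']]]]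
      tl_comp_assoc[OF c d tl_comp_in[OF c' d']] tl_comp_assoc[OF d c' d']
      tl_comp_assoc[OF d' c tl_comp_in[OF d tl_comp_in[OF c' d']]] ..
  moreover have "tl_comp \<delta> ?d' ?c = dg (id_diag N)" "tl_comp \<delta> ?d ?c' = dg (id_diag N)"
    unfolding tl_comp_single zigzag[OF i] by simp_all
  ultimately show ?thesis
    unfolding tl_gen_def tl_gen_eq(2)[OF i'(1), of \<delta>] tl_gen_eq(2)[OF i'(2), of \<delta>]
    by (simp only: tl_comp_id_left[OF d'])
qed

lemma tensor_dg: "tensor n m (dg D) (dg E) = dg (tensor_diag n m D E)"
  by (simp add: tensor_single)

text \<open>The generators act on disjoint blocks of strands, the lowest i + 2 ones and the rest, so
  both products are the same juxtaposition.\<close>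

lemma tl_gen_far:
  assumes ij: "i + 2 \<le> j" "j \<le> N"
  shows "tl_comp \<delta> (tl_gen N j) (tl_gen N i) = tl_comp \<delta> (tl_gen N i) (tl_gen N j)"
proof -
  obtain j' where j': "j = (i + 2) + j'" using ij le_Suc_ex by blast
  define b where "b = N - i - 2"
  have b: "N + 2 = (i + 2) + (b + 2)" "j' \<le> b" using ij j' by (auto simp: b_def)
  let ?u = "cap_diag (i + 2) i" and ?v = "cap_diag (b + 2) j'"
  have L: "cap_diag (N + 2) i = tensor_diag (i + 2) i ?u (id_diag (b + 2))"
    unfolding b(1) by (rule cap_diag_tensor_left) simp
  have R: "cap_diag (N + 2) j = tensor_diag (i + 2) (i + 2) (id_diag (i + 2)) ?v"
    unfolding b(1) j' by (rule cap_diag_tensor_right[OF b(2)])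
  have u: "?u \<in> diagrams (i + 2) i" by (rule cap_diag_in) simp
  have v: "?v \<in> diagrams (b + 2) b" by (rule cap_diag_in[OF b(2)])
  define U :: "'a mor" where "U = tl_comp \<delta> (dg ?u) (dg (refl_diag ?u))"
  define V :: "'a mor" where "V = tl_comp \<delta> (dg ?v) (dg (refl_diag ?v))"
  have UH: "U \<in> Hom (i + 2) (i + 2)" and VH: "V \<in> Hom (b + 2) (b + 2)"
    unfolding U_def V_def
    by (rule tl_comp_in[OF Hom_single[OF u] Hom_single[OF refl_diag_in[OF u]]],
        rule tl_comp_in[OF Hom_single[OF v] Hom_single[OF refl_diag_in[OF v]]])
  have i: "i \<le> N" using ij by simp
  have "tl_gen N i = tl_comp \<delta> (tensor (i + 2) i (dg ?u) (dg (id_diag (b + 2))))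
      (tensor i (i + 2) (dg (refl_diag ?u)) (dg (id_diag (b + 2))))"
    unfolding tl_gen_def tl_gen_eq(2)[OF i, of \<delta>]
    unfolding L refl_tensor[OF u id_diag_in] tensor_dg refl_id ..
  also have "\<dots> = tensor (i + 2) (i + 2) U (dg (id_diag (b + 2)))"
    unfolding U_def tensor_comp[OF Hom_single[OF u] Hom_single[OF id_diag_in] Hom_single[OF refl_diag_in[OF u]] Hom_single[OF id_diag_in]]
      tl_comp_id_left[OF Hom_single[OF id_diag_in]] ..
  finally have gi: "tl_gen N i = tensor (i + 2) (i + 2) U (dg (id_diag (b + 2)))" .
  have "tl_gen N j = tl_comp \<delta> (tensor (i + 2) (i + 2) (dg (id_diag (i + 2))) (dg ?v))
      (tensor (i + 2) (i + 2) (dg (id_diag (i + 2))) (dg (refl_diag ?v)))"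
    unfolding tl_gen_def tl_gen_eq(2)[OF ij(2), of \<delta>]
    unfolding R refl_tensor[OF id_diag_in v] tensor_dg refl_id ..
  also have "\<dots> = tensor (i + 2) (i + 2) (dg (id_diag (i + 2))) V"
    unfolding V_def tensor_comp[OF Hom_single[OF id_diag_in] Hom_single[OF v] Hom_single[OF id_diag_in] Hom_single[OF refl_diag_in[OF v]]]
      tl_comp_id_left[OF Hom_single[OF id_diag_in]] ..
  finally have gj: "tl_gen N j = tensor (i + 2) (i + 2) (dg (id_diag (i + 2))) V" .
  note I = Hom_single[OF id_diag_in]
  show ?thesis
    unfolding gi gj tensor_comp[OF I VH UH I] tensor_comp[OF UH I I VH]
      tl_comp_id_left[OF UH] tl_comp_id_left[OF VH] tl_comp_id_right[OF UH] tl_comp_id_right[OF VH] ..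
qed

text \<open>The Wenzl recursion inside a fixed Hom(N + 2, N + 2): g is the Jones-Wenzl element on j
  + 1 strands and h the one on j strands, both extended by identity strands. The induction also has
  to carry that they commute with the later generators, and the value of \<open>U_j g U_j\<close>,
  which expresses the partial trace of g by h.\<close>

lemma jw_exists_aux:
  fixes \<delta> :: "'k::field"
  assumes q: "\<And>k. 0 < k \<Longrightarrow> qnum \<delta> k \<noteq> 0"
  shows "j \<le> N + 1 \<Longrightarrow> \<exists>g\<in>Hom (N + 2) (N + 2). \<exists>h\<in>Hom (N + 2) (N + 2). lk g (id_diag (N + 2)) = 1 \<and>
    (\<forall>i<j. tl_comp \<delta> g (tl_gen N i) = 0 \<and> tl_comp \<delta> (tl_gen N i) g = 0) \<and>
    (\<forall>i. j < i \<and> i \<le> N \<longrightarrow> tl_comp \<delta> g (tl_gen N i) = tl_comp \<delta> (tl_gen N i) g) \<and>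
    (j \<le> N \<longrightarrow> tl_comp \<delta> h (tl_gen N j) = tl_comp \<delta> (tl_gen N j) h) \<and>
    tl_comp \<delta> g g = g \<and> tl_comp \<delta> h g = g \<and> tl_comp \<delta> g h = g \<and>
    (j \<le> N \<longrightarrow> tl_comp \<delta> (tl_gen N j) (tl_comp \<delta> g (tl_gen N j)) =
      tl_scale (qnum \<delta> (j + 2) / qnum \<delta> (j + 1)) (tl_comp \<delta> h (tl_gen N j)))"
proof (induction j)
  case 0
  let ?I = "dg (id_diag (N + 2)) :: 'k mor"
  have I: "?I \<in> Hom (N + 2) (N + 2)" by (rule Hom_single[OF id_diag_in])
  note l = tl_comp_id_left[OF tl_gen_in[of _ N]] and r = tl_comp_id_right[OF tl_gen_in[of _ N]]
  have 1: "lk ?I (id_diag (N + 2)) = 1" by simp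
  have 2: "tl_comp \<delta> ?I ?I = ?I" by (rule tl_comp_id_left[OF I])
  have 3: "tl_comp \<delta> (tl_gen N 0) (tl_comp \<delta> ?I (tl_gen N 0)) =
      tl_scale (qnum \<delta> (0 + 2) / qnum \<delta> (0 + 1)) (tl_comp \<delta> ?I (tl_gen N 0))"
    unfolding l[OF le0] tl_gen_sq[OF le0] by (simp add: numeral_2_eq_2)
  have 4: "tl_comp \<delta> ?I (tl_gen N i) = tl_comp \<delta> (tl_gen N i) ?I" if "i \<le> N" for i
    unfolding l[OF that] r[OF that] ..
  show ?case
  proof (intro bexI[of _ ?I, OF _ I] conjI allI impI)
    show "tl_comp \<delta> ?I (tl_gen N i) = tl_comp \<delta> (tl_gen N i) ?I" if "0 < i \<and> i \<le> N" for i
      using 4 that by blast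
  qed (use 1 2 3 4 in blast)+
next
  case (Suc j)
  then have j: "j \<le> N" by simp
  let ?U = "tl_gen N :: nat \<Rightarrow> 'k mor"
  let ?H = "Hom (N + 2) (N + 2) :: 'k mor set"
  obtain g h where gH: "g \<in> ?H" and hH: "h \<in> ?H" and g1: "lk g (id_diag (N + 2)) = 1"
    and gk: "\<And>i. i < j \<Longrightarrow> tl_comp \<delta> g (?U i) = 0" "\<And>i. i < j \<Longrightarrow> tl_comp \<delta> (?U i) g = 0"
    and gc: "\<And>i. j < i \<Longrightarrow> i \<le> N \<Longrightarrow> tl_comp \<delta> g (?U i) = tl_comp \<delta> (?U i) g"
    and hc: "tl_comp \<delta> h (?U j) = tl_comp \<delta> (?U j) h"
    and gg: "tl_comp \<delta> g g = g" and hg: "tl_comp \<delta> h g = g" and gh: "tl_comp \<delta> g h = g"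
    and ugu: "tl_comp \<delta> (?U j) (tl_comp \<delta> g (?U j)) = tl_scale (qnum \<delta> (j + 2) / qnum \<delta> (j + 1)) (tl_comp \<delta> h (?U j))"
    using Suc.IH[OF less_imp_le] Suc.prems j by (auto simp: Ball_def Bex_def)
  note A = tl_comp_assoc[of _ "N + 2" "N + 2" _ "N + 2" _ "N + 2"]
  note cl = tl_comp_in[of _ "N + 2" "N + 2" _ "N + 2"]
  have U: "?U i \<in> ?H" if "i \<le> N" for i by (rule tl_gen_in[OF that])
  have Uj: "?U j \<in> ?H" by (rule U[OF j])
  \<comment> \<open>The factor of the Wenzl recursion, inverse to the partial trace factor of g;
    this makes the corrected element vanish against \<open>U_j\<close>.\<close>
  define c where "c = qnum \<delta> (j + 1) / qnum \<delta> (j + 2)"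
  have c: "c * (qnum \<delta> (j + 2) / qnum \<delta> (j + 1)) = 1" using q[of "j + 1"] q[of "j + 2"] by (simp add: c_def)
  define w where "w = tl_comp \<delta> g (tl_comp \<delta> (?U j) g)"
  have wH: "w \<in> ?H" unfolding w_def by (intro cl gH Uj)
  define g' where "g' = g - tl_scale c w"
  have g'H: "g' \<in> ?H" unfolding g'_def by (intro Hom_diff Hom_scale gH wH)
  \<comment> \<open>w factors through N strands, so it has no identity component and the
    normalisation is kept.\<close>
  have w0: "lk w (id_diag (N + 2)) = 0"
  proof -
    let ?c = "dg (cap_diag (N + 2) j) :: 'k mor" and ?d = "dg (cup_diag (N + 2) j) :: 'k mor"
    note c = dg_cap_in[OF j, where 'a = 'k] and d = dg_cup_in[OF j, where 'a = 'k]
    have "w = tl_comp \<delta> (tl_comp \<delta> g ?c) (tl_comp \<delta> ?d g)"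
      unfolding w_def tl_gen_def tl_gen_eq(2)[OF j, of \<delta>] tl_comp_assoc[OF c d gH]
        tl_comp_assoc[OF gH c tl_comp_in[OF d gH]] ..
    then show ?thesis
      using lookup_comp_id_eq_0[OF tl_comp_in[OF gH c] tl_comp_in[OF d gH]] by simp
  qed
  have wg: "tl_comp \<delta> w g = w" "tl_comp \<delta> g w = w"
    unfolding w_def
    by (simp only: A[OF gH cl[OF Uj gH] gH] A[OF Uj gH gH] gg)
      (simp only: A[OF gH gH cl[OF Uj gH], symmetric] gg)
  have g'g: "tl_comp \<delta> g' g = g'" "tl_comp \<delta> g g' = g'"
    unfolding g'_def by (simp_all add: tl_comp_diff_left tl_comp_diff_right tl_comp_scale_left tl_comp_scale_right wg gg)
  have wU: "tl_comp \<delta> w (?U i) = tl_comp \<delta> g (tl_comp \<delta> (?U j) (tl_comp \<delta> g (?U i)))"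
    and Uw: "tl_comp \<delta> (?U i) w = tl_comp \<delta> (tl_comp \<delta> (?U i) g) (tl_comp \<delta> (?U j) g)" if "i \<le> N" for i
    unfolding w_def using A[OF gH cl[OF Uj gH] U[OF that]] A[OF Uj gH U[OF that]] A[OF U[OF that] gH cl[OF Uj gH]]
    by simp_all
  have kl: "tl_comp \<delta> g' (?U i) = 0" "tl_comp \<delta> (?U i) g' = 0" if "i < Suc j" for i
  proof -
    have i: "i \<le> N" using that j by simp
    show "tl_comp \<delta> g' (?U i) = 0"
    proof (cases "i = j")
      case True
      have "tl_comp \<delta> w (?U j) = tl_scale (qnum \<delta> (j + 2) / qnum \<delta> (j + 1)) (tl_comp \<delta> (tl_comp \<delta> g h) (?U j))"
        unfolding wU[OF j] ugu tl_comp_scale_right A[OF gH hH Uj] ..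
      then have "tl_scale c (tl_comp \<delta> w (?U j)) = tl_comp \<delta> g (?U j)" unfolding gh by (simp only: TL.scale_scale c TL.scale_one)
      then show ?thesis unfolding True g'_def tl_comp_diff_left tl_comp_scale_left by simp
    next
      case False
      then have "i < j" using that by simp
      then show ?thesis unfolding g'_def tl_comp_diff_left tl_comp_scale_left wU[OF i] gk(1)[OF \<open>i < j\<close>] by simp
    qed
    show "tl_comp \<delta> (?U i) g' = 0"
    proof (cases "i = j")
      case True
      have "tl_comp \<delta> (?U j) w = tl_comp \<delta> (tl_comp \<delta> (?U j) (tl_comp \<delta> g (?U j))) g"
        unfolding w_def A[OF Uj cl[OF gH Uj] gH] A[OF gH Uj gH] ..
      also have "\<dots> = tl_scale (qnum \<delta> (j + 2) / qnum \<delta> (j + 1)) (tl_comp \<delta> (?U j) g)"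
        unfolding ugu tl_comp_scale_left hc A[OF Uj hH gH] hg ..
      finally have "tl_scale c (tl_comp \<delta> (?U j) w) = tl_comp \<delta> (?U j) g"
        by (simp only: TL.scale_scale c TL.scale_one)
      then show ?thesis unfolding True g'_def tl_comp_diff_right tl_comp_scale_right by simp
    next
      case False
      then have "i < j" using that by simp
      then show ?thesis unfolding g'_def tl_comp_diff_right tl_comp_scale_right Uw[OF i] gk(2)[OF \<open>i < j\<close>] by simp
    qed
  qed
  have comm: "tl_comp \<delta> g' (?U i) = tl_comp \<delta> (?U i) g'" if "Suc j < i" "i \<le> N" for i
  proof -
    have "tl_comp \<delta> w (?U i) = tl_comp \<delta> (?U i) w"
    proof -
      have gi: "tl_comp \<delta> g (?U i) = tl_comp \<delta> (?U i) g" using gc that by simp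
      have uu: "tl_comp \<delta> (?U i) (?U j) = tl_comp \<delta> (?U j) (?U i)" using tl_gen_far[of j i N \<delta>] that by simp
      note Ui = U[OF that(2)]
      have "tl_comp \<delta> w (?U i) = tl_comp \<delta> g (tl_comp \<delta> (tl_comp \<delta> (?U j) (?U i)) g)"
        unfolding wU[OF that(2)] gi A[OF Uj Ui gH] ..
      also have "\<dots> = tl_comp \<delta> (tl_comp \<delta> g (?U i)) (tl_comp \<delta> (?U j) g)"
        unfolding uu[symmetric] A[OF Ui Uj gH] A[OF gH Ui cl[OF Uj gH]] ..
      also have "\<dots> = tl_comp \<delta> (?U i) w" unfolding gi Uw[OF that(2)] ..
      finally show ?thesis .
    qed
    then show ?thesis
      unfolding g'_def tl_comp_diff_left tl_comp_diff_right tl_comp_scale_left tl_comp_scale_right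
      using gc that by simp
  qed
  have idem: "tl_comp \<delta> g' g' = g'"
  proof -
    have "tl_comp \<delta> g' w = tl_comp \<delta> (tl_comp \<delta> (tl_comp \<delta> g' g) (?U j)) g"
      unfolding w_def using A[OF g'H gH cl[OF Uj gH]] A[OF cl[OF g'H gH] Uj gH] by simp
    then have "tl_comp \<delta> g' w = 0" unfolding g'g kl(1)[OF lessI] by simp
    then have "tl_comp \<delta> g' (g - tl_scale c w) = g'"
      unfolding tl_comp_diff_right tl_comp_scale_right g'g(1) by simp
    then show ?thesis unfolding g'_def[symmetric] .
  qed
  have next_step: "tl_comp \<delta> (?U (Suc j)) (tl_comp \<delta> g' (?U (Suc j))) =
      tl_scale (qnum \<delta> (Suc j + 2) / qnum \<delta> (Suc j + 1)) (tl_comp \<delta> g (?U (Suc j)))" if sj: "Suc j \<le> N"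
  proof -
    let ?V = "?U (Suc j)"
    note V = U[OF sj]
    have gV: "tl_comp \<delta> g ?V = tl_comp \<delta> ?V g" using gc sj by simp
    have VV: "tl_comp \<delta> ?V ?V = tl_scale \<delta> ?V" by (rule tl_gen_sq[OF sj])
    have VUV: "tl_comp \<delta> ?V (tl_comp \<delta> (?U j) ?V) = ?V" by (rule tl_gen_braid) (use sj in simp)
    have 1: "tl_comp \<delta> ?V (tl_comp \<delta> g ?V) = tl_scale \<delta> (tl_comp \<delta> g ?V)"
    proof -
      have "tl_comp \<delta> ?V (tl_comp \<delta> g ?V) = tl_comp \<delta> (tl_comp \<delta> g ?V) ?V"
        unfolding gV[symmetric] A[OF V gH V, symmetric] ..
      then show ?thesis unfolding A[OF gH V V] VV tl_comp_scale_right .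
    qed
    have 2: "tl_comp \<delta> ?V (tl_comp \<delta> w ?V) = tl_comp \<delta> g ?V"
    proof -
      have "tl_comp \<delta> w ?V = tl_comp \<delta> g (tl_comp \<delta> (?U j) (tl_comp \<delta> ?V g))"
        unfolding wU[OF sj] gV ..
      then have "tl_comp \<delta> ?V (tl_comp \<delta> w ?V) =
          tl_comp \<delta> (tl_comp \<delta> ?V g) (tl_comp \<delta> (?U j) (tl_comp \<delta> ?V g))"
        unfolding A[OF V gH cl[OF Uj cl[OF V gH]]] by simp
      also have "\<dots> = tl_comp \<delta> g (tl_comp \<delta> (tl_comp \<delta> ?V (tl_comp \<delta> (?U j) ?V)) g)"
        unfolding gV[symmetric] A[OF gH V cl[OF Uj cl[OF gH V]]]
        unfolding gV A[OF V cl[OF Uj V] gH] A[OF Uj V gH] ..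
      also have "\<dots> = tl_comp \<delta> (tl_comp \<delta> g g) ?V"
        unfolding VUV gV[symmetric] A[OF gH gH V] ..
      finally show ?thesis unfolding gg .
    qed
    \<comment> \<open>The recursion \<open>[j+3] = \<delta> [j+2] - [j+1]\<close> divided by
      \<open>[j+2]\<close>.\<close>
    have "\<delta> - c = qnum \<delta> (Suc j + 2) / qnum \<delta> (Suc j + 1)"
      using q[of "j + 2"] by (simp add: c_def field_simps)
    moreover have "tl_comp \<delta> ?V (tl_comp \<delta> g' ?V) = tl_scale (\<delta> - c) (tl_comp \<delta> g ?V)"
      unfolding g'_def tl_comp_diff_left tl_comp_diff_right tl_comp_scale_left tl_comp_scale_right 1 2
      by (simp add: TL.scale_left_diff_distrib)
    ultimately show ?thesis by simp
  qed
  have lk': "lk g' (id_diag (N + 2)) = 1" unfolding g'_def lookup_minus lookup_tl_scale w0 g1 by simp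
  show ?case
  proof (rule bexI[OF _ g'H], rule bexI[OF _ gH], intro conjI allI impI)
    show "tl_comp \<delta> g (?U (Suc j)) = tl_comp \<delta> (?U (Suc j)) g" if "Suc j \<le> N" using gc that by simp
  qed (use lk' kl comm idem g'g next_step in blast)+
qed

lemma jw_exists:
  fixes \<delta> :: "'k::field"
  assumes q: "\<And>k. 0 < k \<Longrightarrow> qnum \<delta> k \<noteq> 0"
  shows "\<exists>f. jw \<delta> n f"
proof (cases "n < 2")
  case True
  have "jw \<delta> n (dg (id_diag n))" using True by (simp add: jw_def Hom_single)
  then show ?thesis ..
next
  case False
  then obtain N where n: "n = N + 2" using le_Suc_ex by (metis add.commute not_less)
  obtain g where g: "g \<in> Hom (N + 2) (N + 2)" "lk g (id_diag (N + 2)) = 1"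
    "\<And>i. i < N + 1 \<Longrightarrow> tl_comp \<delta> g (tl_gen N i) = 0" "\<And>i. i < N + 1 \<Longrightarrow> tl_comp \<delta> (tl_gen N i) g = 0"
    using jw_exists_aux[OF q, of "N + 1" N] by blast
  \<comment> \<open>Here \<delta> is \<open>[2]\<close>. Since a cup followed by a cap is \<delta>
    times an identity, dividing by \<delta> passes from killing the generators to killing the caps
    and cups.\<close>
  have d0: "\<delta> \<noteq> 0" using q[of 2] by (simp add: numeral_2_eq_2)
  have "tl_comp \<delta> g (dg (cap_diag (N + 2) i)) = 0 \<and> tl_comp \<delta> (dg (cup_diag (N + 2) i)) g = 0" if "i < N + 1" for i
  proof
    have i: "i \<le> N" using that by simp
    let ?c = "dg (cap_diag (N + 2) i) :: 'k mor" and ?d = "dg (cup_diag (N + 2) i) :: 'k mor"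
    note c = dg_cap_in[OF i, where 'a = 'k] and d = dg_cup_in[OF i, where 'a = 'k]
    have Ue: "tl_gen N i = tl_comp \<delta> ?c ?d" unfolding tl_gen_def by (rule tl_gen_eq(2)[OF i])
    have cancel: "x = 0" if "tl_scale \<delta> x = 0" for x :: "'k mor"
      using that d0 by (metis TL.scale_one TL.scale_scale TL.scale_zero_right left_inverse)
    have "tl_comp \<delta> (tl_comp \<delta> g (tl_gen N i)) ?c = tl_scale \<delta> (tl_comp \<delta> g ?c)"
      unfolding Ue tl_comp_assoc[OF g(1) tl_comp_in[OF c d] c] tl_comp_assoc[OF c d c] cup_cap[OF i]
        tl_comp_scale_right tl_comp_id_right[OF c] ..
    then show "tl_comp \<delta> g ?c = 0" using cancel g(3)[OF that] by simp
    have "tl_comp \<delta> ?d (tl_comp \<delta> (tl_gen N i) g) = tl_scale \<delta> (tl_comp \<delta> ?d g)"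
      unfolding Ue tl_comp_assoc[OF d tl_comp_in[OF c d] g(1), symmetric] tl_comp_assoc[OF d c d, symmetric] cup_cap[OF i]
        tl_comp_scale_left tl_comp_id_left[OF d] ..
    then show "tl_comp \<delta> ?d g = 0" using cancel g(4)[OF that] by simp
  qed
  then have "jw \<delta> n g" using g unfolding jw_def n by simp
  then show ?thesis ..
qed

subsection \<open>Spin states\<close>

text \<open>The cap of quantum \<open>sl_2\<close>, with \<open>True\<close> for spin up, normalised
  without signs. Against the cup weights 1 for up-down and \<open>qi\<close> for down-up it gives
  the loop value \<open>q + qi\<close>.\<close>

definition cap_wt :: "'a::comm_ring_1 \<Rightarrow> bool \<Rightarrow> bool \<Rightarrow> 'a" where
  "cap_wt q a b = (if a \<and> \<not> b then q else if \<not> a \<and> b then 1 else 0)"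

definition block_wt :: "'a::comm_ring_1 \<Rightarrow> bool list \<Rightarrow> nat set \<Rightarrow> 'a" where
  "block_wt q zs X = cap_wt q (zs ! Min X) (zs ! Max X)"

text \<open>The matrix coefficients of a diagram acting on tensor powers of the natural representation
  of quantum \<open>sl\<^sub>2\<close>. All strands are treated as caps in the order of the boundary points, so
  spins of targets are reversed and the values are normalised by a power of \<open>q\<close>.\<close>

definition spin :: "'a::comm_ring_1 \<Rightarrow> nat \<Rightarrow> nat \<Rightarrow> bool list \<Rightarrow> diagram \<Rightarrow> 'a" where
  "spin q n m zs D = (\<Prod>B\<in>D. block_wt q zs (bpos n m ` B))"

lemma block_finite: "D \<in> diagrams n m \<Longrightarrow> B \<in> D \<Longrightarrow> finite B \<and> B \<noteq> {}"
  using diag_card2[of D n m B] by (metis card.empty card.infinite zero_neq_numeral)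

lemma skip2_mono: "mono (skip2 i)" by (auto simp: mono_def)

lemma nth_skip2:
  "length us = i \<Longrightarrow> (us @ a # b # vs) ! skip2 i k = (us @ vs) ! k"
  by (auto simp: nth_append)

lemma block_wt_skip2:
  assumes "finite X" "X \<noteq> {}" "length us = i"
  shows "block_wt q (us @ a # b # vs) (skip2 i ` X) = block_wt q (us @ vs) X"
proof -
  have "Min (skip2 i ` X) = skip2 i (Min X)" "Max (skip2 i ` X) = skip2 i (Max X)"
    using mono_Min_commute[OF skip2_mono assms(1,2)] mono_Max_commute[OF skip2_mono assms(1,2)] by simp_all
  then show ?thesis unfolding block_wt_def by (simp only: nth_skip2[OF assms(3)])
qed

lemma spin_skip2:
  assumes i: "i \<le> n" "length us = i" and D: "\<And>B. B \<in> D \<Longrightarrow> B \<subseteq> points n m \<and> B \<noteq> {}"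
  shows "(\<Prod>B\<in>(`) (skip2_pt i) ` D. block_wt q (us @ a # b # vs) (bpos (n + 2) m ` B)) =
    (\<Prod>B\<in>D. block_wt q (us @ vs) (bpos n m ` B))"
proof -
  have "inj_on ((`) (skip2_pt i)) D"
    using inj_skip2_pt by (metis inj_image_eq_iff inj_onI)
  then have "(\<Prod>B\<in>(`) (skip2_pt i) ` D. block_wt q (us @ a # b # vs) (bpos (n + 2) m ` B)) =
      (\<Prod>B\<in>D. block_wt q (us @ a # b # vs) (bpos (n + 2) m ` skip2_pt i ` B))"
    by (subst prod.reindex) simp_all
  also have "\<dots> = (\<Prod>B\<in>D. block_wt q (us @ vs) (bpos n m ` B))"
  proof (rule prod.cong[OF refl])
    fix B assume B: "B \<in> D"
    have "bpos (n + 2) m (skip2_pt i x) = skip2 i (bpos n m x)" if "x \<in> B" for x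
      using bpos_skip2_pt[of x n m i] D[OF B] that i by blast
    then have "bpos (n + 2) m ` skip2_pt i ` B = skip2 i ` bpos n m ` B"
      unfolding image_image by (rule image_cong[OF refl])
    moreover have "finite B" using D[OF B] finite_points finite_subset by blast
    ultimately show "block_wt q (us @ a # b # vs) (bpos (n + 2) m ` skip2_pt i ` B) = block_wt q (us @ vs) (bpos n m ` B)"
      using block_wt_skip2[OF _ _ i(2), of "bpos n m ` B"] D[OF B] by simp
  qed
  finally show ?thesis .
qed

lemma spin_ins_cap:
  assumes D: "D \<in> diagrams n m" and i: "i \<le> n" "length us = i"
  shows "spin q (n + 2) m (us @ a # b # vs) (ins_cap i D) = cap_wt q a b * spin q n m (us @ vs) D"
proof -
  have sub: "B \<subseteq> points n m \<and> B \<noteq> {}" if "B \<in> D" for B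
    using that diag_Union[OF D] block_finite[OF D] by blast
  have "{(0, i), (0, i + 1)} \<notin> (`) (skip2_pt i) ` D"
  proof
    assume "{(0, i), (0, i + 1)} \<in> (`) (skip2_pt i) ` D"
    then have "(0, i) \<in> range (skip2_pt i)" by blast
    then show False by (auto simp: skip2_pt_def split: if_splits)
  qed
  moreover have "finite ((`) (skip2_pt i) ` D)" using diag_finite[OF D] by simp
  ultimately have "spin q (n + 2) m (us @ a # b # vs) (ins_cap i D) =
      block_wt q (us @ a # b # vs) (bpos (n + 2) m ` {(0, i), (0, i + 1)}) *
      (\<Prod>B\<in>(`) (skip2_pt i) ` D. block_wt q (us @ a # b # vs) (bpos (n + 2) m ` B))"
    unfolding spin_def ins_cap_def by (subst prod.insert) simp_all
  also have "block_wt q (us @ a # b # vs) (bpos (n + 2) m ` {(0, i), (0, i + 1)}) = cap_wt q a b"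
    using i by (simp add: block_wt_def nth_append)
  also have "(\<Prod>B\<in>(`) (skip2_pt i) ` D. block_wt q (us @ a # b # vs) (bpos (n + 2) m ` B)) = spin q n m (us @ vs) D"
    unfolding spin_def by (rule spin_skip2[OF i]) (rule sub)
  finally show ?thesis .
qed

text \<open>Straightening on the level of spins, one equation for each planar position of the two
  strands met by a cup.\<close>

lemma cap_wt_zigzag:
  assumes "q * qi = (1 :: 'a::comm_ring_1)"
  shows "cap_wt q \<alpha> True * cap_wt q False \<beta> + qi * (cap_wt q \<alpha> False * cap_wt q True \<beta>) = cap_wt q \<alpha> \<beta>"
    and "cap_wt q \<alpha> True * cap_wt q \<beta> False + qi * (cap_wt q \<alpha> False * cap_wt q \<beta> True) = cap_wt q \<beta> \<alpha>"
    and "cap_wt q True \<alpha> * cap_wt q False \<beta> + qi * (cap_wt q False \<alpha> * cap_wt q True \<beta>) = cap_wt q \<beta> \<alpha>"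
proof -
  have "qi * q = 1" "qi * (q * q) = q" using assms by (simp_all add: mult.commute mult.assoc[symmetric])
  then show "cap_wt q \<alpha> True * cap_wt q False \<beta> + qi * (cap_wt q \<alpha> False * cap_wt q True \<beta>) = cap_wt q \<alpha> \<beta>"
    "cap_wt q \<alpha> True * cap_wt q \<beta> False + qi * (cap_wt q \<alpha> False * cap_wt q \<beta> True) = cap_wt q \<beta> \<alpha>"
    "cap_wt q True \<alpha> * cap_wt q False \<beta> + qi * (cap_wt q False \<alpha> * cap_wt q True \<beta>) = cap_wt q \<beta> \<alpha>"
    by (cases \<alpha>; cases \<beta>; simp add: cap_wt_def)+
qed

lemma block_wt_pair: "x < y \<Longrightarrow> block_wt q zs {x, y} = cap_wt q (zs ! x) (zs ! y)"
  "x < y \<Longrightarrow> block_wt q zs {y, x} = cap_wt q (zs ! x) (zs ! y)"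
  by (simp_all add: block_wt_def)

text \<open>Composition with a simple cup is summation over the spins of two neighbouring sources.
  If they are joined to each other, a loop splits off; otherwise two strands are merged and
  \<open>cap_wt_zigzag\<close> applies.\<close>

lemma spin_contract:
  assumes q: "q * qi = (1 :: 'a::comm_ring_1)" and D: "D \<in> diagrams (n + 2) m"
    and i: "i \<le> n" "length us = i"
  shows "spin q (n + 2) m (us @ True # False # vs) D + qi * spin q (n + 2) m (us @ False # True # vs) D =
    (q + qi) ^ loops (cup_diag (n + 2) i) D * spin q n m (us @ vs) (cat_diag (cup_diag (n + 2) i) D)"
proof (cases "{(0, i), (0, i + 1)} \<in> D")
  case True
  then obtain D' where D': "D' \<in> diagrams n m" "D = ins_cap i D'" using ins_cap_exists[OF D] by metis
  show ?thesis
    unfolding D'(2) cat_cup_ins_cap[OF i(1) D'(1)] spin_ins_cap[OF D'(1) i]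
    by (simp add: cap_wt_def distrib_right)
next
  case False
  let ?h = "skip2_pt i" and ?b = "bpos (n + 2) m"
  have pi: "(0, i) \<in> points (n + 2) m" "(0, i + 1) \<in> points (n + 2) m" using i by (auto simp: points_def)
  obtain x' where x': "{(0, i), x'} \<in> D" "x' \<in> points (n + 2) m" "(0, i) \<noteq> x'" by (rule diag_blockE[OF D pi(1)])
  obtain y' where y': "{(0, i + 1), y'} \<in> D" "y' \<in> points (n + 2) m" "(0, i + 1) \<noteq> y'" by (rule diag_blockE[OF D pi(2)])
  have x'i: "x' \<noteq> (0, i + 1)" using x'(1) False by auto
  have y'i: "y' \<noteq> (0, i)" using y'(1) False by (auto simp: insert_commute)
  have "x' \<in> ?h ` points n m" "y' \<in> ?h ` points n m"
    unfolding skip2_pt_points[OF i(1)] using x' y' x'i y'i by auto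
  then obtain x y where x: "x' = ?h x" "x \<in> points n m" and y: "y' = ?h y" "y \<in> points n m" by blast
  let ?B1 = "{?h x, (0, i)}" and ?B2 = "{?h y, (0, i + 1)}"
  have B: "?B1 \<in> D" "?B2 \<in> D" using x'(1) y'(1) x(1) y(1) by (simp_all add: insert_commute)
  have hi: "?h z \<noteq> (0, i)" "?h z \<noteq> (0, i + 1)" for z
    by (auto simp: skip2_pt_def split: prod.splits if_splits)
  have B12: "?B1 \<noteq> ?B2" using hi by (auto simp: doubleton_eq_iff)
  have xy: "x \<noteq> y"
  proof
    assume "x = y"
    then have "?B1 = ?B2" using diag_block_eq[OF D B, of "?h x"] by simp
    then show False using B12 by contradiction
  qed
  define D0 where "D0 = (\<lambda>X. ?h -` X) ` (D - {?B1, ?B2})"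
  have rest: "?h ` (?h -` X) = X" if X: "X \<in> D - {?B1, ?B2}" for X
  proof -
    have "(0, i) \<notin> X" "(0, i + 1) \<notin> X"
      using diag_block_eq[OF D B(1), of X "(0, i)"] diag_block_eq[OF D B(2), of X "(0, i + 1)"] X by auto
    moreover have "X \<subseteq> points (n + 2) m" using X diag_Union[OF D] by blast
    ultimately have "X \<subseteq> ?h ` points n m" unfolding skip2_pt_points[OF i(1)] by blast
    then show ?thesis by blast
  qed
  have D0': "(`) ?h ` D0 = D - {?B1, ?B2}" unfolding D0_def image_image using rest by simp
  have De: "D = insert ?B1 (insert ?B2 ((`) ?h ` D0))" unfolding D0' using B by blast
  have notin: "?B1 \<notin> (`) ?h ` D0" "?B2 \<notin> (`) ?h ` D0" unfolding D0' by auto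
  note cat = cat_cup_join[OF i(1) D De notin]
  have C: "insert {x, y} D0 \<in> diagrams n m"
    using cat_diagrams[OF cup_diag_in[OF i(1)] D] unfolding cat(1) .
  have xyD0: "{x, y} \<notin> D0"
  proof
    assume "{x, y} \<in> D0"
    then have "?h ` {x, y} \<in> D - {?B1, ?B2}" using D0' by blast
    then have "{?h x, ?h y} \<in> D" "{?h x, ?h y} \<noteq> ?B1" by auto
    then show False using diag_block_eq[OF D _ B(1), of "{?h x, ?h y}" "?h x"] by auto
  qed
  have sub: "X \<subseteq> points n m \<and> X \<noteq> {}" if "X \<in> D0" for X
    using that diag_Union[OF C] block_finite[OF C] by blast
  have fin: "finite D0" using diag_finite[OF C] by simp
  let ?R = "\<Prod>X\<in>D0. block_wt q (us @ vs) (bpos n m ` X)"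
  have spD: "spin q (n + 2) m (us @ a # b # vs) D =
      block_wt q (us @ a # b # vs) (?b ` ?B1) * (block_wt q (us @ a # b # vs) (?b ` ?B2) * ?R)" for a b
  proof -
    have "(\<Prod>B\<in>(`) ?h ` D0. block_wt q (us @ a # b # vs) (?b ` B)) = ?R"
      by (rule spin_skip2[OF i]) (rule sub)
    moreover have "spin q (n + 2) m (us @ a # b # vs) D = block_wt q (us @ a # b # vs) (?b ` ?B1) *
        (block_wt q (us @ a # b # vs) (?b ` ?B2) * (\<Prod>B\<in>(`) ?h ` D0. block_wt q (us @ a # b # vs) (?b ` B)))"
      unfolding spin_def by (subst De) (use B12 notin fin in simp)
    ultimately show ?thesis by simp
  qed
  have spC: "spin q n m (us @ vs) (insert {x, y} D0) = block_wt q (us @ vs) (bpos n m ` {x, y}) * ?R"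
    unfolding spin_def using xyD0 fin by (simp add: prod.insert)
  let ?X = "bpos n m x" and ?Y = "bpos n m y"
  have bX: "?b (?h x) = skip2 i ?X" and bY: "?b (?h y) = skip2 i ?Y"
    using bpos_skip2_pt x(2) y(2) i(1) by blast+
  have XY: "?X \<noteq> ?Y" using xy x(2) y(2) bpos_inj[of n m] unfolding inj_on_def by blast
  have img: "?b ` ?B1 = {skip2 i ?X, i}" "?b ` ?B2 = {skip2 i ?Y, i + 1}" using bX bY by simp_all
  have pl: "\<not> (?b a < ?b b' \<and> ?b b' < ?b c \<and> ?b c < ?b d)" if "{a, c} \<in> D" "{b', d} \<in> D" for a b' c d
    using that D unfolding diagrams_def planar_def by blast
  have B': "{(0, i), ?h x} \<in> D" "{(0, i + 1), ?h y} \<in> D" using B by (simp_all add: insert_commute)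
  have v: "(us @ a # b # vs) ! i = a" "(us @ a # b # vs) ! (i + 1) = b"
    "(us @ a # b # vs) ! skip2 i k = (us @ vs) ! k" for a b k
    using i(2) by (simp_all add: nth_append)
  let ?\<alpha> = "(us @ vs) ! ?X" and ?\<beta> = "(us @ vs) ! ?Y"
  \<comment> \<open>\<open>?X\<close> and \<open>?Y\<close> are the positions of the other ends of
    the strands at i and i + 1. Planarity leaves three orders: one end on either side, both to the
    left with \<open>?Y\<close> outermost, or both to the right with \<open>?X\<close>
    outermost.\<close>
  consider "?X < i" "i \<le> ?Y" | "?Y < ?X" "?X < i" | "i \<le> ?Y" "?Y < ?X"
  proof (cases "?X < i")
    case True
    show ?thesis
    proof (cases "i \<le> ?Y")
      case False
      have "\<not> ?X < ?Y" using pl[OF B(1) B(2)] False unfolding bX bY by auto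
      then show ?thesis using that(2) True XY by linarith
    qed (use that True in blast)
  next
    case False
    show ?thesis
    proof (cases "i \<le> ?Y")
      case True
      have "\<not> ?X < ?Y" using pl[OF B'] True False unfolding bX bY by auto
      then show ?thesis using that(3) True XY by linarith
    next
      case F: False
      have "False" using pl[OF B(2) B'(1)] F False unfolding bX bY by auto
      then show ?thesis ..
    qed
  qed
  then have "block_wt q (us @ True # False # vs) (?b ` ?B1) * block_wt q (us @ True # False # vs) (?b ` ?B2)
     + qi * (block_wt q (us @ False # True # vs) (?b ` ?B1) * block_wt q (us @ False # True # vs) (?b ` ?B2))
     = block_wt q (us @ vs) (bpos n m ` {x, y})"
  proof cases
    case 1
    have 2: "skip2 i ?X < i" "i + 1 < skip2 i ?Y" "?X < ?Y" using 1 by auto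
    show ?thesis
      unfolding img unfolding image_insert image_empty block_wt_pair(1)[OF 2(1)] block_wt_pair(2)[OF 2(2)] block_wt_pair(1)[OF 2(3)] v
      by (rule cap_wt_zigzag(1)[OF q])
  next
    case 2
    then have 3: "skip2 i ?X < i" "skip2 i ?Y < i + 1" "?Y < ?X" by auto
    show ?thesis
      unfolding img unfolding image_insert image_empty block_wt_pair(1)[OF 3(1)] block_wt_pair(1)[OF 3(2)] block_wt_pair(2)[OF 3(3)] v
      by (rule cap_wt_zigzag(2)[OF q])
  next
    case 3
    then have 4: "i < skip2 i ?X" "i + 1 < skip2 i ?Y" "?Y < ?X" by auto
    show ?thesis
      unfolding img unfolding image_insert image_empty block_wt_pair(2)[OF 4(1)] block_wt_pair(2)[OF 4(2)] block_wt_pair(2)[OF 4(3)] v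
      by (rule cap_wt_zigzag(3)[OF q])
  qed
  note key = this
  have "A1 * (A2 * R) + qi * (C1 * (C2 * R)) = (A1 * A2 + qi * (C1 * C2)) * R" for A1 A2 C1 C2 R :: 'a
    by (simp add: algebra_simps)
  then show ?thesis unfolding cat spD spC power_0 mult_1_left using key by simp
qed

definition Spin :: "'a::comm_ring_1 \<Rightarrow> nat \<Rightarrow> nat \<Rightarrow> bool list \<Rightarrow> 'a mor \<Rightarrow> 'a" where
  "Spin q n m zs x = (\<Sum>D\<in>diagrams n m. lk x D * spin q n m zs D)"

lemma Spin_add: "Spin q n m zs (x + y) = Spin q n m zs x + Spin q n m zs y"
  by (simp add: Spin_def lookup_add distrib_right sum.distrib)

lemma Spin_zero [simp]: "Spin q n m zs 0 = 0" by (simp add: Spin_def)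

lemma Spin_sum: "Spin q n m zs (sum f I) = (\<Sum>i\<in>I. Spin q n m zs (f i))"
  by (induction I rule: infinite_finite_induct) (simp_all add: Spin_add)

lemma Spin_scale: "Spin q n m zs (tl_scale c x) = c * Spin q n m zs x"
  by (simp add: Spin_def sum_distrib_left mult.assoc)

lemma Spin_single: "D \<in> diagrams n m \<Longrightarrow> Spin q n m zs (Poly_Mapping.single D c) = c * spin q n m zs D"
proof -
  assume D: "D \<in> diagrams n m"
  have "Spin q n m zs (Poly_Mapping.single D c) = (\<Sum>E\<in>diagrams n m. if E = D then c * spin q n m zs D else 0)"
    unfolding Spin_def by (intro sum.cong) (auto simp: lookup_single when_def)
  then show ?thesis using D by simp
qed

lemma Spin_contract:
  assumes q: "q * qi = (1 :: 'a::comm_ring_1)" and i: "i \<le> n" "length us = i" and x: "x \<in> Hom (n + 2) m"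
  shows "Spin q (n + 2) m (us @ True # False # vs) x + qi * Spin q (n + 2) m (us @ False # True # vs) x =
    Spin q n m (us @ vs) (tl_comp (q + qi) (dg (cup_diag (n + 2) i)) x)"
  using x
proof (induction x rule: Hom_induct)
  case (add x y)
  then show ?case by (simp add: Spin_add tl_comp_add_right distrib_left algebra_simps)
next
  case (single D c)
  have "Spin q (n + 2) m (us @ True # False # vs) (Poly_Mapping.single D c) +
      qi * Spin q (n + 2) m (us @ False # True # vs) (Poly_Mapping.single D c) =
      c * (spin q (n + 2) m (us @ True # False # vs) D + qi * spin q (n + 2) m (us @ False # True # vs) D)"
    unfolding Spin_single[OF single] by (simp add: algebra_simps)
  then show ?case
    unfolding spin_contract[OF q single i] tl_comp_single Spin_single[OF cat_diagrams[OF cup_diag_in[OF i(1)] single]]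
    by (simp add: mult.assoc)
qed simp

subsection \<open>Quantum symmetrisation\<close>

abbreviation ups :: "bool list \<Rightarrow> nat" where
  "ups xs \<equiv> count_list xs True"

abbreviation downs :: "bool list \<Rightarrow> nat" where
  "downs xs \<equiv> count_list xs False"

text \<open>The number of inversions of a spin word, that is, of pairs of a down and a later
  up.\<close>

fun hgt :: "bool list \<Rightarrow> nat" where
  "hgt [] = 0"
| "hgt (True # xs) = hgt xs"
| "hgt (False # xs) = ups xs + hgt xs"

lemma ups_downs: "ups xs + downs xs = length xs"
  by (induction xs) auto

lemma hgt_append: "hgt (xs @ ys) = hgt xs + hgt ys + downs xs * ups ys"
  by (induction xs rule: hgt.induct) auto

lemma hgt_swap: "hgt (us @ False # True # vs) = Suc (hgt (us @ True # False # vs))"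
  by (simp add: hgt_append)

lemma hgt_replicate [simp]: "hgt (replicate n b) = 0"
  by (induction n) (cases b; simp add: count_list_0_iff)+

abbreviation srt :: "nat \<Rightarrow> nat \<Rightarrow> bool list" where
  "srt n k \<equiv> replicate k True @ replicate (n - k) False"

text \<open>The exchange rule costs a factor \<open>- q\<close> for each inversion removed, so the
  values on all words with k ups are determined by the value on the sorted word.\<close>

lemma sort_state:
  assumes sw: "\<And>us vs. length us + length vs + 2 = n \<Longrightarrow>
      Y (us @ False # True # vs) = - q * (Y (us @ True # False # vs) :: 'a::comm_ring_1)"
    and len: "length xs = n"
  shows "Y xs = (- q) ^ hgt xs * Y (srt n (ups xs))"
  using assms
proof (induction xs arbitrary: n Y rule: hgt.induct)
  case 1
  then show ?case by simp
next
  case (2 xs)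
  obtain n' where n: "n = Suc n'" using 2(3) by (cases n) auto
  have "Y (True # xs) = (- q) ^ hgt xs * Y (True # srt n' (ups xs))"
  proof (rule 2(1)[of n' "\<lambda>z. Y (True # z)"])
    fix us vs :: "bool list" assume "length us + length vs + 2 = n'"
    then show "Y (True # us @ False # True # vs) = - q * Y (True # us @ True # False # vs)"
      using 2(2)[of "True # us" vs] n by simp
  qed (use 2 n in simp)
  then show ?case by (simp add: n)
next
  case (3 xs)
  obtain n' where n: "n = Suc n'" using 3(3) by (cases n) auto
  have move: "Y (replicate i True @ False # replicate k True @ zs) =
      (- q) ^ k * Y (replicate (i + k) True @ False # zs)" if "i + k + length zs + 1 = n" for i k zs
    using that
  proof (induction k arbitrary: i)
    case (Suc k)
    have "Y (replicate i True @ False # replicate (Suc k) True @ zs) =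
        - q * Y (replicate i True @ True # False # replicate k True @ zs)"
      using 3(2)[of "replicate i True" "replicate k True @ zs"] Suc.prems by simp
    also have "replicate i True @ True # False # replicate k True @ zs =
        replicate (Suc i) True @ False # replicate k True @ zs"
      by (simp add: replicate_app_Cons_same)
    finally show ?case using Suc.IH[of "Suc i"] Suc.prems by simp
  qed simp
  have le: "ups xs \<le> n'" using 3(3) ups_downs[of xs] n by simp
  have "Y (False # xs) = (- q) ^ hgt xs * Y (False # srt n' (ups xs))"
  proof (rule 3(1)[of n' "\<lambda>z. Y (False # z)"])
    fix us vs :: "bool list" assume "length us + length vs + 2 = n'"
    then show "Y (False # us @ False # True # vs) = - q * Y (False # us @ True # False # vs)"
      using 3(2)[of "False # us" vs] n by simp
  qed (use 3 n in simp)
  also have "Y (False # srt n' (ups xs)) = (- q) ^ ups xs * Y (replicate (ups xs) True @ False # replicate (n' - ups xs) False)"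
    using move[of 0 "ups xs" "replicate (n' - ups xs) False"] le n by simp
  also have "False # replicate (n' - ups xs) False = replicate (n - ups (False # xs)) False"
    using le n by (simp add: Suc_diff_le)
  finally show ?case by (simp add: power_add mult.assoc mult.left_commute)
qed

definition states :: "nat \<Rightarrow> nat \<Rightarrow> bool list set" where
  "states n k = {xs. length xs = n \<and> ups xs = k}"

lemma finite_states [simp]: "finite (states n k)"
  by (rule finite_subset[OF _ finite_lists_length_eq[of UNIV n]]) (auto simp: states_def)

text \<open>The square norm of the q-symmetric vector with k ups: the Gaussian binomial coefficient
  of n over k in the variable \<open>q^2\<close>, compare \<open>zsum_fact\<close>.\<close>

definition zsum :: "'a::comm_ring_1 \<Rightarrow> nat \<Rightarrow> nat \<Rightarrow> 'a" where
  "zsum q n k = (\<Sum>xs\<in>states n k. q ^ (2 * hgt xs))"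

text \<open>One factor \<open>(- q) ^ hgt xs\<close> comes from the symmetric vector and a second
  one from sorting; their signs cancel.\<close>

lemma sum_sort_state:
  assumes "\<And>us vs. length us + length vs + 2 = n \<Longrightarrow>
      Y (us @ False # True # vs) = - q * (Y (us @ True # False # vs) :: 'a::comm_ring_1)"
  shows "(\<Sum>xs\<in>states n k. (- q) ^ hgt xs * Y xs) = zsum q n k * Y (srt n k)"
proof -
  have "(- q) ^ hgt xs * Y xs = q ^ (2 * hgt xs) * Y (srt n k)" if "xs \<in> states n k" for xs
  proof -
    have "length xs = n" "ups xs = k" using that by (auto simp: states_def)
    then have "Y xs = (- q) ^ hgt xs * Y (srt n k)" using sort_state[of n Y q xs, OF assms] by simp
    moreover have "(- q) ^ hgt xs * (- q) ^ hgt xs = q ^ (2 * hgt xs)"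
      by (simp only: power_add[symmetric] mult_2[symmetric] power_mult power2_minus)
    ultimately show ?thesis by (simp add: mult.assoc[symmetric])
  qed
  then show ?thesis unfolding zsum_def sum_distrib_right by (rule sum.cong[OF refl])
qed

text \<open>The pairing with the symmetric vector kills everything that contains a simple cap.\<close>

lemma sum_states_cap:
  assumes i: "i + 2 \<le> n"
    and G: "\<And>us a b vs. length us = i \<Longrightarrow> length us + length vs + 2 = n \<Longrightarrow>
      G (us @ a # b # vs) = cap_wt q a b * (G' (us @ vs) :: 'a::comm_ring_1)"
  shows "(\<Sum>xs\<in>states n k. (- q) ^ hgt xs * G xs) = 0"
proof -
  let ?f = "\<lambda>xs. (- q) ^ hgt xs * G xs"
  define A where "A = {xs \<in> states n k. xs ! i \<and> \<not> xs ! (i + 1)}"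
  define B where "B = {xs \<in> states n k. \<not> xs ! i \<and> xs ! (i + 1)}"
  define sw where "sw xs = take i xs @ xs ! (i + 1) # xs ! i # drop (i + 2) xs" for xs :: "bool list"
  have split: "xs = take i xs @ xs ! i # xs ! (i + 1) # drop (i + 2) xs" if "xs \<in> states n k" for xs
  proof -
    have "i + 1 < length xs" using that i by (simp add: states_def)
    then show ?thesis by (metis Suc_eq_plus1 Suc_lessD add_2_eq_Suc' id_take_nth_drop Cons_nth_drop_Suc)
  qed
  have lens: "length (take i xs) = i" "length (take i xs) + length (drop (i + 2) xs) + 2 = n" if "xs \<in> states n k" for xs
    using that i by (simp_all add: states_def)
  have zero: "?f xs = 0" if "xs \<in> states n k" "xs \<notin> A \<union> B" for xs
  proof -
    have "xs ! i = xs ! (i + 1)" using that by (auto simp: A_def B_def)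
    then have "G xs = 0" using split[OF that(1)] G[OF lens[OF that(1)], of "xs ! i" "xs ! (i + 1)"]
      by (simp add: cap_wt_def)
    then show ?thesis by simp
  qed
  \<comment> \<open>Exchanging the entries i and i + 1 adds an inversion, hence a factor
    \<open>- q\<close>, and lowers the cap weight from \<open>q\<close> to 1. The terms cancel in
    pairs.\<close>
  have swA: "sw xs \<in> B \<and> sw (sw xs) = xs \<and> ?f (sw xs) = - ?f xs" if "xs \<in> A" for xs
  proof -
    have st: "xs \<in> states n k" and a: "xs ! i" "\<not> xs ! (i + 1)" using that by (auto simp: A_def)
    obtain us vs where uv: "us = take i xs" "vs = drop (i + 2) xs" by blast
    have xs: "xs = us @ True # False # vs" using split[OF st] a uv by simp
    have lu: "length us = i" "length us + length vs + 2 = n" using lens[OF st] uv by simp_all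
    have sx: "sw xs = us @ False # True # vs" unfolding sw_def using a uv by simp
    have "sw (sw xs) = us @ True # False # vs"
      unfolding sx unfolding sw_def using lu(1) by (simp add: nth_append)
    moreover have "sw xs \<in> B" unfolding B_def sx using st lu(1) by (simp add: states_def xs nth_append)
    moreover have "?f (sw xs) = - ?f xs"
      unfolding sx hgt_swap G[OF lu] unfolding xs G[OF lu] by (simp add: cap_wt_def mult.left_commute mult.commute)
    ultimately show ?thesis using xs by simp
  qed
  have swB: "sw xs \<in> A \<and> sw (sw xs) = xs" if "xs \<in> B" for xs
  proof -
    have st: "xs \<in> states n k" and a: "\<not> xs ! i" "xs ! (i + 1)" using that by (auto simp: B_def)
    obtain us vs where uv: "us = take i xs" "vs = drop (i + 2) xs" by blast
    have xs: "xs = us @ False # True # vs" using split[OF st] a uv by simp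
    have lu: "length us = i" "length us + length vs + 2 = n" using lens[OF st] uv by simp_all
    have sx: "sw xs = us @ True # False # vs" unfolding sw_def using a uv by simp
    have "sw (sw xs) = us @ False # True # vs"
      unfolding sx unfolding sw_def using lu(1) by (simp add: nth_append)
    moreover have "sw xs \<in> A" unfolding A_def sx using st lu(1) by (simp add: states_def xs nth_append)
    ultimately show ?thesis using xs by simp
  qed
  have "(\<Sum>xs\<in>states n k. ?f xs) = (\<Sum>xs\<in>A \<union> B. ?f xs)"
    by (rule sum.mono_neutral_right) (use zero in \<open>auto simp: A_def B_def\<close>)
  also have "\<dots> = (\<Sum>xs\<in>A. ?f xs) + (\<Sum>xs\<in>B. ?f xs)"
    by (rule sum.union_disjoint) (auto simp: A_def B_def)
  also have "(\<Sum>xs\<in>B. ?f xs) = (\<Sum>xs\<in>A. - ?f xs)"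
  proof (rule sum.reindex_bij_witness[of _ sw sw])
    show "- ?f (sw a) = ?f a" if "a \<in> B" for a using swA[of "sw a"] swB[OF that] by simp
  qed (use swA swB in blast)+
  finally show ?thesis by (simp add: sum_negf)
qed

section \<open>Integrality of spin values and of coefficients\<close>

definition is_subring :: "'a::comm_ring_1 set \<Rightarrow> bool" where
  "is_subring S \<longleftrightarrow> 0 \<in> S \<and> 1 \<in> S \<and> (\<forall>x\<in>S. \<forall>y\<in>S. x + y \<in> S \<and> x - y \<in> S \<and> x * y \<in> S)"

lemma subring_sum: "is_subring S \<Longrightarrow> (\<And>i. i \<in> I \<Longrightarrow> f i \<in> S) \<Longrightarrow> sum f I \<in> S"
  by (induction I rule: infinite_finite_induct) (auto simp: is_subring_def)

lemma subring_prod: "is_subring S \<Longrightarrow> (\<And>i. i \<in> I \<Longrightarrow> f i \<in> S) \<Longrightarrow> prod f I \<in> S"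
  by (induction I rule: infinite_finite_induct) (auto simp: is_subring_def)

lemma subring_power: "is_subring S \<Longrightarrow> x \<in> S \<Longrightarrow> x ^ n \<in> S"
  by (induction n) (auto simp: is_subring_def)

lemma subring_uminus: "is_subring S \<Longrightarrow> x \<in> S \<Longrightarrow> - x \<in> S"
  unfolding is_subring_def by (metis diff_0)

lemma subring_spin: "is_subring S \<Longrightarrow> q \<in> S \<Longrightarrow> spin q n m zs D \<in> S"
  unfolding spin_def
  by (rule subring_prod) (auto simp: block_wt_def cap_wt_def is_subring_def)

text \<open>Contraction of the two neighbours vanishes, and multiplication by q solves this for the
  value on down-up. Killing by cups thus becomes the exchange rule of q-symmetric tensors.\<close>

lemma Spin_swap:
  assumes q: "q * qi = (1 :: 'a::comm_ring_1)" and x: "x \<in> Hom (n + 2) m" and us: "length us \<le> n"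
    and z: "tl_comp (q + qi) (dg (cup_diag (n + 2) (length us))) x = 0"
  shows "Spin q (n + 2) m (us @ False # True # vs) x = - q * Spin q (n + 2) m (us @ True # False # vs) x"
proof -
  have "Spin q (n + 2) m (us @ True # False # vs) x + qi * Spin q (n + 2) m (us @ False # True # vs) x = 0"
    unfolding Spin_contract[OF q us refl x] z by simp
  then have "q * (Spin q (n + 2) m (us @ True # False # vs) x + qi * Spin q (n + 2) m (us @ False # True # vs) x) = 0"
    by simp
  then have "q * Spin q (n + 2) m (us @ True # False # vs) x + Spin q (n + 2) m (us @ False # True # vs) x = 0"
    using q by (simp add: distrib_left mult.assoc[symmetric])
  then show ?thesis by (simp add: eq_neg_iff_add_eq_0 add.commute)
qed

text \<open>The pairing of f with the q-symmetric vector on the sources is computed twice. By the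
  exchange rule it is \<open>zsum\<close> times the value on the sorted word. Diagram by diagram,
  everything that begins with a cap is killed, and only the identity remains with coefficient 1, so
  the pairing is integral. Thus \<open>zsum\<close> bounds the denominators of spin values.\<close>

lemma jw_spin:
  assumes q: "q * qi = (1 :: 'a::comm_ring_1)" and f: "jw (q + qi) n f"
    and S: "is_subring S" "q \<in> S" and len: "length xs = n"
  shows "zsum q n (ups xs) * Spin q n n (xs @ ys) f \<in> S"
proof -
  have fH: "f \<in> Hom n n" using f by (simp add: jw_def)
  let ?Y = "\<lambda>xs. Spin q n n (xs @ ys) f"
  have sw: "?Y (us @ False # True # vs) = - q * ?Y (us @ True # False # vs)" if uv: "length us + length vs + 2 = n" for us vs
  proof -
    obtain n' where n': "n' = length us + length vs" by blast
    then have n: "n = n' + 2" using uv by simp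
    have "tl_comp (q + qi) (dg (cup_diag (n' + 2) (length us))) f = 0"
      using f n n' unfolding jw_def n by auto
    then show ?thesis using Spin_swap[OF q fH[unfolded n], of us "vs @ ys"] n' unfolding n by simp
  qed
  let ?k = "ups xs"
  let ?P = "\<Sum>xs\<in>states n ?k. (- q) ^ hgt xs * ?Y xs"
  have id: "?P = (\<Sum>xs\<in>states n ?k. (- q) ^ hgt xs * spin q n n (xs @ ys) (id_diag n))"
  proof -
    have "?P = (\<Sum>D\<in>diagrams n n. lk f D * (\<Sum>xs\<in>states n ?k. (- q) ^ hgt xs * spin q n n (xs @ ys) D))"
      unfolding Spin_def sum_distrib_left by (subst sum.swap) (simp add: mult.left_commute)
    also have "\<dots> = (\<Sum>D\<in>diagrams n n. if D = id_diag n then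
        (\<Sum>xs\<in>states n ?k. (- q) ^ hgt xs * spin q n n (xs @ ys) D) else 0)"
    proof (rule sum.cong[OF refl])
      fix D assume D: "D \<in> diagrams n n"
      have "(\<Sum>xs\<in>states n ?k. (- q) ^ hgt xs * spin q n n (xs @ ys) D) = 0" if ne: "D \<noteq> id_diag n"
      proof -
        obtain i n' D' where i: "n = n' + 2" "i \<le> n'" "D' \<in> diagrams n' n" "D = ins_cap i D'"
          using diag_not_id_ins_cap[OF D ne] .
        show ?thesis
        proof (rule sum_states_cap)
          show "i + 2 \<le> n" using i by simp
          fix us vs :: "bool list" and a b
          assume "length us = i"
          then show "spin q n n ((us @ a # b # vs) @ ys) D = cap_wt q a b * spin q n' n ((us @ vs) @ ys) D'"
            using spin_ins_cap[OF i(3,2), of us q a b "vs @ ys"] unfolding i(1,4) by simp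
        qed
      qed
      then show "lk f D * (\<Sum>xs\<in>states n ?k. (- q) ^ hgt xs * spin q n n (xs @ ys) D) =
        (if D = id_diag n then (\<Sum>xs\<in>states n ?k. (- q) ^ hgt xs * spin q n n (xs @ ys) D) else 0)"
        using f by (auto simp: jw_def)
    qed
    finally show ?thesis by simp
  qed
  have "zsum q n ?k * ?Y xs = (- q) ^ hgt xs * (zsum q n ?k * ?Y (srt n ?k))"
    using sort_state[of n ?Y q xs, OF sw len] by (simp add: mult.left_commute)
  also have "\<dots> = (- q) ^ hgt xs * ?P"
    using sum_sort_state[of n ?Y q ?k, OF sw] by simp
  also have "\<dots> \<in> S"
  proof -
    have pw: "(- q) ^ j \<in> S" for j using S subring_power subring_uminus by metis
    then have "(- q) ^ hgt xs * spin q n n (xs @ ys) (id_diag n) \<in> S" for xs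
      using S subring_spin[OF S] unfolding is_subring_def by blast
    then have "?P \<in> S" unfolding id using S(1) by (intro subring_sum)
    then show ?thesis using pw S(1) unfolding is_subring_def by blast
  qed
  finally show ?thesis .
qed

text \<open>Up at the first end and down at the second end of every strand of D, so that each strand
  of D has weight q.\<close>

definition opener_state :: "nat \<Rightarrow> nat \<Rightarrow> diagram \<Rightarrow> bool list" where
  "opener_state n m D = map (\<lambda>p. p \<in> openers n m D) [0..<n + m]"

lemma diag_block_ordered:
  assumes D: "D \<in> diagrams n m" and B: "B \<in> D"
  obtains x y where "B = {x, y}" "bpos n m x < bpos n m y" "x \<in> points n m" "y \<in> points n m"
proof -
  obtain x y where xy: "B = {x, y}" "x \<noteq> y" using diag_card2[OF D B] by (meson card_2_iff)
  have p: "x \<in> points n m" "y \<in> points n m" using B xy diag_Union[OF D] by blast+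
  then have "bpos n m x \<noteq> bpos n m y" using xy bpos_inj[of n m] unfolding inj_on_def by blast
  then consider "bpos n m x < bpos n m y" | "bpos n m y < bpos n m x" by linarith
  then show ?thesis
  proof cases
    case 1 then show ?thesis using that xy p by blast
  next
    case 2 then show ?thesis using that[of y x] xy p by (simp add: insert_commute)
  qed
qed

lemma spin_opener_self:
  assumes D: "D \<in> diagrams n m"
  shows "spin q n m (opener_state n m D) D = q ^ card D"
proof -
  have "block_wt q (opener_state n m D) (bpos n m ` B) = q" if B: "B \<in> D" for B
  proof -
    obtain x y where xy: "B = {x, y}" "bpos n m x < bpos n m y" "x \<in> points n m" "y \<in> points n m"
      using diag_block_ordered[OF D B] .
    have yx: "{y, x} \<in> D" "x \<noteq> y" using B xy by (auto simp: insert_commute)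
    have "bpos n m x \<in> openers n m D" using B xy unfolding openers_def by blast
    moreover have "bpos n m y \<notin> openers n m D" using opener_iff[OF D yx(1)] yx(2) xy(2) by auto
    ultimately show ?thesis
      using xy bpos_less[OF xy(3)] bpos_less[OF xy(4)]
      by (simp add: block_wt_pair(1) opener_state_def cap_wt_def)
  qed
  then show ?thesis unfolding spin_def by simp
qed

text \<open>On the state of D a diagram E has nonzero weight only if each of its strands joins an
  opener of D to a closer. Let \<open>p B\<close> be the end of the strand \<open>B\<close> of E
  that is an opener of D, and \<open>lo B\<close> its first end. Then \<open>p\<close> and
  \<open>lo\<close> enumerate the openers of D and of E, and \<open>lo\<close> is at most
  \<open>p\<close>, with a strict inequality somewhere since openers determine diagrams.\<close>

lemma spin_opener_other:
  assumes D: "D \<in> diagrams n m" and E: "E \<in> diagrams n m" and nz: "spin q n m (opener_state n m D) E \<noteq> 0" and ne: "E \<noteq> D"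
  shows "\<Sum>(openers n m E) < \<Sum>(openers n m D)"
proof -
  let ?b = "bpos n m" and ?O = "openers n m D"
  have one: "\<exists>x y. B = {x, y} \<and> ?b x < ?b y \<and> x \<in> points n m \<and> y \<in> points n m \<and> (?b x \<in> ?O \<longleftrightarrow> ?b y \<notin> ?O)"
    if B: "B \<in> E" for B
  proof -
    obtain x y where xy: "B = {x, y}" "?b x < ?b y" "x \<in> points n m" "y \<in> points n m"
      using diag_block_ordered[OF E B] .
    have "block_wt q (opener_state n m D) (?b ` B) \<noteq> 0"
      using nz B diag_finite[OF E] unfolding spin_def by (metis prod_zero)
    then have "?b x \<in> ?O \<longleftrightarrow> ?b y \<notin> ?O"
      using xy bpos_less[OF xy(3)] bpos_less[OF xy(4)]
      by (auto simp: block_wt_pair(1) opener_state_def cap_wt_def split: if_splits)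
    then show ?thesis using xy by blast
  qed
  define lo where "lo B = Min (?b ` B)" for B
  define p where "p B = (if lo B \<in> ?O then lo B else Max (?b ` B))" for B
  have lop: "\<exists>x y. B = {x, y} \<and> lo B = ?b x \<and> ?b x < ?b y \<and> x \<in> points n m \<and> y \<in> points n m \<and>
      (p B = ?b x \<or> p B = ?b y) \<and> p B \<in> ?O \<and> (\<forall>z\<in>B. ?b z \<in> ?O \<longrightarrow> ?b z = p B)" if B: "B \<in> E" for B
  proof -
    obtain x y where xy: "B = {x, y}" "?b x < ?b y" "x \<in> points n m" "y \<in> points n m" "?b x \<in> ?O \<longleftrightarrow> ?b y \<notin> ?O"
      using one[OF B] by blast
    have mm: "lo B = ?b x" "Max (?b ` B) = ?b y" using xy by (simp_all add: lo_def)
    have "p B = (if ?b x \<in> ?O then ?b x else ?b y)" unfolding p_def mm ..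
    then show ?thesis using xy mm by (intro exI[of _ x] exI[of _ y]) auto
  qed
  have inj: "inj_on p E" "inj_on lo E"
  proof -
    have pt: "\<exists>z\<in>B. z \<in> points n m \<and> ?b z = p B" "\<exists>z\<in>B. z \<in> points n m \<and> ?b z = lo B" if BE: "B \<in> E" for B
    proof -
      obtain x y where "B = {x, y}" "lo B = ?b x" "x \<in> points n m" "y \<in> points n m" "p B = ?b x \<or> p B = ?b y"
        using lop[OF BE] by blast
      then show "\<exists>z\<in>B. z \<in> points n m \<and> ?b z = p B" "\<exists>z\<in>B. z \<in> points n m \<and> ?b z = lo B"
        by auto
    qed
    have "B = B'" if "B \<in> E" "B' \<in> E" "z \<in> B" "z' \<in> B'" "z \<in> points n m" "z' \<in> points n m" "?b z = ?b z'" for B B' z z'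
    proof -
      have "z = z'" using that bpos_inj[of n m] unfolding inj_on_def by blast
      then show ?thesis using diag_block_eq[OF E] that by blast
    qed
    note * = this
    show "inj_on p E" using pt(1) by (intro inj_onI) (metis *)
    show "inj_on lo E" using pt(2) by (intro inj_onI) (metis *)
  qed
  have imp: "p ` E = ?O"
  proof
    show "p ` E \<subseteq> ?O" using lop by blast
    show "?O \<subseteq> p ` E"
    proof
      fix k assume k: "k \<in> ?O"
      then obtain z where z: "z \<in> points n m" "k = ?b z"
        unfolding openers_def using diag_Union[OF D] by blast
      then obtain B where "B \<in> E" "z \<in> B" using diag_Union[OF E] by blast
      then show "k \<in> p ` E" using lop[of B] k z by blast
    qed
  qed
  have iml: "lo ` E = openers n m E"
  proof
    show "lo ` E \<subseteq> openers n m E"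
    proof
      fix k assume "k \<in> lo ` E"
      then obtain B where "B \<in> E" "k = lo B" by blast
      then obtain x y where "{x, y} \<in> E" "k = ?b x" "?b x < ?b y" using lop[of B] by blast
      then show "k \<in> openers n m E" unfolding openers_def by blast
    qed
    show "openers n m E \<subseteq> lo ` E"
    proof
      fix k assume "k \<in> openers n m E"
      then obtain x y where "{x, y} \<in> E" "?b x < ?b y" "k = ?b x" unfolding openers_def by blast
      then show "k \<in> lo ` E" by (intro image_eqI[of _ _ "{x, y}"]) (simp_all add: lo_def)
    qed
  qed
  have le: "lo B \<le> p B" if BE: "B \<in> E" for B
  proof -
    obtain x y where "lo B = ?b x" "?b x < ?b y" "p B = ?b x \<or> p B = ?b y" using lop[OF BE] by blast
    then show ?thesis by auto
  qed
  have "\<exists>B\<in>E. lo B \<noteq> p B"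
  proof (rule ccontr)
    assume "\<not> (\<exists>B\<in>E. lo B \<noteq> p B)"
    then have "lo ` E = p ` E" by (intro image_cong) auto
    then have "openers n m E = ?O" unfolding imp iml .
    then show False using openers_determine[OF E D] ne by simp
  qed
  then have "sum lo E < sum p E"
    using diag_finite[OF E] le by (intro sum_strict_mono_ex1) (auto simp: le_less)
  then show ?thesis
    unfolding imp[symmetric] iml[symmetric] by (simp add: sum.reindex[OF inj(1)] sum.reindex[OF inj(2)])
qed

text \<open>The coefficients of a morphism are recovered from its spin values by a triangular system
  whose diagonal entries are powers of \<open>q\<close>.\<close>

lemma coeffs_in_subring:
  assumes q: "q * qi = (1 :: 'a::comm_ring_1)" and S: "is_subring S" "q \<in> S" "qi \<in> S"
    and x: "\<And>zs. length zs = n + m \<Longrightarrow> Spin q n m zs x \<in> S"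
  shows "D \<in> diagrams n m \<Longrightarrow> lk x D \<in> S"
proof (induction "\<Sum>(openers n m D)" arbitrary: D rule: less_induct)
  case less
  let ?s = "opener_state n m D"
  have rest: "lk x E * spin q n m ?s E \<in> S" if E: "E \<in> diagrams n m - {D}" for E
  proof (cases "spin q n m ?s E = 0")
    case True then show ?thesis using S(1) by (simp add: is_subring_def)
  next
    case False
    then have "lk x E \<in> S" using spin_opener_other[OF less.prems] less.hyps E by blast
    then show ?thesis using subring_spin[OF S(1,2)] S(1) unfolding is_subring_def by blast
  qed
  have minus: "a - b \<in> S" if "a \<in> S" "b \<in> S" for a b using S(1) that unfolding is_subring_def by blast
  let ?R = "\<Sum>E\<in>diagrams n m - {D}. lk x E * spin q n m ?s E"
  have "Spin q n m ?s x = lk x D * q ^ card D + ?R"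
    unfolding Spin_def using less.prems by (simp add: sum.remove[of _ D] spin_opener_self)
  then have "lk x D * q ^ card D = Spin q n m ?s x - ?R" by simp
  also have "\<dots> \<in> S"
  proof (rule minus)
    show "Spin q n m ?s x \<in> S" by (rule x) (simp add: opener_state_def)
    show "?R \<in> S" using S(1) rest by (rule subring_sum)
  qed
  finally have "lk x D * q ^ card D \<in> S" .
  then have "lk x D * q ^ card D * qi ^ card D \<in> S"
    using subring_power[OF S(1,3)] S(1) unfolding is_subring_def by blast
  moreover have "q ^ card D * qi ^ card D = 1" using q by (metis power_mult_distrib power_one)
  ultimately show ?case by (simp add: mult.assoc)
qed

subsection \<open>Quantum binomial coefficients\<close>

primrec qfact :: "'a::comm_ring_1 \<Rightarrow> nat \<Rightarrow> 'a" where
  "qfact \<delta> 0 = 1"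
| "qfact \<delta> (Suc n) = qnum \<delta> (Suc n) * qfact \<delta> n"

text \<open>\<open>qbin \<delta> a b\<close> is the quantum binomial coefficient \<open>[a + b]! / ([a]! [b]!)\<close>; the recursion
  stays within polynomials in the loop parameter.\<close>

fun qbin :: "'a::comm_ring_1 \<Rightarrow> nat \<Rightarrow> nat \<Rightarrow> 'a" where
  "qbin \<delta> 0 b = 1"
| "qbin \<delta> (Suc a) 0 = 1"
| "qbin \<delta> (Suc a) (Suc b) = qnum \<delta> (Suc (Suc a)) * qbin \<delta> (Suc a) b - qnum \<delta> b * qbin \<delta> a (Suc b)"

lemma qbin_0 [simp]: "qbin \<delta> a 0 = 1" by (cases a) auto

lemma qnum_add: "qnum \<delta> (Suc (m + n)) = qnum \<delta> (Suc m) * qnum \<delta> (Suc n) - qnum \<delta> m * qnum \<delta> n"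
proof (induction n rule: induct_nat_012)
  case (ge2 n)
  have "qnum \<delta> (Suc (m + Suc (Suc n))) = \<delta> * qnum \<delta> (Suc (m + Suc n)) - qnum \<delta> (Suc (m + n))" by simp
  then show ?case unfolding ge2 by (simp add: algebra_simps)
qed (simp_all add: mult.commute)

text \<open>The recursion of \<open>qbin\<close> matches the identity
  \<open>[a+2] [b+1] - [a+1] [b] = [a+b+2]\<close>, an instance of \<open>qnum_add\<close>; no power
  of q is involved.\<close>

lemma qbin_fact: "qbin \<delta> a b * (qfact \<delta> a * qfact \<delta> b) = qfact \<delta> (a + b)"
proof (induction \<delta> a b rule: qbin.induct)
  case (3 \<delta> a b)
  let ?q = "qnum \<delta>"
  have "qbin \<delta> (Suc a) (Suc b) * (qfact \<delta> (Suc a) * qfact \<delta> (Suc b)) =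
      ?q (Suc (Suc a)) * ?q (Suc b) * (qbin \<delta> (Suc a) b * (qfact \<delta> (Suc a) * qfact \<delta> b))
      - ?q b * ?q (Suc a) * (qbin \<delta> a (Suc b) * (qfact \<delta> a * qfact \<delta> (Suc b)))"
    unfolding qbin.simps qfact.simps by (simp only: left_diff_distrib right_diff_distrib mult_ac)
  also have "\<dots> = (?q (Suc (Suc a)) * ?q (Suc b) - ?q (Suc a) * ?q b) * qfact \<delta> (Suc (a + b))"
    unfolding 3 by (simp only: add_Suc add_Suc_right left_diff_distrib right_diff_distrib mult_ac)
  also have "\<dots> = qfact \<delta> (Suc a + Suc b)"
    unfolding qnum_add[symmetric] by (simp add: mult_ac del: qnum.simps)
  finally show ?case .
qed simp_all

lemma qnum_hom:
  assumes "is_hom \<phi>" shows "\<phi> (qnum \<delta> n) = qnum (\<phi> \<delta>) n"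
  by (induction n rule: induct_nat_012) (use assms in \<open>auto simp: is_hom_def is_hom_diff[OF assms]\<close>)

lemma qfact_hom: "is_hom \<phi> \<Longrightarrow> \<phi> (qfact \<delta> n) = qfact (\<phi> \<delta>) n"
  by (induction n) (auto simp: is_hom_def qnum_hom[unfolded is_hom_def])

lemma qbin_hom:
  assumes h: "is_hom \<phi>" shows "\<phi> (qbin \<delta> a b) = qbin (\<phi> \<delta>) a b"
proof -
  have m: "\<phi> (x * y) = \<phi> x * \<phi> y" "\<phi> 1 = 1" for x y using h by (auto simp: is_hom_def)
  show ?thesis
    by (induction \<delta> a b rule: qbin.induct) (simp_all only: qbin.simps m is_hom_diff[OF h] qnum_hom[OF h])
qed

lemma qnum_two: "qnum 2 n = (of_nat n :: 'a::comm_ring_1)"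
  by (induction n rule: induct_nat_012) (simp_all add: algebra_simps)

lemma qnum_add_q:
  assumes q: "q * qi = (1 :: 'a::comm_ring_1)"
  shows "qnum (q + qi) (m + n) = q ^ m * qnum (q + qi) n + qi ^ n * qnum (q + qi) m"
proof -
  have one: "qnum (q + qi) (Suc n) = q * qnum (q + qi) n + qi ^ n" for n
  proof (induction n rule: induct_nat_012)
    case (ge2 n)
    have e: "q * (qi * x) = x" for x using q by (simp add: mult.assoc[symmetric])
    have "qnum (q + qi) (Suc (Suc (Suc n))) = (q + qi) * qnum (q + qi) (Suc (Suc n)) - qnum (q + qi) (Suc n)" by simp
    also have "\<dots> = q * qnum (q + qi) (Suc (Suc n)) + qi * (q * qnum (q + qi) (Suc n) + qi ^ Suc n) - qnum (q + qi) (Suc n)"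
      unfolding distrib_right ge2(2)[symmetric] ..
    also have "\<dots> = q * qnum (q + qi) (Suc (Suc n)) + qi ^ Suc (Suc n)"
      by (simp only: distrib_left mult.left_commute[of qi q] e) simp
    finally show ?case .
  qed simp_all
  have "q ^ n * qi ^ n = 1" for n using q by (metis power_mult_distrib power_one)
  then have e: "q ^ n * (qi ^ n * x) = x" for n x by (simp add: mult.assoc[symmetric])
  show ?thesis
  proof (induction m)
    case 0 then show ?case by simp
  next
    case (Suc m)
    have "qnum (q + qi) (Suc m + n) = q * (q ^ m * qnum (q + qi) n + qi ^ n * qnum (q + qi) m) + qi ^ (m + n)"
      unfolding add_Suc one[of "m + n"] Suc ..
    then show ?case unfolding one[of m] by (simp add: algebra_simps power_add)
  qed
qed

section \<open>Gaussian binomial coefficients as sums over spin words\<close>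

lemma zsum_0 [simp]: "zsum q n 0 = 1"
proof -
  have "states n 0 = {replicate n False}"
  proof (intro equalityI subsetI)
    fix xs assume "xs \<in> states n 0"
    then have "length xs = n" "\<forall>x\<in>set xs. x = False" by (auto simp: states_def count_list_0_iff)
    then show "xs \<in> {replicate n False}" by (metis replicate_length_same singletonI)
  qed (simp add: states_def count_list_0_iff)
  then show ?thesis by (simp add: zsum_def)
qed

lemma zsum_gt: "n < k \<Longrightarrow> zsum q n k = 0"
proof -
  assume "n < k"
  have "states n k = {}"
  proof (intro equals0I)
    fix xs assume "xs \<in> states n k"
    then show False using \<open>n < k\<close> ups_downs[of xs] by (auto simp: states_def)
  qed
  then show ?thesis by (simp add: zsum_def)
qed

lemma states_Suc: "states (Suc n) (Suc k) = (#) True ` states n k \<union> (#) False ` states n (Suc k)"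
proof (intro equalityI subsetI)
  fix xs assume xs: "xs \<in> states (Suc n) (Suc k)"
  then obtain b ys where "xs = b # ys" by (cases xs) (auto simp: states_def)
  then show "xs \<in> (#) True ` states n k \<union> (#) False ` states n (Suc k)"
    using xs by (cases b) (auto simp: states_def)
qed (auto simp: states_def)

text \<open>A leading down stands before all \<open>Suc k\<close> ups and adds that many inversions;
  this is the q-Pascal rule.\<close>

lemma zsum_Suc: "zsum q (Suc n) (Suc k) = zsum q n k + q ^ (2 * Suc k) * zsum q n (Suc k)"
proof -
  have "zsum q (Suc n) (Suc k) =
      (\<Sum>xs\<in>(#) True ` states n k. q ^ (2 * hgt xs)) + (\<Sum>xs\<in>(#) False ` states n (Suc k). q ^ (2 * hgt xs))"
    unfolding zsum_def states_Suc by (rule sum.union_disjoint) auto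
  also have "(\<Sum>xs\<in>(#) True ` states n k. q ^ (2 * hgt xs)) = zsum q n k"
    unfolding zsum_def by (subst sum.reindex) auto
  also have "(\<Sum>xs\<in>(#) False ` states n (Suc k). q ^ (2 * hgt xs)) = (\<Sum>xs\<in>states n (Suc k). q ^ (2 * hgt (False # xs)))"
    by (subst sum.reindex) auto
  also have "\<dots> = (\<Sum>xs\<in>states n (Suc k). q ^ (2 * Suc k) * q ^ (2 * hgt xs))"
  proof (rule sum.cong[OF refl])
    fix xs assume "xs \<in> states n (Suc k)"
    then have "hgt (False # xs) = Suc k + hgt xs" by (simp add: states_def)
    then show "q ^ (2 * hgt (False # xs)) = q ^ (2 * Suc k) * q ^ (2 * hgt xs)"
      by (simp only: distrib_left power_add)
  qed
  finally show ?thesis unfolding zsum_def sum_distrib_left .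
qed

lemma zsum_full: "zsum q n n = 1"
  by (induction n) (simp_all add: zsum_Suc zsum_gt)

text \<open>The Gaussian binomial coefficient in \<open>q^2\<close> is \<open>q ^ (a * b)\<close>
  times the balanced one. Stated with factorials multiplied out, because the ring is only assumed
  commutative.\<close>

lemma zsum_fact:
  assumes q: "q * qi = (1 :: 'a::comm_ring_1)"
  shows "zsum q (a + b) a * (qfact (q + qi) a * qfact (q + qi) b) = q ^ (a * b) * qfact (q + qi) (a + b)"
proof (induction "a + b" arbitrary: a b)
  case 0 then show ?case by simp
next
  case (Suc n)
  let ?\<delta> = "q + qi"
  show ?case
  proof (cases a)
    case 0 then show ?thesis by simp
  next
    case a: (Suc a')
    show ?thesis
    proof (cases b)
      case 0 then show ?thesis by (simp add: zsum_full)
    next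
      case b: (Suc b')
      have i1: "zsum q (a' + b) a' * (qfact ?\<delta> a' * qfact ?\<delta> b) = q ^ (a' * b) * qfact ?\<delta> (a' + b)"
        and i2: "zsum q (a + b') a * (qfact ?\<delta> a * qfact ?\<delta> b') = q ^ (a * b') * qfact ?\<delta> (a + b')"
        by (rule Suc.hyps(1), use Suc.hyps(2) a b in simp)+
      have n: "a' + b = a + b'" using a b by simp
      have ab: "a + b = Suc (a' + b)" using a by simp
      have z: "zsum q (a + b) a = zsum q (a' + b) a' + q ^ (2 * a) * zsum q (a + b') a"
      proof -
        have "zsum q (a + b) a = zsum q (Suc (a' + b)) (Suc a')" by (simp add: a)
        also have "\<dots> = zsum q (a' + b) a' + q ^ (2 * Suc a') * zsum q (a' + b) (Suc a')" by (rule zsum_Suc)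
        finally show ?thesis by (simp only: a[symmetric] n[symmetric])
      qed
      have "zsum q (a + b) a * (qfact ?\<delta> a * qfact ?\<delta> b) =
          qnum ?\<delta> a * (zsum q (a' + b) a' * (qfact ?\<delta> a' * qfact ?\<delta> b)) +
          q ^ (2 * a) * qnum ?\<delta> b * (zsum q (a + b') a * (qfact ?\<delta> a * qfact ?\<delta> b'))"
        unfolding z unfolding a b qfact.simps by (simp only: distrib_left distrib_right mult_ac)
      also have "\<dots> = (qnum ?\<delta> a * q ^ (a' * b) + q ^ (2 * a + a * b') * qnum ?\<delta> b) * qfact ?\<delta> (a' + b)"
        unfolding i1 i2 unfolding n by (simp only: distrib_left distrib_right mult_ac power_add)
      also have "qnum ?\<delta> a * q ^ (a' * b) + q ^ (2 * a + a * b') * qnum ?\<delta> b = q ^ (a * b) * qnum ?\<delta> (a + b)"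
      proof -
        have 1: "q ^ (a * b) * q ^ a = q ^ (2 * a + a * b')" unfolding b by (simp add: power_add[symmetric] algebra_simps mult_2_right)
        have "q ^ (a * b) = q ^ (a' * b) * q ^ b" unfolding a by (simp add: power_add algebra_simps)
        moreover have "q ^ b * qi ^ b = 1" using q by (metis power_mult_distrib power_one)
        ultimately have 2: "q ^ (a * b) * qi ^ b = q ^ (a' * b)" by (simp add: mult.assoc)
        show ?thesis
          unfolding qnum_add_q[OF q, of a b] distrib_left mult.assoc[symmetric] 1 2 by (simp only: add_ac mult_ac)
      qed
      finally show ?thesis unfolding ab by (simp only: qfact.simps mult_ac)
    qed
  qed
qed

subsection \<open>The quantum Lucas theorem\<close>

text \<open>Quantum numbers are periodic with period l up to the sign \<epsilon> =
  \<open>[l+1]\<close>, by the addition formula at a zero. The value of \<open>[l-1]\<close> is -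
  \<epsilon> by the recursion.\<close>

lemma qnum_ell:
  fixes \<delta> :: "'a::comm_ring_1"
  assumes l: "qnum \<delta> l = 0" "l > 0"
  shows "qnum \<delta> (C * l + d) = qnum \<delta> (Suc l) ^ C * qnum \<delta> d" and "qnum \<delta> (Suc l) ^ 2 = 1"
    and "C > 0 \<Longrightarrow> qnum \<delta> (C * l - 1) = - (qnum \<delta> (Suc l) ^ C)"
proof -
  let ?e = "qnum \<delta> (Suc l)"
  obtain l' where l': "l = Suc l'" using l by (cases l) auto
  have step: "qnum \<delta> (l + d) = ?e * qnum \<delta> d" for d
  proof (cases d)
    case 0 then show ?thesis using l by simp
  next
    case (Suc d')
    then show ?thesis using qnum_add[of \<delta> l d'] l by simp
  qed
  show 1: "qnum \<delta> (C * l + d) = ?e ^ C * qnum \<delta> d" for C d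
    by (induction C) (simp_all add: step add.assoc mult.assoc)
  have prev: "qnum \<delta> l' = - ?e" unfolding l' using l l' by simp
  have "1 = ?e ^ 2"
  proof -
    \<comment> \<open>A Cassini identity; at n = l - 1 the square vanishes and the identity says
      that \<epsilon> has square 1.\<close>
    have cassini: "qnum \<delta> (Suc n) * qnum \<delta> (Suc n) - qnum \<delta> (Suc (Suc n)) * qnum \<delta> n = 1" for n
      by (induction n) (simp_all add: algebra_simps)
    from cassini[of l'] show ?thesis using prev l by (simp add: l'[symmetric] power2_eq_square)
  qed
  then show "?e ^ 2 = 1" ..
  show "qnum \<delta> (C * l - 1) = - (?e ^ C)" if C0: "C > 0"
  proof -
    obtain C' where C: "C = Suc C'" using C0 by (cases C) auto
    have "C * l - 1 = C' * l + l'" unfolding C l' by simp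
    then show ?thesis using 1[of C' l'] prev C by simp
  qed
qed

text \<open>The factorial of d + e contains the factor \<open>[l]\<close> exactly if d + e is at
  least l, while the factorials of d and e do not vanish.\<close>

lemma qbin_small_zero:
  fixes \<delta> :: "'a::idom"
  assumes l: "qnum \<delta> l = 0" and nz: "\<And>k. 0 < k \<Longrightarrow> k < l \<Longrightarrow> qnum \<delta> k \<noteq> 0" and de: "d < l" "e < l"
  shows "qbin \<delta> d e = 0 \<longleftrightarrow> l \<le> d + e"
proof -
  have f: "k < l \<Longrightarrow> qfact \<delta> k \<noteq> 0" for k
    by (induction k) (use nz in auto)
  have f0: "l \<le> k \<Longrightarrow> qfact \<delta> k = 0" for k
  proof (induction k)
    case (Suc k)
    then show ?case using l by (cases "l = Suc k") auto
  qed (use l de in auto)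
  have "qbin \<delta> d e * (qfact \<delta> d * qfact \<delta> e) = qfact \<delta> (d + e)" by (rule qbin_fact)
  then show ?thesis using f f0 de by (metis linorder_not_le mult_eq_0_iff)
qed

text \<open>Induction along the recursion of \<open>qbin\<close>, with the sign \<epsilon> tracked
  explicitly. If both remainders are positive, the recursion is the one for
  \<open>qbin \<delta> d e\<close>. If exactly one of them is 0, one term has remainders adding up
  to at least l and vanishes.\<close>

lemma qbin_lucas:
  fixes \<delta> :: "'a::idom"
  assumes l: "qnum \<delta> l = 0" "l > 0" and nz: "\<And>k. 0 < k \<Longrightarrow> k < l \<Longrightarrow> qnum \<delta> k \<noteq> 0"
  shows "d < l \<Longrightarrow> e < l \<Longrightarrow> qbin \<delta> (C * l + d) (E * l + e) =
    qnum \<delta> (Suc l) ^ (l * C * E + C * e + d * E) * of_nat ((C + E) choose C) * qbin \<delta> d e"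
proof (induction "C * l + d + (E * l + e)" arbitrary: C d E e rule: less_induct)
  case less
  let ?\<epsilon> = "qnum \<delta> (Suc l)"
  note qe = qnum_ell[OF l]
  have ee: "?\<epsilon> * ?\<epsilon> = 1" using qe(2) by (simp add: power2_eq_square)
  have zero: "qbin \<delta> d e = 0" if "d < l" "e < l" "l \<le> d + e" for d e
    using qbin_small_zero[OF l(1) nz that(1,2)] that by blast
  consider "C * l + d = 0" | "E * l + e = 0" | "C * l + d > 0" "E * l + e > 0" by linarith
  then show ?case
  proof cases
    case 1
    then have "C = 0" "d = 0" using l(2) by simp_all
    then show ?thesis by simp
  next
    case 2
    then have "E = 0" "e = 0" using l(2) by simp_all
    then show ?thesis by simp
  next
    case 3
    obtain a where a: "C * l + d = Suc a" using gr0_implies_Suc[OF 3(1)] ..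
    obtain b where b: "E * l + e = Suc b" using gr0_implies_Suc[OF 3(2)] ..
    have rec: "qbin \<delta> (C * l + d) (E * l + e) =
        qnum \<delta> (C * l + Suc d) * qbin \<delta> (C * l + d) b - qnum \<delta> b * qbin \<delta> a (E * l + e)"
    proof -
      have "C * l + Suc d = Suc (Suc a)" using a by simp
      then show ?thesis unfolding a b by (simp only: qbin.simps)
    qed
    have q1: "qnum \<delta> (C * l + Suc d) = ?\<epsilon> ^ C * qnum \<delta> (Suc d)" by (rule qe(1))
    show ?thesis
    proof (cases d)
      case d: (Suc d')
      have a': "a = C * l + d'" using a d by simp
      show ?thesis
      proof (cases e)
        case e: (Suc e')
        have b': "b = E * l + e'" using b e by simp
        have i1: "qbin \<delta> (C * l + d) b = ?\<epsilon> ^ (l * C * E + C * e' + d * E) * of_nat ((C + E) choose C) * qbin \<delta> d e'"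
          unfolding b' by (rule less.hyps) (use less.prems d e in auto)
        have i2: "qbin \<delta> a (E * l + e) = ?\<epsilon> ^ (l * C * E + C * e + d' * E) * of_nat ((C + E) choose C) * qbin \<delta> d' e"
          unfolding a' by (rule less.hyps) (use less.prems d e in auto)
        have q2: "qnum \<delta> b = ?\<epsilon> ^ E * qnum \<delta> e'" unfolding b' by (rule qe(1))
        have p1: "?\<epsilon> ^ C * ?\<epsilon> ^ (l * C * E + C * e' + d * E) = ?\<epsilon> ^ (l * C * E + C * e + d * E)"
          unfolding power_add[symmetric] e by (simp add: algebra_simps)
        have p2: "?\<epsilon> ^ E * ?\<epsilon> ^ (l * C * E + C * e + d' * E) = ?\<epsilon> ^ (l * C * E + C * e + d * E)"
          unfolding power_add[symmetric] d by (simp add: algebra_simps)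
        have "qbin \<delta> (C * l + d) (E * l + e) =
          (?\<epsilon> ^ C * ?\<epsilon> ^ (l * C * E + C * e' + d * E)) * of_nat ((C + E) choose C) * (qnum \<delta> (Suc d) * qbin \<delta> d e')
          - (?\<epsilon> ^ E * ?\<epsilon> ^ (l * C * E + C * e + d' * E)) * of_nat ((C + E) choose C) * (qnum \<delta> e' * qbin \<delta> d' e)"
          unfolding rec q1 q2 i1 i2 by (simp only: mult_ac)
        also have "\<dots> = ?\<epsilon> ^ (l * C * E + C * e + d * E) * of_nat ((C + E) choose C) * qbin \<delta> d e"
          unfolding p1 p2 right_diff_distrib[symmetric] unfolding d e qbin.simps ..
        finally show ?thesis .
      next
        case e: 0
        obtain E' where E: "E = Suc E'" using b e by (cases E) auto
        have b': "b = E' * l + (l - 1)" "b = E * l - 1" using b e E l by auto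
        have "qbin \<delta> (C * l + d) b = 0"
        proof -
          have "qbin \<delta> (C * l + d) (E' * l + (l - 1)) =
              ?\<epsilon> ^ (l * C * E' + C * (l - 1) + d * E') * of_nat ((C + E') choose C) * qbin \<delta> d (l - 1)"
            by (rule less.hyps) (use less.prems b' b e l in auto)
          moreover have "qbin \<delta> d (l - 1) = 0" using less.prems d l by (intro zero) auto
          ultimately show ?thesis unfolding b'(1) by simp
        qed
        moreover have "qbin \<delta> a (E * l + 0) = ?\<epsilon> ^ (l * C * E + C * 0 + d' * E) * of_nat ((C + E) choose C) * qbin \<delta> d' 0"
          unfolding a' by (rule less.hyps) (use less.prems d e l in auto)
        moreover have "qnum \<delta> b = - (?\<epsilon> ^ E)" unfolding b'(2) by (rule qe(3)) (simp add: E)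
        moreover have "?\<epsilon> ^ E * ?\<epsilon> ^ (l * C * E + C * 0 + d' * E) = ?\<epsilon> ^ (l * C * E + C * e + d * E)"
          unfolding power_add[symmetric] d e by (simp add: algebra_simps)
        ultimately show ?thesis unfolding rec unfolding e by (simp add: mult.assoc[symmetric])
      qed
    next
      case d: 0
      obtain C' where C: "C = Suc C'" using a d by (cases C) auto
      have a': "a = C' * l + (l - 1)" using a d C l by auto
      show ?thesis
      proof (cases e)
        case e: (Suc e')
        have b': "b = E * l + e'" using b e by simp
        have i1: "qbin \<delta> (C * l + d) b = ?\<epsilon> ^ (l * C * E + C * e' + d * E) * of_nat ((C + E) choose C) * qbin \<delta> d e'"
          unfolding b' by (rule less.hyps) (use less.prems d e in auto)
        have "qbin \<delta> a (E * l + e) = 0"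
        proof -
          have "qbin \<delta> (C' * l + (l - 1)) (E * l + e) =
              ?\<epsilon> ^ (l * C' * E + C' * e + (l - 1) * E) * of_nat ((C' + E) choose C') * qbin \<delta> (l - 1) e"
            by (rule less.hyps) (use less.prems a' a d l in auto)
          moreover have "qbin \<delta> (l - 1) e = 0" using less.prems e l by (intro zero) auto
          ultimately show ?thesis unfolding a' by simp
        qed
        moreover have "?\<epsilon> ^ C * ?\<epsilon> ^ (l * C * E + C * e' + d * E) = ?\<epsilon> ^ (l * C * E + C * e + d * E)"
          unfolding power_add[symmetric] e by (simp add: algebra_simps)
        ultimately show ?thesis unfolding rec q1 i1 using d by (simp add: mult.assoc[symmetric])
      next
        \<comment> \<open>Both remainders vanish: both terms of the recursion survive and combine by
          the Pascal rule for ordinary binomial coefficients of the quotients.\<close>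
        case e: 0
        obtain E' where E: "E = Suc E'" using b e by (cases E) auto
        have b': "b = E' * l + (l - 1)" "b = E * l - 1" using b e E l by auto
        have i1: "qbin \<delta> (C * l + 0) (E' * l + (l - 1)) =
            ?\<epsilon> ^ (l * C * E' + C * (l - 1) + 0 * E') * of_nat ((C + E') choose C) * qbin \<delta> 0 (l - 1)"
          by (rule less.hyps) (use less.prems b' b d e l in auto)
        have i2: "qbin \<delta> (C' * l + (l - 1)) (E * l + 0) =
            ?\<epsilon> ^ (l * C' * E + C' * 0 + (l - 1) * E) * of_nat ((C' + E) choose C') * qbin \<delta> (l - 1) 0"
          by (rule less.hyps) (use less.prems a' a d e l in auto)
        have q2: "qnum \<delta> b = - (?\<epsilon> ^ E)" unfolding b'(2) by (rule qe(3)) (simp add: E)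
        obtain l' where l': "l = Suc l'" using l by (cases l) auto
        have p1: "?\<epsilon> ^ C * ?\<epsilon> ^ (l * C * E' + C * (l - 1) + 0 * E') = ?\<epsilon> ^ (l * C * E)"
          unfolding power_add[symmetric] E l' by (simp add: algebra_simps)
        have p2: "?\<epsilon> ^ E * ?\<epsilon> ^ (l * C' * E + C' * 0 + (l - 1) * E) = ?\<epsilon> ^ (l * C * E)"
          unfolding power_add[symmetric] C l' by (simp add: algebra_simps)
        have "qbin \<delta> (C * l + d) (E * l + e) =
            (?\<epsilon> ^ C * ?\<epsilon> ^ (l * C * E' + C * (l - 1) + 0 * E')) * of_nat ((C + E') choose C) +
            (?\<epsilon> ^ E * ?\<epsilon> ^ (l * C' * E + C' * 0 + (l - 1) * E)) * of_nat ((C' + E) choose C')"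
          unfolding rec unfolding q1 q2 unfolding d e unfolding b'(1) a' i1 i2 by (simp add: mult.assoc)
        also have "\<dots> = ?\<epsilon> ^ (l * C * E) * of_nat (((C + E') choose C) + ((C' + E) choose C'))"
          unfolding p1 p2 of_nat_add distrib_left ..
        also have "((C + E') choose C) + ((C' + E) choose C') = (C + E) choose C"
          unfolding C E by (simp add: add.commute)
        finally show ?thesis using d e by simp
      qed
    qed
  qed
qed

lemma qbin_nonzero_step:
  fixes \<delta> :: "'a::idom"
  assumes l: "qnum \<delta> l = 0" "l > 0" and nz: "\<And>k. 0 < k \<Longrightarrow> k < l \<Longrightarrow> qnum \<delta> k \<noteq> 0"
  shows "qbin \<delta> a b \<noteq> 0 \<longleftrightarrow> a mod l + b mod l < l \<and> (of_nat ((a div l + b div l) choose (a div l)) :: 'a) \<noteq> 0"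
proof -
  have "qnum \<delta> (Suc l) \<noteq> 0" using qnum_ell(2)[OF l] by auto
  moreover have "qbin \<delta> ((a div l) * l + a mod l) ((b div l) * l + b mod l) =
    qnum \<delta> (Suc l) ^ (l * (a div l) * (b div l) + (a div l) * (b mod l) + (a mod l) * (b div l))
    * of_nat ((a div l + b div l) choose (a div l)) * qbin \<delta> (a mod l) (b mod l)"
    using l by (intro qbin_lucas[OF l nz]) auto
  moreover have "qbin \<delta> (a mod l) (b mod l) = 0 \<longleftrightarrow> l \<le> a mod l + b mod l"
    using l by (intro qbin_small_zero[OF l(1) nz]) auto
  ultimately show ?thesis by auto
qed

text \<open>The case q = 1. It is proved over the integers, where the factorials can be cancelled,
  and carried to other rings by the canonical homomorphism.\<close>

lemma qbin_two: "qbin 2 a b = (of_nat ((a + b) choose a) :: 'a::comm_ring_1)"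
proof -
  have *: "qbin 2 a b = int ((a + b) choose a)" for a b
  proof -
    have f: "qfact 2 n = (fact n :: int)" for n by (induction n) (simp_all add: qnum_two del: qnum.simps)
    have "qbin 2 a b * (fact a * fact b) = (fact (a + b) :: int)"
      using qbin_fact[of "2 :: int" a b] unfolding f .
    moreover have "int ((a + b) choose a) * (fact a * fact b) = fact (a + b)"
    proof -
      have "int (fact a * fact b * ((a + b) choose a)) = int (fact (a + b))"
        using binomial_fact_lemma[of a "a + b"] by simp
      then show ?thesis unfolding of_nat_mult of_nat_fact by (simp only: mult_ac)
    qed
    ultimately have "qbin 2 a b * (fact a * fact b) = int ((a + b) choose a) * (fact a * fact b)" by simp
    then show ?thesis by simp
  qed
  have "is_hom (of_int :: int \<Rightarrow> 'a)" by (simp add: is_hom_def)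
  from qbin_hom[OF this, of 2 a b] show ?thesis unfolding * by simp
qed

text \<open>The classical Lucas theorem as the case \<delta> = 2 of the quantum one: there
  \<open>[k] = k\<close>, and the least positive zero is the characteristic.\<close>

lemma choose_nonzero_step:
  assumes p: "CHAR('a::idom) = p" "p > 0"
  shows "(of_nat ((a + b) choose a) :: 'a) \<noteq> 0 \<longleftrightarrow>
    a mod p + b mod p < p \<and> (of_nat ((a div p + b div p) choose (a div p)) :: 'a) \<noteq> 0"
proof -
  have "qnum (2 :: 'a) p = 0" unfolding qnum_two p(1)[symmetric] by (rule of_nat_CHAR)
  moreover have "qnum (2 :: 'a) k \<noteq> 0" if "0 < k" "k < p" for k
    unfolding qnum_two of_nat_eq_0_iff_char_dvd p(1) using that by (auto dest: dvd_imp_le)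
  ultimately show ?thesis using qbin_nonzero_step[of "2 :: 'a" p a b] p(2) by (simp add: qbin_two)
qed

subsection \<open>Denominators of Jones--Wenzl elements\<close>

text \<open>The ring \<open>\<rat>(X)[q] / (q\<^sup>2 - X q + 1)\<close>, in which \<open>X = q + q\<^sup>-\<^sup>1\<close>; \<open>QE u v\<close> stands for
  \<open>u + v q\<close>.\<close>

datatype qext = QE (qre: "int poly fract") (qim: "int poly fract")

instantiation qext :: comm_ring_1
begin

definition "0 = QE 0 0"
definition "1 = QE 1 0"
definition "x + y = QE (qre x + qre y) (qim x + qim y)"
definition "x - y = QE (qre x - qre y) (qim x - qim y)"
definition "- x = QE (- qre x) (- qim x)"
text \<open>Reduced by \<open>q^2 = X q - 1\<close>.\<close>

definition "x * y = QE (qre x * qre y - qim x * qim y)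
  (qre x * qim y + qim x * qre y + qim x * qim y * generic_loop)"

instance
proof
  fix a b c :: qext
  show "a * b * c = a * (b * c)" by (cases a; cases b; cases c) (simp add: times_qext_def algebra_simps)
  show "(a + b) * c = a * c + b * c"
    by (cases a; cases b; cases c) (simp add: times_qext_def plus_qext_def algebra_simps)
qed (auto simp: zero_qext_def one_qext_def plus_qext_def minus_qext_def uminus_qext_def times_qext_def
      algebra_simps intro: qext.expand)

end

abbreviation qX :: qext where "qX \<equiv> QE 0 1"
abbreviation qXi :: qext where "qXi \<equiv> QE generic_loop (-1)"
abbreviation qbase :: "int poly fract \<Rightarrow> qext" where "qbase c \<equiv> QE c 0"

lemma qX_inverse: "qX * qXi = 1" by (simp add: times_qext_def one_qext_def)

lemma qX_loop: "qX + qXi = qbase generic_loop" by (simp add: plus_qext_def)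

lemma is_hom_qbase: "is_hom qbase"
  by (simp add: is_hom_def zero_qext_def one_qext_def plus_qext_def times_qext_def)

text \<open>The ring \<open>Z[X][q]\<close>. Since q is a unit in it, powers of q do not count as
  denominators.\<close>

definition qext_integral :: "qext set" where
  "qext_integral = {QE u v | u v. u \<in> range to_fract \<and> v \<in> range to_fract}"

abbreviation poly_loop :: "int poly" where "poly_loop \<equiv> [:0, 1:]"

lemma is_hom_to_fract: "is_hom (to_fract :: 'a::idom \<Rightarrow> 'a fract)"
  by (simp add: is_hom_def)

lemma subring_qext_integral: "is_subring qext_integral"
proof -
  have r: "to_fract x + to_fract y \<in> range to_fract" "to_fract x - to_fract y \<in> range to_fract"
    "to_fract x * to_fract y \<in> range to_fract" for x y :: "int poly"
    by (metis rangeI to_fract_add, metis rangeI to_fract_diff, metis rangeI to_fract_mult)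
  have 01: "(0 :: int poly fract) \<in> range to_fract" "(1 :: int poly fract) \<in> range to_fract"
    by (metis rangeI to_fract_0, metis rangeI to_fract_1)
  have c: "a + b \<in> range to_fract" "a - b \<in> range to_fract" "a * b \<in> range to_fract"
    if "a \<in> range to_fract" "b \<in> range to_fract" for a b :: "int poly fract"
    using that r by auto
  have X: "generic_loop \<in> range to_fract" by (simp add: generic_loop_def)
  show ?thesis
    unfolding is_subring_def qext_integral_def
    using 01 c X by (auto simp: zero_qext_def one_qext_def plus_qext_def minus_qext_def times_qext_def)
qed

lemma qX_integral: "qX \<in> qext_integral" "qXi \<in> qext_integral"
proof -
  have "0 \<in> range (to_fract :: int poly \<Rightarrow> _)" "1 \<in> range (to_fract :: int poly \<Rightarrow> _)"
    "- 1 \<in> range (to_fract :: int poly \<Rightarrow> _)" "generic_loop \<in> range to_fract"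
    by (metis rangeI to_fract_0, metis rangeI to_fract_1, metis rangeI to_fract_1 to_fract_uminus, simp add: generic_loop_def)
  then show "qX \<in> qext_integral" "qXi \<in> qext_integral" unfolding qext_integral_def by auto
qed

lemma qbase_integral_iff: "qbase c \<in> qext_integral \<longleftrightarrow> c \<in> range to_fract"
proof -
  have "0 \<in> range (to_fract :: int poly \<Rightarrow> _)" by (metis rangeI to_fract_0)
  then show ?thesis by (auto simp: qext_integral_def)
qed

lemma is_hom_poly: "is_hom (\<lambda>p :: 'a::comm_ring_1 poly. poly p x)"
  by (simp add: is_hom_def)

lemma generic_loop_hom: "generic_loop = to_fract poly_loop"
  by (simp add: generic_loop_def)

text \<open>Evaluation at X = 2 turns the quantum number of k into k.\<close>

lemma qnum_generic_nonzero:
  assumes "0 < k" shows "qnum generic_loop k \<noteq> 0"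
proof -
  have "poly (qnum poly_loop k) 2 = qnum (poly poly_loop 2) k"
    by (rule qnum_hom[OF is_hom_poly])
  also have "\<dots> = of_nat k" by (simp add: qnum_two)
  finally have "qnum poly_loop k \<noteq> 0" using assms by auto
  then show ?thesis
    unfolding generic_loop_hom qnum_hom[OF is_hom_to_fract, symmetric] by simp
qed

lemma qfact_generic_nonzero: "qfact generic_loop k \<noteq> 0"
  by (induction k) (use qnum_generic_nonzero in auto)

text \<open>Existence for the definite description in \<open>JW\<close> comes from the recursion.
  For uniqueness, an element g killed by the caps satisfies g g = c g with c its identity
  coefficient; a nonzero idempotent over a field has c = 1, and \<open>jw_unique\<close>
  applies.\<close>

lemma JW_jw: "jw generic_loop n (JW n)"
proof -
  obtain f where f: "jw generic_loop n f" using jw_exists[OF qnum_generic_nonzero] by blast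
  let ?P = "\<lambda>f. f \<in> Hom n n \<and> f \<noteq> 0 \<and> tl_comp generic_loop f f = f
     \<and> (\<forall>i. i + 1 < n \<longrightarrow> tl_comp generic_loop f (dg (cap_diag n i)) = 0
        \<and> tl_comp generic_loop (dg (refl_diag (cap_diag n i))) f = 0)"
  have "?P f" using f jw_absorb[OF f, of f] unfolding jw_def by fastforce
  moreover have "g = f" if g: "?P g" for g
  proof -
    have "tl_comp generic_loop g g = tl_scale (lk g (id_diag n)) g"
      by (rule cap_killer_absorb) (use g in auto)
    then have "tl_scale (lk g (id_diag n) - 1) g = 0" using g by (simp add: TL.scale_left_diff_distrib)
    moreover obtain D where "lk g D \<noteq> 0" using g by (metis lookup_zero poly_mapping_eqI)
    moreover have "lk (tl_scale (lk g (id_diag n) - 1) g) D = (lk g (id_diag n) - 1) * lk g D" by simp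
    ultimately have "lk g (id_diag n) = 1" by simp
    then have "jw generic_loop n g" using g by (simp add: jw_def)
    then show ?thesis using jw_unique f by blast
  qed
  ultimately have "JW n = f" unfolding JW_def by (intro the_equality) blast+
  then show ?thesis using f by simp
qed

lemma jw_mmap:
  assumes h: "is_hom \<phi>" and f: "jw \<delta> n f" shows "jw (\<phi> \<delta>) n (mmap \<phi> f)"
proof -
  have 0: "\<phi> 0 = 0" "\<phi> 1 = 1" using h by (auto simp: is_hom_def)
  have m0: "mmap \<phi> 0 = 0" by (rule poly_mapping_eqI) (simp add: lookup_mmap[of \<phi>, OF 0(1)] 0)
  have s: "mmap \<phi> (dg D) = dg D" for D by (simp add: mmap_single[of \<phi>, OF 0(1)] 0)
  have "tl_comp (\<phi> \<delta>) (mmap \<phi> f) (dg (cap_diag n i)) = 0 \<and> tl_comp (\<phi> \<delta>) (dg (cup_diag n i)) (mmap \<phi> f) = 0"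
    if "i + 1 < n" for i
  proof -
    have "tl_comp \<delta> f (dg (cap_diag n i)) = 0" "tl_comp \<delta> (dg (cup_diag n i)) f = 0"
      using f that by (auto simp: jw_def)
    then have "mmap \<phi> (tl_comp \<delta> f (dg (cap_diag n i))) = 0" "mmap \<phi> (tl_comp \<delta> (dg (cup_diag n i)) f) = 0"
      by (simp_all add: m0)
    then show ?thesis unfolding mmap_comp[OF h] s by simp
  qed
  then show ?thesis using f mmap_in[of \<phi>, OF 0(1)] unfolding jw_def by (simp add: lookup_mmap[of \<phi>, OF 0(1)] 0)
qed

text \<open>The factorials in \<open>zsum_fact\<close> come from the field Q(X), where they are
  invertible. So they can be cancelled although \<open>qext\<close> is only known to be a
  ring.\<close>

lemma zsum_qbin: "zsum qX (a + b) a = qX ^ (a * b) * qbin (qX + qXi) a b"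
proof -
  let ?\<delta> = "qX + qXi"
  define u where "u = qfact generic_loop a * qfact generic_loop b"
  have u0: "u \<noteq> 0" by (simp add: u_def qfact_generic_nonzero)
  have F: "qfact ?\<delta> a * qfact ?\<delta> b = qbase u"
    unfolding qX_loop qfact_hom[OF is_hom_qbase, symmetric] u_def using is_hom_qbase by (simp add: is_hom_def)
  have inv: "qbase u * qbase (1 / u) = 1" using u0 by (simp add: times_qext_def one_qext_def)
  have "zsum qX (a + b) a * qbase u = qX ^ (a * b) * qbin ?\<delta> a b * qbase u"
    using zsum_fact[OF qX_inverse, of a b] qbin_fact[of ?\<delta> a b] unfolding F by (simp add: mult.assoc)
  then have "zsum qX (a + b) a * (qbase u * qbase (1 / u)) = qX ^ (a * b) * qbin ?\<delta> a b * (qbase u * qbase (1 / u))"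
    by (simp only: mult.assoc[symmetric])
  then show ?thesis unfolding inv by simp
qed

text \<open>A common denominator for the coefficients of \<open>JW n\<close>: one binomial
  coefficient for each possible number k of ups among the sources, as suggested by
  \<open>jw_spin\<close> and \<open>zsum_qbin\<close>.\<close>

definition jw_denom :: "'a::comm_ring_1 \<Rightarrow> nat \<Rightarrow> 'a" where
  "jw_denom \<delta> n = (\<Prod>k\<le>n. qbin \<delta> k (n - k))"

lemma jw_denom_hom:
  assumes h: "is_hom \<phi>" shows "\<phi> (jw_denom \<delta> n) = jw_denom (\<phi> \<delta>) n"
proof -
  have "\<phi> (prod f I) = (\<Prod>i\<in>I. \<phi> (f i))" for f :: "nat \<Rightarrow> _" and I
    by (induction I rule: infinite_finite_induct) (use h in \<open>auto simp: is_hom_def\<close>)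
  then show ?thesis unfolding jw_denom_def by (simp add: qbin_hom[OF h])
qed

text \<open>The multiple of \<open>JW n\<close> by \<open>jw_denom\<close> has integral spin values,
  hence integral coefficients in \<open>Z[X][q]\<close>. These coefficients lie in Q(X), and
  \<open>Z[X][q]\<close> meets Q(X) in Z[X].\<close>

lemma JW_denominator: "jw_denom generic_loop n * lk (JW n) D \<in> range to_fract"
proof (cases "D \<in> diagrams n n")
  case False
  then have "lk (JW n) D = 0" using JW_jw[of n] unfolding jw_def Hom_iff by blast
  then show ?thesis by (metis mult_zero_right rangeI to_fract_0)
next
  case True
  let ?S = qext_integral
  let ?f = "mmap qbase (JW n)"
  have 0: "qbase 0 = 0" by (simp add: zero_qext_def)
  have f: "jw (qX + qXi) n ?f" unfolding qX_loop by (rule jw_mmap[OF is_hom_qbase JW_jw])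
  note S = subring_qext_integral
  have mult: "x \<in> ?S \<Longrightarrow> y \<in> ?S \<Longrightarrow> x * y \<in> ?S" for x y using S unfolding is_subring_def by blast
  have loopS: "qX + qXi \<in> ?S" using S qX_integral unfolding is_subring_def by blast
  have qnumS: "qnum (qX + qXi) k \<in> ?S" for k
    by (induction k rule: induct_nat_012) (use S loopS in \<open>auto simp: is_subring_def\<close>)
  have qbinS: "qbin (qX + qXi) a b \<in> ?S" for a b
    by (induction "qX + qXi" a b rule: qbin.induct) (use S qnumS in \<open>auto simp: is_subring_def simp del: qnum.simps\<close>)
  have "jw_denom (qX + qXi) n * Spin qX n n zs ?f \<in> ?S" if "length zs = n + n" for zs
  proof -
    let ?xs = "take n zs" and ?k = "ups (take n zs)"
    have len: "length ?xs = n" using that by simp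
    have k: "?k \<le> n" using ups_downs[of ?xs] len by simp
    have "zsum qX n ?k * Spin qX n n (?xs @ drop n zs) ?f \<in> ?S"
      by (rule jw_spin[OF qX_inverse f S qX_integral(1) len])
    then have "qXi ^ (?k * (n - ?k)) * (zsum qX n ?k * Spin qX n n zs ?f) \<in> ?S"
      using mult subring_power[OF S qX_integral(2)] by simp
    moreover have "qXi ^ (?k * (n - ?k)) * zsum qX n ?k = qbin (qX + qXi) ?k (n - ?k)"
    proof -
      have "zsum qX n ?k = qX ^ (?k * (n - ?k)) * qbin (qX + qXi) ?k (n - ?k)"
        using zsum_qbin[of ?k "n - ?k"] k by simp
      moreover have "qXi ^ j * qX ^ j = 1" for j
        using qX_inverse by (metis mult.commute power_mult_distrib power_one)
      ultimately show ?thesis by (simp only: mult.assoc[symmetric] mult_1_left)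
    qed
    ultimately have 1: "qbin (qX + qXi) ?k (n - ?k) * Spin qX n n zs ?f \<in> ?S"
      by (simp only: mult.assoc[symmetric])
    \<comment> \<open>A spin value with k ups among the sources is made integral by the factor for
      this k; the other factors are integral and do no harm.\<close>
    have "jw_denom (qX + qXi) n = (\<Prod>j\<in>{..n} - {?k}. qbin (qX + qXi) j (n - j)) * qbin (qX + qXi) ?k (n - ?k)"
      unfolding jw_denom_def using k by (subst prod.remove[of _ ?k]) (auto simp: mult.commute)
    moreover have "(\<Prod>j\<in>{..n} - {?k}. qbin (qX + qXi) j (n - j)) \<in> ?S"
      using S qbinS by (rule subring_prod)
    ultimately show ?thesis using mult 1 by (simp add: mult.assoc)
  qed
  then have "lk (tl_scale (jw_denom (qX + qXi) n) ?f) D \<in> ?S"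
    by (intro coeffs_in_subring[OF qX_inverse S qX_integral _ True]) (simp add: Spin_scale)
  then have "qbase (jw_denom generic_loop n) * qbase (lk (JW n) D) \<in> ?S"
    unfolding qX_loop jw_denom_hom[OF is_hom_qbase, symmetric] by (simp add: lookup_mmap[of qbase, OF 0])
  then have "qbase (jw_denom generic_loop n * lk (JW n) D) \<in> ?S" by (simp add: times_qext_def)
  then show ?thesis unfolding qbase_integral_iff .
qed

text \<open>The multiple of \<open>JW n\<close> by its common denominator, as an element over Z[X].
  The choice has a witness by \<open>JW_denominator\<close>, and it is unique because
  \<open>to_fract\<close> is injective.\<close>

definition JW_numer :: "nat \<Rightarrow> int poly mor" where
  "JW_numer n = mmap (\<lambda>c. SOME p. to_fract p = jw_denom generic_loop n * c) (JW n)"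

lemma lookup_JW_numer: "to_fract (lk (JW_numer n) D) = jw_denom generic_loop n * lk (JW n) D"
proof -
  let ?g = "\<lambda>c. SOME p. to_fract p = jw_denom generic_loop n * c"
  have g0: "?g 0 = 0" by simp
  have "\<exists>p. to_fract p = jw_denom generic_loop n * lk (JW n) D" using JW_denominator[of n D] by (metis rangeE)
  from someI_ex[OF this] show ?thesis unfolding JW_numer_def lookup_mmap[of ?g, OF g0] .
qed

section \<open>Specialisation at \<delta>\<close>

lemma eval_at_pCons: "eval_at \<delta> (pCons a p) = of_int a + \<delta> * eval_at \<delta> p"
  by (simp add: eval_at_def map_poly_pCons)

lemma eval_at_simps: "eval_at \<delta> 0 = 0" "eval_at \<delta> 1 = 1" "eval_at \<delta> poly_loop = \<delta>"
  by (simp_all add: eval_at_def map_poly_pCons)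

lemma eval_at_add: "eval_at \<delta> (p + r) = eval_at \<delta> p + eval_at \<delta> r"
  by (induction p r rule: poly_induct2) (simp_all add: eval_at_pCons eval_at_simps algebra_simps)

lemma eval_at_smult: "eval_at \<delta> (smult a p) = of_int a * eval_at \<delta> p"
  by (induction p) (simp_all add: eval_at_pCons eval_at_simps algebra_simps)

lemma is_hom_eval_at: "is_hom (eval_at \<delta>)"
proof -
  have "eval_at \<delta> (p * r) = eval_at \<delta> p * eval_at \<delta> r" for p r
    by (induction p) (simp_all add: eval_at_pCons eval_at_simps eval_at_add eval_at_smult mult_pCons_left algebra_simps)
  then show ?thesis by (simp add: is_hom_def eval_at_simps eval_at_add)
qed

lemma jw_denom_generic: "jw_denom generic_loop n = to_fract (jw_denom poly_loop n)"
  unfolding generic_loop_hom jw_denom_hom[OF is_hom_to_fract] ..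

lemma mmap_JW_numer: "mmap to_fract (JW_numer n) = tl_scale (jw_denom generic_loop n) (JW n)"
  by (rule poly_mapping_eqI) (simp add: lookup_mmap lookup_JW_numer)

text \<open>Two representations of the same fraction are compared by cross multiplication in Z[X].
  Evaluation at \<delta> and cancellation in the domain show that they give the same value.\<close>

lemma specialise_eqI:
  fixes \<delta> :: "'k::idom"
  assumes "f * to_fract Q = to_fract P" "eval_at \<delta> Q \<noteq> 0" "c * eval_at \<delta> Q = eval_at \<delta> P"
  shows "specialise \<delta> f = c"
  unfolding specialise_def
proof (rule the_equality)
  have Q: "Q \<noteq> 0" using assms(2) by (auto simp: eval_at_simps)
  then show "\<exists>P Q. f = to_fract P / to_fract Q \<and> eval_at \<delta> Q \<noteq> 0 \<and> c * eval_at \<delta> Q = eval_at \<delta> P"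
    using assms by (intro exI[of _ P] exI[of _ Q]) (simp add: field_simps)
  fix c' assume "\<exists>P Q. f = to_fract P / to_fract Q \<and> eval_at \<delta> Q \<noteq> 0 \<and> c' * eval_at \<delta> Q = eval_at \<delta> P"
  then obtain P' Q' where *: "f = to_fract P' / to_fract Q'" "eval_at \<delta> Q' \<noteq> 0" "c' * eval_at \<delta> Q' = eval_at \<delta> P'" by blast
  have "Q' \<noteq> 0" using *(2) by (auto simp: eval_at_simps)
  then have "to_fract (P' * Q) = to_fract (P * Q')" using assms(1) *(1) Q by (simp add: field_simps)
  then have "P' * Q = P * Q'" by (simp only: to_fract_eq_iff)
  then have "eval_at \<delta> P' * eval_at \<delta> Q = eval_at \<delta> P * eval_at \<delta> Q'"
    using is_hom_eval_at[of \<delta>] unfolding is_hom_def by metis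
  then have "(c' * (eval_at \<delta> Q' * eval_at \<delta> Q)) = c * (eval_at \<delta> Q' * eval_at \<delta> Q)"
    using *(3) assms(3) by (metis mult.assoc mult.commute)
  then show "c' = c" using assms(2) *(2) by simp
qed

text \<open>Every coefficient is specialised through the representation with denominator
  \<open>jw_denom\<close>, whose value at \<delta> is nonzero; divisibility in the base ring is the
  assumption on \<open>JW\<close> applied to this representation.\<close>

lemma eve_idem_scaled:
  fixes \<delta> :: "'k::idom"
  assumes base: "JW_values_in_base \<delta> n" and nz: "jw_denom \<delta> n \<noteq> 0"
  shows "tl_scale (jw_denom \<delta> n) (eve_idem \<delta> n) = mmap (eval_at \<delta>) (JW_numer n)"
proof (rule poly_mapping_eqI)
  fix D
  let ?Q = "jw_denom poly_loop n" and ?P = "lk (JW_numer n) D"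
  have Q: "eval_at \<delta> ?Q = jw_denom \<delta> n" using jw_denom_hom[OF is_hom_eval_at] by (metis eval_at_simps(3))
  have f: "lk (JW n) D * to_fract ?Q = to_fract ?P"
    unfolding lookup_JW_numer jw_denom_generic by (simp add: mult.commute)
  have "?Q \<noteq> 0" using nz Q by (metis eval_at_simps(1))
  then have "lk (JW n) D = to_fract ?P / to_fract ?Q" using f by (simp add: field_simps)
  then have "eval_at \<delta> ?Q dvd eval_at \<delta> ?P" using base nz Q unfolding JW_values_in_base_def by metis
  then obtain c where c: "c * eval_at \<delta> ?Q = eval_at \<delta> ?P" by (metis dvdE mult.commute)
  have sp: "specialise \<delta> (lk (JW n) D) = c" by (rule specialise_eqI[OF f _ c]) (simp add: Q nz)
  have "lk (eve_idem \<delta> n) D = c"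
  proof (cases "lk (JW n) D = 0")
    case True
    then have "to_fract ?P = 0" using f by simp
    then have "?P = 0" by (simp only: to_fract_eq_0_iff)
    then have "c = 0" using c nz Q by (simp add: eval_at_simps)
    then show ?thesis using True by (simp add: eve_idem_def Poly_Mapping.map.rep_eq)
  next
    case False
    then show ?thesis using sp by (simp add: eve_idem_def Poly_Mapping.map.rep_eq)
  qed
  then show "lk (tl_scale (jw_denom \<delta> n) (eve_idem \<delta> n)) D = lk (mmap (eval_at \<delta>) (JW_numer n)) D"
    using c by (simp add: lookup_mmap eval_at_simps Q mult.commute)
qed

lemma mmap_to_fract_inj: "mmap to_fract x = mmap to_fract y \<Longrightarrow> x = y"
  by (rule poly_mapping_eqI) (metis lookup_mmap to_fract_0 to_fract_eq_iff)

lemma tl_scale_cancel: "c \<noteq> 0 \<Longrightarrow> tl_scale (c :: 'k::idom) x = 0 \<Longrightarrow> x = 0"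
  by (rule poly_mapping_eqI) (metis lookup_tl_scale lookup_zero mult_eq_0_iff)

text \<open>The defining relations hold for \<open>JW_numer\<close> over Z[X], because Z[X] embeds
  in Q(X). They are evaluated at \<delta>, where the nonzero scalar
  \<open>jw_denom \<delta> n\<close> can be cancelled.\<close>

lemma jw_eve_idem:
  fixes \<delta> :: "'k::idom"
  assumes base: "JW_values_in_base \<delta> n" and nz: "jw_denom \<delta> n \<noteq> 0"
  shows "jw \<delta> n (eve_idem \<delta> n)"
proof -
  let ?e = "eve_idem \<delta> n" and ?N = "jw_denom \<delta> n"
  note sc = eve_idem_scaled[OF base nz]
  have ev0: "eval_at \<delta> 0 = 0" "eval_at \<delta> 1 = 1" by (simp_all add: eval_at_simps)
  have Q: "eval_at \<delta> (jw_denom poly_loop n) = ?N" using jw_denom_hom[OF is_hom_eval_at] by (metis eval_at_simps(3))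
  have sgl: "mmap (eval_at \<delta>) (dg D) = dg D" "mmap to_fract (dg D) = (dg D :: int poly fract mor)" for D
    by (simp_all add: mmap_single[of "eval_at \<delta>", OF ev0(1)] ev0 mmap_single[of to_fract])
  have m0: "mmap (eval_at \<delta>) 0 = 0" by (rule poly_mapping_eqI) (simp add: lookup_mmap[of "eval_at \<delta>", OF ev0(1)] ev0)
  have eH: "?e \<in> Hom n n"
  proof -
    have "lk (JW n) D \<noteq> 0" if "lk ?e D \<noteq> 0" for D
      using that by (auto simp: eve_idem_def Poly_Mapping.map.rep_eq)
    then show ?thesis using JW_jw[of n] unfolding jw_def Hom_iff by blast
  qed
  have "lk ?e (id_diag n) = 1"
  proof -
    have "to_fract (lk (JW_numer n) (id_diag n)) = to_fract (jw_denom poly_loop n)"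
      unfolding lookup_JW_numer jw_denom_generic using JW_jw[of n] by (simp add: jw_def)
    then have "lk (JW_numer n) (id_diag n) = jw_denom poly_loop n" by (simp only: to_fract_eq_iff)
    then have "?N * lk ?e (id_diag n) = ?N"
      using arg_cong[OF sc, of "\<lambda>x. lk x (id_diag n)"] by (simp add: lookup_mmap ev0 Q)
    then show ?thesis using nz by simp
  qed
  moreover have "tl_comp \<delta> ?e (dg (cap_diag n i)) = 0 \<and> tl_comp \<delta> (dg (cup_diag n i)) ?e = 0" if i: "i + 1 < n" for i
  proof
    have z: "tl_comp generic_loop (JW n) (dg (cap_diag n i)) = 0" "tl_comp generic_loop (dg (cup_diag n i)) (JW n) = 0"
      using JW_jw[of n] i by (auto simp: jw_def)
    have mf0: "mmap to_fract (0 :: int poly mor) = 0" by (rule poly_mapping_eqI) (simp add: lookup_mmap)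
    have "mmap to_fract (tl_comp poly_loop (JW_numer n) (dg (cap_diag n i))) = mmap to_fract 0"
      unfolding mmap_comp[OF is_hom_to_fract] generic_loop_hom[symmetric] sgl mmap_JW_numer tl_comp_scale_left z mf0 by simp
    then have "tl_comp poly_loop (JW_numer n) (dg (cap_diag n i)) = 0" by (rule mmap_to_fract_inj)
    then have "mmap (eval_at \<delta>) (tl_comp poly_loop (JW_numer n) (dg (cap_diag n i))) = 0" by (simp add: m0)
    then have "tl_scale ?N (tl_comp \<delta> ?e (dg (cap_diag n i))) = 0"
      unfolding mmap_comp[OF is_hom_eval_at] sgl sc[symmetric] eval_at_simps tl_comp_scale_left .
    then show "tl_comp \<delta> ?e (dg (cap_diag n i)) = 0" by (rule tl_scale_cancel[OF nz])
    have "mmap to_fract (tl_comp poly_loop (dg (cup_diag n i)) (JW_numer n)) = mmap to_fract 0"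
      unfolding mmap_comp[OF is_hom_to_fract] generic_loop_hom[symmetric] sgl mmap_JW_numer tl_comp_scale_right z mf0 by simp
    then have "tl_comp poly_loop (dg (cup_diag n i)) (JW_numer n) = 0" by (rule mmap_to_fract_inj)
    then have "mmap (eval_at \<delta>) (tl_comp poly_loop (dg (cup_diag n i)) (JW_numer n)) = 0" by (simp add: m0)
    then have "tl_scale ?N (tl_comp \<delta> (dg (cup_diag n i)) ?e) = 0"
      unfolding mmap_comp[OF is_hom_eval_at] sgl sc[symmetric] eval_at_simps tl_comp_scale_right .
    then show "tl_comp \<delta> (dg (cup_diag n i)) ?e = 0" by (rule tl_scale_cancel[OF nz])
  qed
  ultimately show ?thesis using eH by (simp add: jw_def)
qed

subsection \<open>Two-block elements\<close>

text \<open>What survives of the Jones--Wenzl property for \<open>e\<^sup>\<mu>\<close>: only the middle caps, which join the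
  two blocks, are not killed.\<close>

definition two_block :: "'k::comm_ring_1 \<Rightarrow> nat \<Rightarrow> nat \<Rightarrow> 'k mor \<Rightarrow> bool" where
  "two_block \<delta> a b e \<longleftrightarrow> e \<in> Hom (a + b) (a + b) \<and> lk e (id_diag (a + b)) = 1 \<and>
    (\<forall>i. i + 1 < a + b \<longrightarrow> i + 1 \<noteq> a \<longrightarrow>
      tl_comp \<delta> e (dg (cap_diag (a + b) i)) = 0 \<and> tl_comp \<delta> (dg (cup_diag (a + b) i)) e = 0) \<and>
    (\<forall>D. lk e D \<noteq> 0 \<longrightarrow> D \<noteq> id_diag (a + b) \<longrightarrow>
      (\<exists>k. k + 1 \<noteq> a \<and> {(0, k), (0, k + 1)} \<in> D) \<and> (\<exists>k. k + 1 \<noteq> a \<and> {(1, k), (1, k + 1)} \<in> D))"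

lemma source_cap_exists:
  assumes D: "D \<in> diagrams n n" "D \<noteq> id_diag n"
  shows "\<exists>k. k + 1 < n \<and> {(0, k), (0, k + 1)} \<in> D"
proof -
  obtain k n' D' where "n = n' + 2" "k \<le> n'" "D' \<in> diagrams n' n" "D = ins_cap k D'"
    using diag_not_id_ins_cap[OF D] .
  then show ?thesis using ins_cap_block[of k D'] by (intro exI[of _ k]) simp
qed

lemma target_cup_exists:
  assumes D: "D \<in> diagrams n n" "D \<noteq> id_diag n"
  shows "\<exists>k. k + 1 < n \<and> {(1, k), (1, k + 1)} \<in> D"
proof -
  have "refl_diag D \<noteq> id_diag n" using D(2) refl_refl[OF D(1)] by (metis refl_id)
  then show ?thesis using source_cap_exists[OF refl_diag_in[OF D(1)]] flip_block_iff(2)[OF D(1)] by blast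
qed

text \<open>A factor that is not an identity contributes a simple cap and a simple cup inside its
  own block, so away from the pair a - 1, a that straddles the blocks.\<close>

lemma tensor_diag_caps:
  assumes D: "D \<in> diagrams a a" and E: "E \<in> diagrams b b" and ne: "D \<noteq> id_diag a \<or> E \<noteq> id_diag b"
  shows "\<exists>k. k + 1 \<noteq> a \<and> {(0, k), (0, k + 1)} \<in> tensor_diag a a D E"
    and "\<exists>k. k + 1 \<noteq> a \<and> {(1, k), (1, k + 1)} \<in> tensor_diag a a D E"
proof -
  have sh: "{(l, a + k), (l, a + k + 1)} \<in> tensor_diag a a D E" if "{(l, k), (l, k + 1)} \<in> E" for l k
    using that unfolding tensor_diag_def by (intro UnI2 image_eqI[where x = "{(l, k), (l, k + 1)}"]) auto
  have le: "{(l, k), (l, k + 1)} \<in> tensor_diag a a D E" if "{(l, k), (l, k + 1)} \<in> D" for l k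
    using that unfolding tensor_diag_def by blast
  show "\<exists>k. k + 1 \<noteq> a \<and> {(0, k), (0, k + 1)} \<in> tensor_diag a a D E"
  proof (cases "D = id_diag a")
    case True
    then obtain k where "{(0, k), (0, k + 1)} \<in> E" using source_cap_exists[OF E] ne by blast
    then show ?thesis using sh by (intro exI[of _ "a + k"]) auto
  next
    case False
    then obtain k where "k + 1 < a" "{(0, k), (0, k + 1)} \<in> D" using source_cap_exists[OF D] by blast
    then show ?thesis using le by (intro exI[of _ k]) auto
  qed
  show "\<exists>k. k + 1 \<noteq> a \<and> {(1, k), (1, k + 1)} \<in> tensor_diag a a D E"
  proof (cases "D = id_diag a")
    case True
    then obtain k where "{(1, k), (1, k + 1)} \<in> E" using target_cup_exists[OF E] ne by blast
    then show ?thesis using sh by (intro exI[of _ "a + k"]) auto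
  next
    case False
    then obtain k where "k + 1 < a" "{(1, k), (1, k + 1)} \<in> D" using target_cup_exists[OF D] by blast
    then show ?thesis using le by (intro exI[of _ k]) auto
  qed
qed

lemma id_diag_no_cap: "{(l, i), (l, j)} \<notin> id_diag n"
  by (auto simp: id_diag_def doubleton_eq_iff)

lemma two_block_tensor:
  assumes f: "jw \<delta> a f" and g: "jw \<delta> b g"
  shows "two_block \<delta> a b (tensor a a f g)"
proof -
  have fH: "f \<in> Hom a a" and gH: "g \<in> Hom b b" using f g by (auto simp: jw_def)
  let ?e = "tensor a a f g"
  have lk_e: "lk ?e D = (\<Sum>D1\<in>diagrams a a. \<Sum>D2\<in>diagrams b b. if tensor_diag a a D1 D2 = D then lk f D1 * lk g D2 else 0)" for D
    using fH gH by (subst tensor_superset[of "diagrams a a" "diagrams b b"])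
      (auto simp: Hom_def lookup_sum lookup_single when_def intro!: sum.cong)
  have coeff: "lk ?e (id_diag (a + b)) = 1"
  proof -
    have "tensor_diag a a D1 D2 = id_diag (a + b) \<longleftrightarrow> D1 = id_diag a \<and> D2 = id_diag b"
      if "D1 \<in> diagrams a a" "D2 \<in> diagrams b b" for D1 D2
    proof
      assume e: "tensor_diag a a D1 D2 = id_diag (a + b)"
      show "D1 = id_diag a \<and> D2 = id_diag b"
        using tensor_diag_caps(1)[OF that] id_diag_no_cap unfolding e by blast
    qed simp
    then have "lk ?e (id_diag (a + b)) =
        (\<Sum>D1\<in>diagrams a a. \<Sum>D2\<in>diagrams b b. if D1 = id_diag a then (if D2 = id_diag b then lk f D1 * lk g D2 else 0) else 0)"
      unfolding lk_e by (intro sum.cong refl) auto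
    also have "\<dots> = (\<Sum>D1\<in>diagrams a a. if D1 = id_diag a then lk f D1 * lk g (id_diag b) else 0)"
      by (intro sum.cong refl) simp
    also have "\<dots> = lk f (id_diag a) * lk g (id_diag b)" by simp
    finally show ?thesis using f g by (simp add: jw_def)
  qed
  have caps: "(\<exists>k. k + 1 \<noteq> a \<and> {(0, k), (0, k + 1)} \<in> D) \<and> (\<exists>k. k + 1 \<noteq> a \<and> {(1, k), (1, k + 1)} \<in> D)"
    if nz: "lk ?e D \<noteq> 0" and ni: "D \<noteq> id_diag (a + b)" for D
  proof -
    obtain D1 where D1: "D1 \<in> diagrams a a"
      "(\<Sum>D2\<in>diagrams b b. if tensor_diag a a D1 D2 = D then lk f D1 * lk g D2 else 0) \<noteq> 0"
      using nz unfolding lk_e by (rule sum.not_neutral_contains_not_neutral)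
    from D1(2) obtain D2 where D2': "D2 \<in> diagrams b b" "(if tensor_diag a a D1 D2 = D then lk f D1 * lk g D2 else 0) \<noteq> 0"
      by (rule sum.not_neutral_contains_not_neutral)
    then have D2: "D2 \<in> diagrams b b" "tensor_diag a a D1 D2 = D" by (auto split: if_splits)
    have "D1 \<noteq> id_diag a \<or> D2 \<noteq> id_diag b" using ni D2(2) by auto
    then show ?thesis using tensor_diag_caps[OF D1(1) D2(1)] D2(2) by blast
  qed
  have "tl_comp \<delta> ?e (dg (cap_diag (a + b) i)) = 0 \<and> tl_comp \<delta> (dg (cup_diag (a + b) i)) ?e = 0"
    if i: "i + 1 < a + b" "i + 1 \<noteq> a" for i
  proof (cases "i + 1 < a")
    case True
    obtain a' where a': "a' = a - 2" by blast
    then have a: "a = a' + 2" and ia: "i \<le> a'" using True by auto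
    have C: "cap_diag a i \<in> diagrams a a'" using cap_diag_in[OF ia] a by simp
    have e: "cap_diag (a + b) i = tensor_diag a a' (cap_diag a i) (id_diag b)"
      using cap_diag_tensor_left[OF ia, of b] unfolding a .
    have z: "tl_comp \<delta> f (dg (cap_diag a i)) = 0" "tl_comp \<delta> (dg (cup_diag a i)) f = 0"
      using f True by (auto simp: jw_def)
    show ?thesis
      unfolding e refl_tensor[OF C id_diag_in] tensor_dg[symmetric] refl_id
        tensor_comp[OF fH gH Hom_single[OF C] Hom_single[OF id_diag_in]]
        tensor_comp[OF Hom_single[OF refl_diag_in[OF C]] Hom_single[OF id_diag_in] fH gH] z by simp
  next
    case False
    obtain b' i' where b': "b' = b - 2" "i' = i - a" by blast
    then have b: "b = b' + 2" and ib: "i' \<le> b'" and ii: "i = a + i'" using i False by auto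
    have C: "cap_diag b i' \<in> diagrams b b'" using cap_diag_in[OF ib] b by simp
    have e: "cap_diag (a + b) i = tensor_diag a a (id_diag a) (cap_diag b i')"
      using cap_diag_tensor_right[OF ib, of a] unfolding b ii .
    have z: "tl_comp \<delta> g (dg (cap_diag b i')) = 0" "tl_comp \<delta> (dg (cup_diag b i')) g = 0"
      using g ib b by (auto simp: jw_def)
    show ?thesis
      unfolding e refl_tensor[OF id_diag_in C] tensor_dg[symmetric] refl_id
        tensor_comp[OF fH gH Hom_single[OF id_diag_in] Hom_single[OF C]]
        tensor_comp[OF Hom_single[OF id_diag_in] Hom_single[OF refl_diag_in[OF C]] fH gH] z by simp
  qed
  then show ?thesis unfolding two_block_def using tensor_in[OF fH gH] coeff caps by blast
qed

context
  fixes \<delta> :: "'k::comm_ring_1" and a b :: nat and e :: "'k mor"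
  assumes e: "two_block \<delta> a b e"
begin

lemma tb_in: "e \<in> Hom (a + b) (a + b)" using e by (simp add: two_block_def)

lemma tb_coeff: "lk e (id_diag (a + b)) = 1" using e by (simp add: two_block_def)

lemma tb_caps:
  assumes "lk e D \<noteq> 0" "D \<noteq> id_diag (a + b)"
  obtains k k' where "k + 1 \<noteq> a" "{(0, k), (0, k + 1)} \<in> D" "k' + 1 \<noteq> a" "{(1, k'), (1, k' + 1)} \<in> D"
  using e assms unfolding two_block_def by blast

lemma tb_kill_left:
  assumes D: "D \<in> diagrams (a + b) m" and k: "{(0, k), (0, k + 1)} \<in> D" "k + 1 \<noteq> a"
  shows "tl_comp \<delta> e (Poly_Mapping.single D c) = 0"
proof -
  have "(0, k + 1) \<in> points (a + b) m" using diag_Union[OF D] k by blast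
  then have kn: "k + 1 < a + b" by (simp add: points_def)
  obtain n' where "n' = a + b - 2" by blast
  then have n: "a + b = n' + 2" and k': "k \<le> n'" using kn by auto
  obtain D' where D': "D' \<in> diagrams n' m" "D = ins_cap k D'"
    using ins_cap_exists[OF D[unfolded n] k(1)] by metis
  have "tl_comp \<delta> e (dg (cap_diag (n' + 2) k)) = 0" using e kn k(2) unfolding two_block_def n by blast
  then show ?thesis unfolding D'(2) by (rule cap_kill[OF tb_in[unfolded n] k' D'(1)])
qed

lemma tb_kill_right:
  assumes D: "D \<in> diagrams m (a + b)" and k: "{(1, k), (1, k + 1)} \<in> D" "k + 1 \<noteq> a"
  shows "tl_comp \<delta> (Poly_Mapping.single D c) e = 0"
proof -
  let ?R = "refl_diag D"
  have R: "?R \<in> diagrams (a + b) m" "{(0, k), (0, k + 1)} \<in> ?R"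
    using refl_diag_in[OF D] k flip_block_iff(2)[OF D] by auto
  have "(0, k + 1) \<in> points (a + b) m" using diag_Union[OF R(1)] R(2) by blast
  then have kn: "k + 1 < a + b" by (simp add: points_def)
  obtain n' where "n' = a + b - 2" by blast
  then have n: "a + b = n' + 2" and k': "k \<le> n'" using kn by auto
  obtain D' where D': "D' \<in> diagrams n' m" "?R = ins_cap k D'"
    using ins_cap_exists[OF R(1)[unfolded n] R(2)] by metis
  have "D = cat_diag (refl_diag D') (cup_diag (n' + 2) k)"
    using refl_cat(1)[OF cap_diag_in[OF k'] D'(1)] refl_refl[OF D] unfolding cat_cap_diag[OF k' D'(1)] D'(2)[symmetric] by simp
  moreover have "loops (refl_diag D') (cup_diag (n' + 2) k) = 0"
    using refl_cat(2)[OF cap_diag_in[OF k'] D'(1)] cat_cap_diag(2)[OF k' D'(1)] by simp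
  ultimately have s: "Poly_Mapping.single D c = tl_comp \<delta> (Poly_Mapping.single (refl_diag D') c) (dg (cup_diag (n' + 2) k))"
    by (simp only: tl_comp_single) simp
  have z: "tl_comp \<delta> (dg (cup_diag (n' + 2) k)) e = 0" using e kn k(2) unfolding two_block_def n by blast
  show ?thesis
    unfolding s tl_comp_assoc[OF Hom_single[OF refl_diag_in[OF D'(1)]] dg_cup_in[OF k'] tb_in[unfolded n]] z by simp
qed

lemma tb_absorb:
  assumes x: "x \<in> Hom m (a + b)" and cups: "\<And>D. lk x D \<noteq> 0 \<Longrightarrow> D \<noteq> D0 \<Longrightarrow> \<exists>k. k + 1 \<noteq> a \<and> {(1, k), (1, k + 1)} \<in> D"
    and D0: "D0 \<in> diagrams m (a + b)"
  shows "tl_comp \<delta> x e = tl_comp \<delta> (Poly_Mapping.single D0 (lk x D0)) e"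
proof -
  have "tl_comp \<delta> x e = (\<Sum>D\<in>diagrams m (a + b). tl_comp \<delta> (Poly_Mapping.single D (lk x D)) e)"
    by (subst Hom_expand[OF x]) (rule tl_comp_sum_left)
  also have "\<dots> = (\<Sum>D\<in>diagrams m (a + b). if D = D0 then tl_comp \<delta> (Poly_Mapping.single D (lk x D)) e else 0)"
  proof (rule sum.cong[OF refl])
    fix D assume D: "D \<in> diagrams m (a + b)"
    show "tl_comp \<delta> (Poly_Mapping.single D (lk x D)) e = (if D = D0 then tl_comp \<delta> (Poly_Mapping.single D (lk x D)) e else 0)"
    proof (cases "lk x D = 0 \<or> D = D0")
      case False
      then obtain k where "k + 1 \<noteq> a" "{(1, k), (1, k + 1)} \<in> D" using cups by blast
      then show ?thesis using tb_kill_right[OF D] False by simp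
    qed auto
  qed
  finally show ?thesis using D0 by simp
qed

text \<open>Every term of the reflected element other than the identity has a cup off the middle and
  is killed. In the bilinear form this stands in for idempotency together with invariance under
  reflection.\<close>

lemma tb_refl_absorb: "tl_comp \<delta> (refl_mor e) e = e"
proof -
  have eH: "e \<in> Hom (a + b) (a + b)" by (rule tb_in)
  have lk_r: "lk (refl_mor e) (refl_diag D) = lk e D" if "D \<in> diagrams (a + b) (a + b)" for D
  proof -
    have "lk (refl_mor e) (refl_diag D) = (\<Sum>E\<in>diagrams (a + b) (a + b). if refl_diag E = refl_diag D then lk e E else 0)"
      using eH by (subst refl_mor_superset[of "diagrams (a + b) (a + b)"])
        (auto simp: Hom_def lookup_sum lookup_single when_def intro!: sum.cong)
    also have "\<dots> = (\<Sum>E\<in>diagrams (a + b) (a + b). if E = D then lk e E else 0)"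
      by (intro sum.cong refl if_cong) (metis refl_refl that)
    finally show ?thesis using that by simp
  qed
  have "\<exists>k. k + 1 \<noteq> a \<and> {(1, k), (1, k + 1)} \<in> D" if D: "lk (refl_mor e) D \<noteq> 0" "D \<noteq> id_diag (a + b)" for D
  proof -
    have DD: "D \<in> diagrams (a + b) (a + b)" using D(1) refl_mor_in[OF eH] unfolding Hom_iff by blast
    have "lk e (refl_diag D) \<noteq> 0" using lk_r[OF refl_diag_in[OF DD]] D(1) refl_refl[OF DD] by simp
    moreover have "refl_diag D \<noteq> id_diag (a + b)" using D(2) refl_refl[OF DD] by (metis refl_id)
    ultimately obtain k where "k + 1 \<noteq> a" "{(0, k), (0, k + 1)} \<in> refl_diag D" using tb_caps by metis
    then show ?thesis using flip_block_iff(2)[OF DD] by blast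
  qed
  then have "tl_comp \<delta> (refl_mor e) e = tl_comp \<delta> (Poly_Mapping.single (id_diag (a + b)) (lk (refl_mor e) (id_diag (a + b)))) e"
    by (intro tb_absorb[OF refl_mor_in[OF eH]]) auto
  also have "lk (refl_mor e) (id_diag (a + b)) = 1" using lk_r[OF id_diag_in] tb_coeff by simp
  finally show ?thesis unfolding tl_comp_id_left[OF eH] .
qed

lemma tb_expand:
  assumes x: "x \<in> Hom (a + b) m"
  shows "tl_comp \<delta> e x = x + (\<Sum>D\<in>diagrams (a + b) (a + b) - {id_diag (a + b)}. tl_comp \<delta> (Poly_Mapping.single D (lk e D)) x)"
proof -
  have "tl_comp \<delta> e x = (\<Sum>D\<in>diagrams (a + b) (a + b). tl_comp \<delta> (Poly_Mapping.single D (lk e D)) x)"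
    by (subst Hom_expand[OF tb_in]) (rule tl_comp_sum_left)
  also have "\<dots> = tl_comp \<delta> (dg (id_diag (a + b))) x +
      (\<Sum>D\<in>diagrams (a + b) (a + b) - {id_diag (a + b)}. tl_comp \<delta> (Poly_Mapping.single D (lk e D)) x)"
    by (simp add: sum.remove[of _ "id_diag (a + b)"] tb_coeff)
  finally show ?thesis unfolding tl_comp_id_left[OF x] .
qed

end

text \<open>All caps come from the nested ones. By induction a simple cap of what remains after
  removal of the innermost cap is in the middle, and the reinserted cap separates its two ends by
  two positions.\<close>

lemma nested_cat_mid:
  assumes "r \<le> a" "r \<le> b" and E: "E \<in> diagrams (a + b - 2 * r) m" and nc: "\<And>i j. {(0, i), (0, j)} \<notin> E"
  shows "{(0, k), (0, k + 1)} \<in> cat_diag (nested a b r) E \<Longrightarrow> k + 1 = a"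
  using assms
proof (induction a b r arbitrary: k rule: nested.induct)
  case (1 a b r)
  have rr: "r \<le> a" "r \<le> b" using 1 by auto
  have E: "E \<in> diagrams (a + b - 2 * r) m" using 1(5) by simp
  note N = nested_in[OF rr]
  have a: "a \<le> a + b" by simp
  let ?D = "cat_diag (nested a b r) E"
  have D: "?D \<in> diagrams (a + b) m" by (rule cat_diagrams[OF N E])
  have "cat_diag (nested (Suc a) (Suc b) (Suc r)) E = ins_cap a ?D"
    using cat_assoc[OF cap_diag_in[OF a] N E] unfolding cat_cap_diag(1)[OF a N] cat_cap_diag(1)[OF a D] by simp
  then have "{(0, k), (0, k + 1)} \<in> ins_cap a ?D" using 1(2) by simp
  then have "{(0, k), (0, k + 1)} = {(0 :: nat, a), (0, a + 1)} \<or> (\<exists>X\<in>?D. {(0, k), (0, k + 1)} = skip2_pt a ` X)"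
    unfolding ins_cap_def insert_iff image_iff .
  then consider "{(0, k), (0, k + 1)} = {(0 :: nat, a), (0, a + 1)}" | X where "X \<in> ?D" "{(0, k), (0, k + 1)} = skip2_pt a ` X"
    by (elim disjE bexE) (rule that; assumption)+
  then show ?case
  proof cases
    case 1 then show ?thesis by (auto simp: doubleton_eq_iff)
  next
    case (2 X)
    obtain x y where xy: "X = {x, y}" "skip2_pt a x = (0, k)" "skip2_pt a y = (0, k + 1)"
    proof -
      have "(0, k) \<in> skip2_pt a ` X" "(0, k + 1) \<in> skip2_pt a ` X" unfolding 2(2)[symmetric] by simp_all
      then obtain x y where xy: "x \<in> X" "y \<in> X" "skip2_pt a x = (0, k)" "skip2_pt a y = (0, k + 1)"
        by (elim imageE) simp
      then have "x \<noteq> y" by auto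
      obtain u v where "X = {u, v}" using diag_card2[OF D 2(1)] by (meson card_2_iff)
      then have "X = {x, y}" using xy(1,2) \<open>x \<noteq> y\<close> by auto
      then show ?thesis using that xy(3,4) by blast
    qed
    obtain i where i: "x = (0, i)" "skip2 a i = k" using xy(2) by (cases x) (auto simp: skip2_pt_def split: if_splits)
    obtain j where j: "y = (0, j)" "skip2 a j = k + 1" using xy(3) by (cases y) (auto simp: skip2_pt_def split: if_splits)
    have ij: "j = i + 1" using i(2) j(2) by (auto split: if_splits)
    have "{(0, i), (0, i + 1)} \<in> ?D" using 2(1) xy(1) i(1) j(1) ij by simp
    then have "i + 1 = a" using "1.IH" rr E 1(6) by blast
    then show ?thesis using i(2) j(2) ij by (auto split: if_splits)
  qed
next
  case ("2_1" b r)
  then show ?case by (cases r) simp_all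
next
  case ("2_2" a r)
  then show ?case by (cases r) simp_all
next
  case ("2_3" a b)
  then show ?case by simp
qed

lemma nested_mid: "r \<le> a \<Longrightarrow> r \<le> b \<Longrightarrow> {(0, k), (0, k + 1)} \<in> nested a b r \<Longrightarrow> k + 1 = a"
  using nested_cat_mid[of r a b "id_diag (a + b - 2 * r)" "a + b - 2 * r" k] nested_in[of r a b]
  by (simp add: id_diag_no_cap)

lemma ins_cap_inj: "D \<in> diagrams n m \<Longrightarrow> E \<in> diagrams n m \<Longrightarrow> i \<le> n \<Longrightarrow> ins_cap i D = ins_cap i E \<Longrightarrow> D = E"
  by (metis cat_cup_ins_cap(1))

text \<open>Innermost caps are removed from both sides simultaneously. As E and F have no caps of
  their own, both sides run out of caps at the same time.\<close>

lemma nested_cat_inj: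
  assumes "r \<le> a" "r \<le> b" "s \<le> a" "s \<le> b" "E \<in> diagrams (a + b - 2 * r) m" "F \<in> diagrams (a + b - 2 * s) m"
    and "\<And>i j. {(0, i), (0, j)} \<notin> E" "\<And>i j. {(0, i), (0, j)} \<notin> F"
    and "cat_diag (nested a b r) E = cat_diag (nested a b s) F"
  shows "r = s"
  using assms
proof (induction r arbitrary: a b s)
  case 0
  show ?case
  proof (rule ccontr)
    assume "0 \<noteq> s"
    then obtain s' a' b' where s: "s = Suc s'" "a = Suc a'" "b = Suc b'"
      using 0 by (metis Suc_le_D not0_implies_Suc)
    have rr: "s' \<le> a'" "s' \<le> b'" and F: "F \<in> diagrams (a' + b' - 2 * s') m" using 0 s by auto
    have a': "a' \<le> a' + b'" by simp
    have "cat_diag (nested a b s) F = ins_cap a' (cat_diag (nested a' b' s') F)"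
      using cat_assoc[OF cap_diag_in[OF a'] nested_in[OF rr] F]
      unfolding cat_cap_diag(1)[OF a' nested_in[OF rr]] cat_cap_diag(1)[OF a' cat_diagrams[OF nested_in[OF rr] F]] s by simp
    then have "{(0, a'), (0, a' + 1)} \<in> cat_diag (nested a b 0) E" using 0(9) ins_cap_block by metis
    moreover have "cat_diag (nested a b 0) E = E" using 0(5) by simp
    ultimately show False using 0(7) by simp
  qed
next
  case (Suc r)
  obtain a' b' where ab: "a = Suc a'" "b = Suc b'" using Suc.prems by (metis Suc_le_D)
  have rr: "r \<le> a'" "r \<le> b'" and E: "E \<in> diagrams (a' + b' - 2 * r) m" using Suc.prems ab by auto
  have a': "a' \<le> a' + b'" by simp
  have 1: "cat_diag (nested a b (Suc r)) E = ins_cap a' (cat_diag (nested a' b' r) E)"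
    using cat_assoc[OF cap_diag_in[OF a'] nested_in[OF rr] E]
    unfolding cat_cap_diag(1)[OF a' nested_in[OF rr]] cat_cap_diag(1)[OF a' cat_diagrams[OF nested_in[OF rr] E]] ab by simp
  show ?case
  proof (cases s)
    case 0
    then have "{(0, a'), (0, a' + 1)} \<in> cat_diag (nested a b 0) F" using 1 Suc.prems(9) ins_cap_block by metis
    moreover have "cat_diag (nested a b 0) F = F" using Suc.prems(6) 0 by simp
    ultimately show ?thesis using Suc.prems(8) by simp
  next
    case s: (Suc s')
    have ss: "s' \<le> a'" "s' \<le> b'" and F: "F \<in> diagrams (a' + b' - 2 * s') m" using Suc.prems ab s by auto
    have 2: "cat_diag (nested a b (Suc s')) F = ins_cap a' (cat_diag (nested a' b' s') F)"
      using cat_assoc[OF cap_diag_in[OF a'] nested_in[OF ss] F]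
      unfolding cat_cap_diag(1)[OF a' nested_in[OF ss]] cat_cap_diag(1)[OF a' cat_diagrams[OF nested_in[OF ss] F]] ab by simp
    have "ins_cap a' (cat_diag (nested a' b' r) E) = ins_cap a' (cat_diag (nested a' b' s') F)"
      using Suc.prems(9) 1 2 s by simp
    then have "cat_diag (nested a' b' r) E = cat_diag (nested a' b' s') F"
      by (rule ins_cap_inj[OF cat_diagrams[OF nested_in[OF rr] E] cat_diagrams[OF nested_in[OF ss] F] a'])
    then have "r = s'" using Suc.IH rr ss E F Suc.prems(7,8) by blast
    then show ?thesis using s by simp
  qed
qed

subsection \<open>The value of the form\<close>

text \<open>Pairing with the product of two q-symmetric vectors, one for each block, with k1 and k2
  ups.\<close>

definition pairing :: "'a::comm_ring_1 \<Rightarrow> nat \<Rightarrow> nat \<Rightarrow> nat \<Rightarrow> nat \<Rightarrow> (bool list \<Rightarrow> bool list \<Rightarrow> 'a) \<Rightarrow> 'a" where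
  "pairing q a b k1 k2 F = (\<Sum>xs\<in>states a k1. (- q) ^ hgt xs * (\<Sum>ys\<in>states b k2. (- q) ^ hgt ys * F xs ys))"

lemma states_empty: "n < k \<Longrightarrow> states n k = {}"
proof (intro equals0I)
  fix xs assume "n < k" "xs \<in> states n k"
  then show False using ups_downs[of xs] by (auto simp: states_def)
qed

lemma states_full: "states n n = {replicate n True}"
proof (intro equalityI subsetI)
  fix xs assume "xs \<in> states n n"
  then have "length xs = n" "downs xs = 0" using ups_downs[of xs] by (auto simp: states_def)
  then have "\<forall>x\<in>set xs. x = True" by (metis count_list_0_iff)
  then show "xs \<in> {replicate n True}" using \<open>length xs = n\<close> by (metis replicate_length_same singletonI)
next
  have "ups (replicate n True) = n" by (induction n) simp_all
  then show "xs \<in> {replicate n True} \<Longrightarrow> xs \<in> states n n" for xs by (simp add: states_def)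
qed

lemma sum_states_first:
  "(\<Sum>xs\<in>states (Suc n) k. f xs) =
    (if k = 0 then 0 else \<Sum>xs\<in>states n (k - 1). f (True # xs)) + (\<Sum>xs\<in>states n k. f (False # xs))"
proof (cases k)
  case 0
  have "states (Suc n) 0 = (#) False ` states n 0"
  proof (intro equalityI subsetI)
    fix xs assume xs: "xs \<in> states (Suc n) 0"
    then obtain b ys where "xs = b # ys" by (cases xs) (auto simp: states_def)
    then show "xs \<in> (#) False ` states n 0" using xs by (cases b) (auto simp: states_def)
  qed (auto simp: states_def)
  then show ?thesis using 0 by (simp add: sum.reindex)
next
  case (Suc k')
  have "(\<Sum>xs\<in>states (Suc n) k. f xs) = (\<Sum>xs\<in>(#) True ` states n k'. f xs) + (\<Sum>xs\<in>(#) False ` states n k. f xs)"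
    unfolding Suc states_Suc by (rule sum.union_disjoint) auto
  then show ?thesis using Suc by (simp add: sum.reindex)
qed

lemma sum_states_last:
  "(\<Sum>xs\<in>states (Suc n) k. f xs) =
    (if k = 0 then 0 else \<Sum>xs\<in>states n (k - 1). f (xs @ [True])) + (\<Sum>xs\<in>states n k. f (xs @ [False]))"
proof -
  let ?A = "if k = 0 then {} else (\<lambda>xs. xs @ [True]) ` states n (k - 1)" and ?B = "(\<lambda>xs. xs @ [False]) ` states n k"
  have "states (Suc n) k = ?A \<union> ?B"
  proof (intro equalityI subsetI)
    fix xs assume xs: "xs \<in> states (Suc n) k"
    then obtain b ys where "xs = ys @ [b]" by (cases xs rule: rev_cases) (auto simp: states_def)
    then show "xs \<in> ?A \<union> ?B" using xs by (cases b) (auto simp: states_def)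
  qed (auto simp: states_def split: if_splits)
  moreover have "(\<Sum>xs\<in>?A \<union> ?B. f xs) = (\<Sum>xs\<in>?A. f xs) + (\<Sum>xs\<in>?B. f xs)"
    by (rule sum.union_disjoint) auto
  ultimately show ?thesis by (simp add: sum.reindex inj_on_def)
qed

text \<open>Splits off the letters at the innermost middle cap, the last one of the first word and
  the first one of the second. A final up stands behind \<open>a - (k1 - 1)\<close> downs and an
  initial down before k2 ups, which gives the power of \<open>- q\<close>; the other order adds no
  inversions.\<close>

lemma pairing_step:
  assumes F: "\<And>xs ys s t. length xs = a \<Longrightarrow> length ys = b \<Longrightarrow> F (xs @ [s]) (t # ys) = cap_wt q s t * F' xs ys"
  shows "pairing q (Suc a) (Suc b) k1 k2 F =
    (if k1 = 0 then 0 else q * (- q) ^ (a - (k1 - 1) + k2) * pairing q a b (k1 - 1) k2 F') +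
    (if k2 = 0 then 0 else pairing q a b k1 (k2 - 1) F')"
proof -
  have len: "length xs = n" "ups xs = k" if "xs \<in> states n k" for xs n k using that by (auto simp: states_def)
  have T: "(\<Sum>ys\<in>states (Suc b) k2. (- q) ^ hgt ys * F (xs @ [True]) ys) =
      q * (- q) ^ k2 * (\<Sum>ys\<in>states b k2. (- q) ^ hgt ys * F' xs ys)" if "length xs = a" for xs
    unfolding sum_states_first sum_distrib_left using that
    by (simp add: F len cap_wt_def power_add mult_ac cong: sum.cong)
  have Fs: "(\<Sum>ys\<in>states (Suc b) k2. (- q) ^ hgt ys * F (xs @ [False]) ys) =
      (if k2 = 0 then 0 else \<Sum>ys\<in>states b (k2 - 1). (- q) ^ hgt ys * F' xs ys)" if "length xs = a" for xs
    unfolding sum_states_first using that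
    by (simp add: F len cap_wt_def cong: sum.cong)
  have hT: "hgt (xs @ [True]) = hgt xs + (a - k)" if "xs \<in> states a k" for xs k
    using ups_downs[of xs] len[OF that] by (simp add: hgt_append)
  have hF: "hgt (xs @ [False]) = hgt xs" for xs by (simp add: hgt_append)
  have "(\<Sum>xs\<in>states a (k1 - 1). (- q) ^ hgt (xs @ [True]) * (\<Sum>ys\<in>states (Suc b) k2. (- q) ^ hgt ys * F (xs @ [True]) ys))
    = q * (- q) ^ (a - (k1 - 1) + k2) * pairing q a b (k1 - 1) k2 F'"
    unfolding pairing_def sum_distrib_left[of "q * _"]
    by (rule sum.cong[OF refl]) (simp only: hT T[OF len(1)] power_add mult_ac)
  moreover have "(\<Sum>xs\<in>states a k1. (- q) ^ hgt (xs @ [False]) * (\<Sum>ys\<in>states (Suc b) k2. (- q) ^ hgt ys * F (xs @ [False]) ys))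
    = (if k2 = 0 then 0 else pairing q a b k1 (k2 - 1) F')"
    unfolding pairing_def
    unfolding hF by (subst sum.cong[OF refl, of _ _ "\<lambda>xs. (- q) ^ hgt xs * (if k2 = 0 then 0 else \<Sum>ys\<in>states b (k2 - 1). (- q) ^ hgt ys * F' xs ys)"])
      (simp_all add: Fs len(1))
  ultimately show ?thesis unfolding pairing_def[of q "Suc a"] sum_states_last by simp
qed

lemma pairing_empty: "a < k1 \<or> b < k2 \<Longrightarrow> pairing q a b k1 k2 F = 0"
  unfolding pairing_def by (auto simp: states_empty)

lemma spin_id_top: "spin q n n (replicate n True @ replicate n False) (id_diag n) = q ^ n"
proof -
  have "block_wt q (replicate n True @ replicate n False) (bpos n n ` B) = q" if B: "B \<in> id_diag n" for B
  proof -
    obtain i where i: "i < n" "B = {(0, i), (1, i)}" using B by (auto simp: id_diag_def)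
    have "bpos n n (1, i) = n + n - 1 - i" by (simp add: bpos_def)
    moreover have "i < n + n - 1 - i" using i by simp
    ultimately show ?thesis
      using i by (simp add: block_wt_pair(1) nth_append cap_wt_def)
  qed
  moreover have "card (id_diag n) = n"
  proof -
    have "id_diag n = (\<lambda>i. {(0, i), (1, i)}) ` {..<n}" by (auto simp: id_diag_def)
    moreover have "inj_on (\<lambda>i. {(0 :: nat, i), (1, i)}) {..<n}" by (auto simp: inj_on_def doubleton_eq_iff)
    ultimately show ?thesis by (simp add: card_image)
  qed
  ultimately show ?thesis unfolding spin_def by simp
qed

text \<open>With all sources up, any diagram that begins with a cap has a cap between two ups and
  weight 0. The highest weight value therefore reads off the identity coefficient.\<close>

lemma Spin_top:
  assumes z: "z \<in> Hom n n"
  shows "Spin q n n (replicate n True @ replicate n False) z = q ^ n * lk z (id_diag n)"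
proof -
  have "spin q n n (replicate n True @ replicate n False) D = 0" if D: "D \<in> diagrams n n" "D \<noteq> id_diag n" for D
  proof -
    obtain i n' D' where i: "n = n' + 2" "i \<le> n'" "D' \<in> diagrams n' n" "D = ins_cap i D'"
      using diag_not_id_ins_cap[OF D] .
    have "replicate n True @ replicate n False =
        replicate i True @ True # True # (replicate (n' - i) True @ replicate n False)"
    proof -
      have "replicate n True = replicate i True @ replicate 2 True @ replicate (n' - i) True"
        unfolding replicate_add[symmetric] using i by simp
      then show ?thesis by (simp add: numeral_2_eq_2)
    qed
    then have "spin q n n (replicate n True @ replicate n False) D =
        spin q (n' + 2) n (replicate i True @ True # True # (replicate (n' - i) True @ replicate n False)) (ins_cap i D')"
      using i by simp
    also have "\<dots> = 0" by (subst spin_ins_cap[OF i(3,2)]) (simp_all add: cap_wt_def)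
    finally show ?thesis .
  qed
  then have "Spin q n n (replicate n True @ replicate n False) z =
      (\<Sum>D\<in>diagrams n n. if D = id_diag n then lk z D * q ^ n else 0)"
    unfolding Spin_def by (intro sum.cong) (auto simp: spin_id_top)
  then show ?thesis by (simp add: mult.commute)
qed

text \<open>Each of the r caps carries exactly one up, and l and l' count how many of these lie in
  the first and in the second block, so l + l' = r. Up to sign and a power of q the pairing is the
  quantum binomial coefficient of r over l; the induction step is the rule
  \<open>[l+l'] = q^l' [l] + qi^l [l']\<close>.\<close>

lemma nested_pairing:
  assumes q: "q * qi = (1 :: 'a::comm_ring_1)"
  defines "\<delta> \<equiv> q + qi"
  shows "l + l' = r \<Longrightarrow> pairing q (\<alpha> + r) (\<beta> + r) (\<alpha> + l) (\<beta> + l')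
      (\<lambda>xs ys. spin q (\<alpha> + r + (\<beta> + r)) (\<alpha> + \<beta>) (xs @ ys @ replicate (\<alpha> + \<beta>) False) (nested (\<alpha> + r) (\<beta> + r) r))
      * (qfact \<delta> l * qfact \<delta> l') =
    q ^ (\<alpha> + \<beta>) * (- 1) ^ (l * \<beta>) * q ^ (l * (\<beta> + l' + 1)) * qfact \<delta> r"
proof (induction r arbitrary: l l')
  case 0
  have "replicate \<alpha> True @ replicate \<beta> True @ replicate (\<alpha> + \<beta>) False = replicate (\<alpha> + \<beta>) True @ replicate (\<alpha> + \<beta>) False"
    by (simp add: replicate_add)
  then have "spin q (\<alpha> + \<beta>) (\<alpha> + \<beta>) (replicate \<alpha> True @ replicate \<beta> True @ replicate (\<alpha> + \<beta>) False) (id_diag (\<alpha> + \<beta>)) = q ^ (\<alpha> + \<beta>)"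
    using spin_id_top[of q "\<alpha> + \<beta>"] by (simp only:)
  then show ?case using 0 by (simp add: pairing_def states_full)
next
  case (Suc r)
  let ?a = "\<alpha> + r" and ?b = "\<beta> + r" and ?t = "replicate (\<alpha> + \<beta>) False"
  let ?F = "\<lambda>xs ys. spin q (\<alpha> + Suc r + (\<beta> + Suc r)) (\<alpha> + \<beta>) (xs @ ys @ ?t) (nested (\<alpha> + Suc r) (\<beta> + Suc r) (Suc r))"
  let ?F' = "\<lambda>xs ys. spin q (?a + ?b) (\<alpha> + \<beta>) (xs @ ys @ ?t) (nested ?a ?b r)"
  let ?P = "pairing q ?a ?b"
  have N: "nested ?a ?b r \<in> diagrams (?a + ?b) (\<alpha> + \<beta>)"
    using nested_in[of r ?a ?b] by (simp add: mult_2)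
  have step: "pairing q (\<alpha> + Suc r) (\<beta> + Suc r) (\<alpha> + l) (\<beta> + l') ?F =
    (if \<alpha> + l = 0 then 0 else q * (- q) ^ (?a - (\<alpha> + l - 1) + (\<beta> + l')) * ?P (\<alpha> + l - 1) (\<beta> + l') ?F') +
    (if \<beta> + l' = 0 then 0 else ?P (\<alpha> + l) (\<beta> + l' - 1) ?F')"
  proof -
    have e: "?a + ?b + 2 = \<alpha> + Suc r + (\<beta> + Suc r)" by simp
    have "?F (xs @ [s]) (t # ys) = cap_wt q s t * ?F' xs ys" if "length xs = ?a" for xs ys s t
      using spin_ins_cap[OF N _ that, of q s t "ys @ ?t"] unfolding e by simp
    then show ?thesis unfolding add_Suc_right by (intro pairing_step) simp
  qed
  have cancel: "q * (qi * x) = x" for x using q by (simp add: mult.assoc[symmetric])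
  consider "l = 0" "l' = Suc r" | "l = Suc r" "l' = 0" | k k' where "l = Suc k" "l' = Suc k'" "Suc (k + k') = r"
  proof (cases l)
    case 0 then show ?thesis using that(1) Suc.prems by simp
  next
    case (Suc k)
    show ?thesis
    proof (cases l')
      case 0 then show ?thesis using that(2) Suc.prems by simp
    next
      case (Suc k') then show ?thesis using that(3)[of k k'] \<open>l = Suc k\<close> Suc.prems by simp
    qed
  qed
  then show ?case
  proof cases
    case 1
    have "pairing q (\<alpha> + Suc r) (\<beta> + Suc r) (\<alpha> + l) (\<beta> + l') ?F = ?P (\<alpha> + 0) (\<beta> + r) ?F'"
      unfolding step using 1 by (simp add: pairing_empty)
    then have "pairing q (\<alpha> + Suc r) (\<beta> + Suc r) (\<alpha> + l) (\<beta> + l') ?F * (qfact \<delta> l * qfact \<delta> l') =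
        qnum \<delta> (Suc r) * (?P (\<alpha> + 0) (\<beta> + r) ?F' * (qfact \<delta> 0 * qfact \<delta> r))"
      using 1 by (simp add: mult_ac del: qnum.simps)
    also have "\<dots> = qnum \<delta> (Suc r) * (q ^ (\<alpha> + \<beta>) * (- 1) ^ (0 * \<beta>) * q ^ (0 * (\<beta> + r + 1)) * qfact \<delta> r)"
      using Suc.IH[of 0 r] by simp
    finally show ?thesis using 1 by (simp add: mult_ac del: qnum.simps)
  next
    case 2
    have "pairing q (\<alpha> + Suc r) (\<beta> + Suc r) (\<alpha> + l) (\<beta> + l') ?F = q * (- q) ^ \<beta> * ?P (\<alpha> + r) (\<beta> + 0) ?F'"
      unfolding step using 2 by (simp add: pairing_empty)
    then have "pairing q (\<alpha> + Suc r) (\<beta> + Suc r) (\<alpha> + l) (\<beta> + l') ?F * (qfact \<delta> l * qfact \<delta> l') =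
        q * (- q) ^ \<beta> * qnum \<delta> (Suc r) * (?P (\<alpha> + r) (\<beta> + 0) ?F' * (qfact \<delta> r * qfact \<delta> 0))"
      using 2 by (simp add: mult_ac del: qnum.simps)
    also have "\<dots> = q * (- q) ^ \<beta> * qnum \<delta> (Suc r) * (q ^ (\<alpha> + \<beta>) * (- 1) ^ (r * \<beta>) * q ^ (r * (\<beta> + 0 + 1)) * qfact \<delta> r)"
      using Suc.IH[of r 0] by simp
    also have "(- q) ^ \<beta> = (- 1) ^ \<beta> * q ^ \<beta>" by (rule power_minus)
    finally show ?thesis using 2
      by (simp only: qfact.simps power_add mult_ac mult_Suc mult_Suc_right add_0_right power_one_right)
  next
    case (3 k k')
    have "?a - (\<alpha> + l - 1) + (\<beta> + l') = \<beta> + 2 * l'" using 3 by simp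
    then have st: "pairing q (\<alpha> + Suc r) (\<beta> + Suc r) (\<alpha> + l) (\<beta> + l') ?F =
        q * (- q) ^ (\<beta> + 2 * l') * ?P (\<alpha> + k) (\<beta> + l') ?F' + ?P (\<alpha> + l) (\<beta> + k') ?F'"
      unfolding step using 3 by simp
    have i1: "?P (\<alpha> + k) (\<beta> + l') ?F' * (qfact \<delta> k * qfact \<delta> l') =
        q ^ (\<alpha> + \<beta>) * (- 1) ^ (k * \<beta>) * q ^ (k * (\<beta> + l' + 1)) * qfact \<delta> r"
      using Suc.IH[of k l'] 3 by simp
    have i2: "?P (\<alpha> + l) (\<beta> + k') ?F' * (qfact \<delta> l * qfact \<delta> k') =
        q ^ (\<alpha> + \<beta>) * (- 1) ^ (l * \<beta>) * q ^ (l * (\<beta> + k' + 1)) * qfact \<delta> r"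
      using Suc.IH[of l k'] 3 by simp
    have "pairing q (\<alpha> + Suc r) (\<beta> + Suc r) (\<alpha> + l) (\<beta> + l') ?F * (qfact \<delta> l * qfact \<delta> l') =
        q * (- q) ^ (\<beta> + 2 * l') * qnum \<delta> l * (?P (\<alpha> + k) (\<beta> + l') ?F' * (qfact \<delta> k * qfact \<delta> l')) +
        qnum \<delta> l' * (?P (\<alpha> + l) (\<beta> + k') ?F' * (qfact \<delta> l * qfact \<delta> k'))"
      unfolding st unfolding 3(1,2) qfact.simps by (simp only: distrib_left distrib_right mult_ac)
    also have "\<dots> = q ^ (\<alpha> + \<beta>) * qfact \<delta> r *
        (q * (- q) ^ (\<beta> + 2 * l') * (- 1) ^ (k * \<beta>) * q ^ (k * (\<beta> + l' + 1)) * qnum \<delta> l +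
         (- 1) ^ (l * \<beta>) * q ^ (l * (\<beta> + k' + 1)) * qnum \<delta> l')"
      unfolding i1 i2 by (simp only: distrib_left distrib_right mult_ac)
    also have "q * (- q) ^ (\<beta> + 2 * l') * (- 1) ^ (k * \<beta>) * q ^ (k * (\<beta> + l' + 1)) =
        (- 1) ^ (l * \<beta>) * q ^ (l * (\<beta> + l' + 1)) * q ^ l'"
    proof -
      have "(- q) ^ (\<beta> + 2 * l') = (- 1) ^ \<beta> * q ^ (\<beta> + 2 * l')"
        unfolding power_minus[of q] by (simp add: power_add power_mult)
      then have "q * (- q) ^ (\<beta> + 2 * l') * (- 1) ^ (k * \<beta>) * q ^ (k * (\<beta> + l' + 1)) =
          ((- 1) ^ \<beta> * (- 1) ^ (k * \<beta>)) * (q * q ^ (\<beta> + 2 * l') * q ^ (k * (\<beta> + l' + 1)))"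
        by (simp only: mult_ac)
      also have "(- 1) ^ \<beta> * (- 1) ^ (k * \<beta>) = ((- 1) ^ (l * \<beta>) :: 'a)"
        unfolding 3(1) power_add[symmetric] by simp
      also have "q * q ^ (\<beta> + 2 * l') * q ^ (k * (\<beta> + l' + 1)) = q ^ (l * (\<beta> + l' + 1)) * q ^ l'"
        unfolding 3(1) power_Suc[symmetric] power_add[symmetric] by (rule arg_cong[where f = "power q"]) simp
      finally show ?thesis by (simp only: mult.assoc)
    qed
    also have "q ^ (l * (\<beta> + k' + 1)) = q ^ (l * (\<beta> + l' + 1)) * qi ^ l"
    proof -
      have "q ^ (l * (\<beta> + l' + 1)) = q ^ (l * (\<beta> + k' + 1)) * q ^ l"
        unfolding 3(2) power_add[symmetric] by (rule arg_cong[where f = "power q"]) simp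
      moreover have "q ^ l * qi ^ l = 1" using q by (metis power_mult_distrib power_one)
      ultimately show ?thesis by (simp add: mult.assoc)
    qed
    finally have "pairing q (\<alpha> + Suc r) (\<beta> + Suc r) (\<alpha> + l) (\<beta> + l') ?F * (qfact \<delta> l * qfact \<delta> l') =
        q ^ (\<alpha> + \<beta>) * (- 1) ^ (l * \<beta>) * q ^ (l * (\<beta> + l' + 1)) * ((q ^ l' * qnum \<delta> l + qi ^ l * qnum \<delta> l') * qfact \<delta> r)"
      by (simp only: distrib_left distrib_right mult_ac)
    also have "q ^ l' * qnum \<delta> l + qi ^ l * qnum \<delta> l' = qnum \<delta> (Suc r)"
      unfolding \<delta>_def qnum_add_q[OF q, symmetric] using 3 by (simp add: add.commute)
    finally show ?thesis by (simp only: qfact.simps)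
  qed
qed

text \<open>The shape of the spin values of \<open>e\<^sup>\<mu>\<close> applied to \<open>r\<close> nested middle caps. Contracting the two
  middle points preserves it: \<open>r\<close> drops by one and \<open>K\<close> is multiplied by a quantum number.\<close>

definition two_sym :: "'a::comm_ring_1 \<Rightarrow> 'a \<Rightarrow> nat \<Rightarrow> nat \<Rightarrow> nat \<Rightarrow> nat \<Rightarrow> 'a mor \<Rightarrow> 'a \<Rightarrow> bool" where
  "two_sym q \<delta> \<alpha> \<beta> r m y K \<longleftrightarrow> (\<forall>l l' xs ys. l + l' = r \<longrightarrow> xs \<in> states (\<alpha> + r) (\<alpha> + l) \<longrightarrow> ys \<in> states (\<beta> + r) (\<beta> + l') \<longrightarrow>
    Spin q (\<alpha> + r + (\<beta> + r)) m (xs @ ys @ replicate m False) y * q ^ ((\<alpha> + l) * l') =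
    K * ((- q) ^ (hgt xs + hgt ys) * (- 1) ^ (l * \<beta>) * q ^ l * (qfact \<delta> (\<alpha> + l) * qfact \<delta> (\<beta> + l'))))"

text \<open>The two spin choices for the middle points contribute \<open>[\<alpha>+l+1]\<close> and
  \<open>[\<beta>+l'+1]\<close> with complementary powers of q; by \<open>qnum_add_q\<close> they
  add up to a quantum number that no longer depends on l.\<close>

lemma two_sym_contract:
  assumes q: "q * qi = (1 :: 'a::comm_ring_1)"
    and y: "y \<in> Hom (\<alpha> + r + (\<beta> + r) + 2) m" and s: "two_sym q (q + qi) \<alpha> \<beta> (Suc r) m y K"
  shows "two_sym q (q + qi) \<alpha> \<beta> r m
    (tl_comp (q + qi) (dg (cup_diag (\<alpha> + r + (\<beta> + r) + 2) (\<alpha> + r))) y) (K * qnum (q + qi) (\<alpha> + \<beta> + r + 2))"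
  unfolding two_sym_def
proof (intro allI impI)
  fix l l' xs ys assume ll: "l + l' = r" and xs: "xs \<in> states (\<alpha> + r) (\<alpha> + l)" and ys: "ys \<in> states (\<beta> + r) (\<beta> + l')"
  let ?\<delta> = "q + qi" and ?n = "\<alpha> + r + (\<beta> + r)" and ?t = "replicate m False"
  let ?Y = "\<lambda>xs ys. Spin q (?n + 2) m (xs @ ys @ ?t) y"
  have lx: "length xs = \<alpha> + r" and dx: "downs xs = l'" and ly: "length ys = \<beta> + r" and uy: "ups ys = \<beta> + l'"
    using xs ys ll ups_downs[of xs] by (auto simp: states_def)
  have e: "\<alpha> + Suc r + (\<beta> + Suc r) = ?n + 2" by simp
  note s' = s[unfolded two_sym_def e, rule_format]
  have q1: "q ^ j * qi ^ j = 1" for j using q by (metis power_mult_distrib power_one)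
  let ?h = "(- q) ^ (hgt xs + hgt ys)" and ?Q = "q ^ ((\<alpha> + l) * l')"
  let ?g = "qfact ?\<delta> (\<alpha> + l) * qfact ?\<delta> (\<beta> + l')"
  let ?U = "K * (?h * (- 1) ^ (l * \<beta>) * q ^ l * ?g)"
  have hT: "hgt (xs @ [True]) + hgt (False # ys) = hgt xs + hgt ys + (\<beta> + 2 * l')"
    using dx uy by (simp add: hgt_append)
  have hF: "hgt (xs @ [False]) + hgt (True # ys) = hgt xs + hgt ys" by (simp add: hgt_append)
  have A: "?Y (xs @ [True]) (False # ys) * q ^ ((\<alpha> + Suc l) * l') =
      K * ((- q) ^ (hgt xs + hgt ys + (\<beta> + 2 * l')) * (- 1) ^ (Suc l * \<beta>) * q ^ Suc l * (qfact ?\<delta> (\<alpha> + Suc l) * qfact ?\<delta> (\<beta> + l')))"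
    unfolding hT[symmetric] by (rule s') (use ll xs ys in \<open>auto simp: states_def\<close>)
  have B: "?Y (xs @ [False]) (True # ys) * q ^ ((\<alpha> + l) * Suc l') =
      K * ((- q) ^ (hgt xs + hgt ys) * (- 1) ^ (l * \<beta>) * q ^ l * (qfact ?\<delta> (\<alpha> + l) * qfact ?\<delta> (\<beta> + Suc l')))"
    unfolding hF[symmetric] by (rule s') (use ll xs ys in \<open>auto simp: states_def\<close>)
  have A': "?Y (xs @ [True]) (False # ys) * ?Q = ?U * (q ^ (\<beta> + l' + 1) * qnum ?\<delta> (\<alpha> + l + 1))"
  proof -
    have "?Y (xs @ [True]) (False # ys) * ?Q * q ^ l' = ?Y (xs @ [True]) (False # ys) * q ^ ((\<alpha> + Suc l) * l')"
      by (simp add: power_add algebra_simps)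
    also have "\<dots> = ?U * (q ^ (\<beta> + l' + 1) * qnum ?\<delta> (\<alpha> + l + 1)) * q ^ l'"
    proof -
      have p: "(- q) ^ (\<beta> + 2 * l') * (- 1) ^ \<beta> = q ^ (\<beta> + 2 * l')"
      proof -
        have "(- q) ^ (\<beta> + 2 * l') = (- 1) ^ \<beta> * q ^ (\<beta> + 2 * l')"
          unfolding power_minus[of q] by (simp add: power_add power_mult)
        moreover have "(- 1) ^ \<beta> * (- 1) ^ \<beta> = (1 :: 'a)" by (simp flip: power_add mult_2)
        ultimately show ?thesis by (metis mult.assoc mult.commute mult_1)
      qed
      have "K * ((- q) ^ (hgt xs + hgt ys + (\<beta> + 2 * l')) * (- 1) ^ (Suc l * \<beta>) * q ^ Suc l * (qfact ?\<delta> (\<alpha> + Suc l) * qfact ?\<delta> (\<beta> + l')))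
          = ?U * (q * qnum ?\<delta> (\<alpha> + l + 1)) * ((- q) ^ (\<beta> + 2 * l') * (- 1) ^ \<beta>)"
        by (simp add: power_add mult_ac del: qnum.simps)
      also have "\<dots> = ?U * (q ^ (\<beta> + l' + 1) * qnum ?\<delta> (\<alpha> + l + 1)) * q ^ l'"
      proof -
        have "q ^ (\<beta> + 2 * l') = q ^ \<beta> * q ^ l' * q ^ l'" unfolding mult_2 by (simp only: power_add mult.assoc)
        then show ?thesis unfolding p by (simp only: power_add power_one_right mult_ac)
      qed
      finally show ?thesis unfolding A .
    qed
    finally have "?Y (xs @ [True]) (False # ys) * ?Q * (q ^ l' * qi ^ l') =
        ?U * (q ^ (\<beta> + l' + 1) * qnum ?\<delta> (\<alpha> + l + 1)) * (q ^ l' * qi ^ l')"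
      by (simp only: mult.assoc[symmetric])
    then show ?thesis unfolding q1 by simp
  qed
  have B': "qi * (?Y (xs @ [False]) (True # ys)) * ?Q = ?U * (qi ^ (\<alpha> + l + 1) * qnum ?\<delta> (\<beta> + l' + 1))"
  proof -
    have "?Y (xs @ [False]) (True # ys) * ?Q * q ^ (\<alpha> + l) = ?U * qnum ?\<delta> (\<beta> + l' + 1)"
    proof -
      have "?Y (xs @ [False]) (True # ys) * ?Q * q ^ (\<alpha> + l) = ?Y (xs @ [False]) (True # ys) * q ^ ((\<alpha> + l) * Suc l')"
        by (simp add: power_add algebra_simps)
      then show ?thesis unfolding B by (simp add: mult_ac del: qnum.simps)
    qed
    then have "?Y (xs @ [False]) (True # ys) * ?Q * (q ^ (\<alpha> + l) * qi ^ (\<alpha> + l)) = ?U * qnum ?\<delta> (\<beta> + l' + 1) * qi ^ (\<alpha> + l)"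
      by (simp only: mult.assoc[symmetric])
    then have "?Y (xs @ [False]) (True # ys) * ?Q = ?U * qnum ?\<delta> (\<beta> + l' + 1) * qi ^ (\<alpha> + l)" unfolding q1 by simp
    then show ?thesis by (simp add: mult.assoc mult.left_commute del: qnum.simps)
  qed
  have "Spin q ?n m (xs @ ys @ ?t) (tl_comp ?\<delta> (dg (cup_diag (?n + 2) (\<alpha> + r))) y) =
      ?Y (xs @ [True]) (False # ys) + qi * ?Y (xs @ [False]) (True # ys)"
    using Spin_contract[OF q _ lx y, of "ys @ ?t"] by simp
  then have "Spin q ?n m (xs @ ys @ ?t) (tl_comp ?\<delta> (dg (cup_diag (?n + 2) (\<alpha> + r))) y) * ?Q =
      ?U * (q ^ (\<beta> + l' + 1) * qnum ?\<delta> (\<alpha> + l + 1) + qi ^ (\<alpha> + l + 1) * qnum ?\<delta> (\<beta> + l' + 1))"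
    unfolding distrib_left A'[symmetric] B'[symmetric] by (simp add: distrib_right)
  also have "q ^ (\<beta> + l' + 1) * qnum ?\<delta> (\<alpha> + l + 1) + qi ^ (\<alpha> + l + 1) * qnum ?\<delta> (\<beta> + l' + 1) = qnum ?\<delta> (\<alpha> + \<beta> + r + 2)"
  proof -
    have "\<alpha> + \<beta> + r + 2 = (\<beta> + l' + 1) + (\<alpha> + l + 1)" using ll by simp
    then show ?thesis unfolding qnum_add_q[OF q, symmetric] by (simp only:)
  qed
  finally show "Spin q ?n m (xs @ ys @ ?t) (tl_comp ?\<delta> (dg (cup_diag (?n + 2) (\<alpha> + r))) y) * ?Q =
      K * qnum ?\<delta> (\<alpha> + \<beta> + r + 2) * (?h * (- 1) ^ (l * \<beta>) * q ^ l * ?g)"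
    by (simp only: mult_ac)
qed

lemma refl_nested_Suc:
  assumes "r \<le> a" "r \<le> b" and y: "y \<in> Hom (a + b + 2) m"
  shows "tl_comp \<delta> (dg (refl_diag (nested (Suc a) (Suc b) (Suc r)))) y =
    tl_comp \<delta> (dg (refl_diag (nested a b r))) (tl_comp \<delta> (dg (cup_diag (a + b + 2) a)) y)"
proof -
  have a: "a \<le> a + b" by simp
  note N = nested_in[OF assms(1,2)] and C = cap_diag_in[OF a]
  have "dg (refl_diag (nested (Suc a) (Suc b) (Suc r))) =
      tl_comp \<delta> (dg (refl_diag (nested a b r))) (dg (cup_diag (a + b + 2) a))"
    unfolding nested.simps cat_cap_diag(1)[OF a N, symmetric] refl_cat(1)[OF C N] tl_comp_single refl_cat(2)[OF C N]
      cat_cap_diag(2)[OF a N] by simp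
  then show ?thesis
    unfolding tl_comp_assoc[OF Hom_single[OF refl_diag_in[OF N]] Hom_single[OF refl_diag_in[OF C]] y, symmetric] by simp
qed

text \<open>The r contractions multiply K by the quantum numbers from
  \<open>[\<alpha>+\<beta>+r+1]\<close> down to \<open>[\<alpha>+\<beta>+2]\<close>, a quotient of
  two factorials. What remains is evaluated on the all-up state.\<close>

lemma two_sym_top:
  assumes q: "q * qi = (1 :: 'a::comm_ring_1)"
  shows "y \<in> Hom (\<alpha> + r + (\<beta> + r)) m \<Longrightarrow> two_sym q (q + qi) \<alpha> \<beta> r m y K \<Longrightarrow>
    Spin q (\<alpha> + \<beta>) m (replicate (\<alpha> + \<beta>) True @ replicate m False)
      (tl_comp (q + qi) (dg (refl_diag (nested (\<alpha> + r) (\<beta> + r) r))) y) * qfact (q + qi) (\<alpha> + \<beta> + 1) =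
    K * (qfact (q + qi) \<alpha> * qfact (q + qi) \<beta> * qfact (q + qi) (\<alpha> + \<beta> + r + 1))"
proof (induction r arbitrary: y K)
  case 0
  have "Spin q (\<alpha> + \<beta>) m (replicate \<alpha> True @ replicate \<beta> True @ replicate m False) y = K * (qfact (q + qi) \<alpha> * qfact (q + qi) \<beta>)"
    using 0(2)[unfolded two_sym_def, rule_format, of 0 0 "replicate \<alpha> True" "replicate \<beta> True"] by (simp add: states_full)
  moreover have "tl_comp (q + qi) (dg (refl_diag (nested (\<alpha> + 0) (\<beta> + 0) 0))) y = y"
    using 0(1) by (simp add: tl_comp_id_left)
  ultimately show ?case by (simp add: replicate_add mult_ac del: qnum.simps)
next
  case (Suc r)
  let ?n = "\<alpha> + r + (\<beta> + r)" and ?\<delta> = "q + qi"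
  have e: "\<alpha> + Suc r + (\<beta> + Suc r) = ?n + 2" by simp
  have y: "y \<in> Hom (?n + 2) m" using Suc.prems(1) unfolding e .
  let ?y = "tl_comp ?\<delta> (dg (cup_diag (?n + 2) (\<alpha> + r))) y"
  have yH: "?y \<in> Hom ?n m" by (rule tl_comp_in[OF dg_cup_in y]) simp
  have "tl_comp ?\<delta> (dg (refl_diag (nested (\<alpha> + Suc r) (\<beta> + Suc r) (Suc r)))) y =
      tl_comp ?\<delta> (dg (refl_diag (nested (\<alpha> + r) (\<beta> + r) r))) ?y"
    unfolding add_Suc_right by (rule refl_nested_Suc[OF _ _ y]) simp_all
  then show ?case
    using Suc.IH[OF yH two_sym_contract[OF q y Suc.prems(2)]] by (simp add: mult_ac del: qnum.simps)
qed

text \<open>Apart from its identity term, e consists of diagrams with a simple cap inside one block,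
  and these are killed by the symmetric vector of that block. Hence e drops out of the
  pairing.\<close>

lemma two_block_pairing:
  assumes tb: "two_block \<delta> a b e" and X: "X \<in> diagrams (a + b) m"
  shows "pairing q a b k1 k2 (\<lambda>xs ys. Spin q (a + b) m (xs @ ys @ zs) (tl_comp \<delta> e (Poly_Mapping.single X c))) =
    c * pairing q a b k1 k2 (\<lambda>xs ys. spin q (a + b) m (xs @ ys @ zs) X)"
proof -
  have lin: "pairing q a b k1 k2 (\<lambda>xs ys. c * F xs ys) = c * pairing q a b k1 k2 F" for c F
    unfolding pairing_def by (simp add: sum_distrib_left mult_ac)
  have add: "pairing q a b k1 k2 (\<lambda>xs ys. F xs ys + G xs ys) = pairing q a b k1 k2 F + pairing q a b k1 k2 G" for F G
    unfolding pairing_def by (simp add: distrib_left sum.distrib)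
  have sm: "pairing q a b k1 k2 (\<lambda>xs ys. \<Sum>i\<in>I. F i xs ys) = (\<Sum>i\<in>I. pairing q a b k1 k2 (F i))" for I and F :: "diagram \<Rightarrow> _"
    by (induction I rule: infinite_finite_induct) (simp_all add: add, simp_all add: pairing_def)
  have kill: "pairing q a b k1 k2 (\<lambda>xs ys. spin q (a + b) m (xs @ ys @ zs) D) = 0"
    if D: "D \<in> diagrams (a + b) m" and k: "{(0, k), (0, k + 1)} \<in> D" "k + 1 \<noteq> a" for D k
  proof -
    have "(0, k + 1) \<in> points (a + b) m" using diag_Union[OF D] k by blast
    then have kn: "k + 1 < a + b" by (simp add: points_def)
    obtain n' where "n' = a + b - 2" by blast
    then have n: "a + b = n' + 2" and k': "k \<le> n'" using kn by auto
    obtain D' where D': "D' \<in> diagrams n' m" "D = ins_cap k D'"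
      using ins_cap_exists[OF D[unfolded n] k(1)] by metis
    show ?thesis
    proof (cases "k + 1 < a")
      case True
      have "(\<Sum>xs\<in>states a k1. (- q) ^ hgt xs * spin q (a + b) m (xs @ ys @ zs) D) = 0" for ys
      proof (rule sum_states_cap[of k])
        fix us vs :: "bool list" and s t assume "length us = k"
        then show "spin q (a + b) m ((us @ s # t # vs) @ ys @ zs) D = cap_wt q s t * spin q n' m ((us @ vs) @ ys @ zs) D'"
          using spin_ins_cap[OF D'(1) k', of us q s t "vs @ ys @ zs"] unfolding n D'(2) by simp
      qed (use True in simp)
      then have "(\<Sum>ys\<in>states b k2. (- q) ^ hgt ys * (\<Sum>xs\<in>states a k1. (- q) ^ hgt xs * spin q (a + b) m (xs @ ys @ zs) D)) = 0"
        by simp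
      then show ?thesis
        unfolding pairing_def sum_distrib_left by (subst sum.swap) (simp add: mult.left_commute)
    next
      case False
      have "(\<Sum>ys\<in>states b k2. (- q) ^ hgt ys * spin q (a + b) m (xs @ ys @ zs) D) = 0" if lx: "length xs = a" for xs
      proof (rule sum_states_cap[of "k - a"])
        fix us vs :: "bool list" and s t assume us: "length us = k - a"
        then have "length (xs @ us) = k" using lx False k(2) by simp
        then show "spin q (a + b) m (xs @ (us @ s # t # vs) @ zs) D = cap_wt q s t * spin q n' m (xs @ (us @ vs) @ zs) D'"
          using spin_ins_cap[OF D'(1) k', of "xs @ us" q s t "vs @ zs"] unfolding n D'(2) by simp
      qed (use False kn k(2) in simp)
      then show ?thesis unfolding pairing_def by (simp add: states_def)
    qed
  qed
  let ?x = "Poly_Mapping.single X c"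
  let ?I = "diagrams (a + b) (a + b) - {id_diag (a + b)}"
  have "pairing q a b k1 k2 (\<lambda>xs ys. Spin q (a + b) m (xs @ ys @ zs) (tl_comp \<delta> e ?x)) =
      pairing q a b k1 k2 (\<lambda>xs ys. Spin q (a + b) m (xs @ ys @ zs) ?x) +
      (\<Sum>D\<in>?I. pairing q a b k1 k2 (\<lambda>xs ys. Spin q (a + b) m (xs @ ys @ zs) (tl_comp \<delta> (Poly_Mapping.single D (lk e D)) ?x)))"
    unfolding tb_expand[OF tb Hom_single[OF X]] Spin_add Spin_sum add sm ..
  also have "(\<Sum>D\<in>?I. pairing q a b k1 k2 (\<lambda>xs ys. Spin q (a + b) m (xs @ ys @ zs) (tl_comp \<delta> (Poly_Mapping.single D (lk e D)) ?x))) = 0"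
  proof (rule sum.neutral, rule ballI)
    fix D assume D: "D \<in> ?I"
    show "pairing q a b k1 k2 (\<lambda>xs ys. Spin q (a + b) m (xs @ ys @ zs) (tl_comp \<delta> (Poly_Mapping.single D (lk e D)) ?x)) = 0"
    proof (cases "lk e D = 0")
      case True then show ?thesis by (simp add: pairing_def)
    next
      case False
      then obtain k where k: "k + 1 \<noteq> a" "{(0, k), (0, k + 1)} \<in> D" using tb_caps[OF tb] D by blast
      have DX: "cat_diag D X \<in> diagrams (a + b) m" using cat_diagrams D X by blast
      have "{(0, k), (0, k + 1)} \<in> cat_diag D X" using cat_source_block[OF _ X k(2)] D by blast
      then show ?thesis unfolding tl_comp_single Spin_single[OF DX] lin using kill[OF DX _ k(1)] by simp
    qed
  qed
  finally show ?thesis unfolding Spin_single[OF X] lin by simp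
qed

text \<open>Killing of the cups inside the blocks gives the exchange rule there, so the spin values
  depend on one sorted value for each l. The pairing equals this value times two \<open>zsum\<close>
  factors on the one hand, and is known from \<open>nested_pairing\<close> on the other. The scalar
  \<open>W\<close> clears the denominators coming from \<open>zsum_fact\<close>.\<close>

lemma two_block_two_sym:
  assumes q: "q * qi = (1 :: 'a::comm_ring_1)" and tb: "two_block (q + qi) (\<alpha> + r) (\<beta> + r) e"
  defines "W \<equiv> qfact (q + qi) (\<alpha> + r) * qfact (q + qi) (\<beta> + r)"
  shows "two_sym q (q + qi) \<alpha> \<beta> r (\<alpha> + \<beta>)
    (tl_scale W (tl_comp (q + qi) e (dg (nested (\<alpha> + r) (\<beta> + r) r)))) (q ^ (\<alpha> + \<beta>) * qfact (q + qi) r)"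
  unfolding two_sym_def
proof (intro allI impI)
  fix l l' xs ys assume ll: "l + l' = r" and xs: "xs \<in> states (\<alpha> + r) (\<alpha> + l)" and ys: "ys \<in> states (\<beta> + r) (\<beta> + l')"
  let ?\<delta> = "q + qi" and ?a = "\<alpha> + r" and ?b = "\<beta> + r" and ?m = "\<alpha> + \<beta>" and ?k1 = "\<alpha> + l" and ?k2 = "\<beta> + l'"
  let ?t = "replicate ?m False" and ?x = "dg (nested ?a ?b r) :: 'a mor"
  let ?v = "tl_comp ?\<delta> e ?x"
  let ?Y = "\<lambda>xs ys. Spin q (?a + ?b) ?m (xs @ ys @ ?t) ?v"
  have N: "nested ?a ?b r \<in> diagrams (?a + ?b) ?m" using nested_in[of r ?a ?b] by (simp add: mult_2)
  note eH = tb_in[OF tb]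
  have vH: "?v \<in> Hom (?a + ?b) ?m" by (rule tl_comp_in[OF eH Hom_single[OF N]])
  have swap: "Spin q (?a + ?b) ?m (us @ False # True # vs) ?v = - q * Spin q (?a + ?b) ?m (us @ True # False # vs) ?v"
    if us: "length us + 1 < ?a + ?b" "length us + 1 \<noteq> ?a" for us vs
  proof -
    obtain n' where "n' = ?a + ?b - 2" by blast
    then have n: "?a + ?b = n' + 2" and k': "length us \<le> n'" using us by auto
    have "tl_comp ?\<delta> (dg (cup_diag (?a + ?b) (length us))) e = 0" using tb us unfolding two_block_def by blast
    then have z: "tl_comp ?\<delta> (dg (cup_diag (n' + 2) (length us))) ?v = 0"
      unfolding tl_comp_assoc[OF dg_cup_in[OF k'] eH[unfolded n] Hom_single[OF N[unfolded n]], symmetric] n by simp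
    show ?thesis using Spin_swap[OF q vH[unfolded n] k' z] unfolding n .
  qed
  have lens: "length xs = ?a" "ups xs = ?k1" "length ys = ?b" "ups ys = ?k2" using xs ys by (auto simp: states_def)
  have sx: "?Y (us @ False # True # vs) zs = - q * ?Y (us @ True # False # vs) zs"
    if "length us + length vs + 2 = ?a" for us vs zs using swap[of us "vs @ zs @ ?t"] that by simp
  have sy: "?Y ws (us @ False # True # vs) = - q * ?Y ws (us @ True # False # vs)"
    if "length us + length vs + 2 = ?b" "length ws = ?a" for us vs ws
    using swap[of "ws @ us" "vs @ ?t"] that by simp
  let ?g = "?Y (srt ?a ?k1) (srt ?b ?k2)"
  have lsrt: "length (srt ?a ?k1) = ?a" using ll by simp
  have Yg: "?Y xs ys = (- q) ^ (hgt xs + hgt ys) * ?g"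
    using sort_state[of ?a "\<lambda>xs. ?Y xs ys" q xs, OF sx lens(1)]
      sort_state[of ?b "\<lambda>ys. ?Y (srt ?a ?k1) ys" q ys, OF sy[OF _ lsrt] lens(3)] lens
    by (simp add: power_add mult.assoc)
  have pair: "pairing q ?a ?b ?k1 ?k2 ?Y = zsum q ?a ?k1 * zsum q ?b ?k2 * ?g"
  proof -
    have "pairing q ?a ?b ?k1 ?k2 ?Y = (\<Sum>xs\<in>states ?a ?k1. (- q) ^ hgt xs * (zsum q ?b ?k2 * ?Y xs (srt ?b ?k2)))"
      unfolding pairing_def
    proof (rule sum.cong[OF refl])
      fix xs assume "xs \<in> states ?a ?k1"
      then have "length xs = ?a" by (simp add: states_def)
      then show "(- q) ^ hgt xs * (\<Sum>ys\<in>states ?b ?k2. (- q) ^ hgt ys * ?Y xs ys) =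
          (- q) ^ hgt xs * (zsum q ?b ?k2 * ?Y xs (srt ?b ?k2))"
        using sum_sort_state[of ?b "\<lambda>ys. ?Y xs ys" q ?k2, OF sy] by simp
    qed
    also have "\<dots> = zsum q ?b ?k2 * (\<Sum>xs\<in>states ?a ?k1. (- q) ^ hgt xs * ?Y xs (srt ?b ?k2))"
      by (simp add: sum_distrib_left mult.left_commute)
    also have "\<dots> = zsum q ?b ?k2 * (zsum q ?a ?k1 * ?g)"
      using sum_sort_state[of ?a "\<lambda>xs. ?Y xs (srt ?b ?k2)" q ?k1, OF sx] by simp
    finally show ?thesis by (simp only: mult_ac)
  qed
  have npair: "pairing q ?a ?b ?k1 ?k2 ?Y * (qfact ?\<delta> l * qfact ?\<delta> l') =
      q ^ ?m * (- 1) ^ (l * \<beta>) * q ^ (l * (\<beta> + l' + 1)) * qfact ?\<delta> r"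
    using two_block_pairing[OF tb N, of q ?k1 ?k2 ?t 1] nested_pairing[OF q ll, of \<alpha> \<beta>] by simp
  have za: "zsum q ?a ?k1 * (qfact ?\<delta> ?k1 * qfact ?\<delta> l') = q ^ (?k1 * l') * qfact ?\<delta> ?a"
  proof -
    have "?k1 + l' = ?a" using ll by simp
    then show ?thesis using zsum_fact[OF q, of ?k1 l'] by (simp only:)
  qed
  have zb: "zsum q ?b ?k2 * (qfact ?\<delta> ?k2 * qfact ?\<delta> l) = q ^ (?k2 * l) * qfact ?\<delta> ?b"
  proof -
    have "?k2 + l = ?b" using ll by simp
    then show ?thesis using zsum_fact[OF q, of ?k2 l] by (simp only:)
  qed
  have "(W * ?g * q ^ (?k1 * l')) * q ^ (?k2 * l) =
      (zsum q ?a ?k1 * (qfact ?\<delta> ?k1 * qfact ?\<delta> l')) * (zsum q ?b ?k2 * (qfact ?\<delta> ?k2 * qfact ?\<delta> l)) * ?g"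
    unfolding za zb W_def by (simp only: mult_ac)
  also have "\<dots> = (pairing q ?a ?b ?k1 ?k2 ?Y * (qfact ?\<delta> l * qfact ?\<delta> l')) * (qfact ?\<delta> ?k1 * qfact ?\<delta> ?k2)"
    unfolding pair by (simp only: mult_ac)
  also have "\<dots> = (q ^ ?m * qfact ?\<delta> r * ((- 1) ^ (l * \<beta>) * q ^ l * (qfact ?\<delta> ?k1 * qfact ?\<delta> ?k2))) * q ^ (?k2 * l)"
  proof -
    have "q ^ (l * (\<beta> + l' + 1)) = q ^ l * q ^ (?k2 * l)" unfolding power_add[symmetric] by (simp add: algebra_simps)
    then show ?thesis unfolding npair by (simp only: mult_ac)
  qed
  finally have "(W * ?g * q ^ (?k1 * l')) * (q ^ (?k2 * l) * qi ^ (?k2 * l)) =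
      (q ^ ?m * qfact ?\<delta> r * ((- 1) ^ (l * \<beta>) * q ^ l * (qfact ?\<delta> ?k1 * qfact ?\<delta> ?k2))) * (q ^ (?k2 * l) * qi ^ (?k2 * l))"
    by (simp only: mult.assoc[symmetric])
  moreover have "q ^ (?k2 * l) * qi ^ (?k2 * l) = 1" using q by (metis power_mult_distrib power_one)
  ultimately have key: "W * ?g * q ^ (?k1 * l') = q ^ ?m * qfact ?\<delta> r * ((- 1) ^ (l * \<beta>) * q ^ l * (qfact ?\<delta> ?k1 * qfact ?\<delta> ?k2))"
    by simp
  have "Spin q (?a + ?b) ?m (xs @ ys @ ?t) (tl_scale W ?v) * q ^ (?k1 * l') = (- q) ^ (hgt xs + hgt ys) * (W * ?g * q ^ (?k1 * l'))"
    unfolding Spin_scale Yg by (simp only: mult_ac)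
  then show "Spin q (?a + ?b) ?m (xs @ ys @ ?t) (tl_scale W ?v) * q ^ (?k1 * l') =
      q ^ ?m * qfact ?\<delta> r * ((- q) ^ (hgt xs + hgt ys) * (- 1) ^ (l * \<beta>) * q ^ l * (qfact ?\<delta> ?k1 * qfact ?\<delta> ?k2))"
    unfolding key by (simp only: mult_ac)
qed

text \<open>The form on the generator of the cell module for r caps, with the outer e and the
  truncation left out; \<open>cell_form_vec\<close> restores both.\<close>

definition form_value :: "'k::comm_ring_1 \<Rightarrow> nat \<Rightarrow> nat \<Rightarrow> nat \<Rightarrow> 'k mor \<Rightarrow> 'k" where
  "form_value \<delta> a b r e = lk (tl_comp \<delta> (dg (refl_diag (nested a b r))) (tl_comp \<delta> e (dg (nested a b r)))) (id_diag (a + b - 2 * r))"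

text \<open>For Jones-Wenzl idempotents this is the value of the theta network with internal
  multiplicities r, \<alpha> and \<beta>, divided by the loop value
  \<open>[\<alpha>+\<beta>+1]\<close> of the outer edge.\<close>

lemma form_value_q:
  assumes q: "q * qi = (1 :: 'a::comm_ring_1)" and tb: "two_block (q + qi) (\<alpha> + r) (\<beta> + r) e"
  shows "form_value (q + qi) (\<alpha> + r) (\<beta> + r) r e *
      (qfact (q + qi) (\<alpha> + r) * qfact (q + qi) (\<beta> + r) * qfact (q + qi) (\<alpha> + \<beta> + 1)) =
    qfact (q + qi) r * qfact (q + qi) \<alpha> * qfact (q + qi) \<beta> * qfact (q + qi) (\<alpha> + \<beta> + r + 1)"
proof -
  let ?\<delta> = "q + qi" and ?a = "\<alpha> + r" and ?b = "\<beta> + r" and ?m = "\<alpha> + \<beta>"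
  define W where "W = qfact ?\<delta> ?a * qfact ?\<delta> ?b"
  let ?v = "tl_comp ?\<delta> e (dg (nested ?a ?b r))"
  have N: "nested ?a ?b r \<in> diagrams (?a + ?b) ?m" using nested_in[of r ?a ?b] by (simp add: mult_2)
  have vH: "?v \<in> Hom (?a + ?b) ?m" by (rule tl_comp_in[OF tb_in[OF tb] Hom_single[OF N]])
  have m: "?a + ?b - 2 * r = ?m" by simp
  let ?z = "tl_comp ?\<delta> (dg (refl_diag (nested ?a ?b r))) ?v"
  have zH: "?z \<in> Hom ?m ?m" by (rule tl_comp_in[OF Hom_single[OF refl_diag_in[OF N]] vH])
  have "Spin q ?m ?m (replicate ?m True @ replicate ?m False) (tl_comp ?\<delta> (dg (refl_diag (nested ?a ?b r))) (tl_scale W ?v)) * qfact ?\<delta> (?m + 1) =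
      q ^ ?m * qfact ?\<delta> r * (qfact ?\<delta> \<alpha> * qfact ?\<delta> \<beta> * qfact ?\<delta> (?m + r + 1))"
    by (rule two_sym_top[OF q Hom_scale[OF vH]]) (use two_block_two_sym[OF q tb] in \<open>simp add: W_def\<close>)
  then have "q ^ ?m * (W * form_value ?\<delta> ?a ?b r e * qfact ?\<delta> (?m + 1)) =
      q ^ ?m * (qfact ?\<delta> r * qfact ?\<delta> \<alpha> * qfact ?\<delta> \<beta> * qfact ?\<delta> (?m + r + 1))"
    unfolding tl_comp_scale_right Spin_scale Spin_top[OF zH] form_value_def m by (simp only: mult_ac)
  then have "(qi ^ ?m * q ^ ?m) * (W * form_value ?\<delta> ?a ?b r e * qfact ?\<delta> (?m + 1)) =
      (qi ^ ?m * q ^ ?m) * (qfact ?\<delta> r * qfact ?\<delta> \<alpha> * qfact ?\<delta> \<beta> * qfact ?\<delta> (?m + r + 1))"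
    by (simp only: mult.assoc)
  also have "qi ^ ?m * q ^ ?m = 1" using q by (metis mult.commute power_mult_distrib power_one)
  finally show ?thesis unfolding W_def by (simp only: mult_1_left mult_ac)
qed

section \<open>From the generic value of the form to its value at \<delta>\<close>

lemma form_value_hom:
  assumes h: "is_hom \<phi>" shows "\<phi> (form_value \<delta> a b r e) = form_value (\<phi> \<delta>) a b r (mmap \<phi> e)"
proof -
  have 0: "\<phi> 0 = 0" "\<phi> 1 = 1" using h by (auto simp: is_hom_def)
  have s: "mmap \<phi> (dg D) = dg D" for D by (simp add: mmap_single[of \<phi>, OF 0(1)] 0)
  show ?thesis
    unfolding form_value_def lookup_mmap[of \<phi>, OF 0(1), symmetric] mmap_comp[OF h] s ..
qed

lemma form_value_scale: "form_value \<delta> a b r (tl_scale c e) = c * form_value \<delta> a b r e"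
  by (simp add: form_value_def tl_comp_scale_left tl_comp_scale_right)

lemma tensor_scale: "tensor n m (tl_scale c x) (tl_scale d y) = tl_scale (c * d) (tensor n m x y)"
proof -
  have "Poly_Mapping.keys (tl_scale c x) \<subseteq> Poly_Mapping.keys x" "Poly_Mapping.keys (tl_scale d y) \<subseteq> Poly_Mapping.keys y"
    by (auto simp: in_keys_iff)
  then have "tensor n m (tl_scale c x) (tl_scale d y) =
      (\<Sum>D\<in>Poly_Mapping.keys x. \<Sum>E\<in>Poly_Mapping.keys y.
        Poly_Mapping.single (tensor_diag n m D E) (lk (tl_scale c x) D * lk (tl_scale d y) E))"
    by (intro tensor_superset) auto
  also have "\<dots> = tl_scale (c * d) (tensor n m x y)"
    unfolding tensor_def TL.scale_sum_right tl_scale_single by (simp add: mult_ac)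
  finally show ?thesis .
qed

abbreviation JW2 :: "nat \<Rightarrow> nat \<Rightarrow> int poly fract mor" where
  "JW2 a b \<equiv> tensor a a (JW a) (JW b)"

text \<open>The factorials are regrouped into binomial coefficients and the common nonzero
  factorials are cancelled. Unlike the factorials, the binomial coefficients remain informative at a
  root of unity.\<close>

lemma form_value_generic:
  "form_value generic_loop (\<alpha> + r) (\<beta> + r) r (JW2 (\<alpha> + r) (\<beta> + r)) *
      (qbin generic_loop r \<alpha> * qbin generic_loop r \<beta>) = qbin generic_loop r (\<alpha> + \<beta> + 1)"
proof -
  let ?a = "\<alpha> + r" and ?b = "\<beta> + r" and ?f = "qfact generic_loop"
  let ?c = "form_value generic_loop ?a ?b r (JW2 ?a ?b)"
  note h = is_hom_qbase
  have "two_block (qbase generic_loop) ?a ?b (mmap qbase (JW2 ?a ?b))"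
    unfolding mmap_tensor[OF h] by (intro two_block_tensor jw_mmap[OF h] JW_jw)
  then have "form_value (qbase generic_loop) ?a ?b r (mmap qbase (JW2 ?a ?b)) *
      (qfact (qbase generic_loop) ?a * qfact (qbase generic_loop) ?b * qfact (qbase generic_loop) (\<alpha> + \<beta> + 1)) =
      qfact (qbase generic_loop) r * qfact (qbase generic_loop) \<alpha> * qfact (qbase generic_loop) \<beta> *
      qfact (qbase generic_loop) (\<alpha> + \<beta> + r + 1)"
    by (rule form_value_q[OF qX_inverse, unfolded qX_loop])
  then have "qbase (?c * (?f ?a * ?f ?b * ?f (\<alpha> + \<beta> + 1))) = qbase (?f r * ?f \<alpha> * ?f \<beta> * ?f (\<alpha> + \<beta> + r + 1))"
    unfolding form_value_hom[OF h, symmetric] qfact_hom[OF h, symmetric] using h by (simp only: is_hom_def)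
  then have "?c * (?f ?a * ?f ?b * ?f (\<alpha> + \<beta> + 1)) = ?f r * ?f \<alpha> * ?f \<beta> * ?f (\<alpha> + \<beta> + r + 1)" by simp
  moreover have "?f ?a = qbin generic_loop r \<alpha> * (?f r * ?f \<alpha>)" "?f ?b = qbin generic_loop r \<beta> * (?f r * ?f \<beta>)"
    unfolding qbin_fact by (simp_all only: add.commute)
  moreover have "?f (\<alpha> + \<beta> + r + 1) = qbin generic_loop r (\<alpha> + \<beta> + 1) * (?f r * ?f (\<alpha> + \<beta> + 1))"
    unfolding qbin_fact by (simp only: add_ac)
  ultimately have "(?c * (qbin generic_loop r \<alpha> * qbin generic_loop r \<beta>)) * (?f r * ?f \<alpha> * (?f r * ?f \<beta>) * ?f (\<alpha> + \<beta> + 1)) =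
      qbin generic_loop r (\<alpha> + \<beta> + 1) * (?f r * ?f \<alpha> * (?f r * ?f \<beta>) * ?f (\<alpha> + \<beta> + 1))"
    by (simp only: mult_ac)
  then show ?thesis by (simp only: mult_cancel_right mult_eq_0_iff qfact_generic_nonzero simp_thms)
qed

text \<open>Multiplication by both common denominators turns the generic identity into one over
  Z[X]. It is evaluated at \<delta>, and the denominators, nonzero there, are cancelled
  again.\<close>

lemma form_value_eve:
  fixes \<delta> :: "'k::idom"
  assumes base: "JW_values_in_base \<delta> (\<alpha> + r)" "JW_values_in_base \<delta> (\<beta> + r)"
    and nz: "jw_denom \<delta> (\<alpha> + r) \<noteq> 0" "jw_denom \<delta> (\<beta> + r) \<noteq> 0"
  shows "form_value \<delta> (\<alpha> + r) (\<beta> + r) r (eve_idem2 \<delta> (\<alpha> + r) (\<beta> + r)) * (qbin \<delta> r \<alpha> * qbin \<delta> r \<beta>) =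
    qbin \<delta> r (\<alpha> + \<beta> + 1)"
proof -
  let ?a = "\<alpha> + r" and ?b = "\<beta> + r"
  let ?P = "tensor ?a ?a (JW_numer ?a) (JW_numer ?b)" and ?n = "jw_denom poly_loop ?a * jw_denom poly_loop ?b"
  let ?z = "form_value poly_loop ?a ?b r ?P"
  note hf = is_hom_to_fract[where 'a = "int poly"] and he = is_hom_eval_at[of \<delta>]
  have "to_fract ?z = to_fract ?n * form_value generic_loop ?a ?b r (JW2 ?a ?b)"
    unfolding form_value_hom[OF hf] mmap_tensor[OF hf] mmap_JW_numer tensor_scale form_value_scale
      generic_loop_hom[symmetric] jw_denom_generic by simp
  then have "to_fract (?z * (qbin poly_loop r \<alpha> * qbin poly_loop r \<beta>)) = to_fract (?n * qbin poly_loop r (\<alpha> + \<beta> + 1))"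
    unfolding to_fract_mult qbin_hom[OF hf] generic_loop_hom[symmetric] form_value_generic[symmetric]
    by (simp only: mult.assoc)
  then have "eval_at \<delta> (?z * (qbin poly_loop r \<alpha> * qbin poly_loop r \<beta>)) = eval_at \<delta> (?n * qbin poly_loop r (\<alpha> + \<beta> + 1))"
    by (simp only: to_fract_eq_iff)
  then have "eval_at \<delta> ?z * (qbin \<delta> r \<alpha> * qbin \<delta> r \<beta>) =
      jw_denom \<delta> ?a * jw_denom \<delta> ?b * qbin \<delta> r (\<alpha> + \<beta> + 1)"
    using he by (simp only: is_hom_def qbin_hom[OF he] jw_denom_hom[OF he] eval_at_simps)
  moreover have "eval_at \<delta> ?z = jw_denom \<delta> ?a * jw_denom \<delta> ?b * form_value \<delta> ?a ?b r (eve_idem2 \<delta> ?a ?b)"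
    unfolding form_value_hom[OF he] mmap_tensor[OF he] eve_idem_scaled[OF base(1) nz(1), symmetric]
      eve_idem_scaled[OF base(2) nz(2), symmetric] tensor_scale form_value_scale eval_at_simps eve_idem2_def ..
  ultimately have "(jw_denom \<delta> ?a * jw_denom \<delta> ?b) * (form_value \<delta> ?a ?b r (eve_idem2 \<delta> ?a ?b) * (qbin \<delta> r \<alpha> * qbin \<delta> r \<beta>)) =
      (jw_denom \<delta> ?a * jw_denom \<delta> ?b) * qbin \<delta> r (\<alpha> + \<beta> + 1)"
    by (simp only: mult.assoc)
  then show ?thesis using nz by (simp only: mult_cancel_left mult_eq_0_iff simp_thms)
qed

text \<open>The binomial coefficients of a over r and of b over r are factors of the two common
  denominators, hence nonzero at \<delta>.\<close>

lemma form_value_nonzero_iff: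
  fixes \<delta> :: "'k::idom"
  assumes base: "JW_values_in_base \<delta> a" "JW_values_in_base \<delta> b"
    and nz: "jw_denom \<delta> a \<noteq> 0" "jw_denom \<delta> b \<noteq> 0" and r: "r \<le> a" "r \<le> b"
  shows "form_value \<delta> a b r (eve_idem2 \<delta> a b) \<noteq> 0 \<longleftrightarrow> qbin \<delta> r (a + b - 2 * r + 1) \<noteq> 0"
proof -
  obtain \<alpha> \<beta> where ab: "a = \<alpha> + r" "b = \<beta> + r" using r by (metis add.commute le_Suc_ex)
  have "qbin \<delta> r (c - r) \<noteq> 0" if "jw_denom \<delta> c \<noteq> 0" "r \<le> c" for c
    using that by (simp add: jw_denom_def)
  from this[OF nz(1) r(1)] this[OF nz(2) r(2)]
  have "qbin \<delta> r \<alpha> * qbin \<delta> r \<beta> \<noteq> 0" unfolding ab by simp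
  moreover have "a + b - 2 * r + 1 = \<alpha> + \<beta> + 1" unfolding ab by simp
  ultimately show ?thesis
    using form_value_eve[OF base[unfolded ab] nz[unfolded ab]] unfolding ab
    by (metis mult_eq_0_iff)
qed

subsection \<open>Cell modules and the algebra of a two-part composition\<close>

text \<open>Coefficients at the diagrams \<open>Ds\<close> serve as dual functionals, which gives
  independence over any commutative ring.\<close>

lemma has_rank_dualI:
  fixes S :: "'k::comm_ring_1 mor set"
  assumes S: "S = range (\<lambda>c. \<Sum>i<r. tl_scale (c i) (vs i))"
    and dual: "\<And>i j. i < r \<Longrightarrow> j < r \<Longrightarrow> lk (vs i) (Ds j) = (if i = j then 1 else 0)"
  shows "has_rank S r"
proof -
  let ?B = "vs ` {..<r}"
  have inj: "inj_on vs {..<r}" by (rule inj_onI) (metis dual lessThan_iff zero_neq_one)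
  have sum_B: "(\<Sum>v\<in>?B. tl_scale (u v) v) = (\<Sum>i<r. tl_scale (u (vs i)) (vs i))" for u :: "'k mor \<Rightarrow> 'k"
    using sum.reindex[OF inj] by simp
  have "u (vs j) = 0" if u: "(\<Sum>i<r. tl_scale (u (vs i)) (vs i)) = 0" and j: "j < r" for u j
  proof -
    have "lk (\<Sum>i<r. tl_scale (u (vs i)) (vs i)) (Ds j) = (\<Sum>i<r. if i = j then u (vs i) else 0)"
      unfolding lookup_sum by (rule sum.cong) (simp_all add: dual j)
    then show ?thesis using u j by simp
  qed
  then have "TL.independent ?B" by (auto simp: TL.dependent_finite sum_B)
  moreover have "TL.span ?B = S"
  proof -
    have "\<exists>u. (\<Sum>i<r. tl_scale (c i) (vs i)) = (\<Sum>i<r. tl_scale (u (vs i)) (vs i))" for c :: "nat \<Rightarrow> 'k"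
      by (rule exI[of _ "\<lambda>v. c (the_inv_into {..<r} vs v)"]) (simp add: the_inv_into_f_f[OF inj])
    then show ?thesis unfolding S TL.span_finite[OF finite_imageI[OF finite_lessThan]] sum_B by auto
  qed
  ultimately show ?thesis unfolding has_rank_def using card_image[OF inj] by (intro exI[of _ ?B]) simp
qed

section \<open>Truncation and the bilinear form\<close>

lemma lookup_comp_nonzero:
  assumes "lk (tl_comp \<delta> x y) Y \<noteq> 0"
  obtains D E where "lk x D \<noteq> 0" "lk y E \<noteq> 0" "cat_diag D E = Y"
proof -
  obtain D E where "D \<in> Poly_Mapping.keys x" "E \<in> Poly_Mapping.keys y" "cat_diag D E = Y"
    using assms unfolding tl_comp_def lookup_sum
    by (metis (no_types, lifting) lookup_single_not_eq sum.neutral)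
  then show ?thesis by (intro that) (simp_all add: in_keys_iff)
qed

lemma lookup_trunc: "lk (trunc m x) D = (if m \<le> through D then lk x D else 0)"
proof -
  let ?S = "{D \<in> Poly_Mapping.keys x. m \<le> through D}"
  have "lk (trunc m x) D = (\<Sum>E\<in>?S. if E = D then lk x D else 0)"
    unfolding trunc_def lookup_sum by (rule sum.cong) (auto simp: lookup_single when_def)
  then show ?thesis by (auto simp: in_keys_iff)
qed

lemma trunc_scale: "trunc m (tl_scale c x) = tl_scale c (trunc m x)"
  by (rule poly_mapping_eqI) (simp add: lookup_trunc)

lemma trunc_in: "x \<in> Hom n m \<Longrightarrow> trunc m' x \<in> Hom n m"
  unfolding Hom_iff lookup_trunc by metis

text \<open>A truncated term has through degree below m, so it has a strand between two targets.
  This strand persists in the product, whereas the identity has none.\<close>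

lemma lookup_comp_trunc_right:
  assumes x: "x \<in> Hom m n" and y: "y \<in> Hom n m"
  shows "lk (tl_comp \<delta> x (trunc m y)) (id_diag m) = lk (tl_comp \<delta> x y) (id_diag m)"
proof -
  have "lk (tl_comp \<delta> x (trunc m y - y)) (id_diag m) = 0"
  proof (rule ccontr)
    assume "lk (tl_comp \<delta> x (trunc m y - y)) (id_diag m) \<noteq> 0"
    then obtain D E where DE: "lk x D \<noteq> 0" "lk (trunc m y - y) E \<noteq> 0" "cat_diag D E = id_diag m"
      by (rule lookup_comp_nonzero)
    then have E: "\<not> m \<le> through E" "lk y E \<noteq> 0" by (auto simp: lookup_minus lookup_trunc split: if_splits)
    have D': "D \<in> diagrams m n" "E \<in> diagrams n m" using x y DE(1) E(2) unfolding Hom_iff by auto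
    then obtain k l where "{(1, k), (1, l)} \<in> E" using through_eq_iff(2)[OF D'(2)] E(1) by auto
    then have "{(1, k), (1, l)} \<in> id_diag m" using cat_target_block[OF D'] DE(3) by auto
    then show False using id_diag_no_cap by blast
  qed
  then show ?thesis by (simp add: tl_comp_diff_right lookup_minus)
qed

lemma lookup_comp_refl_id:
  assumes x: "x \<in> Hom n m" and y: "y \<in> Hom n m"
  shows "lk (tl_comp \<delta> (refl_mor x) y) (id_diag m) = lk (tl_comp \<delta> (refl_mor y) x) (id_diag m)"
proof -
  have z: "tl_comp \<delta> (refl_mor x) y \<in> Hom m m" by (rule tl_comp_in[OF refl_mor_in[OF x] y])
  have "lk (refl_mor w) (id_diag m) = lk w (id_diag m)" if w: "w \<in> Hom m m" for w :: "'a mor"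
    using w
  proof (induction w rule: Hom_induct)
    case (single D c)
    then have "refl_diag D = id_diag m \<longleftrightarrow> D = id_diag m" by (metis refl_id refl_refl)
    then show ?case by (simp add: lookup_single when_def)
  qed (simp_all add: refl_mor_add lookup_add)
  from this[OF z] show ?thesis by (simp add: refl_mor_comp[OF refl_mor_in[OF x] y] refl_mor_refl[OF x])
qed

lemma cell_form_trunc:
  assumes x: "x \<in> Hom n m" and y: "y \<in> Hom n m"
  shows "cell_form \<delta> m (trunc m x) (trunc m y) = cell_form \<delta> m x y"
  unfolding cell_form_def
  using lookup_comp_trunc_right[OF refl_mor_in[OF trunc_in[OF x]] y]
    lookup_comp_refl_id[OF trunc_in[OF x] y] lookup_comp_trunc_right[OF refl_mor_in[OF y] x]
    lookup_comp_refl_id[OF y x]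
  by simp

abbreviation nested_loop :: "nat \<Rightarrow> nat \<Rightarrow> nat \<Rightarrow> diagram" where
  "nested_loop a b r \<equiv> cat_diag (nested a b r) (refl_diag (nested a b r))"

lemma nested_loop_in: "r \<le> a \<Longrightarrow> r \<le> b \<Longrightarrow> nested_loop a b r \<in> diagrams (a + b) (a + b)"
  by (rule cat_diagrams[OF nested_in refl_diag_in[OF nested_in]])

lemma refl_nested_no_cap: "r \<le> a \<Longrightarrow> r \<le> b \<Longrightarrow> {(0, i), (0, j)} \<notin> refl_diag (nested a b r)"
  using flip_block_iff(2)[OF nested_in] nested_no_cup by blast

lemma nested_loop_mid:
  assumes "r \<le> a" "r \<le> b"
  shows "{(0, k), (0, k + 1)} \<in> nested_loop a b r \<Longrightarrow> k + 1 = a"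
    and "{(1, k), (1, k + 1)} \<in> nested_loop a b r \<Longrightarrow> k + 1 = a"
proof -
  note N = nested_in[OF assms] and L = nested_loop_in[OF assms]
  show *: "k + 1 = a" if "{(0, k), (0, k + 1)} \<in> nested_loop a b r"
    using nested_cat_mid[OF assms refl_diag_in[OF N] refl_nested_no_cap[OF assms] that] .
  have "refl_diag (nested_loop a b r) = nested_loop a b r"
    by (simp add: refl_cat(1)[OF N refl_diag_in[OF N]] refl_refl[OF N])
  then show "k + 1 = a" if "{(1, k), (1, k + 1)} \<in> nested_loop a b r"
    using * flip_block_iff(1)[OF L] that by simp
qed

lemma nested_loop_inj:
  assumes "r \<le> a" "r \<le> b" "s \<le> a" "s \<le> b" "nested_loop a b r = nested_loop a b s"
  shows "r = s"
  by (rule nested_cat_inj[OF assms(1-4) refl_diag_in[OF nested_in] refl_diag_in[OF nested_in]])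
    (use assms refl_nested_no_cap in auto)

context
  fixes \<delta> :: "'k::idom" and a b :: nat
  assumes tb: "two_block \<delta> a b (eve_idem2 \<delta> a b)"
begin

abbreviation "idem2 \<equiv> eve_idem2 \<delta> a b"

text \<open>Apart from the identity, all terms of the idempotent have a cap off the middle, which
  persists in the product. Coefficients at diagrams with middle caps only are thus unchanged and act
  as dual functionals.\<close>

lemma lookup_tb_comp_left:
  assumes x: "x \<in> Hom (a + b) m" and Y: "\<And>k. {(0, k), (0, k + 1)} \<in> Y \<Longrightarrow> k + 1 = a"
  shows "lk (tl_comp \<delta> idem2 x) Y = lk x Y"
proof -
  have "lk (tl_comp \<delta> (idem2 - dg (id_diag (a + b))) x) Y = 0"
  proof (rule ccontr)
    assume "lk (tl_comp \<delta> (idem2 - dg (id_diag (a + b))) x) Y \<noteq> 0"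
    then obtain D E where DE: "lk (idem2 - dg (id_diag (a + b))) D \<noteq> 0" "lk x E \<noteq> 0" "cat_diag D E = Y"
      by (rule lookup_comp_nonzero)
    have "D \<noteq> id_diag (a + b)" using DE(1) tb_coeff[OF tb] by (auto simp: lookup_minus)
    then have D: "D \<noteq> id_diag (a + b)" "lk idem2 D \<noteq> 0" using DE(1) by (auto simp: lookup_minus lookup_single when_def)
    obtain k where k: "k + 1 \<noteq> a" "{(0, k), (0, k + 1)} \<in> D" using tb_caps[OF tb D(2,1)] .
    have "D \<in> diagrams (a + b) (a + b)" "E \<in> diagrams (a + b) m" using tb_in[OF tb] x D DE unfolding Hom_iff by auto
    then have "{(0, k), (0, k + 1)} \<in> Y" using cat_source_block k DE(3) by blast
    then show False using Y k by blast
  qed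
  then show ?thesis by (simp add: tl_comp_diff_left tl_comp_id_left[OF x] lookup_minus)
qed

lemma lookup_tb_comp_right:
  assumes x: "x \<in> Hom m (a + b)" and Y: "\<And>k. {(1, k), (1, k + 1)} \<in> Y \<Longrightarrow> k + 1 = a"
  shows "lk (tl_comp \<delta> x idem2) Y = lk x Y"
proof -
  have "lk (tl_comp \<delta> x (idem2 - dg (id_diag (a + b)))) Y = 0"
  proof (rule ccontr)
    assume "lk (tl_comp \<delta> x (idem2 - dg (id_diag (a + b)))) Y \<noteq> 0"
    then obtain D E where DE: "lk x D \<noteq> 0" "lk (idem2 - dg (id_diag (a + b))) E \<noteq> 0" "cat_diag D E = Y"
      by (rule lookup_comp_nonzero)
    have "E \<noteq> id_diag (a + b)" using DE(2) tb_coeff[OF tb] by (auto simp: lookup_minus)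
    then have E: "E \<noteq> id_diag (a + b)" "lk idem2 E \<noteq> 0" using DE(2) by (auto simp: lookup_minus lookup_single when_def)
    obtain k where k: "k + 1 \<noteq> a" "{(1, k), (1, k + 1)} \<in> E" using tb_caps[OF tb E(2,1)] .
    have "D \<in> diagrams m (a + b)" "E \<in> diagrams (a + b) (a + b)" using tb_in[OF tb] x E DE unfolding Hom_iff by auto
    then have "{(1, k), (1, k + 1)} \<in> Y" using cat_target_block k DE(3) by blast
    then show False using Y k by blast
  qed
  then show ?thesis by (simp add: tl_comp_diff_right tl_comp_id_right[OF x] lookup_minus)
qed

text \<open>Diagrams all of whose simple caps and cups sit in the middle are the
  \<open>nested_loop a b r\<close> with 0 \<le> r \<le> min a b; every other diagram is killed on
  one side. The value r = 0 accounts for the summand 1 in the rank.\<close>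

lemma TL_mu_rank: "has_rank (TL_mu \<delta> a b) (min a b + 1)"
proof (rule has_rank_dualI)
  let ?f = "\<lambda>D. tl_comp \<delta> (tl_comp \<delta> idem2 (dg D)) idem2" and ?n = "a + b" and ?N = "min a b + 1"
  let ?M = "nested_loop a b" and ?T = "\<lambda>x. tl_comp \<delta> (tl_comp \<delta> idem2 x) idem2"
  note eH = tb_in[OF tb]
  have MH: "?M i \<in> diagrams ?n ?n" if "i < ?N" for i using that by (intro nested_loop_in) simp_all
  have inj: "inj_on ?M {..<?N}" by (rule inj_onI, rule nested_loop_inj[of _ a b]) simp_all
  have T_sum: "?T (\<Sum>i\<in>I. tl_scale (c i) (g i)) = (\<Sum>i\<in>I. tl_scale (c i) (?T (g i)))" for c g and I :: "'i set"
    by (simp add: tl_comp_sum_right tl_comp_sum_left tl_comp_scale_right tl_comp_scale_left)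
  show "lk (?f (?M i)) (?M j) = (if i = j then 1 else 0)" if ij: "i < ?N" "j < ?N" for i j
  proof -
    have "j \<le> a" "j \<le> b" using ij by auto
    note mid = nested_loop_mid[OF this]
    have M: "dg (?M i) \<in> Hom ?n ?n" by (rule Hom_single[OF MH[OF ij(1)]])
    have "lk (?f (?M i)) (?M j) = lk (dg (?M i)) (?M j)"
      by (simp only: lookup_tb_comp_right[OF tl_comp_in[OF eH M] mid(2)] lookup_tb_comp_left[OF M mid(1)])
    moreover have "?M i = ?M j \<longleftrightarrow> i = j" using inj_on_eq_iff[OF inj] ij by simp
    ultimately show ?thesis by (simp add: lookup_single when_def)
  qed
  have kill: "?f D = 0" if D: "D \<in> diagrams ?n ?n" "D \<notin> ?M ` {..<?N}" for D
  proof -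
    have "\<not> ((\<forall>k. {(0, k), (0, k + 1)} \<in> D \<longrightarrow> k + 1 = a) \<and> (\<forall>k. {(1, k), (1, k + 1)} \<in> D \<longrightarrow> k + 1 = a))"
    proof
      assume "(\<forall>k. {(0, k), (0, k + 1)} \<in> D \<longrightarrow> k + 1 = a) \<and> (\<forall>k. {(1, k), (1, k + 1)} \<in> D \<longrightarrow> k + 1 = a)"
      then obtain r where "r \<le> a" "r \<le> b" "D = ?M r" using middle_caps_both[OF D(1)] by blast
      then show False using D(2) by simp
    qed
    then obtain k where "k + 1 \<noteq> a" "{(0, k), (0, k + 1)} \<in> D \<or> {(1, k), (1, k + 1)} \<in> D" by blast
    then show ?thesis
    proof (elim disjE)
      assume "k + 1 \<noteq> a" "{(0, k), (0, k + 1)} \<in> D"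
      then show ?thesis using tb_kill_left[OF tb D(1)] by simp
    next
      assume "k + 1 \<noteq> a" "{(1, k), (1, k + 1)} \<in> D"
      then show ?thesis unfolding tl_comp_assoc[OF eH Hom_single[OF D(1)] eH] using tb_kill_right[OF tb D(1)] by simp
    qed
  qed
  show "TL_mu \<delta> a b = range (\<lambda>c. \<Sum>i<?N. tl_scale (c i) (?f (?M i)))"
  proof (intro equalityI subsetI)
    fix y assume "y \<in> TL_mu \<delta> a b"
    then obtain x where x: "x \<in> Hom ?n ?n" "y = ?T x" unfolding TL_mu_def by blast
    have "y = ?T (\<Sum>D\<in>diagrams ?n ?n. tl_scale (lk x D) (dg D))"
      unfolding x(2) using Hom_expand[OF x(1)] by simp
    also have "\<dots> = (\<Sum>D\<in>diagrams ?n ?n. tl_scale (lk x D) (?f D))" by (rule T_sum)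
    also have "\<dots> = (\<Sum>D\<in>?M ` {..<?N}. tl_scale (lk x D) (?f D))"
      by (rule sum.mono_neutral_right) (use MH kill in auto)
    also have "\<dots> = (\<Sum>i<?N. tl_scale (lk x (?M i)) (?f (?M i)))" using sum.reindex[OF inj] by simp
    finally show "y \<in> range (\<lambda>c. \<Sum>i<?N. tl_scale (c i) (?f (?M i)))"
      by (rule range_eqI[of _ _ "\<lambda>i. lk x (?M i)"])
  next
    fix y assume "y \<in> range (\<lambda>c. \<Sum>i<?N. tl_scale (c i) (?f (?M i)))"
    then obtain c where "y = (\<Sum>i<?N. tl_scale (c i) (?f (?M i)))" by blast
    then have "y = ?T (\<Sum>i<?N. tl_scale (c i) (dg (?M i)))" unfolding T_sum .
    moreover have "(\<Sum>i<?N. tl_scale (c i) (dg (?M i))) \<in> Hom ?n ?n"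
      by (intro Hom_sum Hom_scale Hom_single MH) simp
    ultimately show "y \<in> TL_mu \<delta> a b" unfolding TL_mu_def by blast
  qed
qed

lemma tb_kill_monic:
  assumes D: "D \<in> monic (a + b) m" and r: "\<And>r. r \<le> a \<Longrightarrow> r \<le> b \<Longrightarrow> m = a + b - 2 * r \<Longrightarrow> D \<noteq> nested a b r"
  shows "tl_comp \<delta> idem2 (Poly_Mapping.single D c) = 0"
proof -
  have D': "D \<in> diagrams (a + b) m" "through D = m" using D by (auto simp: monic_def)
  have nc: "{(1, k), (1, l)} \<notin> D" for k l using D' through_eq_iff(2) by blast
  have "\<exists>k. {(0, k), (0, k + 1)} \<in> D \<and> k + 1 \<noteq> a"
  proof (rule ccontr)
    assume "\<nexists>k. {(0, k), (0, k + 1)} \<in> D \<and> k + 1 \<noteq> a"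
    then obtain r where "r \<le> a" "r \<le> b" "m = a + b - 2 * r" "D = nested a b r"
      using middle_caps_monic[OF D'(1) _ nc] by blast
    then show False using r by blast
  qed
  then show ?thesis using tb_kill_left[OF tb D'(1)] by blast
qed

lemma cell_mu_trivial:
  assumes "\<And>r. r \<le> a \<Longrightarrow> r \<le> b \<Longrightarrow> m \<noteq> a + b - 2 * r"
  shows "cell_mu \<delta> a b m = {0}"
proof -
  have t0: "trunc m 0 = 0" by (rule poly_mapping_eqI) (simp add: lookup_trunc)
  have "tl_comp \<delta> idem2 x = 0" if x: "x \<in> cell (a + b) m" for x
  proof -
    have "tl_comp \<delta> idem2 x = (\<Sum>D\<in>Poly_Mapping.keys x. tl_comp \<delta> idem2 (Poly_Mapping.single D (lk x D)))"
      using mor_expand[of "Poly_Mapping.keys x" x] tl_comp_sum_right[of \<delta> idem2] by (metis finite_keys order_refl)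
    also have "\<dots> = 0"
    proof (rule sum.neutral, rule ballI)
      fix D assume "D \<in> Poly_Mapping.keys x"
      then have "D \<in> monic (a + b) m" using x by (auto simp: cell_def)
      then show "tl_comp \<delta> idem2 (Poly_Mapping.single D (lk x D)) = 0" by (rule tb_kill_monic) (use assms in blast)
    qed
    finally show ?thesis .
  qed
  then have "cell_act \<delta> m idem2 x = 0" if "x \<in> cell (a + b) m" for x using that by (simp add: cell_act_def t0)
  moreover have "0 \<in> cell (a + b) m" by (simp add: cell_def)
  ultimately show ?thesis unfolding cell_mu_def by auto
qed

definition cell_vec :: "nat \<Rightarrow> 'k mor" where
  "cell_vec r = trunc (a + b - 2 * r) (tl_comp \<delta> idem2 (dg (nested a b r)))"

context
  fixes r :: nat assumes r: "r \<le> a" "r \<le> b"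
begin

lemma nested_monic: "nested a b r \<in> monic (a + b) (a + b - 2 * r)"
  using nested_in[OF r] nested_through[OF r] by (simp add: monic_def)

lemma cell_mu_vec: "cell_mu \<delta> a b (a + b - 2 * r) = range (\<lambda>c. tl_scale c (cell_vec r))"
proof -
  let ?m = "a + b - 2 * r" and ?N = "nested a b r"
  have single: "Poly_Mapping.single ?N c = tl_scale c (dg ?N)" for c :: 'k by simp
  have act: "cell_act \<delta> ?m idem2 (tl_scale c (dg ?N)) = tl_scale c (cell_vec r)" for c
    by (simp only: cell_act_def cell_vec_def tl_comp_scale_right trunc_scale)
  have "cell_act \<delta> ?m idem2 x = tl_scale (lk x ?N) (cell_vec r)" if x: "x \<in> cell (a + b) ?m" for x
  proof -
    have fin: "finite (insert ?N (Poly_Mapping.keys x))" by simp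
    have "tl_comp \<delta> idem2 x = (\<Sum>D\<in>insert ?N (Poly_Mapping.keys x). tl_comp \<delta> idem2 (Poly_Mapping.single D (lk x D)))"
      using mor_expand[OF fin subset_insertI] tl_comp_sum_right[of \<delta> idem2] by metis
    also have "\<dots> = (\<Sum>D\<in>{?N}. tl_comp \<delta> idem2 (Poly_Mapping.single D (lk x D)))"
    proof (rule sum.mono_neutral_right[OF fin])
      show "\<forall>D\<in>insert ?N (Poly_Mapping.keys x) - {?N}. tl_comp \<delta> idem2 (Poly_Mapping.single D (lk x D)) = 0"
      proof
        fix D assume D: "D \<in> insert ?N (Poly_Mapping.keys x) - {?N}"
        then have "D \<in> monic (a + b) ?m" using x by (auto simp: cell_def)
        then show "tl_comp \<delta> idem2 (Poly_Mapping.single D (lk x D)) = 0"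
        proof (rule tb_kill_monic)
          fix s assume "s \<le> a" "s \<le> b" "?m = a + b - 2 * s"
          then have "s = r" using r by linarith
          then show "D \<noteq> nested a b s" using D by simp
        qed
      qed
    qed simp
    finally have "tl_comp \<delta> idem2 x = tl_comp \<delta> idem2 (tl_scale (lk x ?N) (dg ?N))" by simp
    then show ?thesis unfolding act[symmetric] by (simp only: cell_act_def)
  qed
  moreover have "tl_scale c (cell_vec r) \<in> cell_mu \<delta> a b ?m" for c
  proof -
    have "tl_scale c (dg ?N) \<in> cell (a + b) ?m"
      unfolding single[symmetric] using nested_monic by (simp add: cell_def)
    then show ?thesis unfolding cell_mu_def act[symmetric] by blast
  qed
  ultimately show ?thesis unfolding cell_mu_def by auto
qed

lemma cell_vec_coeff: "lk (cell_vec r) (nested a b r) = 1"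
  unfolding cell_vec_def lookup_trunc nested_through[OF r]
  using lookup_tb_comp_left[OF Hom_single[OF nested_in[OF r]], of "nested a b r"] nested_mid[OF r] by simp

lemma cell_mu_rank: "has_rank (cell_mu \<delta> a b (a + b - 2 * r)) 1"
proof (rule has_rank_dualI)
  have 1: "(\<Sum>i<(1 :: nat). tl_scale (c i) (cell_vec r)) = tl_scale (c 0) (cell_vec r)" for c :: "nat \<Rightarrow> 'k" by simp
  have "tl_scale d (cell_vec r) \<in> range (\<lambda>c. tl_scale (c (0 :: nat)) (cell_vec r))" for d
    by (rule range_eqI[of _ _ "\<lambda>_ :: nat. d"]) simp
  then show "cell_mu \<delta> a b (a + b - 2 * r) = range (\<lambda>c. \<Sum>i<(1 :: nat). tl_scale (c i) (cell_vec r))"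
    unfolding cell_mu_vec 1 by blast
qed (use cell_vec_coeff in auto)

lemma cell_mu_nonzero: "cell_mu \<delta> a b (a + b - 2 * r) \<noteq> {0}"
proof
  assume "cell_mu \<delta> a b (a + b - 2 * r) = {0}"
  moreover have "tl_scale 1 (cell_vec r) \<in> cell_mu \<delta> a b (a + b - 2 * r)" unfolding cell_mu_vec by blast
  ultimately have "cell_vec r = 0" by simp
  then show False using cell_vec_coeff by simp
qed

text \<open>Reflection moves the left copy of the idempotent next to the right one, and
  \<open>tb_refl_absorb\<close> merges the two.\<close>

lemma cell_form_vec: "cell_form \<delta> (a + b - 2 * r) (cell_vec r) (cell_vec r) = form_value \<delta> a b r idem2"
proof -
  let ?m = "a + b - 2 * r" and ?N = "nested a b r"
  note eH = tb_in[OF tb] and NH = Hom_single[OF nested_in[OF r], where c = "1 :: 'k"]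
  note NH' = Hom_single[OF refl_diag_in[OF nested_in[OF r]], where c = "1 :: 'k"]
  note vH = tl_comp_in[OF eH NH]
  have "refl_mor (tl_comp \<delta> idem2 (dg ?N)) = tl_comp \<delta> (dg (refl_diag ?N)) (refl_mor idem2)"
    unfolding refl_mor_comp[OF eH NH] by simp
  then have "tl_comp \<delta> (refl_mor (tl_comp \<delta> idem2 (dg ?N))) (tl_comp \<delta> idem2 (dg ?N)) =
      tl_comp \<delta> (dg (refl_diag ?N)) (tl_comp \<delta> (refl_mor idem2) (tl_comp \<delta> idem2 (dg ?N)))"
    using tl_comp_assoc[OF NH' refl_mor_in[OF eH] vH] by simp
  also have "tl_comp \<delta> (refl_mor idem2) (tl_comp \<delta> idem2 (dg ?N)) = tl_comp \<delta> idem2 (dg ?N)"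
    unfolding tl_comp_assoc[OF refl_mor_in[OF eH] eH NH, symmetric] tb_refl_absorb[OF tb] ..
  finally show ?thesis unfolding cell_vec_def cell_form_trunc[OF vH vH]
    unfolding cell_form_def form_value_def by simp
qed

lemma Lambda_mu_0_iff: "a + b - 2 * r \<in> Lambda_mu_0 \<delta> a b \<longleftrightarrow> form_value \<delta> a b r idem2 \<noteq> 0"
proof -
  have "cell_form \<delta> m (tl_scale c x) (tl_scale d y) = c * d * cell_form \<delta> m x y" for m c d and x y :: "'k mor"
    by (simp add: cell_form_def refl_mor_scale tl_comp_scale_left tl_comp_scale_right)
  then have "a + b - 2 * r \<in> Lambda_mu_0 \<delta> a b \<longleftrightarrow> (\<exists>c d. c * d * form_value \<delta> a b r idem2 \<noteq> 0)"
    unfolding Lambda_mu_0_def mem_Collect_eq cell_mu_vec by (simp add: cell_form_vec)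
  then show ?thesis by (metis mult_1 mult_zero_right)
qed

end

lemma Lambda_mu_0_le:
  assumes "m \<in> Lambda_mu_0 \<delta> a b" obtains r where "r \<le> a" "r \<le> b" "m = a + b - 2 * r"
proof -
  have "cell_mu \<delta> a b m \<noteq> {0}"
  proof
    assume "cell_mu \<delta> a b m = {0}"
    then show False using assms by (simp add: Lambda_mu_0_def cell_form_def)
  qed
  then show ?thesis using cell_mu_trivial that by blast
qed

end

lemma E_set_iff:
  assumes "b \<le> a" shows "m \<in> E_set a b \<longleftrightarrow> (\<exists>r\<le>b. m = a + b - 2 * r)"
proof
  assume "m \<in> E_set a b"
  then obtain j where "m = nat \<bar>int a - int b\<bar> + 2 * j" "m \<le> a + b" by (auto simp: E_set_def)
  then have "m = a + b - 2 * (b - j)" "b - j \<le> b" using assms by auto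
  then show "\<exists>r\<le>b. m = a + b - 2 * r" by blast
next
  assume "\<exists>r\<le>b. m = a + b - 2 * r"
  then obtain r where "r \<le> b" "m = a + b - 2 * r" by blast
  then have "m = nat \<bar>int a - int b\<bar> + 2 * (b - r)" "m \<le> a + b" using assms by auto
  then show "m \<in> E_set a b" unfolding E_set_def by blast
qed

lemma Lambda_mu_results:
  fixes \<delta> :: "'k::idom"
  assumes base: "JW_values_in_base \<delta> a" "JW_values_in_base \<delta> b"
    and nz: "jw_denom \<delta> a \<noteq> 0" "jw_denom \<delta> b \<noteq> 0" and ab: "b \<le> a"
  shows "has_rank (TL_mu \<delta> a b) (min a b + 1)" and "Lambda_mu \<delta> a b = E_set a b"
    and "m \<in> E_set a b \<Longrightarrow> has_rank (cell_mu \<delta> a b m) 1"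
    and "Lambda_mu_0 \<delta> a b = {a + b - 2 * r | r. r \<le> b \<and> qbin \<delta> r (a + b - 2 * r + 1) \<noteq> 0}"
proof -
  have tb: "two_block \<delta> a b (eve_idem2 \<delta> a b)"
    unfolding eve_idem2_def by (intro two_block_tensor jw_eve_idem base nz)
  show "has_rank (TL_mu \<delta> a b) (min a b + 1)" by (rule TL_mu_rank[OF tb])
  show "Lambda_mu \<delta> a b = E_set a b"
  proof (intro equalityI subsetI)
    fix m assume "m \<in> Lambda_mu \<delta> a b"
    then have "cell_mu \<delta> a b m \<noteq> {0}" by (simp add: Lambda_mu_def)
    then show "m \<in> E_set a b" unfolding E_set_iff[OF ab] using cell_mu_trivial[OF tb] by blast
  next
    fix m assume "m \<in> E_set a b"
    then obtain r where "r \<le> b" "m = a + b - 2 * r" unfolding E_set_iff[OF ab] by blast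
    then show "m \<in> Lambda_mu \<delta> a b" using cell_mu_nonzero[OF tb, of r] ab by (simp add: Lambda_mu_def)
  qed
  show "has_rank (cell_mu \<delta> a b m) 1" if "m \<in> E_set a b"
    using that cell_mu_rank[OF tb] ab unfolding E_set_iff[OF ab] by auto
  show "Lambda_mu_0 \<delta> a b = {a + b - 2 * r | r. r \<le> b \<and> qbin \<delta> r (a + b - 2 * r + 1) \<noteq> 0}"
  proof (intro equalityI subsetI)
    fix m assume m: "m \<in> Lambda_mu_0 \<delta> a b"
    then obtain r where r: "r \<le> a" "r \<le> b" "m = a + b - 2 * r" by (rule Lambda_mu_0_le[OF tb])
    then have "qbin \<delta> r (a + b - 2 * r + 1) \<noteq> 0"
      using m Lambda_mu_0_iff[OF tb r(1,2)] form_value_nonzero_iff[OF base nz r(1,2)] by simp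
    then show "m \<in> {a + b - 2 * r | r. r \<le> b \<and> qbin \<delta> r (a + b - 2 * r + 1) \<noteq> 0}" using r by blast
  next
    fix m assume "m \<in> {a + b - 2 * r | r. r \<le> b \<and> qbin \<delta> r (a + b - 2 * r + 1) \<noteq> 0}"
    then obtain r where r: "r \<le> a" "r \<le> b" "m = a + b - 2 * r" "qbin \<delta> r (a + b - 2 * r + 1) \<noteq> 0" using ab by auto
    then show "m \<in> Lambda_mu_0 \<delta> a b"
      using Lambda_mu_0_iff[OF tb r(1,2)] form_value_nonzero_iff[OF base nz r(1,2)] by simp
  qed
qed

subsection \<open>Mixed radix digits\<close>

text \<open>Remainder and quotient by a base that may be infinite: then the digit takes all of N and
  nothing is passed on.\<close>

definition emod :: "nat \<Rightarrow> enat \<Rightarrow> nat" where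
  "emod N b = (case b of enat b \<Rightarrow> N mod b | \<infinity> \<Rightarrow> N)"

definition ediv :: "nat \<Rightarrow> enat \<Rightarrow> nat" where
  "ediv N b = (case b of enat b \<Rightarrow> N div b | \<infinity> \<Rightarrow> 0)"

lemma emod_ediv_simps [simp]:
  "emod N (enat b) = N mod b" "emod N \<infinity> = N" "ediv N (enat b) = N div b" "ediv N \<infinity> = 0"
  by (simp_all add: emod_def ediv_def)

text \<open>Digits for an arbitrary sequence of bases. Shifting the sequence in the recursion allows
  induction by removal of the lowest digit.\<close>

fun digs :: "(nat \<Rightarrow> enat) \<Rightarrow> nat \<Rightarrow> nat \<Rightarrow> nat" where
  "digs B N 0 = emod N (B 0)"
| "digs B N (Suc i) = digs (\<lambda>j. B (Suc j)) (ediv N (B 0)) i"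

abbreviation place :: "(nat \<Rightarrow> enat) \<Rightarrow> nat \<Rightarrow> enat" where
  "place B i \<equiv> \<Prod>j<i. B j"

definition expansion :: "(nat \<Rightarrow> enat) \<Rightarrow> nat \<Rightarrow> (nat \<Rightarrow> nat) \<Rightarrow> bool" where
  "expansion B N d \<longleftrightarrow> (\<forall>i. enat (d i) < B i) \<and>
    (\<exists>n. (\<forall>i\<ge>n. d i = 0) \<and> enat N = (\<Sum>i<n. enat (d i) * place B i))"

lemma expansion_step:
  assumes B: "\<And>i. 2 \<le> B i"
  shows "expansion B N d \<longleftrightarrow> d 0 = emod N (B 0) \<and> expansion (\<lambda>j. B (Suc j)) (ediv N (B 0)) (\<lambda>i. d (Suc i))"
proof -
  let ?B = "\<lambda>j. B (Suc j)" and ?d = "\<lambda>i. d (Suc i)"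
  let ?S = "\<lambda>n. \<Sum>i<n. enat (?d i) * place ?B i"
  have place_Suc: "place B (Suc i) = B 0 * place ?B i" for i by (rule prod.lessThan_Suc_shift)
  have sum_Suc: "(\<Sum>i<Suc n. enat (d i) * place B i) = enat (d 0) + B 0 * ?S n" for n
    unfolding sum.lessThan_Suc_shift place_Suc sum_distrib_left by (simp add: mult.left_commute)
  have B0: "B 0 \<noteq> 0" using B[of 0] by auto
  \<comment> \<open>For an infinite base the left side forces M = 0 and the digit N, in accordance
    with \<open>ediv N \<infinity> = 0\<close>.\<close>
  have eq: "enat N = enat (d 0) + B 0 * M \<and> enat (d 0) < B 0 \<longleftrightarrow> d 0 = emod N (B 0) \<and> enat (ediv N (B 0)) = M" for M
  proof (cases "B 0")
    case (enat b)
    then have b: "b > 0" using B0 by (simp add: zero_enat_def)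
    show ?thesis
    proof (cases M)
      case (enat k)
      then show ?thesis using \<open>B 0 = enat b\<close> b by (auto simp: mult.commute)
    qed (use enat b in simp)
  next
    case infinity
    then show ?thesis by (cases M) (auto simp: zero_enat_def)
  qed
  have "expansion B N d \<longleftrightarrow> (\<forall>i. enat (d i) < B i) \<and>
      (\<exists>n. (\<forall>i\<ge>Suc n. d i = 0) \<and> enat N = (\<Sum>i<Suc n. enat (d i) * place B i))"
  proof -
    have "\<exists>n. (\<forall>i\<ge>Suc n. d i = 0) \<and> enat N = (\<Sum>i<Suc n. enat (d i) * place B i)"
      if "\<forall>i\<ge>n. d i = 0" "enat N = (\<Sum>i<n. enat (d i) * place B i)" for n
      using that by (intro exI[of _ n]) (simp add: zero_enat_def[symmetric])
    then show ?thesis unfolding expansion_def by blast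
  qed
  also have "\<dots> \<longleftrightarrow> (\<forall>i. enat (?d i) < ?B i) \<and> (\<exists>n. (\<forall>i\<ge>n. ?d i = 0) \<and>
      (enat N = enat (d 0) + B 0 * ?S n \<and> enat (d 0) < B 0))"
  proof -
    have "(\<forall>i. enat (d i) < B i) \<longleftrightarrow> enat (d 0) < B 0 \<and> (\<forall>i. enat (?d i) < ?B i)" by (metis not0_implies_Suc)
    moreover have "(\<forall>i\<ge>Suc n. d i = 0) \<longleftrightarrow> (\<forall>i\<ge>n. ?d i = 0)" for n by (metis Suc_le_D Suc_le_mono)
    ultimately show ?thesis unfolding sum_Suc by auto
  qed
  finally show ?thesis unfolding eq expansion_def by blast
qed

lemma digs_0: "digs B 0 i = 0"
proof (induction i arbitrary: B)
  case 0 show ?case by (cases "B 0") simp_all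
next
  case (Suc i) then show ?case by (cases "B 0") simp_all
qed

lemma expansion_digs:
  assumes "\<And>i. 2 \<le> B i" shows "expansion B N (digs B N)"
  using assms
proof (induction N arbitrary: B rule: less_induct)
  case (less N)
  show ?case
  proof (cases "N = 0")
    case True
    have "0 < B i" for i using less.prems[of i] by (metis not_gr_zero not_numeral_le_zero)
    then show ?thesis unfolding True expansion_def digs_0 by (auto simp: zero_enat_def[symmetric] intro: exI[of _ 0])
  next
    case False
    have "ediv N (B 0) < N"
    proof (cases "B 0")
      case (enat b)
      then have "2 \<le> b" using less.prems[of 0] by (simp add: numeral_eq_enat)
      then show ?thesis using False enat by simp
    qed (use False in simp)
    then show ?thesis unfolding expansion_step[of B, OF less.prems] using less by simp
  qed
qed

lemma expansion_unique:
  assumes "\<And>i. 2 \<le> B i" "expansion B N d" shows "d = digs B N"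
proof
  show "d i = digs B N i" for i using assms
  proof (induction i arbitrary: B N d)
    case 0
    show ?case using iffD1[OF expansion_step[of B, OF 0(1)] 0(2)] by simp
  next
    case (Suc i)
    then have "expansion (\<lambda>j. B (Suc j)) (ediv N (B 0)) (\<lambda>i. d (Suc i))" using expansion_step[of B] by blast
    from Suc.IH[OF _ this] Suc.prems(1) show ?case by simp
  qed
qed

definition digit_le :: "(nat \<Rightarrow> enat) \<Rightarrow> nat \<Rightarrow> nat \<Rightarrow> bool" where
  "digit_le B N R \<longleftrightarrow> (\<forall>i. digs B R i \<le> digs B N i)"

lemma digit_le_step: "digit_le B N R \<longleftrightarrow> emod R (B 0) \<le> emod N (B 0) \<and> digit_le (\<lambda>j. B (Suc j)) (ediv N (B 0)) (ediv R (B 0))"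
proof -
  have "(\<forall>i. digs B R i \<le> digs B N i) \<longleftrightarrow> digs B R 0 \<le> digs B N 0 \<and> (\<forall>i. digs B R (Suc i) \<le> digs B N (Suc i))"
    by (metis not0_implies_Suc)
  then show ?thesis unfolding digit_le_def by simp
qed

lemma digit_le_0: "digit_le B N 0" by (simp add: digit_le_def digs_0)

lemma digit_le_small:
  assumes "enat R < B 0" shows "digit_le B N R \<longleftrightarrow> R \<le> emod N (B 0)"
  unfolding digit_le_step[of B] using assms by (cases "B 0") (simp_all add: digit_le_0)

text \<open>A carry lowers the digit of the sum below both digits; without a carry the digits add.
  So the absence of carries can be read off by comparing a with a + b digitwise.\<close>

lemma mod_add_less_iff:
  fixes a b l :: nat assumes "l > 0"
  shows "a mod l + b mod l < l \<longleftrightarrow> a mod l \<le> (a + b) mod l"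
    and "a mod l + b mod l < l \<Longrightarrow> (a + b) div l = a div l + b div l"
proof -
  have "(a + b) mod l = (a mod l + b mod l) mod l" by (simp add: mod_add_eq)
  moreover have "a mod l + b mod l < 2 * l" using assms mod_less_divisor[of l a] mod_less_divisor[of l b] by linarith
  moreover have "b mod l < l" using assms by simp
  moreover have "x + y < l \<longleftrightarrow> x \<le> (x + y) mod l" if "x + y < 2 * l" "y < l" for x y
    using that by (cases "x + y < l") (simp_all add: le_mod_geq)
  ultimately show "a mod l + b mod l < l \<longleftrightarrow> a mod l \<le> (a + b) mod l" by metis
  show "a mod l + b mod l < l \<Longrightarrow> (a + b) div l = a div l + b div l"
    using div_add1_eq[of a b l] by simp
qed

lemma digit_le_add_step:
  assumes B: "B 0 = enat l" "l > 0"
  shows "digit_le B (a + b) a \<longleftrightarrow> a mod l + b mod l < l \<and> digit_le (\<lambda>j. B (Suc j)) (a div l + b div l) (a div l)"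
  unfolding digit_le_step[of B] B(1) emod_ediv_simps mod_add_less_iff(1)[OF B(2), symmetric]
  by (rule conj_cong[OF refl]) (simp add: mod_add_less_iff(2)[OF B(2)])

text \<open>In characteristic 0 the base is infinite, the only digit is the number itself and the
  condition holds trivially. Otherwise the Lucas step is iterated.\<close>

lemma choose_nonzero_iff:
  "(of_nat ((a + b) choose a) :: 'k::idom) \<noteq> 0 \<longleftrightarrow> digit_le (\<lambda>_. char_enat TYPE('k)) (a + b) a"
proof (cases "CHAR('k) = 0")
  case True
  have "digit_le (\<lambda>_. \<infinity>) (a + b) a" by (subst digit_le_step) (simp add: digit_le_0)
  then show ?thesis using True by (simp add: char_enat_def of_nat_eq_0_iff_char_dvd binomial_eq_0_iff)
next
  case False
  let ?p = "CHAR('k)"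
  have p: "?p > 0" "1 < ?p" using False CHAR_not_1'[where 'a = 'k] by linarith+
  have c: "char_enat TYPE('k) = enat ?p" using False by (simp add: char_enat_def)
  show ?thesis unfolding c
  proof (induction "a + b" arbitrary: a b rule: less_induct)
    case less
    show ?case
    proof (cases "a + b = 0")
      case False
      have "a div ?p + b div ?p < a + b"
      proof (cases "a = 0")
        case True
        then show ?thesis using \<open>a + b \<noteq> 0\<close> p by simp
      next
        case a: False
        then have "a div ?p < a" using p by simp
        then show ?thesis using div_le_dividend[of b ?p] by linarith
      qed
      from less[OF this] show ?thesis
        using choose_nonzero_step[OF refl p(1), of a b] digit_le_add_step[of "\<lambda>_. enat ?p", OF refl p(1), of a b] by blast
    qed (simp add: digit_le_0)
  qed
qed

section \<open>Digits with respect to \<ell> and p\<close>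

context
  fixes \<delta> :: "'k::idom"
begin

lemma ell_cases:
  obtains "ell \<delta> = \<infinity>" "\<And>k. 0 < k \<Longrightarrow> qnum \<delta> k \<noteq> 0"
  | l where "ell \<delta> = enat l" "2 \<le> l" "qnum \<delta> l = 0" "\<And>k. 0 < k \<Longrightarrow> k < l \<Longrightarrow> qnum \<delta> k \<noteq> 0"
proof (cases "\<exists>m>0. qnum \<delta> m = 0")
  case True
  define l where "l = (LEAST m. m > 0 \<and> qnum \<delta> m = 0)"
  have l: "l > 0 \<and> qnum \<delta> l = 0" unfolding l_def using True by (rule LeastI_ex)
  then have "l \<noteq> 1" by auto
  moreover have "qnum \<delta> k \<noteq> 0" if "0 < k" "k < l" for k using not_less_Least[of k] that unfolding l_def by blast
  moreover have "ell \<delta> = enat l" using True by (simp add: ell_def l_def)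
  ultimately show ?thesis using that(2)[of l] l by auto
next
  case False
  show ?thesis by (rule that(1)) (use False in \<open>simp add: ell_def\<close>, use False in blast)
qed

lemma pbase_ge_2: "2 \<le> pbase \<delta> i"
proof -
  have "2 \<le> ell \<delta>" by (cases rule: ell_cases) (simp_all add: numeral_eq_enat)
  moreover have "2 \<le> char_enat TYPE('k)"
  proof (cases "CHAR('k) = 0")
    case False
    then have "2 \<le> CHAR('k)" using CHAR_not_1'[where 'a = 'k] by linarith
    then show ?thesis by (simp add: char_enat_def numeral_eq_enat)
  qed (simp add: char_enat_def)
  ultimately show ?thesis by (simp add: pbase_def)
qed

lemma ppow_place: "ppow \<delta> i = place (pbase \<delta>) i"
proof (cases i)
  case (Suc j)
  then show ?thesis by (simp only: prod.lessThan_Suc_shift) (simp add: ppow_def pbase_def)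
qed (simp add: ppow_def)

lemma is_expansion_iff: "is_expansion \<delta> N d \<longleftrightarrow> expansion (pbase \<delta>) N d"
proof -
  have "(finite {i. d i \<noteq> 0} \<and> enat N = (\<Sum>i | d i \<noteq> 0. enat (d i) * ppow \<delta> i)) \<longleftrightarrow>
      (\<exists>n. (\<forall>i\<ge>n. d i = 0) \<and> enat N = (\<Sum>i<n. enat (d i) * ppow \<delta> i))"
  proof -
    have eq: "(\<Sum>i | d i \<noteq> 0. enat (d i) * ppow \<delta> i) = (\<Sum>i<n. enat (d i) * ppow \<delta> i)" if "\<forall>i\<ge>n. d i = 0" for n
    proof (rule sum.mono_neutral_left)
      show "{i. d i \<noteq> 0} \<subseteq> {..<n}" using that by (metis (mono_tags) lessThan_iff mem_Collect_eq not_le_imp_less subsetI)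
    qed (auto simp: zero_enat_def[symmetric])
    have ex: "(\<exists>n. \<forall>i\<ge>n. d i = 0) \<longleftrightarrow> finite {i. d i \<noteq> 0}"
      unfolding finite_nat_set_iff_bounded by (metis (mono_tags, lifting) mem_Collect_eq not_le)
    show ?thesis unfolding ex[symmetric] using eq by auto
  qed
  moreover have "(A \<and> B \<and> C \<longleftrightarrow> B \<and> D) \<longleftrightarrow> (B \<longrightarrow> (A \<and> C \<longleftrightarrow> D))" for A B C D by blast
  ultimately show ?thesis unfolding is_expansion_def expansion_def ppow_place by (simp only: simp_thms)
qed

lemma digit_eq: "digit \<delta> N = digs (pbase \<delta>) N"
  unfolding digit_def is_expansion_iff
  using expansion_digs[of "pbase \<delta>", OF pbase_ge_2] expansion_unique[of "pbase \<delta>", OF pbase_ge_2] by blast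

lemma dominates_iff: "dominates \<delta> N R \<longleftrightarrow> digit_le (pbase \<delta>) N R"
  by (simp add: dominates_def digit_le_def digit_eq)

text \<open>The quantum Lucas theorem handles the lowest position, with base \<ell>, and the
  classical one all higher positions, with base p.\<close>

lemma qbin_nonzero_iff: "qbin \<delta> a b \<noteq> 0 \<longleftrightarrow> digit_le (pbase \<delta>) (a + b) a"
proof (cases rule: ell_cases)
  case 1
  have "qfact \<delta> k \<noteq> 0" for k by (induction k) (use 1(2) in \<open>auto simp del: qnum.simps\<close>)
  then have "qbin \<delta> a b \<noteq> 0" using qbin_fact[of \<delta> a b] by (metis mult_zero_left)
  moreover have "digit_le (pbase \<delta>) (a + b) a" unfolding digit_le_step[of "pbase \<delta>"] by (simp add: pbase_def 1 digit_le_0)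
  ultimately show ?thesis by simp
next
  case (2 l)
  have l: "pbase \<delta> 0 = enat l" "l > 0" using 2 by (auto simp: pbase_def)
  have s: "(\<lambda>j. pbase \<delta> (Suc j)) = (\<lambda>_. char_enat TYPE('k))" by (simp add: pbase_def)
  show ?thesis
    using qbin_nonzero_step[OF 2(3) l(2) 2(4), of a b]
    unfolding digit_le_add_step[of "pbase \<delta>", OF l] s choose_nonzero_iff by blast
qed

end

section \<open>Eve numbers and the digits of the sum of two of them\<close>

lemma enat_mult_eq_enat:
  assumes "x * y = enat n" "n > 0" obtains a b where "x = enat a" "y = enat b" "n = a * b"
  using assms by (cases x; cases y) (auto simp: zero_enat_def split: if_splits)

lemma place_Suc_finite:
  assumes B: "\<And>i. 2 \<le> B i" and P: "place B (Suc i) = enat P"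
  obtains b P' where "B 0 = enat b" "2 \<le> b" "place (\<lambda>j. B (Suc j)) i = enat P'" "P = b * P'"
proof -
  have "B j \<noteq> 0" for j using B[of j] by auto
  then have "place B k \<noteq> 0" for k by (induction k) simp_all
  then have "P > 0" using P by (metis neq0_conv zero_enat_def)
  then obtain b P' where "B 0 = enat b" "place (\<lambda>j. B (Suc j)) i = enat P'" "P = b * P'"
    using enat_mult_eq_enat[OF P[unfolded prod.lessThan_Suc_shift]] by metis
  then show ?thesis using that B[of 0] by (simp add: numeral_eq_enat)
qed

text \<open>All digits of \<open>N\<close> below position \<open>i\<close> are maximal.\<close>

lemma digit_le_eve:
  assumes "\<And>i. 2 \<le> B i" and "place B i = enat P" "N + 1 = a * P" "enat a < B i" "R \<le> N"
  shows "digit_le B N R"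
  using assms
proof (induction i arbitrary: B N R P)
  case 0
  then have "P = 1" by (simp add: one_enat_def)
  then have N: "enat N < B 0" using 0 by (metis add.commute enat_ord_simps(2) less_add_one mult_1_right order_less_trans)
  then have "enat R < B 0" using 0(5) by (metis enat_ord_simps(1) order_le_less_trans)
  then show ?case using 0(5) N by (cases "B 0") (simp_all add: digit_le_small)
next
  case (Suc i)
  obtain b P' where b: "B 0 = enat b" "2 \<le> b" "place (\<lambda>j. B (Suc j)) i = enat P'" "P = b * P'"
    using place_Suc_finite[OF Suc.prems(1,2)] .
  have aP: "a * P' > 0" using Suc.prems(3) b(4) by (metis Suc_eq_plus1 mult_is_0 nat.distinct(1) neq0_conv)
  \<comment> \<open>N + 1 is divisible by b, so the lowest digit of N is b - 1 and the quotient is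
    again one less than a multiple of a place value.\<close>
  have "N = b * (a * P' - 1) + (b - 1)"
  proof -
    have "b * (a * P' - 1) + b = b * (a * P')" using aP by (metis Suc_pred' mult_Suc_right add.commute)
    also have "\<dots> = N + 1" unfolding Suc.prems(3) b(4) by (simp only: mult_ac)
    finally show ?thesis using b(2) by linarith
  qed
  moreover have "(b * x + y) mod b = y" "(b * x + y) div b = x" if "y < b" for x y using that by simp_all
  moreover have "b - 1 < b" using b(2) by simp
  ultimately have N: "N mod b = b - 1" "N div b = a * P' - 1" by (simp_all only:)
  have "R div b \<le> a * P' - 1" unfolding N(2)[symmetric] by (rule div_le_mono[OF Suc.prems(5)])
  then have "digit_le (\<lambda>j. B (Suc j)) (a * P' - 1) (R div b)"
    using Suc.prems(1,4) aP by (intro Suc.IH[OF _ b(3)]) simp_all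
  moreover have "R mod b \<le> b - 1" using b(2) by (metis Suc_pred' less_Suc_eq_le mod_less_divisor order_less_le_trans zero_less_numeral)
  ultimately show ?case unfolding digit_le_step[of B] b(1) by (simp add: N)
qed

text \<open>All digits of \<mu> below the leading one are maximal, so every k \<le> \<mu> is
  dominated by \<mu> and no binomial coefficient of \<mu> over k vanishes.\<close>

lemma jw_denom_eve:
  fixes \<delta> :: "'k::idom"
  assumes "enat (\<mu> + 1) = enat a * ppow \<delta> i" "enat a < pbase \<delta> i"
  shows "jw_denom \<delta> \<mu> \<noteq> 0"
proof -
  obtain a' P where P: "enat a = enat a'" "ppow \<delta> i = enat P" "\<mu> + 1 = a' * P"
    using enat_mult_eq_enat[OF assms(1)[symmetric]] by auto
  have "qbin \<delta> k (\<mu> - k) \<noteq> 0" if "k \<le> \<mu>" for k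
  proof -
    have "digit_le (pbase \<delta>) \<mu> k"
      using P assms(2) that by (intro digit_le_eve[of "pbase \<delta>" i P]) (simp_all add: pbase_ge_2 ppow_place)
    then show ?thesis using that by (simp add: qbin_nonzero_iff)
  qed
  then show ?thesis by (simp add: jw_denom_def)
qed

text \<open>The set \<open>top_digits\<close>, in terms of the base \<open>b\<close> at the leading position of the second part.\<close>

definition lead_digits :: "bool \<Rightarrow> enat \<Rightarrow> nat \<Rightarrow> nat \<Rightarrow> nat set" where
  "lead_digits gt b a1 a2 = (if gt then {0..(a2 - 1) div 2}
      else let c = emod (a1 + a2 - 1) b
           in {0..min (a2 - 1) (c div 2)} \<union> {k. c + 1 \<le> k \<and> enat k \<le> min (enat (a2 - 1)) (half (b + enat c))})"

lemma lead_digits_less: "k \<in> lead_digits gt b a1 a2 \<Longrightarrow> 0 < a2 \<Longrightarrow> k < a2"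
  by (auto simp: lead_digits_def Let_def split: if_splits)

text \<open>Let c be the remainder of a1 + a2 - 1 modulo the base. Subtracting r gives the digit c -
  r for r \<le> c, and base + c - r after a borrow for r > c. The conditions that r is at most these
  digits are the bounds c/2 and (base + c)/2.\<close>

lemma emod_lead_eq:
  assumes a: "0 < a1" "0 < a2" "enat a1 < b" "enat a2 < b" and r: "r < a2"
  shows "r \<le> emod (a1 + a2 - 1 - r) b \<longleftrightarrow> r \<in> lead_digits False b a1 a2"
proof (cases b)
  case infinity
  then show ?thesis using a r by (auto simp: lead_digits_def half_def)
next
  case (enat n)
  then have n: "a1 < n" "a2 < n" using a by auto
  let ?c = "(a1 + a2 - 1) mod n"
  have X: "r \<in> lead_digits False b a1 a2 \<longleftrightarrow> r \<le> ?c div 2 \<or> ?c + 1 \<le> r \<and> r \<le> (n + ?c) div 2"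
    unfolding lead_digits_def Let_def using enat r by (auto simp: half_def)
  show ?thesis
  proof (cases "a1 + a2 - 1 < n")
    case True
    then show ?thesis unfolding X unfolding enat using a r by auto
  next
    case False
    then have c: "?c = a1 + a2 - 1 - n" using n by (simp add: le_mod_geq)
    show ?thesis
    proof (cases "r \<le> ?c")
      case True
      then have "(a1 + a2 - 1 - r) mod n = ?c - r" using c n False by (simp add: le_mod_geq)
      then show ?thesis unfolding X unfolding enat using True by auto
    next
      case gt: False
      then have "(a1 + a2 - 1 - r) mod n = n + ?c - r" using c n False by simp
      then show ?thesis unfolding X unfolding enat using gt by auto
    qed
  qed
qed

lemma half_pred: "2 \<le> b \<Longrightarrow> enat k \<le> half (enat b - 1) \<longleftrightarrow> k + k \<le> b - 1"
  by (auto simp: half_def one_enat_def)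

text \<open>Induction removes the lowest position. Below position i2 all digits of N are maximal, so
  subtracting r needs no borrow there and replaces the digit by b - 1 - r0, where r0 is the digit of
  r; domination means that r0 is at most half of b - 1. Borrows matter only at the leading
  position.\<close>

lemma digit_le_lead_digits:
  assumes "\<And>j. 2 \<le> B j" "i2 \<le> i1" "place B i1 = enat P1" "place B i2 = enat P2" "N + 1 = a1 * P1 + a2 * P2"
    "0 < a1" "0 < a2" "enat a1 < B i1" "enat a2 < B i2"
  shows "r < a2 * P2 \<and> digit_le B (N - r) r \<longleftrightarrow> (\<exists>k. r = (\<Sum>i\<le>i2. k i * the_enat (place B i)) \<and>
    k i2 \<in> lead_digits (i2 < i1) (B i2) a1 a2 \<and> (\<forall>i<i2. enat (k i) \<le> half (B i - 1)))"
  using assms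
proof (induction i2 arbitrary: B i1 P1 P2 N r)
  case 0
  have P2: "P2 = 1" using 0(4) by (simp add: one_enat_def)
  have "r < a2 \<and> digit_le B (N - r) r \<longleftrightarrow> r \<in> lead_digits (0 < i1) (B 0) a1 a2"
  proof (cases "r < a2")
    case True
    then have r: "enat r < B 0" using 0(9) by (metis enat_ord_simps(2) order_less_trans)
    have "r \<le> emod (N - r) (B 0) \<longleftrightarrow> r \<in> lead_digits (0 < i1) (B 0) a1 a2"
    proof (cases i1)
      case 0
      then have "P1 = 1" "enat a1 < B 0" using \<open>place B i1 = enat P1\<close> \<open>enat a1 < B i1\<close> by (simp_all add: one_enat_def)
      then have "N - r = a1 + a2 - 1 - r" using \<open>N + 1 = _\<close> P2 by simp
      then show ?thesis
        using emod_lead_eq[OF \<open>0 < a1\<close> \<open>0 < a2\<close> \<open>enat a1 < B 0\<close> \<open>enat a2 < B 0\<close> True] 0 by simp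
    next
      case (Suc j)
      obtain b P' where b: "B 0 = enat b" "2 \<le> b" "P1 = b * P'"
        using place_Suc_finite[of B j P1] 0(1,3) unfolding Suc by metis
      \<comment> \<open>Here i1 > 0, so a1 P1 is a multiple of the lowest base and the lowest digit
        of N - r is a2 - 1 - r.\<close>
      have "N - r = b * (a1 * P') + (a2 - 1 - r)" using 0(5) True unfolding b(3) P2 by (simp add: mult.left_commute)
      moreover have "a2 - 1 - r < b" using 0(9) b(1) by simp
      ultimately have "emod (N - r) (B 0) = a2 - 1 - r" unfolding b(1) by simp
      then show ?thesis using True Suc by (auto simp: lead_digits_def)
    qed
    then show ?thesis using True digit_le_small[where B = B and R = r, OF r] by simp
  qed (use lead_digits_less 0(7) in blast)
  also have "\<dots> \<longleftrightarrow> (\<exists>k :: nat \<Rightarrow> nat. r = k 0 \<and> k 0 \<in> lead_digits (0 < i1) (B 0) a1 a2)"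
    by (auto intro: exI[of _ "\<lambda>_. r"])
  finally show ?case unfolding P2 by (simp add: one_enat_def)
next
  case (Suc i2)
  note prems = Suc.prems
  obtain i1' where i1: "i1 = Suc i1'" using prems(2) by (metis Suc_le_D)
  let ?B = "\<lambda>j. B (Suc j)"
  obtain b P1' where b: "B 0 = enat b" "2 \<le> b" "place ?B i1' = enat P1'" "P1 = b * P1'"
    using place_Suc_finite[of B, OF prems(1) prems(3)[unfolded i1]] .
  obtain P2' where P2': "place ?B i2 = enat P2'" "P2 = b * P2'"
    using place_Suc_finite[of B, OF prems(1) prems(4)] b(1) by (metis enat.inject)
  have fin: "\<exists>P. place ?B i = enat P" if "i \<le> i2" for i
  proof -
    have "place ?B i \<le> place ?B (Suc i)" for i
    proof -
      have "place ?B i * 1 \<le> place ?B i * ?B i"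
        by (rule mult_left_mono) (use prems(1)[of "Suc i"] in \<open>auto intro: order_trans[rotated] simp: numeral_eq_enat one_enat_def\<close>)
      then show ?thesis by simp
    qed
    then have "place ?B i \<le> place ?B i2" using that lift_Suc_mono_le[of "place ?B"] by blast
    then show ?thesis unfolding P2' by (metis enat_ile)
  qed
  \<comment> \<open>The quotient of N by the lowest base b: all of N + 1 is divisible by b.\<close>
  define M where "M = a1 * P1' + a2 * P2' - 1"
  have a2P: "0 < a2 * P2'" 
  proof -
    have "?B j \<noteq> 0" for j using prems(1)[of "Suc j"] by auto
    then have "place ?B k \<noteq> 0" for k by (induction k) simp_all
    then show ?thesis using P2'(1) prems(7) by (metis nat_0_less_mult_iff neq0_conv zero_enat_def)
  qed
  then have M: "M + 1 = a1 * P1' + a2 * P2'" unfolding M_def by linarith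
  have "N + 1 = b * (M + 1)" unfolding prems(5) b(4) P2'(2) M by (simp add: distrib_left mult.left_commute)
  then have N: "N = b * M + (b - 1)" using b(2) by (simp add: distrib_left)
  have divmod: "(b * x + y) mod b = y" "(b * x + y) div b = x" if "y < b" for x y using that by simp_all
  have IH: "r' < a2 * P2' \<and> digit_le ?B (M - r') r' \<longleftrightarrow> (\<exists>k. r' = (\<Sum>i\<le>i2. k i * the_enat (place ?B i)) \<and>
    k i2 \<in> lead_digits (i2 < i1') (B (Suc i2)) a1 a2 \<and> (\<forall>i<i2. enat (k i) \<le> half (?B i - 1)))" for r'
    using Suc.IH[of ?B i1' P1' P2' M r'] prems b(3) P2'(1) M by (simp add: i1)
  \<comment> \<open>The lowest digit b - 1 of N is maximal, so the lowest digit and the quotient are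
    subtracted independently.\<close>
  have step: "b * r' + r0 < a2 * P2 \<and> digit_le B (N - (b * r' + r0)) (b * r' + r0) \<longleftrightarrow>
      r0 + r0 \<le> b - 1 \<and> r' < a2 * P2' \<and> digit_le ?B (M - r') r'" if r0: "r0 < b" for r' r0
  proof -
    have lt: "b * r' + r0 < a2 * P2 \<longleftrightarrow> r' < a2 * P2'"
    proof -
      have "r' < a2 * P2' \<longleftrightarrow> (b * r' + r0) div b < a2 * P2'" by (simp only: divmod[OF r0])
      also have "\<dots> \<longleftrightarrow> b * r' + r0 < a2 * P2' * b" using b(2) by (intro less_mult_imp_div_less[THEN iffI] div_less_iff_less_mult) simp_all
      finally show ?thesis unfolding P2'(2) by (simp add: mult_ac)
    qed
    show ?thesis
    proof (cases "r' < a2 * P2'")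
      case True
      then have "r' \<le> M" using M by linarith
      then have "N - (b * r' + r0) = b * (M - r') + (b - 1 - r0)" unfolding N using r0
        by (simp add: diff_mult_distrib2)
      moreover have "b - 1 - r0 < b" using b(2) by linarith
      ultimately have d: "(N - (b * r' + r0)) mod b = b - 1 - r0" "(N - (b * r' + r0)) div b = M - r'"
        by (simp_all only: divmod)
      have "r0 \<le> b - 1 - r0 \<longleftrightarrow> r0 + r0 \<le> b - 1" using r0 by linarith
      then show ?thesis unfolding digit_le_step[of B] b(1) emod_ediv_simps d divmod[OF r0] lt by blast
    qed (use lt in blast)
  qed
  have sum: "(\<Sum>i\<le>Suc i2. k i * the_enat (place B i)) = b * (\<Sum>i\<le>i2. k (Suc i) * the_enat (place ?B i)) + k 0" for k
  proof -
    have "the_enat (place B (Suc i)) = b * the_enat (place ?B i)" if "i \<le> i2" for i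
      unfolding prod.lessThan_Suc_shift using fin[OF that] b(1) by auto
    then have "(\<Sum>i\<le>i2. k (Suc i) * the_enat (place B (Suc i))) = (\<Sum>i\<le>i2. b * (k (Suc i) * the_enat (place ?B i)))"
      by (intro sum.cong) (simp_all add: mult.left_commute del: prod.lessThan_Suc)
    then show ?thesis unfolding sum.atMost_Suc_shift by (simp add: sum_distrib_left one_enat_def del: prod.lessThan_Suc)
  qed
  have all: "(\<forall>i<Suc i2. enat (k i) \<le> half (B i - 1)) \<longleftrightarrow> k 0 + k 0 \<le> b - 1 \<and> (\<forall>i<i2. enat (k (Suc i)) \<le> half (?B i - 1))" for k
    unfolding All_less_Suc2 b(1) half_pred[OF b(2)] ..
  let ?Q = "\<lambda>k r'. r' = (\<Sum>i\<le>i2. k i * the_enat (place ?B i)) \<and>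
    k i2 \<in> lead_digits (i2 < i1') (B (Suc i2)) a1 a2 \<and> (\<forall>i<i2. enat (k i) \<le> half (?B i - 1))"
  have lt: "Suc i2 < i1 \<longleftrightarrow> i2 < i1'" unfolding i1 by simp
  show ?case unfolding sum all lt
  proof
    assume r: "r < a2 * P2 \<and> digit_le B (N - r) r"
    have "r mod b < b" "r = b * (r div b) + r mod b" using b(2) by simp_all
    then have "r mod b + r mod b \<le> b - 1 \<and> r div b < a2 * P2' \<and> digit_le ?B (M - r div b) (r div b)"
      using step r by metis
    then obtain k where "?Q k (r div b)" "r mod b + r mod b \<le> b - 1" using IH by blast
    then show "\<exists>k. r = b * (\<Sum>i\<le>i2. k (Suc i) * the_enat (place ?B i)) + k 0 \<and>
        k (Suc i2) \<in> lead_digits (i2 < i1') (B (Suc i2)) a1 a2 \<and>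
        k 0 + k 0 \<le> b - 1 \<and> (\<forall>i<i2. enat (k (Suc i)) \<le> half (?B i - 1))"
      using \<open>r = _\<close> by (intro exI[of _ "case_nat (r mod b) k"]) simp
  next
    assume "\<exists>k. r = b * (\<Sum>i\<le>i2. k (Suc i) * the_enat (place ?B i)) + k 0 \<and>
        k (Suc i2) \<in> lead_digits (i2 < i1') (B (Suc i2)) a1 a2 \<and>
        k 0 + k 0 \<le> b - 1 \<and> (\<forall>i<i2. enat (k (Suc i)) \<le> half (?B i - 1))"
    then obtain k where k: "?Q (\<lambda>i. k (Suc i)) (\<Sum>i\<le>i2. k (Suc i) * the_enat (place ?B i))"
      "r = b * (\<Sum>i\<le>i2. k (Suc i) * the_enat (place ?B i)) + k 0" "k 0 + k 0 \<le> b - 1" by blast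
    let ?r = "\<Sum>i\<le>i2. k (Suc i) * the_enat (place ?B i)"
    have "k 0 < b" using k(3) b(2) by linarith
    moreover have "?r < a2 * P2' \<and> digit_le ?B (M - ?r) ?r"
      by (rule iffD2[OF IH], rule exI[of _ "\<lambda>i. k (Suc i)"]) (rule k(1))
    ultimately show "r < a2 * P2 \<and> digit_le B (N - r) r"
      unfolding k(2) using iffD2[OF step[of "k 0" ?r]] k(3) by (simp only: simp_thms)
  qed
qed

lemma digs_place:
  assumes "\<And>j. 2 \<le> B j" "place B i = enat P" shows "digs B (M * P) i = emod M (B i)"
  using assms
proof (induction i arbitrary: B P)
  case 0
  then show ?case by (auto simp: one_enat_def)
next
  case (Suc i)
  obtain b P' where b: "B 0 = enat b" "2 \<le> b" "place (\<lambda>j. B (Suc j)) i = enat P'" "P = b * P'"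
    using place_Suc_finite[of B, OF Suc.prems] .
  then have "ediv (M * P) (B 0) = M * P'" by (simp add: mult.left_commute)
  then show ?case using Suc.IH[of "\<lambda>j. B (Suc j)", OF Suc.prems(1) b(3)] by simp
qed

text \<open>A single digit at position i gives less than the place value at any later position.
  Applied to \<mu>1 + 1 and \<mu>2 + 1, this turns \<mu>2 \<le> \<mu>1 into i2 \<le> i1.\<close>

lemma place_strict:
  assumes B: "\<And>j. 2 \<le> B j" and "i < j" "place B j = enat Q" "place B i = enat P" "enat a < B i"
  shows "a * P < Q"
proof -
  have nz: "B k \<noteq> 0" for k using B[of k] by auto
  then have place_nz: "place B k \<noteq> 0" for k by (induction k) simp_all
  have "place B k \<le> place B (Suc k)" for k
  proof -
    have "1 \<le> B k" using B[of k] by (metis one_le_numeral order_trans)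
    then show ?thesis using mult_left_mono[of 1 "B k" "place B k"] by simp
  qed
  then have "place B (Suc i) \<le> place B j" using \<open>i < j\<close> lift_Suc_mono_le[of "place B"] by (metis Suc_leI)
  then obtain R where R: "place B (Suc i) = enat R" "R \<le> Q" using assms(3) by (metis enat_ile enat_ord_simps(1))
  have "R > 0" using R(1) place_nz by (metis neq0_conv zero_enat_def)
  then obtain P' b where "place B i = enat P'" "B i = enat b" "R = P' * b"
    using enat_mult_eq_enat[of "place B i" "B i" R] R(1) by auto
  then have "a < b" "R = P * b" "P > 0" using assms(4,5) \<open>R > 0\<close> by auto
  then show ?thesis using R(2) by (metis mult.commute mult_less_mono1 order_less_le_trans)
qed

theorem theorem8p1:
  fixes \<delta> :: "'k::idom" and n \<mu>1 \<mu>2 a1 a2 i1 i2 :: nat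
  assumes "n = \<mu>1 + \<mu>2"
    and "eve \<delta> \<mu>1" and "eve \<delta> \<mu>2"
    and "JW_values_in_base \<delta> \<mu>1" and "JW_values_in_base \<delta> \<mu>2"
    and "digit \<delta> (\<mu>1 + 1) i1 = a1" and "a1 \<noteq> 0" and "enat (\<mu>1 + 1) = enat a1 * ppow \<delta> i1"
    and "digit \<delta> (\<mu>2 + 1) i2 = a2" and "a2 \<noteq> 0" and "enat (\<mu>2 + 1) = enat a2 * ppow \<delta> i2"
    and "\<mu>1 \<ge> \<mu>2"
  shows "has_rank (TL_mu \<delta> \<mu>1 \<mu>2) (min \<mu>1 \<mu>2 + 1)
    \<and> (Lambda_mu \<delta> \<mu>1 \<mu>2 = E_set \<mu>1 \<mu>2
        \<and> E_set \<mu>1 \<mu>2 \<subseteq> Lambda_n n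
        \<and> (\<forall>m\<in>Lambda_mu \<delta> \<mu>1 \<mu>2. has_rank (cell_mu \<delta> \<mu>1 \<mu>2 m) 1))
    \<and> (Lambda_mu_0 \<delta> \<mu>1 \<mu>2
          = {m \<in> E_set \<mu>1 \<mu>2. dominates \<delta> ((n + m) div 2 + 1) ((n - m) div 2)}
        \<and> int ` Lambda_mu_0 \<delta> \<mu>1 \<mu>2 = digit_set \<delta> n i2 (top_digits \<delta> i1 a1 i2 a2))"
proof -
  let ?B = "pbase \<delta>"
  note n = assms(1) and le = assms(12) and B = pbase_ge_2[of \<delta>]
  have digit_less: "enat (digit \<delta> N i) < ?B i" for N i
    using expansion_digs[of ?B N, OF B] by (simp add: expansion_def digit_eq)
  then have a: "enat a1 < ?B i1" "enat a2 < ?B i2" using assms(6,9) by blast+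
  obtain P1 where P1: "place ?B i1 = enat P1" "\<mu>1 + 1 = a1 * P1"
    using enat_mult_eq_enat[OF assms(8)[symmetric]] unfolding ppow_place by auto
  obtain P2 where P2: "place ?B i2 = enat P2" "\<mu>2 + 1 = a2 * P2"
    using enat_mult_eq_enat[OF assms(11)[symmetric]] unfolding ppow_place by auto
  note res = Lambda_mu_results[OF assms(4,5) jw_denom_eve[OF assms(8) a(1)] jw_denom_eve[OF assms(11) a(2)] le]
  note E = E_set_iff[OF le]
  have i: "i2 \<le> i1"
  proof (rule ccontr)
    assume "\<not> i2 \<le> i1"
    then have "a1 * P1 < P2" using place_strict[of ?B, OF B _ P2(1) P1(1) a(1)] by simp
    also have "P2 \<le> a2 * P2" using assms(10) by simp
    finally show False using P1(2) P2(2) le by linarith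
  qed
  \<comment> \<open>The upper entry of the binomial coefficient is r + (n - 2 r + 1) = n + 1 - r,
    which is (n + m)/2 + 1 for m = n - 2 r.\<close>
  have qb: "qbin \<delta> r (n - 2 * r + 1) \<noteq> 0 \<longleftrightarrow> digit_le ?B (n + 1 - r) r" if "r \<le> \<mu>2" for r
  proof -
    have "r + (n - 2 * r + 1) = n + 1 - r" using that le n by linarith
    then show ?thesis unfolding qbin_nonzero_iff by (simp only:)
  qed
  have L0: "Lambda_mu_0 \<delta> \<mu>1 \<mu>2 = {n - 2 * r | r. r \<le> \<mu>2 \<and> digit_le ?B (n + 1 - r) r}"
    unfolding res(4) n[symmetric] using qb by blast
  have sub: "E_set \<mu>1 \<mu>2 \<subseteq> Lambda_n n"
  proof
    fix m assume "m \<in> E_set \<mu>1 \<mu>2"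
    then obtain r where "r \<le> \<mu>2" "m = n - 2 * r" unfolding E n by blast
    then have "m + 2 * r = n" using le n by linarith
    then show "m \<in> Lambda_n n" unfolding Lambda_n_def by auto
  qed
  have digit_le_E: "Lambda_mu_0 \<delta> \<mu>1 \<mu>2 = {m \<in> E_set \<mu>1 \<mu>2. dominates \<delta> ((n + m) div 2 + 1) ((n - m) div 2)}"
  proof -
    have "dominates \<delta> ((n + m) div 2 + 1) ((n - m) div 2) \<longleftrightarrow> digit_le ?B (n + 1 - r) r"
      if "r \<le> \<mu>2" "m = n - 2 * r" for m r
    proof -
      have "(n + m) div 2 + 1 = n + 1 - r" "(n - m) div 2 = r" using that le n by linarith+
      then show ?thesis by (simp add: dominates_iff)
    qed
    then show ?thesis unfolding L0 using E n by blast
  qed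
  \<comment> \<open>For i1 = i2 the digit c of (a1 + a2 - 1) times the place value is a1 + a2 - 1
    modulo the base at that position.\<close>
  have X: "top_digits \<delta> i1 a1 i2 a2 = lead_digits (i2 < i1) (?B i2) a1 a2"
  proof (cases "i2 < i1")
    case False
    then have "i1 = i2" using i by simp
    moreover have "digit \<delta> ((a1 + a2 - 1) * the_enat (ppow \<delta> i1)) i1 = emod (a1 + a2 - 1) (?B i1)"
      unfolding digit_eq ppow_place P1(1) the_enat.simps by (rule digs_place[of ?B, OF B P1(1)])
    ultimately show ?thesis by (simp add: top_digits_def lead_digits_def)
  qed (simp add: top_digits_def lead_digits_def)
  have digits: "r \<le> \<mu>2 \<and> digit_le ?B (n + 1 - r) r \<longleftrightarrow> (\<exists>k. r = (\<Sum>i\<le>i2. k i * the_enat (ppow \<delta> i)) \<and>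
      k i2 \<in> top_digits \<delta> i1 a1 i2 a2 \<and> (\<forall>i<i2. enat (k i) \<le> half (?B i - 1)))" for r
  proof -
    \<comment> \<open>The dominating number is N - r with N = n + 1, and N + 1 = n + 2 is the sum of
      \<mu>1 + 1 and \<mu>2 + 1. The bound r < a2 P2 is r \<le> \<mu>2.\<close>
    have "n + 1 + 1 = a1 * P1 + a2 * P2" using n P1(2) P2(2) by linarith
    from digit_le_lead_digits[of ?B, OF B i P1(1) P2(1) this _ _ a, of r]
    show ?thesis unfolding X ppow_place P2(2)[symmetric] using assms(7,10) by (simp add: less_Suc_eq_le)
  qed
  have "int ` Lambda_mu_0 \<delta> \<mu>1 \<mu>2 = {int n - 2 * int r | r. r \<le> \<mu>2 \<and> digit_le ?B (n + 1 - r) r}"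
  proof -
    \<comment> \<open>Natural subtraction does not truncate here, as r \<le> \<mu>2 \<le>
      \<mu>1.\<close>
    have "int (n - 2 * r) = int n - 2 * int r" if "r \<le> \<mu>2" for r using that le n by linarith
    then show ?thesis unfolding L0 by force
  qed
  also have "\<dots> = digit_set \<delta> n i2 (top_digits \<delta> i1 a1 i2 a2)"
    unfolding digits digit_set_def of_nat_sum[symmetric] by blast
  finally show ?thesis using res(1-3) sub digit_le_E by blast
qed

end
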